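(* Let $\mathrm{NaivePCE}_{\rho,\beta,\kappa}$ be the algorithm which, on input $X_1,\dots,X_n\in\mathbb{R}^d$, sets $S=\{i:\|X_i\|_2^2\le O(d\kappa\log(n/\beta))\}$, $\sigma=\Theta(\frac{d\kappa\log(n/\beta)}{n\rho^{1/2}})$, $M'=\frac1n\sum_{i\in S}X_iX_i^\top+N$ with $N\sim\mathrm{GUE}(\sigma^2)$, and outputs the projection of $M'$ onto the PSD cone. Let $\mathrm{PPC}_{\rho,\beta,\kappa}$ be the recursive private preconditioner: with $T=O(\log\kappa)$, $\rho'=\rho/T$, $\beta'=\beta/T$, $\kappa^{(1)}=\kappa$, $X^{(1)}_i=X_i$, for $t=1,\dots,T$ it computes $Z^{(t)}=\mathrm{NaivePCE}_{\rho',\beta',\kappa^{(t)}}(X^{(t)})$, lets $V^{(t)}$ be the span of eigenvectors of $Z^{(t)}$ with eigenvalue $\ge\kappa^{(t)}/2$, sets $A^{(t)}=1.1(\frac{1}{\sqrt K}\Pi_{V^{(t)}}+\Pi_{(V^{(t)})^\perp})$ for a suitable absolute constant $K$, $\kappa^{(t+1)}=0.7\kappa^{(t)}$, $X^{(t+1)}_i=A^{(t)}X^{(t)}_i$, and returns $A=\prod_tA^{(t)}$. Let $\mathrm{PGCE}_{\rho,\beta,\kappa}$ be the algorithm which sets $\rho'=\rho/2$, $\beta'=\beta/2$, $A\gets\mathrm{PPC}_{\rho',\beta',\kappa}(X_1,\dots,X_n)$, $Y_i=AX_i$, $\tilde\Sigma\gets\mathrm{NaivePCE}_{\rho',\beta',1000}(Y_1,\dots,Y_n)$,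 and returns $\hat\Sigma=A^{-1}\tilde\Sigma A^{-1}$. Then for every $\rho,\beta,\kappa>0$, $\mathrm{PGCE}_{\rho,\beta,\kappa}$ is $\rho$-zCDP and, when given $$n=O\left(\frac{d^2+\log(\frac1\beta)}{\alpha^2}+\frac{d^2\,\mathrm{polylog}(\frac{d}{\alpha\beta\rho})}{\alpha\rho^{1/2}}+\frac{d^{3/2}\log^{1/2}(\kappa)\,\mathrm{polylog}(\frac{d\log\kappa}{\rho\beta})}{\rho^{1/2}}\right)$$ samples $X_1,\dots,X_n\sim\mathcal{N}(0,\Sigma)$ for $\mathbb{I}\preceq\Sigma\preceq\kappa\mathbb{I}$, with probability $1-O(\beta)$ it outputs $\hat\Sigma$ such that $\|\Sigma-\hat\Sigma\|_\Sigma\le O(\alpha)$.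
   Context: $O(\cdot),\Theta(\cdot)$ denote fixed absolute constants. $\|A\|_\Sigma=\|\Sigma^{-1/2}A\Sigma^{-1/2}\|_F$. $\mathrm{GUE}(\sigma^2)$ is the distribution over symmetric $d\times d$ matrices with entries $M_{ij}$, $i\le j$, i.i.d. $\mathcal{N}(0,\sigma^2)$. An algorithm $M$ is $\rho$-zCDP if for all datasets $X,X'$ differing in one entry and all $\alpha>1$, the Rényi divergence $D_\alpha(M(X)\|M(X'))\le\rho\alpha$.
   Formalization: Proved for 0<α≤1; the output is A^{-1}Σ̃A^{-T} with A=A^{(T)}⋯A^{(1)}, since A need not be symmetric and A^{-1}Σ̃A^{-1} fails for large κ; inside both polylogs ρ is replaced by min(1,ρ), since a large ρ would otherwise cancel the other parameters. *)

theory Defs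
  imports
    "HOL-Probability.Probability"
    "Jordan_Normal_Form.Gauss_Jordan_Elimination"
    "Jordan_Normal_Form.Char_Poly"
    "Jordan_Normal_Form.VS_Connect"
begin

no_notation inner (infix "\<bullet>" 70)
no_notation vec_nth (infixl "$" 90)

text \<open>
  The dimension \<open>d\<close> is an explicit natural number (and not a type), because the absolute constants
  of the main statement must not depend on it.  Vectors and matrices are those of
  \<open>Jordan_Normal_Form\<close>; the Borel structures below are the ones given by the coordinates.
\<close>

section \<open>Linear algebra\<close>

definition inv_mat :: "nat \<Rightarrow> real mat \<Rightarrow> real mat" where
  "inv_mat d A = (case mat_inverse A of Some B \<Rightarrow> B | None \<Rightarrow> 0\<^sub>m d d)"

definition frob_norm :: "real mat \<Rightarrow> real" where
  "frob_norm A = sqrt (\<Sum>i<dim_row A. \<Sum>j<dim_col A. (A $$ (i, j))\<^sup>2)"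

definition psd_cone :: "nat \<Rightarrow> real mat set" where
  "psd_cone d = {A \<in> carrier_mat d d. transpose_mat A = A \<and>
     (\<forall>x\<in>carrier_vec d. 0 \<le> x \<bullet> (A *\<^sub>v x))}"

definition loewner_le :: "nat \<Rightarrow> real mat \<Rightarrow> real mat \<Rightarrow> bool" where
  "loewner_le d A B \<longleftrightarrow> A \<in> carrier_mat d d \<and> B \<in> carrier_mat d d \<and> B - A \<in> psd_cone d"

definition mat_sqrt :: "nat \<Rightarrow> real mat \<Rightarrow> real mat" where
  "mat_sqrt d S = (THE B. B \<in> psd_cone d \<and> B * B = S)"

definition rel_norm :: "nat \<Rightarrow> real mat \<Rightarrow> real mat \<Rightarrow> real" where
  "rel_norm d S A = (let R = inv_mat d (mat_sqrt d S) in frob_norm (R * A * R))"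

text \<open>Projection with respect to the Frobenius norm; the minimiser is unique.\<close>
definition psd_proj :: "nat \<Rightarrow> real mat \<Rightarrow> real mat" where
  "psd_proj d M = arg_min (\<lambda>P. frob_norm (M - P)) (\<lambda>P. P \<in> psd_cone d)"

definition span_vecs :: "nat \<Rightarrow> real Matrix.vec set \<Rightarrow> real Matrix.vec set" where
  "span_vecs d W = LinearCombinations.module.span class_ring (module_vec TYPE(real) d) W"

definition orth_compl :: "nat \<Rightarrow> real Matrix.vec set \<Rightarrow> real Matrix.vec set" where
  "orth_compl d V = {x \<in> carrier_vec d. \<forall>v\<in>V. x \<bullet> v = 0}"

definition orth_proj :: "nat \<Rightarrow> real Matrix.vec set \<Rightarrow> real mat" where
  "orth_proj d V = (THE P. P \<in> carrier_mat d d \<and>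
     (\<forall>x\<in>carrier_vec d. P *\<^sub>v x \<in> V \<and> x - P *\<^sub>v x \<in> orth_compl d V))"

section \<open>Measurable structures and distributions\<close>

definition vec_borel :: "nat \<Rightarrow> real Matrix.vec measure" where
  "vec_borel d = vimage_algebra (carrier_vec d) (\<lambda>v. \<lambda>i\<in>{..<d}. v $ i) (\<Pi>\<^sub>M i\<in>{..<d}. borel)"

definition mat_borel :: "nat \<Rightarrow> real mat measure" where
  "mat_borel d = vimage_algebra (carrier_mat d d) (\<lambda>A. \<lambda>p\<in>{..<d} \<times> {..<d}. A $$ p)
     (\<Pi>\<^sub>M p\<in>{..<d} \<times> {..<d}. borel)"

definition psd_borel :: "nat \<Rightarrow> real mat measure" where
  "psd_borel d = restrict_space (mat_borel d) (psd_cone d)"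

text \<open>The second argument is the variance; variance \<open>0\<close> gives a point mass.\<close>
definition normal_law :: "real \<Rightarrow> real \<Rightarrow> real measure" where
  "normal_law m v =
     (if v = 0 then return borel m else density lborel (normal_density m (sqrt v)))"

definition gue :: "nat \<Rightarrow> real \<Rightarrow> real mat measure" where
  "gue d v = distr (\<Pi>\<^sub>M p\<in>{(i, j). i \<le> j \<and> j < d}. normal_law 0 v) (mat_borel d)
     (\<lambda>g. Matrix.mat d d (\<lambda>(i, j). g (min i j, max i j)))"

text \<open>The centred Gaussian law with a positive definite covariance matrix \<open>S\<close>, by its density.\<close>
definition gaussian :: "nat \<Rightarrow> real mat \<Rightarrow> real Matrix.vec measure" where
  "gaussian d S = density (distr (\<Pi>\<^sub>M i\<in>{..<d}. lborel) (vec_borel d) (\<lambda>f. Matrix.vec d f))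
     (\<lambda>x. ennreal (exp (- (x \<bullet> (inv_mat d S *\<^sub>v x)) / 2)
                    / sqrt ((2 * pi) ^ d * Determinant.det S)))"

section \<open>Zero-concentrated differential privacy\<close>

definition renyi_divergence :: "real \<Rightarrow> 'a measure \<Rightarrow> 'a measure \<Rightarrow> ereal" where
  "renyi_divergence a P Q =
     (let I = \<integral>\<^sup>+ x. ennreal (enn2real (RN_deriv Q P x) powr a) \<partial>Q in
      if absolutely_continuous Q P \<and> I < \<infinity> then ereal (ln (enn2real I) / (a - 1)) else \<infinity>)"

text \<open>
  A randomised algorithm on datasets of \<open>n\<close> entries from \<open>D\<close> is given by its output distribution,
  which has to be a probability measure on the measurable space \<open>N\<close>.
\<close>
definition zCDP ::
  "real \<Rightarrow> nat \<Rightarrow> 'x set \<Rightarrow> 'a measure \<Rightarrow> ((nat \<Rightarrow> 'x) \<Rightarrow> 'a measure) \<Rightarrow> bool" where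
  "zCDP \<rho> n D N M \<longleftrightarrow>
     (\<forall>X \<in> {..<n} \<rightarrow>\<^sub>E D. M X \<in> space (prob_algebra N)) \<and>
     (\<forall>X \<in> {..<n} \<rightarrow>\<^sub>E D. \<forall>X' \<in> {..<n} \<rightarrow>\<^sub>E D.
        (\<exists>j<n. \<forall>i<n. i \<noteq> j \<longrightarrow> X i = X' i) \<longrightarrow>
        (\<forall>a>1. renyi_divergence a (M X) (M X') \<le> ereal (\<rho> * a)))"

section \<open>The algorithms\<close>

text \<open>
  \<open>cS\<close>, \<open>c\<sigma>\<close> and \<open>cT\<close> are the constants hidden in the \<open>O\<close> of the truncation radius, in the \<open>\<Theta>\<close> of
  the noise level, and in the \<open>O\<close> of the number of rounds, respectively.
\<close>
definition naive_pce :: "real \<Rightarrow> real \<Rightarrow> nat \<Rightarrow> nat \<Rightarrow> real \<Rightarrow> real \<Rightarrow> real \<Rightarrow>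
    (nat \<Rightarrow> real Matrix.vec) \<Rightarrow> real mat measure" where
  "naive_pce cS c\<sigma> d n \<rho> \<beta> \<kappa> X =
     (let r = real d * \<kappa> * ln (real n / \<beta>);
          S = {i. i < n \<and> X i \<bullet> X i \<le> cS * r};
          \<sigma> = c\<sigma> * r / (real n * sqrt \<rho>);
          E = Matrix.mat d d (\<lambda>(j, k). (\<Sum>i\<in>S. X i $ j * X i $ k) / real n)
      in do {
           N \<leftarrow> gue d (\<sigma>\<^sup>2);
           return (psd_borel d) (psd_proj d (E + N))
         })"

definition top_eigenspace :: "nat \<Rightarrow> real \<Rightarrow> real mat \<Rightarrow> real Matrix.vec set" where
  "top_eigenspace d c Z = span_vecs d {v. \<exists>k\<ge>c. eigenvector Z v k}"

definition precond_step :: "nat \<Rightarrow> real \<Rightarrow> real \<Rightarrow> real mat \<Rightarrow> real mat" where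
  "precond_step d K \<kappa> Z = (let V = top_eigenspace d (\<kappa> / 2) Z in
     1.1 \<cdot>\<^sub>m ((1 / sqrt K) \<cdot>\<^sub>m orth_proj d V + orth_proj d (orth_compl d V)))"

text \<open>
  The remaining rounds of the preconditioner, with fixed per-round privacy and failure parameters.
  Since \<open>X\<close> is updated to \<open>A X\<close>, the factors accumulate on the left: the result is
  \<open>A\<^sup>(\<^sup>T\<^sup>) \<cdots> A\<^sup>(\<^sup>1\<^sup>)\<close>, the matrix that takes the original data to the data after the last round.
\<close>
primrec ppc_rounds :: "real \<Rightarrow> real \<Rightarrow> real \<Rightarrow> nat \<Rightarrow> nat \<Rightarrow> real \<Rightarrow> real \<Rightarrow> nat \<Rightarrow>
    real \<Rightarrow> (nat \<Rightarrow> real Matrix.vec) \<Rightarrow> real mat measure" where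
  "ppc_rounds cS c\<sigma> K d n \<rho> \<beta> 0 \<kappa> X = return (mat_borel d) (1\<^sub>m d)"
| "ppc_rounds cS c\<sigma> K d n \<rho> \<beta> (Suc t) \<kappa> X = do {
     Z \<leftarrow> naive_pce cS c\<sigma> d n \<rho> \<beta> \<kappa> X;
     let A = precond_step d K \<kappa> Z;
     B \<leftarrow> ppc_rounds cS c\<sigma> K d n \<rho> \<beta> t (0.7 * \<kappa>) (\<lambda>i. A *\<^sub>v X i);
     return (mat_borel d) (B * A)
   }"

definition ppc :: "real \<Rightarrow> real \<Rightarrow> real \<Rightarrow> real \<Rightarrow> nat \<Rightarrow> nat \<Rightarrow> real \<Rightarrow> real \<Rightarrow> real \<Rightarrow>
    (nat \<Rightarrow> real Matrix.vec) \<Rightarrow> real mat measure" where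
  "ppc cS c\<sigma> cT K d n \<rho> \<beta> \<kappa> X =
     (let T = nat \<lceil>cT * ln \<kappa>\<rceil>
      in ppc_rounds cS c\<sigma> K d n (\<rho> / real T) (\<beta> / real T) T \<kappa> X)"

text \<open>
  The product \<open>A\<close> of the (symmetric) factors need not be symmetric, and \<open>A X\<close> has covariance
  \<open>A \<Sigma> A\<^sup>T\<close>; so the right-hand factor which undoes the preconditioning is the inverse of \<open>A\<^sup>T\<close>.
\<close>
definition pgce :: "real \<Rightarrow> real \<Rightarrow> real \<Rightarrow> real \<Rightarrow> nat \<Rightarrow> nat \<Rightarrow> real \<Rightarrow> real \<Rightarrow> real \<Rightarrow>
    (nat \<Rightarrow> real Matrix.vec) \<Rightarrow> real mat measure" where
  "pgce cS c\<sigma> cT K d n \<rho> \<beta> \<kappa> X = do {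
     A \<leftarrow> ppc cS c\<sigma> cT K d n (\<rho> / 2) (\<beta> / 2) \<kappa> X;
     S \<leftarrow> naive_pce cS c\<sigma> d n (\<rho> / 2) (\<beta> / 2) 1000 (\<lambda>i. A *\<^sub>v X i);
     return (mat_borel d) (inv_mat d A * S * transpose_mat (inv_mat d A))
   }"

section \<open>Sample complexity\<close>

definition polylog :: "nat \<Rightarrow> real \<Rightarrow> real" where
  "polylog p x = (1 + max 0 (ln x)) ^ p"

text \<open>
  A polylogarithm in \<open>1 / \<rho>\<close> is read as bounded below for large \<open>\<rho>\<close>, hence \<open>min 1 \<rho>\<close>: otherwise a
  large privacy budget would cancel the logarithmic dependence on the other parameters.
\<close>
definition sample_bound :: "nat \<Rightarrow> nat \<Rightarrow> real \<Rightarrow> real \<Rightarrow> real \<Rightarrow> real \<Rightarrow> real" where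
  "sample_bound p d \<alpha> \<rho> \<beta> \<kappa> =
     ((real d)\<^sup>2 + ln (1 / \<beta>)) / \<alpha>\<^sup>2
     + (real d)\<^sup>2 * polylog p (real d / (\<alpha> * \<beta> * min 1 \<rho>)) / (\<alpha> * sqrt \<rho>)
     + real d powr (3 / 2) * sqrt (ln \<kappa>) * polylog p (real d * ln \<kappa> / (min 1 \<rho> * \<beta>)) / sqrt \<rho>"

end

theory Submission
  imports Defs
begin

text \<open>
  Privacy: for the conjugate exponent \<open>a / (a - 1)\<close>, the Renyi bound is equivalent to an inequality
  between integrals of test functions, which is preserved by post-processing and by adaptive
  composition. It remains to treat one Gaussian mechanism, where it is Hoelder's inequality applied to
  the density ratio.

  Accuracy: write \<open>X\<^sub>i = L g\<^sub>i\<close> with a Cholesky factor \<open>L\<close> of the covariance and standard normal \<open>g\<^sub>i\<close>.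
  With high probability \<open>1/n \<Sum> g\<^sub>i g\<^sub>i\<^sup>T - I\<close> has Frobenius norm \<open>O(\<alpha>)\<close> and every \<open>g\<^sub>i\<close> is short. Fix such a
  sample. If \<open>M\<close> is the product of \<open>L\<close> with the preconditioners found so far, then the empirical
  covariance is a small relative perturbation of \<open>M M\<^sup>T\<close>, whatever these preconditioners are, so only
  the noise is random from here on. Each round keeps \<open>M M\<^sup>T\<close> above \<open>1/2000\<close> and lowers the upper
  bound \<open>\<kappa>\<^sub>t\<close> by the factor \<open>0.7\<close>. The number of rounds is chosen such that \<open>\<kappa>\<^sub>t \<ge> 1\<close> before every round
  and \<open>\<kappa>\<^sub>t \<le> 1\<close> after the last one; the remaining Frobenius error is then the relative error up to a
  constant. Concentration of the sample covariance and of the noise comes from exponential moments and a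
  union bound over a grid.
\<close>

section \<open>Spectral theorem for real symmetric matrices\<close>

text \<open>Two obstacles shape the proof. The algorithms use eigenspaces, orthogonal projections
  and a nearest psd matrix, all introduced by choice or description operators, while their
  composition needs measurable kernels. Both operations on matrices are therefore first identified
  as a function applied to the eigenvalues, and such a function is a limit of polynomials in the
  matrix; eigenvectors never have to be chosen measurably. The second obstacle is that the number of
  rounds grows with \<kappa>, so no loss per round is affordable in the lower bound. With per-round
  error \<open>0.01 * \<kappa>\<close>, \<open>K = 20\<close> and lower bound 1/2000, the upper
  bound closes because 1.1^2 (1/20 + 0.51) < 0.7, and the lower bound because (sqrt 20 (2/44 +
  0.02))^2 + 1 < 1.1^2: the factor 1.1 pays for the error. The same data serve every round: a sample
  is \<open>M g\<close> with \<open>M\<close> bounded by the current \<kappa>, so on a good sample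
  nothing is ever truncated and the deviation of the empirical covariance of the \<open>g\<close> is
  one fixed matrix. The noise scales with the current \<kappa> as well, so all rounds have the same
  failure probability.\<close>

lemma scalar_prod_self_sum: "(v :: real Matrix.vec) \<in> carrier_vec d \<Longrightarrow> v \<bullet> v = (\<Sum>i<d. (v $ i)\<^sup>2)"
  by (auto simp: scalar_prod_def power2_eq_square lessThan_atLeast0)

lemma scalar_prod_self_nonneg: "0 \<le> (v :: real Matrix.vec) \<bullet> v"
  by (simp add: scalar_prod_def sum_nonneg)

lemma scalar_prod_self_eq_0:
  assumes "(v :: real Matrix.vec) \<in> carrier_vec d"
  shows "v \<bullet> v = 0 \<longleftrightarrow> v = 0\<^sub>v d"
  using assms by (auto simp: scalar_prod_self_sum sum_nonneg_eq_0_iff intro!: eq_vecI)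

lemma scalar_prod_symmetric_mat:
  assumes "(A :: real mat) \<in> carrier_mat d d" "transpose_mat A = A" "v \<in> carrier_vec d" "w \<in> carrier_vec d"
  shows "v \<bullet> (A *\<^sub>v w) = (A *\<^sub>v v) \<bullet> w"
  using transpose_vec_mult_scalar[of A d d w v] assms by simp

text \<open>The fundamental theorem of algebra gives a complex eigenpair. Splitting the eigenvector
  into real and imaginary parts \<open>x\<close>, \<open>y\<close> and comparing
  \<open>y \<bullet> (A *\<^sub>v x)\<close> with \<open>(A *\<^sub>v y) \<bullet> x\<close> forces
  \<open>Im z * (x \<bullet> x + y \<bullet> y) = 0\<close>; so the eigenvalue is real, and
  whichever of \<open>x\<close>, \<open>y\<close> is nonzero is a real eigenvector.\<close>

lemma real_symmetric_eigenvector: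
  fixes A :: "real mat"
  assumes A: "A \<in> carrier_mat d d" and sym: "transpose_mat A = A" and d: "d > 0"
  shows "\<exists>v k. eigenvector A v k"
proof -
  let ?C = "map_mat complex_of_real A"
  have C: "?C \<in> carrier_mat d d" using A by simp
  have "degree (char_poly ?C) = d" using degree_monic_char_poly[OF C] by simp
  hence "\<not> constant (poly (char_poly ?C))" using d by (simp add: constant_degree)
  then obtain z where "poly (char_poly ?C) z = 0" using fundamental_theorem_of_algebra by blast
  hence "eigenvalue ?C z" using eigenvalue_root_char_poly[OF C] by simp
  then obtain v where v: "v \<in> carrier_vec d" "v \<noteq> 0\<^sub>v d" "?C *\<^sub>v v = z \<cdot>\<^sub>v v"
    using A unfolding eigenvalue_def eigenvector_def by auto
  define x y where "x = map_vec Re v" and "y = map_vec Im v"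
  have xy: "x \<in> carrier_vec d" "y \<in> carrier_vec d" using v by (auto simp: x_def y_def)
  have comp: "(?C *\<^sub>v v) $ i = complex_of_real ((A *\<^sub>v x) $ i) + \<i> * complex_of_real ((A *\<^sub>v y) $ i)"
    if "i < d" for i
    using that A v(1)
    by (simp add: scalar_prod_def x_def y_def complex_eq_iff)
  have Ax: "A *\<^sub>v x = Re z \<cdot>\<^sub>v x - Im z \<cdot>\<^sub>v y"
  proof (rule eq_vecI)
    fix i assume "i < dim_vec (Re z \<cdot>\<^sub>v x - Im z \<cdot>\<^sub>v y)"
    hence i: "i < d" using xy by simp
    have "(A *\<^sub>v x) $ i = Re ((?C *\<^sub>v v) $ i)" using comp[OF i] by simp
    also have "\<dots> = (Re z \<cdot>\<^sub>v x - Im z \<cdot>\<^sub>v y) $ i" using i v(1) xy by (simp add: v(3) x_def y_def)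
    finally show "(A *\<^sub>v x) $ i = (Re z \<cdot>\<^sub>v x - Im z \<cdot>\<^sub>v y) $ i" .
  qed (use A xy in auto)
  have Ay: "A *\<^sub>v y = Im z \<cdot>\<^sub>v x + Re z \<cdot>\<^sub>v y"
  proof (rule eq_vecI)
    fix i assume "i < dim_vec (Im z \<cdot>\<^sub>v x + Re z \<cdot>\<^sub>v y)"
    hence i: "i < d" using xy by simp
    have "(A *\<^sub>v y) $ i = Im ((?C *\<^sub>v v) $ i)" using comp[OF i] by simp
    also have "\<dots> = (Im z \<cdot>\<^sub>v x + Re z \<cdot>\<^sub>v y) $ i" using i v(1) xy by (simp add: v(3) x_def y_def)
    finally show "(A *\<^sub>v y) $ i = (Im z \<cdot>\<^sub>v x + Re z \<cdot>\<^sub>v y) $ i" .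
  qed (use A xy in auto)
  have nz: "x \<noteq> 0\<^sub>v d \<or> y \<noteq> 0\<^sub>v d"
  proof (rule ccontr)
    assume "\<not> ?thesis"
    hence *: "\<And>i. i < d \<Longrightarrow> x $ i = 0 \<and> y $ i = 0" by simp
    have "v = 0\<^sub>v d"
      using v(1) * by (intro eq_vecI) (auto simp: x_def y_def complex_eq_iff)
    thus False using v(2) by simp
  qed
  have "y \<bullet> (A *\<^sub>v x) = (A *\<^sub>v y) \<bullet> x" using scalar_prod_symmetric_mat[OF A sym] xy by simp
  hence "Im z * (x \<bullet> x + y \<bullet> y) = 0"
    using xy by (simp add: Ax Ay scalar_prod_minus_distrib[where n=d] add_scalar_prod_distrib[where n=d]
        comm_scalar_prod[of y d x] algebra_simps)
  moreover have "x \<bullet> x + y \<bullet> y \<noteq> 0"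
    using nz xy scalar_prod_self_nonneg[of x] scalar_prod_self_nonneg[of y] scalar_prod_self_eq_0
    by (metis add_nonneg_eq_0_iff)
  ultimately have "Im z = 0" by simp
  hence "A *\<^sub>v x = Re z \<cdot>\<^sub>v x" "A *\<^sub>v y = Re z \<cdot>\<^sub>v y"
    using xy by (auto simp: Ax Ay intro!: eq_vecI)
  hence "eigenvector A x (Re z) \<or> eigenvector A y (Re z)"
    using nz xy A by (auto simp: eigenvector_def)
  thus ?thesis by blast
qed

lemma mult_block_diag:
  assumes "(A :: real mat) \<in> carrier_mat m m" "A' \<in> carrier_mat m m" "D \<in> carrier_mat n n" "D' \<in> carrier_mat n n"
  shows "four_block_mat A (0\<^sub>m m n) (0\<^sub>m n m) D * four_block_mat A' (0\<^sub>m m n) (0\<^sub>m n m) D' =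
    four_block_mat (A * A') (0\<^sub>m m n) (0\<^sub>m n m) (D * D')"
  using assms by (subst mult_four_block_mat[of _ m m _ n _ n _ _ m _ n]) auto

text \<open>\<open>H\<close> is the Householder reflection that exchanges \<open>v\<close> and the first unit vector.\<close>
lemma reflection_exists:
  assumes v: "(v :: real Matrix.vec) \<in> carrier_vec (Suc n)" and v1: "v \<bullet> v = 1"
  shows "\<exists>H \<in> carrier_mat (Suc n) (Suc n). transpose_mat H = H \<and> H * H = 1\<^sub>m (Suc n) \<and>
    H *\<^sub>v unit_vec (Suc n) 0 = v"
proof (cases "v = unit_vec (Suc n) 0")
  case True
  then show ?thesis by (intro bexI[of _ "1\<^sub>m (Suc n)"]) auto
next
  case False
  define u where "u = v - unit_vec (Suc n) 0"
  have u: "u \<in> carrier_vec (Suc n)" using v by (simp add: u_def)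
  have "u \<noteq> 0\<^sub>v (Suc n)"
  proof
    assume "u = 0\<^sub>v (Suc n)"
    hence "\<forall>i<Suc n. u $ i = 0" by simp
    hence "v = unit_vec (Suc n) 0" using v by (intro eq_vecI) (auto simp: u_def)
    thus False using False by simp
  qed
  hence uu: "u \<bullet> u \<noteq> 0" using u scalar_prod_self_eq_0 by blast
  have "u \<bullet> u = v \<bullet> v - v $ 0 - (v $ 0 - 1)"
    using v unfolding u_def
    by (simp add: scalar_prod_minus_distrib[where n="Suc n"] minus_scalar_prod_distrib[where n="Suc n"])
  hence uu2: "u \<bullet> u = - 2 * u $ 0" using v1 v by (simp add: u_def)
  define c where "c = 2 / (u \<bullet> u)"
  have cu: "c * u $ 0 = -1" using uu uu2 by (simp add: c_def)
  have cuu: "c * (u \<bullet> u) = 2" using uu by (simp add: c_def)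
  define H where "H = Matrix.mat (Suc n) (Suc n) (\<lambda>(i, j). (if i = j then 1 else 0) - c * u $ i * u $ j)"
  have "H * H = 1\<^sub>m (Suc n)"
  proof (rule eq_matI)
    fix i j assume ij: "i < dim_row (1\<^sub>m (Suc n) :: real mat)" "j < dim_col (1\<^sub>m (Suc n) :: real mat)"
    have "(H * H) $$ (i, j) = (\<Sum>k<Suc n. ((if i = k then 1 else 0) - c * u $ i * u $ k) *
        ((if k = j then 1 else 0) - c * u $ k * u $ j))"
      using ij by (simp add: H_def scalar_prod_def lessThan_atLeast0)
    also have "\<dots> = (\<Sum>k<Suc n. (if k = i then (if i = j then 1 else 0) - c * u $ i * u $ j else 0)
        - (if k = j then c * u $ i * u $ j else 0) + (c * c * u $ i * u $ j) * (u $ k * u $ k))"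
      by (intro sum.cong) (auto simp: algebra_simps)
    also have "\<dots> = (if i = j then 1 else 0) - 2 * c * u $ i * u $ j + (c * c * u $ i * u $ j) * (u \<bullet> u)"
      using ij u unfolding sum.distrib sum_subtractf sum_distrib_left[symmetric]
      by (simp add: scalar_prod_def lessThan_atLeast0 del: sum.op_ivl_Suc)
    also have "\<dots> = (if i = j then 1 else 0) + c * u $ i * u $ j * (c * (u \<bullet> u) - 2)"
      by (simp add: algebra_simps)
    also have "\<dots> = 1\<^sub>m (Suc n) $$ (i, j)" using ij by (simp add: cuu)
    finally show "(H * H) $$ (i, j) = 1\<^sub>m (Suc n) $$ (i, j)" .
  qed (auto simp: H_def)
  moreover have "H *\<^sub>v unit_vec (Suc n) 0 = v"
  proof (rule eq_vecI)
    fix i assume "i < dim_vec v"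
    hence i: "i < Suc n" using v by simp
    hence "(H *\<^sub>v unit_vec (Suc n) 0) $ i = (if i = 0 then 1 else 0) - u $ i * (c * u $ 0)"
      by (simp add: H_def)
    also have "\<dots> = v $ i" unfolding cu using v i by (auto simp: u_def)
    finally show "(H *\<^sub>v unit_vec (Suc n) 0) $ i = v $ i" .
  qed (use v in \<open>auto simp: H_def\<close>)
  moreover have "transpose_mat H = H" by (rule eq_matI) (auto simp: H_def)
  ultimately show ?thesis by (intro bexI[of _ H]) (auto simp: H_def)
qed

definition spectral_decomp :: "nat \<Rightarrow> real mat \<Rightarrow> real mat \<Rightarrow> (nat \<Rightarrow> real) \<Rightarrow> bool" where
  "spectral_decomp d A U l \<longleftrightarrow> U \<in> carrier_mat d d \<and> transpose_mat U * U = 1\<^sub>m d \<and>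
     U * transpose_mat U = 1\<^sub>m d \<and> A = U * mat_diag d l * transpose_mat U"

text \<open>Deflation by induction on the dimension. A reflection \<open>H\<close> takes the first
  unit vector to a unit eigenvector, so \<open>H * A * H\<close> has first column \<open>k\<close>
  times that unit vector, and by symmetry the same first row. The remaining block is symmetric and
  is diagonalised by the induction hypothesis.\<close>

theorem spectral_decomp_exists:
  fixes A :: "real mat"
  assumes "A \<in> carrier_mat d d" and "transpose_mat A = A"
  shows "\<exists>U l. spectral_decomp d A U l"
  using assms
proof (induction d arbitrary: A)
  case 0
  have "spectral_decomp 0 A (1\<^sub>m 0) (\<lambda>_. 0)"
    using 0 by (auto simp: spectral_decomp_def intro!: eq_matI)
  then show ?case by blast
next
  case (Suc n A)
  note A = Suc.prems(1) and sym = Suc.prems(2)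
  from real_symmetric_eigenvector[OF A sym] obtain w k where w: "eigenvector A w k" by auto
  hence wc: "w \<in> carrier_vec (Suc n)" "w \<noteq> 0\<^sub>v (Suc n)" "A *\<^sub>v w = k \<cdot>\<^sub>v w"
    using A by (auto simp: eigenvector_def)
  have ww: "w \<bullet> w > 0" using wc scalar_prod_self_nonneg[of w] scalar_prod_self_eq_0 by (metis less_eq_real_def)
  define v where "v = (1 / sqrt (w \<bullet> w)) \<cdot>\<^sub>v w"
  have v: "v \<in> carrier_vec (Suc n)" "v \<bullet> v = 1" "A *\<^sub>v v = k \<cdot>\<^sub>v v"
    using wc ww A by (auto simp: v_def mult_mat_vec[where nr="Suc n" and nc="Suc n"] smult_smult_assoc
        power2_eq_square[symmetric] field_simps real_sqrt_pow2)
  from reflection_exists[OF v(1,2)] obtain H where H: "H \<in> carrier_mat (Suc n) (Suc n)"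
    "transpose_mat H = H" "H * H = 1\<^sub>m (Suc n)" "H *\<^sub>v unit_vec (Suc n) 0 = v" by auto
  let ?e = "unit_vec (Suc n) 0 :: real Matrix.vec"
  define B where "B = H * A * H"
  have B: "B \<in> carrier_mat (Suc n) (Suc n)" using A H by (simp add: B_def)
  have Bs: "transpose_mat B = B"
    using A H sym by (simp add: B_def transpose_mult[where nr="Suc n" and n="Suc n" and nc="Suc n"]
        assoc_mult_mat[where n\<^sub>1="Suc n" and n\<^sub>2="Suc n" and n\<^sub>3="Suc n" and n\<^sub>4="Suc n"])
  have Hv: "H *\<^sub>v v = ?e" unfolding H(4)[symmetric]
    using H(1) by (simp add: assoc_mult_mat_vec[symmetric, of H _ _ H "Suc n"] H(3))
  have Be: "B *\<^sub>v ?e = k \<cdot>\<^sub>v ?e"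
    unfolding B_def using A H v Hv by (simp add: assoc_mult_mat_vec[of _ "Suc n" "Suc n" _ "Suc n"] mult_mat_vec[where nr="Suc n" and nc="Suc n"])
  have B0: "B $$ (i, 0) = (if i = 0 then k else 0)" if "i < Suc n" for i
  proof -
    have "(B *\<^sub>v ?e) $ i = B $$ (i, 0)" using B that by simp
    thus ?thesis using that by (auto simp: Be split: if_splits)
  qed
  have B0': "B $$ (0, i) = (if i = 0 then k else 0)" if "i < Suc n" for i
    using B0[OF that] that Bs B by (metis carrier_matD(1) carrier_matD(2) index_transpose_mat(1) zero_less_Suc)
  define C where "C = Matrix.mat n n (\<lambda>(i, j). B $$ (Suc i, Suc j))"
  have C: "C \<in> carrier_mat n n" by (simp add: C_def)
  have Cs: "transpose_mat C = C"
  proof (rule eq_matI)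
    fix i j assume "i < dim_row C" "j < dim_col C"
    thus "transpose_mat C $$ (i, j) = C $$ (i, j)"
      using B Bs by (auto simp: C_def) (metis Suc_less_eq carrier_matD(1) carrier_matD(2) index_transpose_mat(1))
  qed (auto simp: C_def)
  from Suc.IH[OF C Cs] obtain V l where V: "spectral_decomp n C V l" by blast
  let ?Z = "0\<^sub>m 1 n :: real mat" and ?Z' = "0\<^sub>m n 1 :: real mat"
  define W where "W = four_block_mat (1\<^sub>m 1) ?Z ?Z' V"
  define m where "m = (\<lambda>i. case i of 0 \<Rightarrow> k | Suc j \<Rightarrow> l j)"
  have Vc: "V \<in> carrier_mat n n" and V1: "transpose_mat V * V = 1\<^sub>m n" "V * transpose_mat V = 1\<^sub>m n"
    and VC: "C = V * mat_diag n l * transpose_mat V" using V by (auto simp: spectral_decomp_def)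
  have Wc: "W \<in> carrier_mat (Suc n) (Suc n)"
    using Vc four_block_carrier_mat[of "1\<^sub>m 1" 1 1 V n n] by (simp add: W_def)
  have WT: "transpose_mat W = four_block_mat (1\<^sub>m 1) ?Z ?Z' (transpose_mat V)"
    unfolding W_def using Vc by (subst transpose_four_block_mat[of _ 1 1 _ n _ n]) auto
  have D: "mat_diag (Suc n) m = four_block_mat (mat_diag 1 (\<lambda>_. k)) ?Z ?Z' (mat_diag n l)"
    by (rule eq_matI) (auto simp: mat_diag_def m_def split: nat.split)
  have BB: "B = four_block_mat (mat_diag 1 (\<lambda>_. k)) ?Z ?Z' C"
    by (rule eq_matI) (use B in \<open>auto simp: B0 B0' mat_diag_def C_def not_less\<close>)
  have one: "four_block_mat (1\<^sub>m 1) ?Z ?Z' (1\<^sub>m n) = 1\<^sub>m (Suc n)"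
    using four_block_one_mat[of 1 n] by simp
  have W1: "transpose_mat W * W = 1\<^sub>m (Suc n)" "W * transpose_mat W = 1\<^sub>m (Suc n)"
    unfolding WT unfolding W_def one[symmetric] using Vc V1
    by (auto simp: mult_block_diag[where m=1 and n=n] simp del: One_nat_def)
  have "W * mat_diag (Suc n) m = four_block_mat (1\<^sub>m 1 * mat_diag 1 (\<lambda>_. k)) ?Z ?Z' (V * mat_diag n l)"
    unfolding D W_def using Vc by (intro mult_block_diag) auto
  also have "1\<^sub>m 1 * mat_diag 1 (\<lambda>_. k) = mat_diag 1 (\<lambda>_. k)" by (rule left_mult_one_mat[OF mat_diag_dim])
  finally have "W * mat_diag (Suc n) m * transpose_mat W =
      four_block_mat (mat_diag 1 (\<lambda>_. k)) ?Z ?Z' (V * mat_diag n l) *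
      four_block_mat (1\<^sub>m 1) ?Z ?Z' (transpose_mat V)" unfolding WT by simp
  also have "\<dots> = four_block_mat (mat_diag 1 (\<lambda>_. k) * 1\<^sub>m 1) ?Z ?Z' (V * mat_diag n l * transpose_mat V)"
    using mult_carrier_mat[OF Vc mat_diag_dim, of l] Vc by (intro mult_block_diag) auto
  also have "mat_diag 1 (\<lambda>_. k) * 1\<^sub>m 1 = mat_diag 1 (\<lambda>_. k)" by (rule right_mult_one_mat[OF mat_diag_dim])
  finally have WB: "B = W * mat_diag (Suc n) m * transpose_mat W" unfolding BB VC ..
  define U where "U = H * W"
  have Uc: "U \<in> carrier_mat (Suc n) (Suc n)" using H Wc by (simp add: U_def)
  have UT: "transpose_mat U = transpose_mat W * H"
    using H Wc by (simp add: U_def transpose_mult[where nr="Suc n" and n="Suc n" and nc="Suc n"])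
  note assoc = assoc_mult_mat[where n\<^sub>1="Suc n" and n\<^sub>2="Suc n" and n\<^sub>3="Suc n" and n\<^sub>4="Suc n"]
  have HH: "H * (H * X) = X" if "X \<in> carrier_mat (Suc n) (Suc n)" for X
    using that H by (simp add: assoc[symmetric] del: assoc_mult_mat)
  have WW: "W * (transpose_mat W * X) = X" if "X \<in> carrier_mat (Suc n) (Suc n)" for X
    using that Wc W1 by (simp add: assoc[symmetric] del: assoc_mult_mat)
  have U1: "transpose_mat U * U = 1\<^sub>m (Suc n)"
    unfolding UT using H(1) Wc W1 by (simp add: U_def assoc HH)
  have U2: "U * transpose_mat U = 1\<^sub>m (Suc n)"
    unfolding UT using H Wc by (simp add: U_def assoc WW)
  have "A = H * B * H" using A H(1,3) by (simp add: B_def assoc HH)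
  also have "\<dots> = U * mat_diag (Suc n) m * transpose_mat U"
    unfolding WB UT using H(1) Wc mat_diag_dim[of "Suc n" m] by (simp add: U_def assoc del: mat_diag_dim)
  finally show ?case using Uc U1 U2 by (auto simp: spectral_decomp_def)
qed

section \<open>Functions of a symmetric matrix\<close>

definition vnorm :: "real Matrix.vec \<Rightarrow> real" where
  "vnorm v = sqrt (v \<bullet> v)"

lemma vnorm_nonneg [simp]: "0 \<le> vnorm v"
  by (simp add: vnorm_def scalar_prod_self_nonneg)

lemma vnorm_sq: "(vnorm v)\<^sup>2 = v \<bullet> v"
  by (simp add: vnorm_def scalar_prod_self_nonneg)

lemma vnorm_Cauchy_Schwarz:
  assumes "v \<in> carrier_vec d" "w \<in> carrier_vec d"
  shows "\<bar>v \<bullet> w\<bar> \<le> vnorm v * vnorm w"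
proof -
  have vw: "v \<bullet> w = (\<Sum>i<d. v $ i * w $ i)"
    using assms(2) unfolding scalar_prod_def by (simp add: lessThan_atLeast0)
  have "(v \<bullet> w)\<^sup>2 \<le> (v \<bullet> v) * (w \<bullet> w)"
    unfolding vw scalar_prod_self_sum[OF assms(1)] scalar_prod_self_sum[OF assms(2)]
    by (rule Cauchy_Schwarz_ineq_sum)
  hence "sqrt ((v \<bullet> w)\<^sup>2) \<le> sqrt ((v \<bullet> v) * (w \<bullet> w))" by (rule real_sqrt_le_mono)
  thus ?thesis by (simp add: vnorm_def real_sqrt_mult)
qed

lemma vnorm_triangle:
  assumes "v \<in> carrier_vec d" "w \<in> carrier_vec d"
  shows "vnorm (v + w) \<le> vnorm v + vnorm w"
proof -
  have "(vnorm (v + w))\<^sup>2 = v \<bullet> v + w \<bullet> w + 2 * (v \<bullet> w)"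
    using assms by (simp add: vnorm_sq scalar_prod_add_distrib[where n=d] add_scalar_prod_distrib[where n=d]
        comm_scalar_prod[of w d v])
  also have "\<dots> \<le> (vnorm v + vnorm w)\<^sup>2"
    using vnorm_Cauchy_Schwarz[OF assms] by (simp add: power2_sum vnorm_sq)
  finally show ?thesis by (rule power2_le_imp_le) simp
qed

lemma vnorm_smult: "vnorm (c \<cdot>\<^sub>v v) = \<bar>c\<bar> * vnorm v"
  by (simp add: vnorm_def real_sqrt_mult power2_eq_square[symmetric] flip: mult.assoc)

definition orth_mat :: "nat \<Rightarrow> real mat \<Rightarrow> bool" where
  "orth_mat d U \<longleftrightarrow> U \<in> carrier_mat d d \<and> transpose_mat U * U = 1\<^sub>m d \<and> U * transpose_mat U = 1\<^sub>m d"

text \<open>A functional calculus: for fixed \<open>U\<close>, sums, scalings, products and powers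
  act pointwise on \<open>l\<close>, and applying \<open>f\<close> to the matrix means replacing
  \<open>l\<close> by \<open>\<lambda>k. f (l k)\<close>. The eigenvalues need no order, and
  repeated ones need no care.\<close>

definition spec_mat :: "nat \<Rightarrow> real mat \<Rightarrow> (nat \<Rightarrow> real) \<Rightarrow> real mat" where
  "spec_mat d U l = U * mat_diag d l * transpose_mat U"

text \<open>Coordinates with respect to the orthonormal columns of \<open>U\<close>. They turn
  scalar products and quadratic forms of \<open>spec_mat d U l\<close> into sums over eigenvalues
  that can be compared term by term.\<close>

definition eig_coord :: "real mat \<Rightarrow> real Matrix.vec \<Rightarrow> nat \<Rightarrow> real" where
  "eig_coord U x k = (transpose_mat U *\<^sub>v x) $ k"

lemma symmetric_spec_mat:
  assumes "A \<in> carrier_mat d d" and "transpose_mat A = A"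
  obtains U l where "orth_mat d U" "A = spec_mat d U l"
  using spectral_decomp_exists[OF assms] unfolding spectral_decomp_def orth_mat_def spec_mat_def by blast

lemma mat_assoc6:
  assumes "(A :: real mat) \<in> carrier_mat d d" "B \<in> carrier_mat d d" "C \<in> carrier_mat d d"
    "A' \<in> carrier_mat d d" "B' \<in> carrier_mat d d" "C' \<in> carrier_mat d d"
  shows "(A * B * C) * (A' * B' * C') = A * (B * ((C * A') * B')) * C'"
  using assms by (simp add: assoc_mult_mat[where n\<^sub>1=d and n\<^sub>2=d and n\<^sub>3=d and n\<^sub>4=d])

lemma mat_assoc_vec4:
  assumes "(A :: real mat) \<in> carrier_mat d d" "B \<in> carrier_mat d d" "C \<in> carrier_mat d d"
    "A' \<in> carrier_mat d d" "x \<in> carrier_vec d"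
  shows "A' *\<^sub>v ((A * B * C) *\<^sub>v x) = (A' * A) *\<^sub>v (B *\<^sub>v (C *\<^sub>v x))"
  using assms by (simp add: assoc_mult_mat_vec[where n\<^sub>1=d and n\<^sub>2=d and n\<^sub>3=d])

context
  fixes d :: nat and U :: "real mat"
  assumes U: "orth_mat d U"
begin

lemma orth_mat_carrier: "U \<in> carrier_mat d d"
  using U by (simp add: orth_mat_def)

lemma spec_mat_carrier [simp]: "spec_mat d U l \<in> carrier_mat d d"
  using mult_carrier_mat[OF mult_carrier_mat[OF orth_mat_carrier mat_diag_dim] transpose_carrier_mat[THEN iffD2, OF orth_mat_carrier]]
  by (simp add: spec_mat_def)

lemma dim_spec_mat [simp]: "dim_row (spec_mat d U l) = d" "dim_col (spec_mat d U l) = d"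
  using spec_mat_carrier[of l] by (blast dest: carrier_matD)+

lemma spec_mat_index:
  assumes "i < d" "j < d"
  shows "spec_mat d U l $$ (i, j) = (\<Sum>k<d. U $$ (i, k) * l k * U $$ (j, k))"
  using assms orth_mat_carrier unfolding spec_mat_def
  by (subst mat_diag_mult_right[of _ d d]) (auto simp: scalar_prod_def lessThan_atLeast0)

lemma spec_mat_transpose [simp]: "transpose_mat (spec_mat d U l) = spec_mat d U l"
  by (intro eq_matI) (auto simp: spec_mat_index mult_ac)

lemma spec_mat_add: "spec_mat d U l + spec_mat d U m = spec_mat d U (\<lambda>k. l k + m k)"
  by (intro eq_matI) (auto simp: spec_mat_index algebra_simps sum.distrib)

lemma spec_mat_minus: "spec_mat d U l - spec_mat d U m = spec_mat d U (\<lambda>k. l k - m k)"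
  by (intro eq_matI) (auto simp: spec_mat_index algebra_simps sum_subtractf)

lemma spec_mat_smult: "c \<cdot>\<^sub>m spec_mat d U l = spec_mat d U (\<lambda>k. c * l k)"
  by (intro eq_matI) (auto simp: spec_mat_index sum_distrib_left mult_ac)

lemma spec_mat_one [simp]: "spec_mat d U (\<lambda>_. 1) = 1\<^sub>m d"
  using U right_mult_one_mat[of U d d] by (simp add: spec_mat_def orth_mat_def)

lemma spec_mat_mult: "spec_mat d U l * spec_mat d U m = spec_mat d U (\<lambda>k. l k * m k)"
proof -
  let ?T = "transpose_mat U"
  have "spec_mat d U l * spec_mat d U m = U * (mat_diag d l * ((?T * U) * mat_diag d m)) * ?T"
    unfolding spec_mat_def using orth_mat_carrier by (intro mat_assoc6) auto
  also have "(?T * U) * mat_diag d m = mat_diag d m"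
    using U by (simp add: orth_mat_def left_mult_one_mat[of _ d d])
  finally show ?thesis by (simp add: spec_mat_def)
qed

lemma spec_mat_pow: "spec_mat d U l ^\<^sub>m n = spec_mat d U (\<lambda>k. l k ^ n)"
proof (induction n)
  case 0
  then show ?case by simp
next
  case (Suc n)
  then show ?case by (simp add: spec_mat_mult mult.commute)
qed

lemma eig_coord_spec_mat:
  assumes x: "x \<in> carrier_vec d" and k: "k < d"
  shows "eig_coord U (spec_mat d U l *\<^sub>v x) k = l k * eig_coord U x k"
proof -
  let ?T = "transpose_mat U"
  have "?T *\<^sub>v (spec_mat d U l *\<^sub>v x) = (?T * U) *\<^sub>v (mat_diag d l *\<^sub>v (?T *\<^sub>v x))"
    unfolding spec_mat_def using orth_mat_carrier x by (intro mat_assoc_vec4) auto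
  also have "?T * U = 1\<^sub>m d" using U by (simp add: orth_mat_def)
  also have "1\<^sub>m d *\<^sub>v (mat_diag d l *\<^sub>v (?T *\<^sub>v x)) = mat_diag d l *\<^sub>v (?T *\<^sub>v x)"
    by (rule one_mult_mat_vec, rule mult_mat_vec_carrier[OF mat_diag_dim], rule mult_mat_vec_carrier[where nr=d and n=d])
       (use orth_mat_carrier x in auto)
  finally have *: "?T *\<^sub>v (spec_mat d U l *\<^sub>v x) = mat_diag d l *\<^sub>v (?T *\<^sub>v x)" .
  have **: "(mat_diag d l *\<^sub>v y) $ k = l k * y $ k" if "y \<in> carrier_vec d" for y
  proof -
    have "(mat_diag d l *\<^sub>v y) $ k = (\<Sum>j<d. (if k = j then l j else 0) * y $ j)"
      using k that by (simp add: mat_diag_def scalar_prod_def lessThan_atLeast0)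
    also have "\<dots> = (\<Sum>j<d. if j = k then l k * y $ k else 0)" by (intro sum.cong) auto
    finally show ?thesis using k by simp
  qed
  show ?thesis unfolding eig_coord_def * using orth_mat_carrier x by (subst **) auto
qed

lemma scalar_prod_eig_coord:
  assumes x: "x \<in> carrier_vec d" and y: "y \<in> carrier_vec d"
  shows "x \<bullet> y = (\<Sum>k<d. eig_coord U x k * eig_coord U y k)"
proof -
  let ?T = "transpose_mat U"
  have "(\<Sum>k<d. eig_coord U x k * eig_coord U y k) = (?T *\<^sub>v x) \<bullet> (?T *\<^sub>v y)"
    using orth_mat_carrier by (simp add: eig_coord_def scalar_prod_def lessThan_atLeast0)
  also have "\<dots> = x \<bullet> (U *\<^sub>v (?T *\<^sub>v y))"
    using transpose_vec_mult_scalar[of U d d "?T *\<^sub>v y" x] x y orth_mat_carrier by simp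
  also have "U *\<^sub>v (?T *\<^sub>v y) = (U * ?T) *\<^sub>v y"
    using orth_mat_carrier y by (simp add: assoc_mult_mat_vec[where n\<^sub>1=d and n\<^sub>2=d and n\<^sub>3=d])
  also have "\<dots> = y" using U y by (simp add: orth_mat_def)
  finally show ?thesis by simp
qed

lemma quad_spec_mat:
  assumes x: "x \<in> carrier_vec d" and y: "y \<in> carrier_vec d"
  shows "x \<bullet> (spec_mat d U l *\<^sub>v y) = (\<Sum>k<d. l k * eig_coord U x k * eig_coord U y k)"
proof -
  have "spec_mat d U l *\<^sub>v y \<in> carrier_vec d"
    by (rule mult_mat_vec_carrier[OF spec_mat_carrier y])
  thus ?thesis using assms
    by (subst scalar_prod_eig_coord) (auto simp: eig_coord_spec_mat mult_ac)
qed

lemma spec_mat_psd: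
  assumes "\<And>k. k < d \<Longrightarrow> 0 \<le> l k"
  shows "spec_mat d U l \<in> psd_cone d"
  unfolding psd_cone_def using assms
  by (auto simp: quad_spec_mat mult.assoc intro!: sum_nonneg mult_nonneg_nonneg[OF _ zero_le_square])

lemma eig_coord_col: "k < d \<Longrightarrow> j < d \<Longrightarrow> eig_coord U (col U k) j = (if j = k then 1 else 0)"
proof -
  assume kj: "k < d" "j < d"
  have "eig_coord U (col U k) j = (transpose_mat U * U) $$ (j, k)"
    using kj orth_mat_carrier by (simp add: eig_coord_def)
  thus ?thesis using U kj by (simp add: orth_mat_def)
qed

lemma col_carrier: "col U k \<in> carrier_vec d"
  using col_dim[of U k] carrier_matD(1)[OF orth_mat_carrier] by simp

lemma quad_spec_mat_col: "k < d \<Longrightarrow> col U k \<bullet> (spec_mat d U l *\<^sub>v col U k) = l k"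
proof -
  assume k: "k < d"
  have "col U k \<bullet> (spec_mat d U l *\<^sub>v col U k) = (\<Sum>j<d. l j * eig_coord U (col U k) j * eig_coord U (col U k) j)"
    using col_carrier by (rule quad_spec_mat[OF _ col_carrier])
  also have "\<dots> = (\<Sum>j<d. if j = k then l k else 0)"
    by (intro sum.cong refl) (use k in \<open>auto simp: eig_coord_col\<close>)
  finally have "col U k \<bullet> (spec_mat d U l *\<^sub>v col U k) = (\<Sum>j<d. if j = k then l k else 0)" .
  thus ?thesis using k by simp
qed

lemma spec_mat_psd_iff: "spec_mat d U l \<in> psd_cone d \<longleftrightarrow> (\<forall>k<d. 0 \<le> l k)"
proof
  assume "spec_mat d U l \<in> psd_cone d"
  hence "0 \<le> col U k \<bullet> (spec_mat d U l *\<^sub>v col U k)" for k using col_carrier by (simp add: psd_cone_def)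
  thus "\<forall>k<d. 0 \<le> l k" using quad_spec_mat_col by metis
qed (auto intro: spec_mat_psd)

lemma col_normalized: "k < d \<Longrightarrow> col U k \<bullet> col U k = 1"
  using quad_spec_mat_col[of k "\<lambda>_. 1"] col_carrier by simp

end

text \<open>The right-hand side mentions the matrix only through its powers. This is what makes the
  entries of a function of a matrix accessible to measurability arguments without reference to
  \<open>U\<close>.\<close>

lemma spec_mat_polynomial:
  assumes U: "orth_mat d U" and ij: "i < d" "j < d"
  shows "(\<Sum>r<d. U $$ (i, r) * (\<Sum>k\<le>n. a k * l r ^ k) * U $$ (j, r)) =
    (\<Sum>k\<le>n. a k * (spec_mat d U l ^\<^sub>m k) $$ (i, j))"
proof -
  have "(\<Sum>k\<le>n. a k * (spec_mat d U l ^\<^sub>m k) $$ (i, j)) =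
    (\<Sum>k\<le>n. \<Sum>r<d. U $$ (i, r) * (a k * l r ^ k) * U $$ (j, r))"
    using ij by (simp add: spec_mat_pow[OF U] spec_mat_index[OF U] sum_distrib_left mult_ac)
  also have "\<dots> = (\<Sum>r<d. \<Sum>k\<le>n. U $$ (i, r) * (a k * l r ^ k) * U $$ (j, r))" by (rule sum.swap)
  finally show ?thesis by (simp add: sum_distrib_left sum_distrib_right)
qed

section \<open>The projection onto the cone of positive semidefinite matrices\<close>

definition frob_inner :: "nat \<Rightarrow> real mat \<Rightarrow> real mat \<Rightarrow> real" where
  "frob_inner d A B = (\<Sum>i<d. \<Sum>j<d. A $$ (i, j) * B $$ (i, j))"

lemma frob_norm_nonneg [simp]: "0 \<le> frob_norm A"
  by (simp add: frob_norm_def sum_nonneg)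

lemma frob_inner_spec_mat:
  assumes U: "orth_mat d U" and Q: "Q \<in> carrier_mat d d"
  shows "frob_inner d (spec_mat d U l) Q = (\<Sum>k<d. l k * (col U k \<bullet> (Q *\<^sub>v col U k)))"
proof -
  have "frob_inner d (spec_mat d U l) Q =
      (\<Sum>i<d. \<Sum>j<d. \<Sum>k<d. l k * (U $$ (i, k) * (Q $$ (i, j) * U $$ (j, k))))"
    unfolding frob_inner_def
    by (intro sum.cong refl) (simp add: spec_mat_index[OF U] sum_distrib_right sum_distrib_left mult_ac)
  also have "\<dots> = (\<Sum>i<d. \<Sum>k<d. \<Sum>j<d. l k * (U $$ (i, k) * (Q $$ (i, j) * U $$ (j, k))))"
    by (intro sum.cong refl sum.swap)
  also have "\<dots> = (\<Sum>k<d. \<Sum>i<d. \<Sum>j<d. l k * (U $$ (i, k) * (Q $$ (i, j) * U $$ (j, k))))"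
    by (rule sum.swap)
  also have "\<dots> = (\<Sum>k<d. l k * (col U k \<bullet> (Q *\<^sub>v col U k)))"
    using orth_mat_carrier[OF U] Q
    by (intro sum.cong refl)
       (simp add: scalar_prod_def lessThan_atLeast0 sum_distrib_left)
  finally show ?thesis .
qed

lemma frob_inner_psd_nonneg:
  assumes "orth_mat d U" "\<And>k. k < d \<Longrightarrow> 0 \<le> l k" "Q \<in> psd_cone d"
  shows "0 \<le> frob_inner d (spec_mat d U l) Q"
  using assms col_carrier[OF assms(1)]
  by (subst frob_inner_spec_mat) (auto simp: psd_cone_def intro!: sum_nonneg mult_nonneg_nonneg)

text \<open>The projection is defined on all square matrices, but the spectral theorem covers
  symmetric ones. The skew part is Frobenius-orthogonal to every symmetric matrix, so
  \<open>M\<close> and \<open>sym_part d M\<close> have the same nearest psd matrix.\<close>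

definition sym_part :: "nat \<Rightarrow> real mat \<Rightarrow> real mat" where
  "sym_part d M = Matrix.mat d d (\<lambda>(i, j). (M $$ (i, j) + M $$ (j, i)) / 2)"

lemma sym_part_carrier [simp]: "sym_part d M \<in> carrier_mat d d"
  by (simp add: sym_part_def)

lemma sym_part_transpose [simp]: "transpose_mat (sym_part d M) = sym_part d M"
  by (rule eq_matI) (auto simp: sym_part_def add.commute)

lemma sym_part_symmetric: "M \<in> carrier_mat d d \<Longrightarrow> transpose_mat M = M \<Longrightarrow> sym_part d M = M"
  using index_transpose_mat(1)[of _ M] by (intro eq_matI) (auto simp: sym_part_def)

lemma psd_cone_sym: "Q \<in> psd_cone d \<Longrightarrow> i < d \<Longrightarrow> j < d \<Longrightarrow> Q $$ (j, i) = Q $$ (i, j)"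
  using index_transpose_mat(1)[of i Q j] by (auto simp: psd_cone_def)

lemma sum_square_swap: "(\<Sum>i<d. \<Sum>j<d. f i j) = (\<Sum>i<d. \<Sum>j<(d::nat). f j i :: real)"
  by (rule sum.swap)

text \<open>Split the symmetric part into positive and negative parts, \<open>P - D\<close>. They
  are orthogonal, and \<open>D\<close> has nonnegative Frobenius product with every psd
  \<open>Q\<close>; hence the cross term between \<open>M - P\<close> and \<open>P - Q\<close> is
  nonnegative when the square of \<open>M - Q\<close> is expanded.\<close>

lemma psd_proj_pythagoras:
  assumes M: "M \<in> carrier_mat d d" and U: "orth_mat d U" and MU: "sym_part d M = spec_mat d U l"
    and Q: "Q \<in> psd_cone d"
  defines "P \<equiv> spec_mat d U (\<lambda>k. max 0 (l k))"
  shows "(frob_norm (M - P))\<^sup>2 + (frob_norm (P - Q))\<^sup>2 \<le> (frob_norm (M - Q))\<^sup>2"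
proof -
  define D where "D = spec_mat d U (\<lambda>k. max 0 (- l k))"
  have P: "P \<in> psd_cone d" unfolding P_def by (intro spec_mat_psd[OF U]) auto
  have c: "P \<in> carrier_mat d d" "D \<in> carrier_mat d d" "Q \<in> carrier_mat d d"
    using Q U by (auto simp: P_def D_def psd_cone_def)
  have PD: "P - D = sym_part d M" unfolding MU P_def D_def spec_mat_minus[OF U]
    by (intro arg_cong[of _ _ "spec_mat d U"]) auto
  have sp: "(M $$ (i, j) + M $$ (j, i)) / 2 = P $$ (i, j) - D $$ (i, j)" if "i < d" "j < d" for i j
    using arg_cong[OF PD, of "\<lambda>A. A $$ (i, j)"] that c by (simp add: sym_part_def)
  have zero: "frob_inner d D P = 0"
    unfolding D_def P_def
    by (subst frob_inner_spec_mat[OF U]) (auto simp: quad_spec_mat_col[OF U] U intro!: sum.neutral)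
  have pos: "0 \<le> frob_inner d D Q"
    unfolding D_def by (intro frob_inner_psd_nonneg U Q) auto
  define R where "R = (\<lambda>i j. P $$ (i, j) - Q $$ (i, j))"
  have Rs: "R j i = R i j" if "i < d" "j < d" for i j
    using psd_cone_sym[OF P that] psd_cone_sym[OF Q that] by (simp add: R_def)
  \<comment> \<open>Since \<open>R\<close> is symmetric, \<open>M\<close> may be replaced by its
    symmetric part in the cross term.\<close>
  have "(\<Sum>i<d. \<Sum>j<d. (M $$ (i, j) - P $$ (i, j)) * R i j)
     = (\<Sum>i<d. \<Sum>j<d. ((M $$ (i, j) + M $$ (j, i)) / 2 - P $$ (i, j)) * R i j)"
  proof -
    have a: "(\<Sum>i<d. \<Sum>j<d. M $$ (i, j) * R i j) = (\<Sum>i<d. \<Sum>j<d. M $$ (j, i) * R i j)"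
      by (subst sum_square_swap) (intro sum.cong refl, simp add: Rs)
    have "(\<Sum>i<d. \<Sum>j<d. ((M $$ (i, j) + M $$ (j, i)) / 2 - P $$ (i, j)) * R i j)
      = (\<Sum>i<d. \<Sum>j<d. M $$ (i, j) * R i j / 2 + M $$ (j, i) * R i j / 2 - P $$ (i, j) * R i j)"
      by (intro sum.cong refl) (simp add: field_simps)
    also have "\<dots> = ((\<Sum>i<d. \<Sum>j<d. M $$ (i, j) * R i j) / 2 + (\<Sum>i<d. \<Sum>j<d. M $$ (j, i) * R i j) / 2)
        - (\<Sum>i<d. \<Sum>j<d. P $$ (i, j) * R i j)"
      by (simp only: sum.distrib sum_subtractf sum_divide_distrib)
    also have "\<dots> = (\<Sum>i<d. \<Sum>j<d. M $$ (i, j) * R i j) - (\<Sum>i<d. \<Sum>j<d. P $$ (i, j) * R i j)"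
      unfolding a[symmetric] by simp
    also have "\<dots> = (\<Sum>i<d. \<Sum>j<d. (M $$ (i, j) - P $$ (i, j)) * R i j)"
      by (simp only: sum_subtractf left_diff_distrib)
    finally show ?thesis by simp
  qed
  also have "\<dots> = (\<Sum>i<d. \<Sum>j<d. D $$ (i, j) * Q $$ (i, j)) - (\<Sum>i<d. \<Sum>j<d. D $$ (i, j) * P $$ (i, j))"
    unfolding sum_subtractf[symmetric]
    by (intro sum.cong refl) (simp add: sp R_def algebra_simps)
  also have "\<dots> \<ge> 0" using zero pos by (simp add: frob_inner_def)
  finally have cross: "0 \<le> (\<Sum>i<d. \<Sum>j<d. (M $$ (i, j) - P $$ (i, j)) * R i j)" .
  have "(frob_norm (M - Q))\<^sup>2 = (\<Sum>i<d. \<Sum>j<d. (M $$ (i, j) - Q $$ (i, j))\<^sup>2)"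
    using M c by (simp add: frob_norm_def sum_nonneg)
  also have "\<dots> = (\<Sum>i<d. \<Sum>j<d. (M $$ (i, j) - P $$ (i, j))\<^sup>2) + (\<Sum>i<d. \<Sum>j<d. (R i j)\<^sup>2)
      + 2 * (\<Sum>i<d. \<Sum>j<d. (M $$ (i, j) - P $$ (i, j)) * R i j)"
    unfolding sum.distrib[symmetric] sum_distrib_left
    by (intro sum.cong refl) (simp add: R_def power2_eq_square algebra_simps)
  finally show ?thesis
    using cross M c by (simp add: frob_norm_def sum_nonneg R_def)
qed

lemma frob_norm_eq_0: "A \<in> carrier_mat d d \<Longrightarrow> frob_norm A = 0 \<Longrightarrow> i < d \<Longrightarrow> j < d \<Longrightarrow> A $$ (i, j) = 0"
  by (auto simp: frob_norm_def sum_nonneg_eq_0_iff sum_nonneg)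

text \<open>The Pythagorean inequality gives minimality, and the extra square in it gives
  uniqueness, so the choice hidden in \<open>arg_min\<close> is determined: negative eigenvalues are
  clipped to zero.\<close>

lemma psd_proj_eq:
  assumes M: "M \<in> carrier_mat d d" and U: "orth_mat d U" and MU: "sym_part d M = spec_mat d U l"
  shows "psd_proj d M = spec_mat d U (\<lambda>k. max 0 (l k))" (is "_ = ?P")
proof -
  note pyth = psd_proj_pythagoras[OF M U MU]
  have P: "?P \<in> psd_cone d" by (intro spec_mat_psd[OF U]) auto
  have le: "frob_norm (M - ?P) \<le> frob_norm (M - Q)" if "Q \<in> psd_cone d" for Q
  proof (rule power2_le_imp_le)
    show "(frob_norm (M - ?P))\<^sup>2 \<le> (frob_norm (M - Q))\<^sup>2"
      using pyth[OF that] zero_le_power2[of "frob_norm (?P - Q)"] by linarith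
  qed simp
  show ?thesis unfolding psd_proj_def arg_min_def
  proof (rule some_equality)
    show "is_arg_min (\<lambda>P. frob_norm (M - P)) (\<lambda>P. P \<in> psd_cone d) ?P"
      using P le by (force simp: is_arg_min_def not_less)
  next
    fix Q assume Q: "is_arg_min (\<lambda>P. frob_norm (M - P)) (\<lambda>P. P \<in> psd_cone d) Q"
    hence Qp: "Q \<in> psd_cone d" by (simp add: is_arg_min_def)
    have "frob_norm (M - Q) \<le> frob_norm (M - ?P)" using Q P by (auto simp: is_arg_min_def not_less)
    hence "(frob_norm (M - Q))\<^sup>2 \<le> (frob_norm (M - ?P))\<^sup>2" by (intro power_mono) auto
    hence "(frob_norm (?P - Q))\<^sup>2 \<le> 0" using pyth[OF Qp] by linarith
    hence "frob_norm (?P - Q) = 0" by simp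
    moreover have "?P - Q \<in> carrier_mat d d" using Qp by (auto simp: psd_cone_def)
    ultimately have "(?P - Q) $$ (i, j) = 0" if "i < d" "j < d" for i j
      using frob_norm_eq_0 that by blast
    thus "Q = ?P"
      using Qp spec_mat_carrier[OF U, of "\<lambda>k. max 0 (l k)"]
      by (intro eq_matI) (force simp: psd_cone_def)+
  qed
qed

lemma psd_proj_psd:
  assumes M: "M \<in> carrier_mat d d"
  shows "psd_proj d M \<in> psd_cone d"
proof -
  obtain U l where U: "orth_mat d U" and MU: "sym_part d M = spec_mat d U l"
    using symmetric_spec_mat[OF sym_part_carrier sym_part_transpose, of d M] by blast
  show ?thesis unfolding psd_proj_eq[OF M U MU] by (rule spec_mat_psd[OF U]) simp
qed

text \<open>Used with \<open>Q\<close> the true second moment matrix in the final call, where the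
  error is measured in Frobenius norm.\<close>

lemma psd_proj_frob_le:
  assumes M: "M \<in> carrier_mat d d" and Q: "Q \<in> psd_cone d"
  shows "frob_norm (psd_proj d M - Q) \<le> frob_norm (M - Q)"
proof -
  obtain U l where U: "orth_mat d U" and MU: "sym_part d M = spec_mat d U l"
    using symmetric_spec_mat[OF sym_part_carrier sym_part_transpose, of d M] by blast
  show ?thesis unfolding psd_proj_eq[OF M U MU]
  proof (rule power2_le_imp_le)
    show "(frob_norm (spec_mat d U (\<lambda>k. max 0 (l k)) - Q))\<^sup>2 \<le> (frob_norm (M - Q))\<^sup>2"
      using psd_proj_pythagoras[OF M U MU Q] zero_le_power2[of "frob_norm (M - spec_mat d U (\<lambda>k. max 0 (l k)))"]
      by linarith
  qed simp
qed

text \<open>Testing the closeness assumption on eigenvectors of \<open>M\<close> shows that no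
  eigenvalue lies below \<open>- e\<close>, because \<open>Q\<close> is psd. Clipping therefore
  moves the bilinear form by at most \<open>e\<close>, and the distance from \<open>M\<close> to
  \<open>Q\<close> contributes the other \<open>e\<close>. The preconditioning rounds need this
  form, since a Frobenius bound on the noise would lose a factor \<open>sqrt d\<close>.\<close>

lemma psd_proj_op_le:
  assumes M: "M \<in> carrier_mat d d" "transpose_mat M = M" and Q: "Q \<in> psd_cone d" and e: "0 \<le> e"
    and close: "\<And>x y. x \<in> carrier_vec d \<Longrightarrow> y \<in> carrier_vec d \<Longrightarrow>
      \<bar>x \<bullet> (M *\<^sub>v y) - x \<bullet> (Q *\<^sub>v y)\<bar> \<le> e * vnorm x * vnorm y"
    and x: "x \<in> carrier_vec d" and y: "y \<in> carrier_vec d"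
  shows "\<bar>x \<bullet> (psd_proj d M *\<^sub>v y) - x \<bullet> (Q *\<^sub>v y)\<bar> \<le> 2 * e * vnorm x * vnorm y"
proof -
  obtain U l where U: "orth_mat d U" and MU: "M = spec_mat d U l"
    using symmetric_spec_mat[OF M] by blast
  have P: "psd_proj d M = spec_mat d U (\<lambda>k. max 0 (l k))"
    by (rule psd_proj_eq[OF M(1) U]) (simp add: sym_part_symmetric[OF M] MU[symmetric])
  have l: "- e \<le> l k" if "k < d" for k
  proof -
    let ?u = "col U k"
    have u: "?u \<in> carrier_vec d" "vnorm ?u = 1"
      using col_carrier[OF U] col_normalized[OF U that] by (auto simp: vnorm_def)
    have "?u \<bullet> (M *\<^sub>v ?u) = l k" unfolding MU by (rule quad_spec_mat_col[OF U that])
    moreover have "0 \<le> ?u \<bullet> (Q *\<^sub>v ?u)" using Q u by (auto simp: psd_cone_def)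
    ultimately show ?thesis using close[OF u(1) u(1)] u(2) by simp
  qed
  have eq: "x \<bullet> (psd_proj d M *\<^sub>v y) - x \<bullet> (M *\<^sub>v y)
      = (\<Sum>k<d. max 0 (- l k) * eig_coord U x k * eig_coord U y k)"
    unfolding P unfolding MU
    by (subst (1 2) quad_spec_mat[OF U x y], subst sum_subtractf[symmetric], intro sum.cong)
       (auto simp: max_def algebra_simps)
  have "\<bar>x \<bullet> (psd_proj d M *\<^sub>v y) - x \<bullet> (M *\<^sub>v y)\<bar> \<le> (\<Sum>k<d. e * (\<bar>eig_coord U x k\<bar> * \<bar>eig_coord U y k\<bar>))"
    unfolding eq
  proof (rule order_trans[OF sum_abs sum_mono])
    fix k assume "k \<in> {..<d}"
    hence "max 0 (- l k) \<le> e" using l[of k] e by auto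
    thus "\<bar>max 0 (- l k) * eig_coord U x k * eig_coord U y k\<bar> \<le> e * (\<bar>eig_coord U x k\<bar> * \<bar>eig_coord U y k\<bar>)"
      by (simp add: abs_mult mult.assoc mult_right_mono)
  qed
  also have "\<dots> = e * (\<Sum>k<d. \<bar>eig_coord U x k\<bar> * \<bar>eig_coord U y k\<bar>)" by (simp add: sum_distrib_left)
  also have "(\<Sum>k<d. \<bar>eig_coord U x k\<bar> * \<bar>eig_coord U y k\<bar>) \<le> vnorm x * vnorm y"
  proof (rule power2_le_imp_le)
    have "(vnorm x * vnorm y)\<^sup>2 = (\<Sum>k<d. \<bar>eig_coord U x k\<bar>\<^sup>2) * (\<Sum>k<d. \<bar>eig_coord U y k\<bar>\<^sup>2)"
      by (simp add: power_mult_distrib vnorm_sq scalar_prod_eig_coord[OF U x x] scalar_prod_eig_coord[OF U y y])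
         (simp add: power2_eq_square)
    thus "(\<Sum>k<d. \<bar>eig_coord U x k\<bar> * \<bar>eig_coord U y k\<bar>)\<^sup>2 \<le> (vnorm x * vnorm y)\<^sup>2"
      using Cauchy_Schwarz_ineq_sum[of "\<lambda>k. \<bar>eig_coord U x k\<bar>" "\<lambda>k. \<bar>eig_coord U y k\<bar>" "{..<d}"] by simp
  qed simp
  finally have "\<bar>x \<bullet> (psd_proj d M *\<^sub>v y) - x \<bullet> (M *\<^sub>v y)\<bar> \<le> e * (vnorm x * vnorm y)" using e by (simp add: mult_left_mono)
  thus ?thesis using close[OF x y] by (simp add: algebra_simps)
qed

section \<open>The preconditioning step\<close>

lemma mat_eq_vecI:
  assumes "(A :: real mat) \<in> carrier_mat n m" "B \<in> carrier_mat n m"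
    and "\<And>x. x \<in> carrier_vec m \<Longrightarrow> A *\<^sub>v x = B *\<^sub>v x"
  shows "A = B"
proof (rule eq_matI)
  fix i j assume ij: "i < dim_row B" "j < dim_col B"
  have "(A *\<^sub>v unit_vec m j) $ i = (B *\<^sub>v unit_vec m j) $ i" using assms(3)[of "unit_vec m j"] by simp
  thus "A $$ (i, j) = B $$ (i, j)" using ij assms(1,2) by simp
qed (use assms in auto)

lemma spec_mat_apply:
  assumes U: "orth_mat d U" and x: "x \<in> carrier_vec d" and i: "i < d"
  shows "(spec_mat d U m *\<^sub>v x) $ i = (\<Sum>k<d. U $$ (i, k) * (m k * eig_coord U x k))"
proof -
  have c: "spec_mat d U m *\<^sub>v x \<in> carrier_vec d" by (rule mult_mat_vec_carrier[OF spec_mat_carrier[OF U] x])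
  have "(spec_mat d U m *\<^sub>v x) $ i = unit_vec d i \<bullet> (spec_mat d U m *\<^sub>v x)"
    by (rule scalar_prod_left_unit[OF c i, symmetric])
  also have "\<dots> = (\<Sum>k<d. m k * eig_coord U (unit_vec d i) k * eig_coord U x k)"
    by (rule quad_spec_mat[OF U _ x]) simp
  also have "\<dots> = (\<Sum>k<d. U $$ (i, k) * (m k * eig_coord U x k))"
    using orth_mat_carrier[OF U] i by (intro sum.cong refl) (simp add: eig_coord_def)
  finally show ?thesis .
qed

lemma spec_mat_vec_carrier: "orth_mat d U \<Longrightarrow> x \<in> carrier_vec d \<Longrightarrow> spec_mat d U m *\<^sub>v x \<in> carrier_vec d"
  by (rule mult_mat_vec_carrier[OF spec_mat_carrier])

lemma spec_mat_vec_lincomb: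
  assumes U: "orth_mat d U" and x: "x \<in> carrier_vec d"
  shows "spec_mat d U (\<lambda>k. a * m k + b * n k) *\<^sub>v x =
    a \<cdot>\<^sub>v (spec_mat d U m *\<^sub>v x) + b \<cdot>\<^sub>v (spec_mat d U n *\<^sub>v x)"
proof (rule eq_vecI)
  fix i assume "i < dim_vec (a \<cdot>\<^sub>v (spec_mat d U m *\<^sub>v x) + b \<cdot>\<^sub>v (spec_mat d U n *\<^sub>v x))"
  hence i: "i < d" by (simp add: dim_spec_mat[OF U])
  have "(spec_mat d U (\<lambda>k. a * m k + b * n k) *\<^sub>v x) $ i =
      (\<Sum>k<d. U $$ (i, k) * ((a * m k + b * n k) * eig_coord U x k))" by (rule spec_mat_apply[OF U x i])
  also have "\<dots> = a * (\<Sum>k<d. U $$ (i, k) * (m k * eig_coord U x k)) + b * (\<Sum>k<d. U $$ (i, k) * (n k * eig_coord U x k))"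
    unfolding sum_distrib_left sum.distrib[symmetric] by (intro sum.cong refl) (simp add: algebra_simps)
  also have "\<dots> = a * (spec_mat d U m *\<^sub>v x) $ i + b * (spec_mat d U n *\<^sub>v x) $ i"
    unfolding spec_mat_apply[OF U x i] ..
  also have "\<dots> = (a \<cdot>\<^sub>v (spec_mat d U m *\<^sub>v x) + b \<cdot>\<^sub>v (spec_mat d U n *\<^sub>v x)) $ i"
    using i by (simp add: dim_spec_mat[OF U] del: index_mult_mat_vec)
  finally show "(spec_mat d U (\<lambda>k. a * m k + b * n k) *\<^sub>v x) $ i =
      (a \<cdot>\<^sub>v (spec_mat d U m *\<^sub>v x) + b \<cdot>\<^sub>v (spec_mat d U n *\<^sub>v x)) $ i" .
qed (simp add: dim_spec_mat[OF U])

text \<open>An eigenvector of eigenvalue at least \<open>c\<close> has vanishing coordinate wherever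
  \<open>l\<close> differs from that eigenvalue, hence is fixed by the spectral projection
  \<open>P\<close>; the fixed space is a submodule, so it contains the span. Conversely a fixed
  vector is a combination of those columns of \<open>U\<close> whose eigenvalue is at least
  \<open>c\<close>.\<close>

lemma top_eigenspace_spec_mat:
  fixes l :: "nat \<Rightarrow> real" and c :: real
  assumes U: "orth_mat d U"
  defines "P \<equiv> spec_mat d U (\<lambda>k. if c \<le> l k then 1 else 0)"
  shows "top_eigenspace d c (spec_mat d U l) = {v \<in> carrier_vec d. P *\<^sub>v v = v}"
proof -
  interpret vec_space "TYPE(real)" d .
  let ?W = "{v. \<exists>k\<ge>c. eigenvector (spec_mat d U l) v k}"
  let ?N = "{v \<in> carrier_vec d. P *\<^sub>v v = v}"
  have Pc: "P \<in> carrier_mat d d" unfolding P_def by (rule spec_mat_carrier[OF U])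
  have Wc: "?W \<subseteq> carrier_vec d" by (auto simp: eigenvector_def dim_spec_mat[OF U])
  have "?W \<subseteq> ?N"
  proof
    fix v assume "v \<in> ?W"
    then obtain k where k: "k \<ge> c" "v \<in> carrier_vec d" "spec_mat d U l *\<^sub>v v = k \<cdot>\<^sub>v v"
      by (auto simp: eigenvector_def dim_spec_mat[OF U])
    have e: "l i * eig_coord U v i = k * eig_coord U v i" if "i < d" for i
    proof -
      have "l i * eig_coord U v i = eig_coord U (k \<cdot>\<^sub>v v) i"
        using eig_coord_spec_mat[OF U k(2) that, of l] by (simp add: k(3))
      also have "\<dots> = k * eig_coord U v i"
        using orth_mat_carrier[OF U] k(2) that unfolding eig_coord_def
        by (subst mult_mat_vec[where nr=d and nc=d]) auto
      finally show ?thesis .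
    qed
    have "P *\<^sub>v v = v"
    proof (rule eq_vecI)
      fix i assume "i < dim_vec v"
      hence i: "i < d" using k(2) by simp
      have "(P *\<^sub>v v) $ i = (\<Sum>k<d. U $$ (i, k) * ((if c \<le> l k then 1 else 0) * eig_coord U v k))"
        unfolding P_def by (rule spec_mat_apply[OF U k(2) i])
      also have "\<dots> = (\<Sum>k<d. U $$ (i, k) * (1 * eig_coord U v k))"
      proof (intro sum.cong refl)
        fix j assume "j \<in> {..<d}"
        thus "U $$ (i, j) * ((if c \<le> l j then 1 else 0) * eig_coord U v j) = U $$ (i, j) * (1 * eig_coord U v j)"
          using e[of j] k(1) by (cases "eig_coord U v j = 0") auto
      qed
      also have "\<dots> = (spec_mat d U (\<lambda>_. 1) *\<^sub>v v) $ i" by (rule spec_mat_apply[OF U k(2) i, symmetric])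
      finally show "(P *\<^sub>v v) $ i = v $ i" using k(2) by (simp add: spec_mat_one[OF U])
    qed (use Pc k(2) in auto)
    thus "v \<in> ?N" using k(2) by simp
  qed
  moreover have "submodule class_ring ?N (module_vec TYPE(real) d)"
  proof (unfold_locales)
    show "?N \<subseteq> carrier V" by auto
    show "v \<oplus>\<^bsub>V\<^esub> w \<in> ?N" if "v \<in> ?N" "w \<in> ?N" for v w
      using that Pc by (auto simp: mult_add_distrib_mat_vec[where nr=d and nc=d])
    show "\<zero>\<^bsub>V\<^esub> \<in> ?N" using Pc by (auto intro!: eq_vecI)
    show "k \<odot>\<^bsub>V\<^esub> v \<in> ?N" if "v \<in> ?N" for k v
      using that Pc by (auto simp: module_vec_simps mult_mat_vec[where nr=d and nc=d])
  qed
  ultimately have 1: "span ?W \<subseteq> ?N" by (rule span_is_subset)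
  have "?N \<subseteq> span ?W"
  proof
    fix v assume v: "v \<in> ?N"
    \<comment> \<open>Partial sums of the eigenvector expansion of \<open>v\<close>: they stay in
      the span when a column is added, and \<open>s d = v\<close>.\<close>
    define s where "s = (\<lambda>N. spec_mat d U (\<lambda>k. if k < N \<and> c \<le> l k then 1 else 0) *\<^sub>v v)"
    have vc: "v \<in> carrier_vec d" using v by simp
    have sc: "s N \<in> carrier_vec d" for N unfolding s_def by (rule spec_mat_vec_carrier[OF U vc])
    have "N \<le> d \<Longrightarrow> s N \<in> span ?W" for N
    proof (induction N)
      case 0
      have "s 0 = 0\<^sub>v d" using sc[of 0] U vc
        by (intro eq_vecI) (auto simp: s_def spec_mat_apply simp del: index_mult_mat_vec)
      thus ?case using span_zero by simp
    next
      case (Suc N)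
      define u where "u = (if c \<le> l N then eig_coord U v N \<cdot>\<^sub>v col U N else 0\<^sub>v d)"
      have u: "u \<in> carrier_vec d" using col_carrier[OF U] by (simp add: u_def)
      have "s (Suc N) = s N + u"
      proof (rule eq_vecI)
        fix i assume "i < dim_vec (s N + u)"
        hence i: "i < d" using u by simp
        have "s (Suc N) $ i = (\<Sum>k<d. U $$ (i, k) * ((if k < N \<and> c \<le> l k then 1 else 0) * eig_coord U v k)
            + (if k = N then U $$ (i, N) * ((if c \<le> l N then 1 else 0) * eig_coord U v N) else 0))"
          unfolding s_def spec_mat_apply[OF U vc i] by (intro sum.cong refl) auto
        also have "\<dots> = s N $ i + U $$ (i, N) * ((if c \<le> l N then 1 else 0) * eig_coord U v N)"
          unfolding sum.distrib s_def spec_mat_apply[OF U vc i] using Suc.prems by simp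
        also have "U $$ (i, N) * ((if c \<le> l N then 1 else 0) * eig_coord U v N) = u $ i"
          using i orth_mat_carrier[OF U] Suc.prems by (simp add: u_def)
        finally show "s (Suc N) $ i = (s N + u) $ i" using i u by simp
      qed (use sc[of "Suc N"] u in simp)
      moreover have "u \<in> span ?W"
      proof (cases "c \<le> l N")
        case True
        have N: "N < d" using Suc.prems by simp
        have "spec_mat d U l *\<^sub>v col U N = l N \<cdot>\<^sub>v col U N"
        proof (rule eq_vecI)
          fix i assume "i < dim_vec (l N \<cdot>\<^sub>v col U N)"
          hence i: "i < d" using orth_mat_carrier[OF U] by simp
          have "(spec_mat d U l *\<^sub>v col U N) $ i = (\<Sum>k<d. if k = N then U $$ (i, N) * l N else 0)"
            unfolding spec_mat_apply[OF U col_carrier[OF U] i]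
            by (intro sum.cong refl) (use N in \<open>auto simp: eig_coord_col[OF U]\<close>)
          thus "(spec_mat d U l *\<^sub>v col U N) $ i = (l N \<cdot>\<^sub>v col U N) $ i"
            using N i orth_mat_carrier[OF U] by simp
        qed (use orth_mat_carrier[OF U] in \<open>auto simp: dim_spec_mat[OF U]\<close>)
        moreover have "col U N \<noteq> 0\<^sub>v d" using col_normalized[OF U N] col_carrier[OF U, of N] by auto
        ultimately have "col U N \<in> ?W"
          using True col_carrier[OF U, of N] by (auto simp: eigenvector_def dim_spec_mat[OF U])
        hence "col U N \<in> span ?W" using in_own_span[of ?W] Wc by auto
        thus ?thesis using smult_in_span[OF Wc] True by (simp add: u_def)
      qed (use span_zero in \<open>simp add: u_def\<close>)
      moreover have "s N \<in> span ?W" using Suc by simp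
      ultimately show ?case using span_add1[of ?W "s N" u] Wc by simp
    qed
    moreover have "s d = v"
    proof -
      have "s d = P *\<^sub>v v" using U vc sc[of d] Pc unfolding P_def
        by (intro eq_vecI) (auto simp: s_def spec_mat_apply dim_spec_mat simp del: index_mult_mat_vec intro!: sum.cong)
      thus ?thesis using v by simp
    qed
    ultimately show "v \<in> span ?W" using order_refl by metis
  qed
  with 1 show ?thesis unfolding top_eigenspace_def span_vecs_def by blast
qed

text \<open>Uniqueness, which the \<open>THE\<close> in \<open>orth_proj\<close> requires: for a
  second candidate \<open>Q\<close> the vector \<open>Q *\<^sub>v x - P *\<^sub>v x\<close> lies in
  the space and is a difference of two vectors orthogonal to it, so it is orthogonal to
  itself.\<close>

lemma orth_proj_fixed_space:
  assumes P: "P \<in> carrier_mat d d" "transpose_mat P = P" "P * P = P"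
  shows "orth_proj d {v \<in> carrier_vec d. P *\<^sub>v v = v} = P"
proof -
  have PP: "P *\<^sub>v (P *\<^sub>v x) = P *\<^sub>v x" if "x \<in> carrier_vec d" for x
    using assoc_mult_mat_vec[OF P(1) P(1) that] P(3) by simp
  have Pc: "P *\<^sub>v x \<in> carrier_vec d" if "x \<in> carrier_vec d" for x using P(1) that by simp
  have orth: "x - P *\<^sub>v x \<in> orth_compl d {v \<in> carrier_vec d. P *\<^sub>v v = v}" if x: "x \<in> carrier_vec d" for x
  proof -
    have "(x - P *\<^sub>v x) \<bullet> v = 0" if v: "v \<in> carrier_vec d" "P *\<^sub>v v = v" for v
      using scalar_prod_symmetric_mat[OF P(1,2) x v(1)] x v Pc
      by (simp add: minus_scalar_prod_distrib[where n=d])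
    thus ?thesis using x Pc by (auto simp: orth_compl_def)
  qed
  show ?thesis unfolding orth_proj_def
  proof (rule the_equality)
    show "P \<in> carrier_mat d d \<and> (\<forall>x\<in>carrier_vec d. P *\<^sub>v x \<in> {v \<in> carrier_vec d. P *\<^sub>v v = v} \<and>
        x - P *\<^sub>v x \<in> orth_compl d {v \<in> carrier_vec d. P *\<^sub>v v = v})"
      using P PP Pc orth by blast
  next
    fix Q assume Q: "Q \<in> carrier_mat d d \<and> (\<forall>x\<in>carrier_vec d. Q *\<^sub>v x \<in> {v \<in> carrier_vec d. P *\<^sub>v v = v} \<and>
        x - Q *\<^sub>v x \<in> orth_compl d {v \<in> carrier_vec d. P *\<^sub>v v = v})"
    show "Q = P"
    proof (rule mat_eq_vecI[of _ d d])
      fix x :: "real Matrix.vec" assume x: "x \<in> carrier_vec d"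
      define y where "y = Q *\<^sub>v x - P *\<^sub>v x"
      have Qx: "Q *\<^sub>v x \<in> carrier_vec d" "P *\<^sub>v (Q *\<^sub>v x) = Q *\<^sub>v x" using Q x by auto
      have y: "y \<in> carrier_vec d" using Qx Pc[OF x] by (simp add: y_def)
      have "P *\<^sub>v y = y" unfolding y_def using mult_minus_distrib_mat_vec[OF P(1) Qx(1) Pc[OF x]] Qx PP[OF x] by simp
      hence "(x - Q *\<^sub>v x) \<bullet> y = 0" "(x - P *\<^sub>v x) \<bullet> y = 0"
        using Q x orth[OF x] y unfolding orth_compl_def by blast+
      moreover have "y \<bullet> y = (x - P *\<^sub>v x) \<bullet> y - (x - Q *\<^sub>v x) \<bullet> y"
        using x y Qx Pc[OF x] by (simp add: y_def minus_scalar_prod_distrib[where n=d])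
      ultimately have "y = 0\<^sub>v d" using scalar_prod_self_eq_0[OF y] by simp
      hence "\<forall>i<d. (Q *\<^sub>v x) $ i - (P *\<^sub>v x) $ i = 0"
        using P(1) Qx unfolding y_def by (metis carrier_vecD index_minus_vec(1) index_zero_vec(1) Pc x)
      thus "Q *\<^sub>v x = P *\<^sub>v x" using carrier_vecD[OF Qx(1)] carrier_vecD[OF Pc[OF x]]
        by (intro eq_vecI) (simp_all del: index_mult_mat_vec dim_mult_mat_vec)
    qed (use Q P in auto)
  qed
qed

text \<open>Orthogonality to the range of \<open>P\<close> means
  \<open>P *\<^sub>v x = 0\<^sub>v d\<close>. Written this way the complement is again a fixed
  space, so \<open>orth_proj_fixed_space\<close> applies to it as well.\<close>

lemma orth_compl_fixed_space:
  assumes P: "P \<in> carrier_mat d d" "transpose_mat P = P" "P * P = P"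
  shows "orth_compl d {v \<in> carrier_vec d. P *\<^sub>v v = v} = {v \<in> carrier_vec d. (1\<^sub>m d - P) *\<^sub>v v = v}"
proof -
  have PP: "P *\<^sub>v (P *\<^sub>v x) = P *\<^sub>v x" if "x \<in> carrier_vec d" for x
    using assoc_mult_mat_vec[OF P(1) P(1) that] P(3) by simp
  have Pc: "P *\<^sub>v x \<in> carrier_vec d" if "x \<in> carrier_vec d" for x using P(1) that by simp
  have m: "(1\<^sub>m d - P) *\<^sub>v x = x - P *\<^sub>v x" if "x \<in> carrier_vec d" for x
    using minus_mult_distrib_mat_vec[OF one_carrier_mat P(1) that] that by simp
  have "x \<in> orth_compl d {v \<in> carrier_vec d. P *\<^sub>v v = v} \<longleftrightarrow> P *\<^sub>v x = 0\<^sub>v d" if x: "x \<in> carrier_vec d" for x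
  proof
    assume "x \<in> orth_compl d {v \<in> carrier_vec d. P *\<^sub>v v = v}"
    hence "x \<bullet> (P *\<^sub>v (P *\<^sub>v x)) = 0" using PP[OF x] Pc[OF x] by (simp add: orth_compl_def)
    hence "(P *\<^sub>v x) \<bullet> (P *\<^sub>v x) = 0" using scalar_prod_symmetric_mat[OF P(1,2) x Pc[OF x]] by simp
    thus "P *\<^sub>v x = 0\<^sub>v d" using scalar_prod_self_eq_0[OF Pc[OF x]] by simp
  next
    assume 0: "P *\<^sub>v x = 0\<^sub>v d"
    have "x \<bullet> v = 0" if "v \<in> carrier_vec d" "P *\<^sub>v v = v" for v
      using scalar_prod_symmetric_mat[OF P(1,2) x that(1)] that 0 by simp
    thus "x \<in> orth_compl d {v \<in> carrier_vec d. P *\<^sub>v v = v}" using x by (simp add: orth_compl_def)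
  qed
  moreover have "P *\<^sub>v x = 0\<^sub>v d \<longleftrightarrow> x - P *\<^sub>v x = x" if x: "x \<in> carrier_vec d" for x
  proof
    assume e: "x - P *\<^sub>v x = x"
    show "P *\<^sub>v x = 0\<^sub>v d"
    proof (rule eq_vecI)
      fix i assume "i < dim_vec (0\<^sub>v d :: real Matrix.vec)"
      thus "(P *\<^sub>v x) $ i = 0\<^sub>v d $ i" using arg_cong[OF e, of "\<lambda>v. v $ i"] x P(1) by (simp del: index_mult_mat_vec)
    qed (use P(1) in simp)
  qed (use x in auto)
  ultimately have "x \<in> orth_compl d {v \<in> carrier_vec d. P *\<^sub>v v = v} \<longleftrightarrow> (1\<^sub>m d - P) *\<^sub>v x = x"
    if "x \<in> carrier_vec d" for x
    using m that by simp
  moreover have "orth_compl d {v \<in> carrier_vec d. P *\<^sub>v v = v} \<subseteq> carrier_vec d"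
    by (auto simp: orth_compl_def)
  ultimately show ?thesis by blast
qed

text \<open>From here on spans and orthogonal projections disappear: a preconditioner is a
  two-valued function of the eigenvalues of \<open>Z\<close>, which serves both its measurability
  and its analysis.\<close>

lemma precond_step_spec_mat:
  assumes U: "orth_mat d U"
  shows "precond_step d K \<kappa> (spec_mat d U l) =
    spec_mat d U (\<lambda>k. 1.1 * (if \<kappa> / 2 \<le> l k then 1 / sqrt K else 1))"
proof -
  define \<pi> :: "nat \<Rightarrow> real" where "\<pi> = (\<lambda>k. if \<kappa> / 2 \<le> l k then 1 else 0)"
  let ?P = "spec_mat d U \<pi>" and ?Q = "spec_mat d U (\<lambda>k. 1 - \<pi> k)"
  have Q: "1\<^sub>m d - ?P = ?Q" using spec_mat_minus[OF U, of "\<lambda>_. 1" \<pi>] by (simp add: spec_mat_one[OF U])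
  have Pid: "?P * ?P = ?P" "?Q * ?Q = ?Q"
    unfolding spec_mat_mult[OF U] by (intro arg_cong[of _ _ "spec_mat d U"] ext; simp add: \<pi>_def)+
  have P: "orth_proj d (top_eigenspace d (\<kappa> / 2) (spec_mat d U l)) = ?P"
    unfolding top_eigenspace_spec_mat[OF U] \<pi>_def[symmetric]
    by (rule orth_proj_fixed_space) (auto simp: U Pid)
  have C: "orth_proj d (orth_compl d (top_eigenspace d (\<kappa> / 2) (spec_mat d U l))) = ?Q"
    unfolding top_eigenspace_spec_mat[OF U] \<pi>_def[symmetric]
    by (subst orth_compl_fixed_space) (auto simp: U Pid Q intro!: orth_proj_fixed_space)
  show ?thesis
    unfolding precond_step_def Let_def P C
    by (simp add: spec_mat_smult[OF U] spec_mat_add[OF U])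
       (intro arg_cong[of _ _ "spec_mat d U"] ext, simp add: \<pi>_def)
qed

lemma precond_step_symmetric:
  assumes "Z \<in> psd_cone d"
  shows "precond_step d K \<kappa> Z \<in> carrier_mat d d" "transpose_mat (precond_step d K \<kappa> Z) = precond_step d K \<kappa> Z"
proof -
  obtain U l where "orth_mat d U" "Z = spec_mat d U l"
    using symmetric_spec_mat[of Z d] assms by (auto simp: psd_cone_def)
  thus "precond_step d K \<kappa> Z \<in> carrier_mat d d" "transpose_mat (precond_step d K \<kappa> Z) = precond_step d K \<kappa> Z"
    by (simp_all add: precond_step_spec_mat)
qed

lemma two_term_Cauchy_Schwarz: "(a * p + b * q)\<^sup>2 \<le> (a\<^sup>2 + b\<^sup>2) * (p\<^sup>2 + q\<^sup>2 :: real)"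
proof -
  have "(a\<^sup>2 + b\<^sup>2) * (p\<^sup>2 + q\<^sup>2) - (a * p + b * q)\<^sup>2 = (a * q - b * p)\<^sup>2"
    by (simp add: power2_eq_square algebra_simps)
  thus ?thesis using zero_le_power2[of "a * q - b * p"] by linarith
qed

text \<open>
  The lower bound must not degrade, although \<open>Z\<close> is only close to \<open>G\<^sup>T G\<close> relative to \<open>\<kappa>\<close>.
  It is dual to an upper bound for the inverse of \<open>G\<^sup>T G\<close> on the discarded eigenspace: every \<open>v\<close>
  in that space is \<open>Z v'\<close> with \<open>v'\<close> of norm at most \<open>2 / \<kappa>\<close> times that of \<open>v\<close>.
\<close>
lemma precond_step_invariant:
  assumes G: "G \<in> carrier_mat d d" and Z: "Z \<in> psd_cone d" and k: "1 \<le> \<kappa>"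
    and lo: "\<And>x. x \<in> carrier_vec d \<Longrightarrow> x \<bullet> x \<le> 2000 * ((G *\<^sub>v x) \<bullet> (G *\<^sub>v x))"
    and hi: "\<And>x. x \<in> carrier_vec d \<Longrightarrow> (G *\<^sub>v x) \<bullet> (G *\<^sub>v x) \<le> \<kappa> * (x \<bullet> x)"
    and close: "\<And>x y. x \<in> carrier_vec d \<Longrightarrow> y \<in> carrier_vec d \<Longrightarrow>
      \<bar>x \<bullet> (Z *\<^sub>v y) - (G *\<^sub>v x) \<bullet> (G *\<^sub>v y)\<bar> \<le> 0.01 * \<kappa> * vnorm x * vnorm y"
    and z: "z \<in> carrier_vec d"
  defines "y \<equiv> precond_step d 20 \<kappa> Z *\<^sub>v z"
  shows "z \<bullet> z \<le> 2000 * ((G *\<^sub>v y) \<bullet> (G *\<^sub>v y))"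
    and "(G *\<^sub>v y) \<bullet> (G *\<^sub>v y) \<le> 0.7 * \<kappa> * (z \<bullet> z)"
proof -
  obtain U l where U: "orth_mat d U" and ZU: "Z = spec_mat d U l"
    using symmetric_spec_mat[of Z d] Z by (auto simp: psd_cone_def)
  define \<pi> :: "nat \<Rightarrow> real" where "\<pi> = (\<lambda>k. if \<kappa> / 2 \<le> l k then 1 else 0)"
  define e where "e = eig_coord U z"
  define v where "v = spec_mat d U \<pi> *\<^sub>v z"
  define w where "w = spec_mat d U (\<lambda>k. 1 - \<pi> k) *\<^sub>v z"
  \<comment> \<open>The preimage of \<open>v\<close> under \<open>Z\<close>. On the support of
    \<open>\<pi>\<close> the eigenvalue is at least \<open>\<kappa> / 2\<close>; elsewhere the
    numerator is zero, so the value of the quotient there does no harm.\<close>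
  define v' where "v' = spec_mat d U (\<lambda>k. \<pi> k / l k) *\<^sub>v z"
  define s :: real where "s = sqrt 20"
  have "s * s = 20" by (simp add: s_def)
  moreover have "4.47 < s" unfolding s_def by (rule real_less_rsqrt) (simp add: power2_eq_square)
  moreover have "s < 4.48" unfolding s_def by (rule real_less_lsqrt) (simp_all add: power2_eq_square)
  ultimately have s: "s * s = 20" "4.47 < s" "s < 4.48" by blast+
  have s0: "s \<noteq> 0" using s by auto
  have carr: "v \<in> carrier_vec d" "w \<in> carrier_vec d" "v' \<in> carrier_vec d"
    unfolding v_def w_def v'_def by (rule spec_mat_vec_carrier[OF U z])+
  have ev: "eig_coord U v i = \<pi> i * e i" "eig_coord U w i = (1 - \<pi> i) * e i"
    "eig_coord U v' i = \<pi> i / l i * e i" if "i < d" for i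
    unfolding v_def w_def v'_def e_def using eig_coord_spec_mat[OF U z that] by simp_all
  have pi01: "\<pi> i * \<pi> i = \<pi> i" "\<pi> i * (1 - \<pi> i) = 0" for i by (simp_all add: \<pi>_def)
  have y: "y = (1.1 / s) \<cdot>\<^sub>v v + 1.1 \<cdot>\<^sub>v w"
  proof -
    have "precond_step d 20 \<kappa> Z = spec_mat d U (\<lambda>k. (1.1 / s) * \<pi> k + 1.1 * (1 - \<pi> k))"
      unfolding ZU precond_step_spec_mat[OF U] by (intro arg_cong[of _ _ "spec_mat d U"] ext) (simp add: \<pi>_def s_def)
    thus ?thesis unfolding y_def v_def w_def by (simp only: spec_mat_vec_lincomb[OF U z])
  qed
  have yc: "y \<in> carrier_vec d" using carr by (simp add: y)
  have zz: "z \<bullet> z = v \<bullet> v + w \<bullet> w"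
    unfolding scalar_prod_eig_coord[OF U z z] scalar_prod_eig_coord[OF U carr(1,1)]
      scalar_prod_eig_coord[OF U carr(2,2)] sum.distrib[symmetric]
    by (intro sum.cong refl) (simp add: ev e_def[symmetric] \<pi>_def)
  have vw: "v \<bullet> w = 0"
    unfolding scalar_prod_eig_coord[OF U carr(1,2)]
    by (intro sum.neutral ballI) (simp add: ev \<pi>_def)
  have Zv': "Z *\<^sub>v v' = v"
  proof -
    have "Z *\<^sub>v v' = (Z * spec_mat d U (\<lambda>k. \<pi> k / l k)) *\<^sub>v z"
      unfolding v'_def ZU by (rule assoc_mult_mat_vec[OF spec_mat_carrier[OF U] spec_mat_carrier[OF U] z, symmetric])
    also have "Z * spec_mat d U (\<lambda>k. \<pi> k / l k) = spec_mat d U \<pi>"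
      unfolding ZU spec_mat_mult[OF U] using k by (intro arg_cong[of _ _ "spec_mat d U"] ext) (auto simp: \<pi>_def)
    finally show ?thesis by (simp add: v_def)
  qed
  have v'v: "vnorm v' \<le> 2 / \<kappa> * vnorm v"
  proof (rule power2_le_imp_le)
    have "v' \<bullet> v' \<le> (2 / \<kappa>)\<^sup>2 * (v \<bullet> v)"
      unfolding scalar_prod_eig_coord[OF U carr(1,1)] scalar_prod_eig_coord[OF U carr(3,3)] sum_distrib_left
    proof (rule sum_mono)
      fix i assume "i \<in> {..<d}"
      hence i: "i < d" by simp
      show "eig_coord U v' i * eig_coord U v' i \<le> (2 / \<kappa>)\<^sup>2 * (eig_coord U v i * eig_coord U v i)"
      proof (cases "\<kappa> / 2 \<le> l i")
        case True
        hence "1 / l i \<le> 2 / \<kappa>" using k by (simp add: field_simps)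
        hence "(1 / l i)\<^sup>2 \<le> (2 / \<kappa>)\<^sup>2" using True k by (intro power_mono) auto
        hence "(1 / l i)\<^sup>2 * (e i * e i) \<le> (2 / \<kappa>)\<^sup>2 * (e i * e i)" by (rule mult_right_mono) simp
        thus ?thesis using True i by (simp add: ev \<pi>_def power2_eq_square field_simps)
      qed (use i in \<open>simp add: ev \<pi>_def\<close>)
    qed
    thus "(vnorm v')\<^sup>2 \<le> (2 / \<kappa> * vnorm v)\<^sup>2" by (simp only: vnorm_sq power_mult_distrib)
  qed (use k in auto)
  have wZw: "w \<bullet> (Z *\<^sub>v w) \<le> \<kappa> / 2 * (w \<bullet> w)"
    unfolding ZU quad_spec_mat[OF U carr(2,2)] unfolding scalar_prod_eig_coord[OF U carr(2,2)] sum_distrib_left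
  proof (rule sum_mono)
    fix i assume "i \<in> {..<d}"
    hence i: "i < d" by simp
    show "l i * eig_coord U w i * eig_coord U w i \<le> \<kappa> / 2 * (eig_coord U w i * eig_coord U w i)"
    proof (cases "\<kappa> / 2 \<le> l i")
      case False
      hence "l i * (eig_coord U w i * eig_coord U w i) \<le> \<kappa> / 2 * (eig_coord U w i * eig_coord U w i)"
        by (intro mult_right_mono) auto
      thus ?thesis by (simp add: mult.assoc)
    qed (use i in \<open>simp add: ev \<pi>_def\<close>)
  qed
  define p where "p = vnorm v"
  define q where "q = vnorm w"
  define g where "g = vnorm (G *\<^sub>v y)"
  have pq: "0 \<le> p" "0 \<le> q" "0 \<le> g" by (auto simp: p_def q_def g_def)
  have zzpq: "z \<bullet> z = p\<^sup>2 + q\<^sup>2" by (simp add: zz p_def q_def vnorm_sq)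
  have Gc: "G *\<^sub>v x \<in> carrier_vec d" if "x \<in> carrier_vec d" for x using G that by simp
  have hi': "vnorm (G *\<^sub>v x) \<le> sqrt \<kappa> * vnorm x" if "x \<in> carrier_vec d" for x
    using hi[OF that] unfolding vnorm_def by (metis real_sqrt_le_mono real_sqrt_mult)
  have Gy: "G *\<^sub>v y = (1.1 / s) \<cdot>\<^sub>v (G *\<^sub>v v) + 1.1 \<cdot>\<^sub>v (G *\<^sub>v w)"
    unfolding y using carr G
    by (simp add: mult_add_distrib_mat_vec[where nr=d and nc=d] mult_mat_vec[where nr=d and nc=d])
  \<comment> \<open>On the low eigenspace \<open>Z\<close> is at most \<open>\<kappa> / 2\<close>,
    and the closeness error adds \<open>0.01 * \<kappa>\<close>: this is the origin of 0.51.\<close>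
  have "(G *\<^sub>v w) \<bullet> (G *\<^sub>v w) \<le> w \<bullet> (Z *\<^sub>v w) + 0.01 * \<kappa> * vnorm w * vnorm w"
    using close[OF carr(2,2)] by linarith
  also have "\<dots> \<le> \<kappa> / 2 * (w \<bullet> w) + 0.01 * \<kappa> * vnorm w * vnorm w" using wZw by simp
  also have "\<dots> = 0.51 * \<kappa> * q\<^sup>2" unfolding vnorm_sq[symmetric] q_def by (simp add: power2_eq_square)
  finally have "(G *\<^sub>v w) \<bullet> (G *\<^sub>v w) \<le> 0.51 * \<kappa> * q\<^sup>2" .
  hence "vnorm (G *\<^sub>v w) \<le> sqrt (0.51 * \<kappa>) * q"
    using pq k unfolding vnorm_def by (metis real_sqrt_le_mono real_sqrt_mult real_sqrt_abs abs_of_nonneg)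
  hence Gw: "vnorm (G *\<^sub>v w) \<le> sqrt \<kappa> * (sqrt 0.51 * q)" by (simp only: real_sqrt_mult mult_ac)
  have "g \<le> 1.1 / s * vnorm (G *\<^sub>v v) + 1.1 * vnorm (G *\<^sub>v w)"
    unfolding g_def Gy using vnorm_triangle[of "(1.1 / s) \<cdot>\<^sub>v (G *\<^sub>v v)" d "1.1 \<cdot>\<^sub>v (G *\<^sub>v w)"] Gc carr s
    by (simp add: vnorm_smult)
  also have "\<dots> \<le> 1.1 / s * (sqrt \<kappa> * p) + 1.1 * (sqrt \<kappa> * (sqrt 0.51 * q))"
    using Gw hi'[OF carr(1)] s by (intro add_mono mult_left_mono) (auto simp: p_def)
  also have "\<dots> = sqrt \<kappa> * (1.1 / s * p + 1.1 * sqrt 0.51 * q)" by (simp add: algebra_simps)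
  finally have "g\<^sup>2 \<le> (sqrt \<kappa> * (1.1 / s * p + 1.1 * sqrt 0.51 * q))\<^sup>2"
    using pq by (intro power_mono) auto
  also have "\<dots> = \<kappa> * (1.1 / s * p + 1.1 * sqrt 0.51 * q)\<^sup>2" using k by (simp add: power_mult_distrib)
  also have "\<dots> \<le> \<kappa> * (((1.1 / s)\<^sup>2 + (1.1 * sqrt 0.51)\<^sup>2) * (p\<^sup>2 + q\<^sup>2))"
    using k by (intro mult_left_mono two_term_Cauchy_Schwarz) auto
  \<comment> \<open>Here the choice \<open>K = 20\<close> enters: 0.51 + 1/20 = 0.56, and 1.21 *
    0.56 = 0.6776 is below the required rate 0.7.\<close>
  also have "(1.1 / s)\<^sup>2 + (1.1 * sqrt 0.51)\<^sup>2 = (1.21 * 0.56 :: real)"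
    using s(1) by (simp add: power_mult_distrib power_divide power2_eq_square)
  also have "\<kappa> * (1.21 * 0.56 * (p\<^sup>2 + q\<^sup>2)) \<le> 0.7 * \<kappa> * (p\<^sup>2 + q\<^sup>2)"
  proof -
    have "0 \<le> \<kappa> * (p\<^sup>2 + q\<^sup>2)" using k by simp
    thus ?thesis by (simp add: algebra_simps)
  qed
  finally show "(G *\<^sub>v y) \<bullet> (G *\<^sub>v y) \<le> 0.7 * \<kappa> * (z \<bullet> z)" by (simp add: g_def vnorm_sq zzpq)
  \<comment> \<open>In terms of \<open>m\<close> the claim reads
    \<open>p\<^sup>2 + q\<^sup>2 \<le> m\<^sup>2\<close>. The old lower bound is used only as
    \<open>vnorm y \<le> m\<close>, that is, only inside error terms and in
    \<open>y \<bullet> w\<close>.\<close>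
  define m where "m = sqrt 2000 * g"
  have m0: "0 \<le> m" using pq by (simp add: m_def)
  have ym: "vnorm y \<le> m"
    using lo[OF yc] unfolding m_def g_def vnorm_def by (metis real_sqrt_le_mono real_sqrt_mult)
  have gm: "44 * g \<le> m" unfolding m_def using pq by (intro mult_right_mono real_le_rsqrt) auto
  have yv: "y \<bullet> v = 1.1 / s * p\<^sup>2" and yw: "y \<bullet> w = 1.1 * q\<^sup>2"
    unfolding y using carr vw comm_scalar_prod[OF carr(1,2)]
    by (simp_all add: add_scalar_prod_distrib[where n=d] p_def q_def vnorm_sq)
  \<comment> \<open>The product \<open>y \<bullet> v\<close> is known exactly; writing
    \<open>v\<close> as \<open>Z\<close> applied to \<open>v'\<close> bounds it in terms of
    \<open>g\<close> and \<open>m\<close>. The main term is small against \<open>m\<close> because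
    sqrt 2000 > 44, and 2/44 + 0.02 < 0.066.\<close>
  have "y \<bullet> v \<le> (G *\<^sub>v y) \<bullet> (G *\<^sub>v v') + 0.01 * \<kappa> * vnorm y * vnorm v'"
    using close[OF yc carr(3)] unfolding Zv' by linarith
  also have "\<dots> \<le> g * (sqrt \<kappa> * (2 / \<kappa> * p)) + 0.01 * \<kappa> * m * (2 / \<kappa> * p)"
  proof (rule add_mono)
    have "(G *\<^sub>v y) \<bullet> (G *\<^sub>v v') \<le> g * vnorm (G *\<^sub>v v')"
      using vnorm_Cauchy_Schwarz[OF Gc[OF yc] Gc[OF carr(3)]] by (simp add: g_def)
    also have "\<dots> \<le> g * (sqrt \<kappa> * (2 / \<kappa> * p))"
      using pq k v'v order_trans[OF hi'[OF carr(3)] mult_left_mono[OF v'v]]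
      by (intro mult_left_mono) (auto simp: p_def)
    finally show "(G *\<^sub>v y) \<bullet> (G *\<^sub>v v') \<le> g * (sqrt \<kappa> * (2 / \<kappa> * p))" .
    show "0.01 * \<kappa> * vnorm y * vnorm v' \<le> 0.01 * \<kappa> * m * (2 / \<kappa> * p)"
      using ym v'v k m0 by (intro mult_mono mult_left_mono mult_nonneg_nonneg) (auto simp: p_def)
  qed
  also have "g * (sqrt \<kappa> * (2 / \<kappa> * p)) = 2 * (g * p) / sqrt \<kappa>"
    using k real_sqrt_mult_self[of \<kappa>] by (simp add: field_simps)
  also have "\<dots> \<le> 2 * (g * p)"
    using k mult_left_mono[of 1 "sqrt \<kappa>" "2 * (g * p)"] mult_nonneg_nonneg[OF pq(3,1)]
    by (simp add: divide_le_eq)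
  also have "2 * (g * p) \<le> 2 * (m / 44 * p)" using gm pq by (intro mult_left_mono mult_right_mono) auto
  also have "0.01 * \<kappa> * m * (2 / \<kappa> * p) = 0.02 * (m * p)" using k by simp
  finally have "y \<bullet> v \<le> 2 * (m / 44 * p) + 0.02 * (m * p)" by simp
  hence "y \<bullet> v \<le> (2 / 44 + 0.02) * (m * p)" by (simp add: algebra_simps)
  moreover have "(2 / 44 + 0.02) * (m * p) \<le> 0.066 * (m * p)"
    using mult_nonneg_nonneg[OF m0 pq(1)] by (intro mult_right_mono) auto
  ultimately have yv_le: "y \<bullet> v \<le> 0.066 * (m * p)" by (rule order_trans)
  have "y \<bullet> w \<le> m * q"
    using vnorm_Cauchy_Schwarz[OF yc carr(2)] mult_right_mono[OF ym pq(2)] by (simp add: q_def)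
  hence "1.1 * (p\<^sup>2 + q\<^sup>2) \<le> s * (0.066 * (m * p)) + m * q"
    using yv_le mult_left_mono[OF yv_le, of s] s s0 by (simp add: yv yw)
  also have "s * (0.066 * (m * p)) \<le> 0.3 * (m * p)"
    using s mult_right_mono[of "s * 0.066" "0.3" "m * p"] m0 pq by simp
  \<comment> \<open>By Cauchy-Schwarz the right side contributes 0.3^2 + 1 = 1.09, while the left
    side contributes 1.1^2 = 1.21. The factor 1.1 in the preconditioner exists for this
    margin.\<close>
  finally have "1.1 * (p\<^sup>2 + q\<^sup>2) \<le> m * (0.3 * p + 1 * q)" by (simp add: algebra_simps)
  hence "(1.1 * (p\<^sup>2 + q\<^sup>2))\<^sup>2 \<le> (m * (0.3 * p + 1 * q))\<^sup>2" by (intro power_mono) auto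
  also have "\<dots> = m\<^sup>2 * (0.3 * p + 1 * q)\<^sup>2" by (rule power_mult_distrib)
  also have "\<dots> \<le> m\<^sup>2 * ((0.3\<^sup>2 + 1\<^sup>2) * (p\<^sup>2 + q\<^sup>2))"
    by (intro mult_left_mono two_term_Cauchy_Schwarz) auto
  finally have "1.21 * (p\<^sup>2 + q\<^sup>2) * (p\<^sup>2 + q\<^sup>2) \<le> 1.09 * m\<^sup>2 * (p\<^sup>2 + q\<^sup>2)"
    by (simp add: power2_eq_square algebra_simps)
  hence "p\<^sup>2 + q\<^sup>2 \<le> m\<^sup>2"
  proof (cases "p\<^sup>2 + q\<^sup>2 = 0")
    case False
    hence pos: "0 < p\<^sup>2 + q\<^sup>2" by (metis less_eq_real_def add_nonneg_nonneg zero_le_power2)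
    assume "1.21 * (p\<^sup>2 + q\<^sup>2) * (p\<^sup>2 + q\<^sup>2) \<le> 1.09 * m\<^sup>2 * (p\<^sup>2 + q\<^sup>2)"
    hence "1.21 * (p\<^sup>2 + q\<^sup>2) \<le> 1.09 * m\<^sup>2" using mult_right_le_imp_le pos by blast
    hence "121 * (p\<^sup>2 + q\<^sup>2) \<le> 109 * m\<^sup>2" by simp
    also have "109 * m\<^sup>2 \<le> 121 * m\<^sup>2" by (intro mult_right_mono) auto
    finally show ?thesis by simp
  qed simp
  thus "z \<bullet> z \<le> 2000 * ((G *\<^sub>v y) \<bullet> (G *\<^sub>v y))"
    by (simp add: zzpq m_def g_def power_mult_distrib vnorm_sq)
qed

section \<open>The relative norm\<close>

lemma det_nonzero_inverse:
  assumes A: "(A :: real mat) \<in> carrier_mat d d" and D: "Determinant.det A \<noteq> 0"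
  shows "inv_mat d A \<in> carrier_mat d d" "A * inv_mat d A = 1\<^sub>m d" "inv_mat d A * A = 1\<^sub>m d"
proof -
  have "mat_inverse A \<noteq> None"
    using mat_inverse(1)[OF A, where b="()"] det_non_zero_imp_unit[OF A D, where b="()"] by blast
  then obtain B where "mat_inverse A = Some B" by auto
  thus "inv_mat d A \<in> carrier_mat d d" "A * inv_mat d A = 1\<^sub>m d" "inv_mat d A * A = 1\<^sub>m d"
    using mat_inverse(2)[OF A] by (auto simp: inv_mat_def)
qed

lemma det_zero_inverse:
  assumes A: "(A :: real mat) \<in> carrier_mat d d" and D: "Determinant.det A = 0"
  shows "inv_mat d A = 0\<^sub>m d d"
proof (cases "mat_inverse A")
  case (Some B)
  hence "A * B = 1\<^sub>m d" "B \<in> carrier_mat d d" using mat_inverse(2)[OF A] by auto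
  hence "Determinant.det A * Determinant.det B = 1" using det_mult[OF A] det_one by metis
  thus ?thesis using D by simp
qed (simp add: inv_mat_def)

text \<open>Cramer's rule, valid also for singular matrices because both sides are then zero under
  the conventions for \<open>inv_mat\<close> and division by zero. The entries of the inverse thus
  become quotients of polynomials on the whole matrix space, hence measurable.\<close>

lemma inv_mat_adj:
  assumes A: "(A :: real mat) \<in> carrier_mat d d"
  shows "inv_mat d A = (1 / Determinant.det A) \<cdot>\<^sub>m adj_mat A"
proof (cases "Determinant.det A = 0")
  case True
  thus ?thesis using adj_mat(1)[OF A] det_zero_inverse[OF A] by (intro eq_matI) auto
next
  case False
  note adj = adj_mat[OF A] and inv = det_nonzero_inverse[OF A False]
  have "(1 / Determinant.det A) \<cdot>\<^sub>m adj_mat A * A = 1\<^sub>m d"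
    using False by (simp add: mult_smult_assoc_mat[OF adj(1) A] adj(3)) (auto intro!: eq_matI)
  hence "((1 / Determinant.det A) \<cdot>\<^sub>m adj_mat A) * (A * inv_mat d A) = inv_mat d A"
    using adj(1) A inv(1) left_mult_one_mat[OF inv(1)]
    by (subst assoc_mult_mat[where n\<^sub>1=d and n\<^sub>2=d and n\<^sub>3=d and n\<^sub>4=d, symmetric]) auto
  thus ?thesis using adj(1) by (simp add: inv(2) right_mult_one_mat[where nr=d and nc=d])
qed

lemma inv_mat_carrier [simp]: "A \<in> carrier_mat d d \<Longrightarrow> inv_mat d A \<in> carrier_mat d d"
  by (simp add: inv_mat_adj adj_mat(1))

lemma det_nonzero_if_injective:
  assumes A: "(A :: real mat) \<in> carrier_mat d d"
    and inj: "\<And>x. x \<in> carrier_vec d \<Longrightarrow> A *\<^sub>v x = 0\<^sub>v d \<Longrightarrow> x = 0\<^sub>v d"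
  shows "Determinant.det A \<noteq> 0"
  using det_0_iff_vec_prod_zero_field[OF A] inj by blast

lemma psd_sqrt_exists:
  assumes "S \<in> psd_cone d"
  shows "\<exists>B \<in> psd_cone d. B * B = S"
proof -
  obtain U l where U: "orth_mat d U" and S: "S = spec_mat d U l"
    using symmetric_spec_mat[of S d] assms by (auto simp: psd_cone_def)
  have l: "\<forall>k<d. 0 \<le> l k" using assms spec_mat_psd_iff[OF U] S by simp
  have "spec_mat d U (\<lambda>k. sqrt \<bar>l k\<bar>) * spec_mat d U (\<lambda>k. sqrt \<bar>l k\<bar>) = spec_mat d U l"
    unfolding spec_mat_mult[OF U] using l
    by (intro eq_matI) (auto simp: spec_mat_index[OF U] dim_spec_mat[OF U] intro!: sum.cong)
  thus ?thesis unfolding S by (intro bexI[of _ "spec_mat d U (\<lambda>k. sqrt \<bar>l k\<bar>)"] spec_mat_psd[OF U]) auto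
qed

text \<open>Diagonalise \<open>D = B - C\<close>. On a unit eigenvector \<open>u\<close> with
  eigenvalue \<open>l\<close>, equality of the lengths of \<open>B *\<^sub>v u\<close> and
  \<open>C *\<^sub>v u\<close> gives \<open>l = 0\<close> or
  \<open>l = 2 * (u \<bullet> (B *\<^sub>v u))\<close>. In the second case
  \<open>u \<bullet> (C *\<^sub>v u)\<close> is the negative of
  \<open>u \<bullet> (B *\<^sub>v u)\<close>; both are nonnegative, so both vanish.\<close>

lemma psd_sqrt_unique:
  assumes B: "B \<in> psd_cone d" and C: "C \<in> psd_cone d" and eq: "B * B = C * C"
  shows "B = C"
proof -
  have c: "B \<in> carrier_mat d d" "C \<in> carrier_mat d d" using B C by (auto simp: psd_cone_def)
  have s: "transpose_mat B = B" "transpose_mat C = C" using B C by (auto simp: psd_cone_def)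
  define D where "D = B - C"
  have D: "D \<in> carrier_mat d d" "transpose_mat D = D"
    using c s by (auto simp: D_def transpose_minus[where nr=d and nc=d])
  obtain U l where U: "orth_mat d U" and DU: "D = spec_mat d U l" using symmetric_spec_mat[OF D] by blast
  have "l k = 0" if k: "k < d" for k
  proof -
    let ?u = "col U k"
    have u: "?u \<in> carrier_vec d" by (rule col_carrier[OF U])
    have Du: "D *\<^sub>v ?u = l k \<cdot>\<^sub>v ?u"
    proof (rule eq_vecI)
      fix i assume "i < dim_vec (l k \<cdot>\<^sub>v ?u)"
      hence i: "i < d" using orth_mat_carrier[OF U] by simp
      have "(D *\<^sub>v ?u) $ i = (\<Sum>j<d. if j = k then U $$ (i, k) * l k else 0)"
        unfolding DU spec_mat_apply[OF U u i]
        by (intro sum.cong refl) (use k in \<open>auto simp: eig_coord_col[OF U]\<close>)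
      thus "(D *\<^sub>v ?u) $ i = (l k \<cdot>\<^sub>v ?u) $ i" using k i orth_mat_carrier[OF U] by simp
    qed (use D orth_mat_carrier[OF U] in auto)
    have Bu: "B *\<^sub>v ?u \<in> carrier_vec d" "C *\<^sub>v ?u \<in> carrier_vec d" using c u by auto
    have Dx: "D *\<^sub>v x = B *\<^sub>v x - C *\<^sub>v x" if "x \<in> carrier_vec d" for x
      unfolding D_def by (rule minus_mult_distrib_mat_vec[OF c that])
    have "(B *\<^sub>v ?u) \<bullet> (B *\<^sub>v ?u) = ?u \<bullet> ((B * B) *\<^sub>v ?u)"
      using scalar_prod_symmetric_mat[OF c(1) s(1) u Bu(1)] c u by simp
    also have "\<dots> = (C *\<^sub>v ?u) \<bullet> (C *\<^sub>v ?u)"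
      unfolding eq using scalar_prod_symmetric_mat[OF c(2) s(2) u Bu(2)] c u by simp
    also have "C *\<^sub>v ?u = B *\<^sub>v ?u - l k \<cdot>\<^sub>v ?u"
      using Dx[OF u] Bu u unfolding Du by (intro eq_vecI) (auto dest: arg_cong[of _ _ "\<lambda>v. v $ _"] simp: algebra_simps)
    also have "(B *\<^sub>v ?u - l k \<cdot>\<^sub>v ?u) \<bullet> (B *\<^sub>v ?u - l k \<cdot>\<^sub>v ?u) =
        (B *\<^sub>v ?u) \<bullet> (B *\<^sub>v ?u) - 2 * l k * (?u \<bullet> (B *\<^sub>v ?u)) + l k * l k"
      using Bu u col_normalized[OF U k]
      by (simp add: minus_scalar_prod_distrib[where n=d] scalar_prod_minus_distrib[where n=d]
          comm_scalar_prod[OF Bu(1) u] algebra_simps)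
    finally have 1: "l k * l k = 2 * l k * (?u \<bullet> (B *\<^sub>v ?u))" by simp
    have "?u \<bullet> (D *\<^sub>v ?u) = l k" using col_normalized[OF U k] u unfolding Du by simp
    hence 2: "?u \<bullet> (B *\<^sub>v ?u) - ?u \<bullet> (C *\<^sub>v ?u) = l k"
      using Dx[OF u] Bu u by (simp add: scalar_prod_minus_distrib[where n=d])
    have 3: "0 \<le> ?u \<bullet> (B *\<^sub>v ?u)" "0 \<le> ?u \<bullet> (C *\<^sub>v ?u)" using B C u by (auto simp: psd_cone_def)
    show "l k = 0"
    proof (rule ccontr)
      assume "l k \<noteq> 0"
      hence "l k = 2 * (?u \<bullet> (B *\<^sub>v ?u))" using 1 by simp
      hence "?u \<bullet> (B *\<^sub>v ?u) = 0" using 2 3 by linarith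
      thus False using \<open>l k = 2 * (?u \<bullet> (B *\<^sub>v ?u))\<close> \<open>l k \<noteq> 0\<close> by simp
    qed
  qed
  hence "D = 0\<^sub>m d d"
    unfolding DU by (intro eq_matI) (auto simp: spec_mat_index[OF U] dim_spec_mat[OF U])
  hence "B $$ (i, j) - C $$ (i, j) = 0" if "i < d" "j < d" for i j
  proof -
    have "(B - C) $$ (i, j) = 0" unfolding D_def[symmetric] \<open>D = 0\<^sub>m d d\<close> using that by simp
    thus ?thesis using that c by simp
  qed
  thus "B = C" using c by (intro eq_matI) auto
qed

lemma mat_sqrt:
  assumes "S \<in> psd_cone d"
  shows "mat_sqrt d S \<in> psd_cone d" "mat_sqrt d S * mat_sqrt d S = S"
proof -
  have "\<exists>!B. B \<in> psd_cone d \<and> B * B = S"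
    using psd_sqrt_exists[OF assms] psd_sqrt_unique by blast
  from theI'[OF this] show "mat_sqrt d S \<in> psd_cone d" "mat_sqrt d S * mat_sqrt d S = S"
    unfolding mat_sqrt_def by auto
qed

lemma transpose_op_bound:
  assumes A: "(A :: real mat) \<in> carrier_mat d d" and c: "0 \<le> c"
    and b: "\<And>x. x \<in> carrier_vec d \<Longrightarrow> vnorm (A *\<^sub>v x) \<le> c * vnorm x"
    and y: "y \<in> carrier_vec d"
  shows "vnorm (transpose_mat A *\<^sub>v y) \<le> c * vnorm y"
proof -
  let ?z = "transpose_mat A *\<^sub>v y"
  have z: "?z \<in> carrier_vec d" using A y by simp
  have "(vnorm ?z)\<^sup>2 = y \<bullet> (A *\<^sub>v ?z)"
    using transpose_vec_mult_scalar[OF A z y] by (simp add: vnorm_sq)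
  also have "\<dots> \<le> vnorm y * vnorm (A *\<^sub>v ?z)"
    using vnorm_Cauchy_Schwarz[OF y, of "A *\<^sub>v ?z"] A z by simp
  also have "\<dots> \<le> vnorm y * (c * vnorm ?z)" by (intro mult_left_mono b z) simp
  finally have "vnorm ?z * vnorm ?z \<le> (c * vnorm y) * vnorm ?z" by (simp add: power2_eq_square mult_ac)
  thus ?thesis using c vnorm_nonneg[of ?z] vnorm_nonneg[of y]
    by (cases "vnorm ?z = 0") (auto simp: mult_le_cancel_right)
qed

lemma frob_norm_sq_cols: "M \<in> carrier_mat d d \<Longrightarrow> (frob_norm M)\<^sup>2 = (\<Sum>j<d. col M j \<bullet> col M j)"
proof -
  assume M: "M \<in> carrier_mat d d"
  have "(frob_norm M)\<^sup>2 = (\<Sum>i<d. \<Sum>j<d. (M $$ (i, j))\<^sup>2)" using M by (simp add: frob_norm_def sum_nonneg)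
  also have "\<dots> = (\<Sum>j<d. \<Sum>i<d. (M $$ (i, j))\<^sup>2)" by (rule sum.swap)
  also have "\<dots> = (\<Sum>j<d. col M j \<bullet> col M j)"
    using M by (intro sum.cong refl) (simp add: scalar_prod_self_sum[where d=d])
  finally show ?thesis .
qed

lemma frob_norm_transpose: "M \<in> carrier_mat d d \<Longrightarrow> frob_norm (transpose_mat M) = frob_norm M"
proof -
  assume M: "M \<in> carrier_mat d d"
  have "(\<Sum>i<d. \<Sum>j<d. (M $$ (j, i))\<^sup>2) = (\<Sum>i<d. \<Sum>j<d. (M $$ (i, j))\<^sup>2)" by (rule sum.swap)
  thus ?thesis using M by (simp add: frob_norm_def)
qed

lemma frob_norm_mult_left:
  assumes A: "(A :: real mat) \<in> carrier_mat d d" and M: "M \<in> carrier_mat d d" and c: "0 \<le> c"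
    and b: "\<And>x. x \<in> carrier_vec d \<Longrightarrow> vnorm (A *\<^sub>v x) \<le> c * vnorm x"
  shows "frob_norm (A * M) \<le> c * frob_norm M"
proof (rule power2_le_imp_le)
  have AM: "A * M \<in> carrier_mat d d" using A M by simp
  have "(frob_norm (A * M))\<^sup>2 = (\<Sum>j<d. (vnorm (A *\<^sub>v col M j))\<^sup>2)"
    unfolding frob_norm_sq_cols[OF AM] vnorm_sq
    by (intro sum.cong refl) (simp only: lessThan_iff col_mult2[OF A M])
  also have "\<dots> \<le> (\<Sum>j<d. (c * vnorm (col M j))\<^sup>2)"
    using M by (intro sum_mono power_mono b) auto
  also have "\<dots> = (c * frob_norm M)\<^sup>2"
    unfolding power_mult_distrib frob_norm_sq_cols[OF M] sum_distrib_left vnorm_sq ..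
  finally show "(frob_norm (A * M))\<^sup>2 \<le> (c * frob_norm M)\<^sup>2" .
qed (use c in simp)

lemma frob_norm_conjugate:
  assumes A: "(A :: real mat) \<in> carrier_mat d d" and M: "M \<in> carrier_mat d d" and c: "0 \<le> c"
    and b: "\<And>x. x \<in> carrier_vec d \<Longrightarrow> vnorm (A *\<^sub>v x) \<le> c * vnorm x"
  shows "frob_norm (A * M * transpose_mat A) \<le> c * c * frob_norm M"
proof -
  have AM: "A * M \<in> carrier_mat d d" using A M by simp
  have "A * M * transpose_mat A \<in> carrier_mat d d" using A M by simp
  from frob_norm_transpose[OF this]
  have "frob_norm (A * M * transpose_mat A) = frob_norm (A * transpose_mat (A * M))"
    using transpose_mult[OF AM, of "transpose_mat A" d] A by simp
  also have "\<dots> \<le> c * frob_norm (transpose_mat (A * M))" 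
    by (rule frob_norm_mult_left[OF A _ c b]) (use AM in auto)
  also have "\<dots> = c * frob_norm (A * M)" by (simp add: frob_norm_transpose[OF AM])
  also have "\<dots> \<le> c * (c * frob_norm M)" by (intro mult_left_mono frob_norm_mult_left[OF A M c b] c)
  finally show ?thesis by simp
qed

lemma mat_assoc_vec3:
  assumes "(A :: real mat) \<in> carrier_mat d d" "B \<in> carrier_mat d d" "C \<in> carrier_mat d d" "x \<in> carrier_vec d"
  shows "(A * B * C) *\<^sub>v x = A *\<^sub>v (B *\<^sub>v (C *\<^sub>v x))"
  using assms by (simp add: assoc_mult_mat_vec[where n\<^sub>1=d and n\<^sub>2=d and n\<^sub>3=d])

text \<open>Let \<open>J\<close> invert \<open>A\<close>, let \<open>I\<close> invert the square
  root of \<open>S\<close>, and put \<open>B = I * J\<close>. The normalised error equals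
  \<open>B * (M * transpose_mat M - Z) * transpose_mat B\<close> with \<open>M = A * L\<close>.
  Since \<open>B * M\<close> is orthogonal, a lower bound for the Gram matrix of \<open>M\<close> is
  an upper bound for the operator norm of \<open>B\<close>, and conjugation by \<open>B\<close>
  costs at most its square.\<close>

lemma rel_norm_preconditioned:
  assumes S: "S \<in> psd_cone d" and L: "L \<in> carrier_mat d d" "S = L * transpose_mat L"
    and A: "A \<in> carrier_mat d d" and Z: "Z \<in> carrier_mat d d"
    and lo: "\<And>x. x \<in> carrier_vec d \<Longrightarrow>
      x \<bullet> x \<le> c\<^sup>2 * ((transpose_mat (A * L) *\<^sub>v x) \<bullet> (transpose_mat (A * L) *\<^sub>v x))" and c: "0 \<le> c"
  shows "rel_norm d S (S - inv_mat d A * Z * transpose_mat (inv_mat d A))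
    \<le> c * c * frob_norm ((A * L) * transpose_mat (A * L) - Z)"
proof -
  define M where "M = A * L"
  have M: "M \<in> carrier_mat d d" "transpose_mat M \<in> carrier_mat d d" using A L by (auto simp: M_def)
  note assoc = assoc_mult_mat[where n\<^sub>1=d and n\<^sub>2=d and n\<^sub>3=d and n\<^sub>4=d]
  note tm = transpose_mult[where nr=d and n=d and nc=d]
  have "Determinant.det (transpose_mat M) \<noteq> 0"
  \<comment> \<open>The lower bound makes \<open>transpose_mat M\<close> injective, so both
    \<open>A\<close> and \<open>L\<close> are invertible, and with them the square root of
    \<open>S\<close>.\<close>
  proof (rule det_nonzero_if_injective[OF M(2)])
    fix x :: "real Matrix.vec" assume x: "x \<in> carrier_vec d" "transpose_mat M *\<^sub>v x = 0\<^sub>v d"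
    hence "x \<bullet> x \<le> 0" using lo[OF x(1)] by (simp add: M_def)
    thus "x = 0\<^sub>v d" using scalar_prod_self_nonneg[of x] scalar_prod_self_eq_0[OF x(1)] by simp
  qed
  hence dM: "Determinant.det A * Determinant.det L \<noteq> 0"
    using det_transpose[OF M(1)] det_mult[OF A L(1)] by (simp add: M_def)
  define R where "R = mat_sqrt d S"
  have Rp: "R \<in> psd_cone d" and RR: "R * R = S" using mat_sqrt[OF S] by (auto simp: R_def)
  have R: "R \<in> carrier_mat d d" "transpose_mat R = R" using Rp by (auto simp: psd_cone_def)
  have "Determinant.det R * Determinant.det R = Determinant.det L * Determinant.det L"
    using det_mult[OF R(1) R(1)] det_mult[OF L(1), of "transpose_mat L"] det_transpose[OF L(1)] L RR by simp
  hence dR: "Determinant.det R \<noteq> 0" using dM by auto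
  have dA: "Determinant.det A \<noteq> 0" using dM by auto
  define I where "I = inv_mat d R"
  define J where "J = inv_mat d A"
  have I: "I \<in> carrier_mat d d" "R * I = 1\<^sub>m d" "I * R = 1\<^sub>m d" using det_nonzero_inverse[OF R(1) dR] by (auto simp: I_def)
  have J: "J \<in> carrier_mat d d" "A * J = 1\<^sub>m d" "J * A = 1\<^sub>m d" using det_nonzero_inverse[OF A dA] by (auto simp: J_def)
  have IT: "transpose_mat I = I"
  proof -
    have "transpose_mat I * R = 1\<^sub>m d" using tm[OF R(1) I(1)] I R by simp
    moreover have "transpose_mat I * (R * I) = (transpose_mat I * R) * I"
      using assoc[of "transpose_mat I" R I] I(1) R(1) by simp
    ultimately show ?thesis using I by simp
  qed
  have MM: "M * transpose_mat M = A * S * transpose_mat A"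
    using A L by (simp add: M_def tm assoc)
  have JAX: "J * (A * X) = X" if "X \<in> carrier_mat d d" for X
    using that J A by (simp add: assoc[symmetric] del: assoc_mult_mat)
  have AJt: "transpose_mat A * transpose_mat J = 1\<^sub>m d"
    using tm[OF J(1) A] J by simp
  have Sc: "S \<in> carrier_mat d d" using S by (simp add: psd_cone_def)
  have JS: "J * (M * transpose_mat M) * transpose_mat J = S"
    unfolding MM using J A Sc by (simp add: assoc JAX AJt)
  have JM: "S - J * Z * transpose_mat J = J * (M * transpose_mat M - Z) * transpose_mat J"
  proof -
    have "J * (M * transpose_mat M - Z) * transpose_mat J =
        J * (M * transpose_mat M) * transpose_mat J - J * Z * transpose_mat J"
      using J M Z by (simp add: mult_minus_distrib_mat[where nr=d and n=d and nc=d]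
          minus_mult_distrib_mat[where nr=d and n=d and nc=d] del: assoc_mult_mat)
    thus ?thesis by (simp add: JS)
  qed
  define B where "B = I * J"
  have B: "B \<in> carrier_mat d d" using I J by (simp add: B_def)
  have Y: "M * transpose_mat M - Z \<in> carrier_mat d d" using Z by (rule minus_carrier_mat)
  have "I * (S - J * Z * transpose_mat J) * I = B * (M * transpose_mat M - Z) * transpose_mat B"
    unfolding JM B_def using I J Y by (simp add: tm IT assoc)
  hence eq: "rel_norm d S (S - J * Z * transpose_mat J) = frob_norm (B * (M * transpose_mat M - Z) * transpose_mat B)"
    by (simp add: rel_norm_def Let_def R_def[symmetric] I_def[symmetric])
  have bT: "vnorm (transpose_mat B *\<^sub>v y) \<le> c * vnorm y" if y: "y \<in> carrier_vec d" for y
  proof -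
    define z where "z = transpose_mat B *\<^sub>v y"
    have z: "z \<in> carrier_vec d" using B y by (simp add: z_def)
    have AB: "A * B \<in> carrier_mat d d" using A B by simp
    \<comment> \<open>Orthogonality of \<open>B * M\<close>, obtained from \<open>R * R = S\<close>
      on the left and right of the two copies of \<open>I\<close>.\<close>
    have zz: "(transpose_mat M *\<^sub>v z) \<bullet> (transpose_mat M *\<^sub>v z) = y \<bullet> y"
    proof -
      have "(transpose_mat M *\<^sub>v z) \<bullet> (transpose_mat M *\<^sub>v z) = z \<bullet> (M *\<^sub>v (transpose_mat M *\<^sub>v z))"
        using transpose_vec_mult_scalar[OF M(1), of "transpose_mat M *\<^sub>v z" z] M z by simp
      also have "\<dots> = z \<bullet> ((M * transpose_mat M) *\<^sub>v z)" using M z by simp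
      also have "\<dots> = y \<bullet> (B *\<^sub>v ((M * transpose_mat M) *\<^sub>v z))"
        using transpose_vec_mult_scalar[OF B, of "(M * transpose_mat M) *\<^sub>v z" y] M z y
        unfolding z_def[symmetric] by simp
      also have "B *\<^sub>v ((M * transpose_mat M) *\<^sub>v z) = (B * (M * transpose_mat M) * transpose_mat B) *\<^sub>v y"
        unfolding z_def by (rule mat_assoc_vec3[symmetric]) (use B M y in auto)
      also have "B * (M * transpose_mat M) * transpose_mat B = I * (J * (M * transpose_mat M) * transpose_mat J) * I"
        unfolding B_def using I J M by (simp add: tm IT assoc)
      also have "\<dots> = (I * R) * (R * I)" unfolding JS RR[symmetric] using I(1) R(1) by (simp add: assoc)
      also have "\<dots> = 1\<^sub>m d" by (simp add: I)
      finally show ?thesis using y by simp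
    qed
    have "(vnorm z)\<^sup>2 \<le> (c * vnorm y)\<^sup>2"
      using lo[OF z] unfolding M_def[symmetric] zz by (simp only: power_mult_distrib vnorm_sq)
    thus ?thesis unfolding z_def by (rule power2_le_imp_le) (use c in simp)
  qed
  have "vnorm (B *\<^sub>v y) \<le> c * vnorm y" if "y \<in> carrier_vec d" for y
    using transpose_op_bound[of "transpose_mat B" d c y] B bT that c by simp
  from frob_norm_conjugate[OF B Y c this] show ?thesis
    using eq by (simp add: J_def M_def)
qed

section \<open>Measurability\<close>

lemma space_mat_borel [simp]: "space (mat_borel d) = carrier_mat d d"
  by (simp add: mat_borel_def)

lemma space_vec_borel [simp]: "space (vec_borel d) = carrier_vec d"
  by (simp add: vec_borel_def)

lemma space_psd_borel [simp]: "space (psd_borel d) = psd_cone d"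
  by (auto simp: psd_borel_def space_restrict_space psd_cone_def)

lemma measurable_eqI:
  assumes "g \<in> M \<rightarrow>\<^sub>M N" "\<And>x. x \<in> space M \<Longrightarrow> f x = g x"
  shows "f \<in> M \<rightarrow>\<^sub>M N"
  using assms measurable_cong[of M f g N] by blast

lemma measurable_mat_entry:
  assumes "i < d" "j < d"
  shows "(\<lambda>A. A $$ (i, j)) \<in> borel_measurable (mat_borel d)"
proof -
  have "(\<lambda>A. \<lambda>p\<in>{..<d} \<times> {..<d}. A $$ p) \<in> mat_borel d \<rightarrow>\<^sub>M (\<Pi>\<^sub>M p\<in>{..<d} \<times> {..<d}. borel)"
    unfolding mat_borel_def by (rule measurable_vimage_algebra1) (auto simp: space_PiM)
  from measurable_compose[OF this measurable_component_singleton[of "(i, j)"]] assms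
  show ?thesis by simp
qed

lemma measurable_vec_entry:
  assumes "i < d"
  shows "(\<lambda>v. v $ i) \<in> borel_measurable (vec_borel d)"
proof -
  have "(\<lambda>v. \<lambda>i\<in>{..<d}. v $ i) \<in> vec_borel d \<rightarrow>\<^sub>M (\<Pi>\<^sub>M i\<in>{..<d}. borel)"
    unfolding vec_borel_def by (rule measurable_vimage_algebra1) (auto simp: space_PiM)
  from measurable_compose[OF this measurable_component_singleton[of i]] assms
  show ?thesis by simp
qed

lemma measurable_mat_borelI:
  assumes "\<And>x. x \<in> space M \<Longrightarrow> f x \<in> carrier_mat d d"
    and "\<And>i j. i < d \<Longrightarrow> j < d \<Longrightarrow> (\<lambda>x. f x $$ (i, j)) \<in> borel_measurable M"
  shows "f \<in> M \<rightarrow>\<^sub>M mat_borel d"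
  unfolding mat_borel_def
proof (rule measurable_vimage_algebra2)
  show "(\<lambda>x. \<lambda>p\<in>{..<d} \<times> {..<d}. f x $$ p) \<in> M \<rightarrow>\<^sub>M (\<Pi>\<^sub>M p\<in>{..<d} \<times> {..<d}. borel)"
    by (rule measurable_restrict) (use assms(2) in auto)
qed (use assms(1) in auto)

lemma measurable_vec_borelI:
  assumes "\<And>x. x \<in> space M \<Longrightarrow> f x \<in> carrier_vec d"
    and "\<And>i. i < d \<Longrightarrow> (\<lambda>x. f x $ i) \<in> borel_measurable M"
  shows "f \<in> M \<rightarrow>\<^sub>M vec_borel d"
  unfolding vec_borel_def
proof (rule measurable_vimage_algebra2)
  show "(\<lambda>x. \<lambda>i\<in>{..<d}. f x $ i) \<in> M \<rightarrow>\<^sub>M (\<Pi>\<^sub>M i\<in>{..<d}. borel)"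
    by (rule measurable_restrict) (use assms(2) in auto)
qed (use assms(1) in auto)

context
  fixes M :: "'a measure" and f :: "'a \<Rightarrow> real mat" and d :: nat
  assumes f: "f \<in> M \<rightarrow>\<^sub>M mat_borel d"
begin

lemma measurable_mat_carrier: "x \<in> space M \<Longrightarrow> f x \<in> carrier_mat d d"
  using measurable_space[OF f] by simp

lemma measurable_mat_entry': "i < d \<Longrightarrow> j < d \<Longrightarrow> (\<lambda>x. f x $$ (i, j)) \<in> borel_measurable M"
  using measurable_compose[OF f measurable_mat_entry] by simp

lemma measurable_mat_transpose: "(\<lambda>x. transpose_mat (f x)) \<in> M \<rightarrow>\<^sub>M mat_borel d"
proof (rule measurable_mat_borelI)
  fix i j assume ij: "i < d" "j < d"
  have "transpose_mat (f x) $$ (i, j) = f x $$ (j, i)" if "x \<in> space M" for x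
    using measurable_mat_carrier[OF that] ij by simp
  thus "(\<lambda>x. transpose_mat (f x) $$ (i, j)) \<in> borel_measurable M"
    using measurable_mat_entry'[OF ij(2,1)] by (simp cong: measurable_cong)
qed (simp add: measurable_mat_carrier)

lemma measurable_mat_mult:
  assumes g: "g \<in> M \<rightarrow>\<^sub>M mat_borel d"
  shows "(\<lambda>x. f x * g x) \<in> M \<rightarrow>\<^sub>M mat_borel d"
proof (rule measurable_mat_borelI)
  have gc: "g x \<in> carrier_mat d d" if "x \<in> space M" for x using measurable_space[OF g that] by simp
  fix i j assume ij: "i < d" "j < d"
  have "(f x * g x) $$ (i, j) = (\<Sum>k<d. f x $$ (i, k) * g x $$ (k, j))" if "x \<in> space M" for x
    using measurable_mat_carrier[OF that] gc[OF that] ij by (simp add: scalar_prod_def lessThan_atLeast0)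
  moreover have "(\<lambda>x. \<Sum>k<d. f x $$ (i, k) * g x $$ (k, j)) \<in> borel_measurable M"
    using measurable_mat_entry' measurable_compose[OF g measurable_mat_entry] ij
    by (intro borel_measurable_sum borel_measurable_times) auto
  ultimately show "(\<lambda>x. (f x * g x) $$ (i, j)) \<in> borel_measurable M" by (simp cong: measurable_cong)
next
  fix x assume "x \<in> space M"
  thus "f x * g x \<in> carrier_mat d d"
    using measurable_mat_carrier[of x] measurable_space[OF g, of x] by simp
qed

lemma measurable_mat_mult_vec:
  assumes g: "g \<in> M \<rightarrow>\<^sub>M vec_borel d"
  shows "(\<lambda>x. f x *\<^sub>v g x) \<in> M \<rightarrow>\<^sub>M vec_borel d"
proof (rule measurable_vec_borelI)
  have gc: "g x \<in> carrier_vec d" if "x \<in> space M" for x using measurable_space[OF g that] by simp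
  fix i assume i: "i < d"
  have "(f x *\<^sub>v g x) $ i = (\<Sum>k<d. f x $$ (i, k) * g x $ k)" if "x \<in> space M" for x
    using measurable_mat_carrier[OF that] gc[OF that] i by (simp add: scalar_prod_def lessThan_atLeast0)
  moreover have "(\<lambda>x. \<Sum>k<d. f x $$ (i, k) * g x $ k) \<in> borel_measurable M"
    using measurable_mat_entry' measurable_compose[OF g measurable_vec_entry] i
    by (intro borel_measurable_sum borel_measurable_times) auto
  ultimately show "(\<lambda>x. (f x *\<^sub>v g x) $ i) \<in> borel_measurable M" by (simp cong: measurable_cong)
next
  fix x assume "x \<in> space M"
  thus "f x *\<^sub>v g x \<in> carrier_vec d"
    using measurable_mat_carrier[of x] measurable_space[OF g, of x] by simp
qed

lemma measurable_mat_pow: "(\<lambda>x. f x ^\<^sub>m k) \<in> M \<rightarrow>\<^sub>M mat_borel d"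
proof (induction k)
  case 0
  have "(\<lambda>x. 1\<^sub>m d) \<in> M \<rightarrow>\<^sub>M mat_borel d" by (rule measurable_const) simp
  moreover have "f x ^\<^sub>m 0 = 1\<^sub>m d" if "x \<in> space M" for x using measurable_mat_carrier[OF that] by simp
  ultimately show ?case by (simp cong: measurable_cong)
next
  case (Suc k)
  have "(\<lambda>x. f x ^\<^sub>m k * f x) \<in> M \<rightarrow>\<^sub>M mat_borel d"
  proof (rule measurable_mat_borelI)
    fix i j assume ij: "i < d" "j < d"
    have "(f x ^\<^sub>m k * f x) $$ (i, j) = (\<Sum>r<d. (f x ^\<^sub>m k) $$ (i, r) * f x $$ (r, j))" if "x \<in> space M" for x
      using measurable_mat_carrier[OF that] measurable_space[OF Suc that] ij
      by (simp add: scalar_prod_def lessThan_atLeast0)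
    moreover have "(\<lambda>x. \<Sum>r<d. (f x ^\<^sub>m k) $$ (i, r) * f x $$ (r, j)) \<in> borel_measurable M"
      using measurable_mat_entry' measurable_compose[OF Suc measurable_mat_entry] ij
      by (intro borel_measurable_sum borel_measurable_times) auto
    ultimately show "(\<lambda>x. (f x ^\<^sub>m k * f x) $$ (i, j)) \<in> borel_measurable M" by (simp cong: measurable_cong)
  next
    fix x assume "x \<in> space M"
    from measurable_mat_carrier[OF this] show "f x ^\<^sub>m k * f x \<in> carrier_mat d d"
      by (intro mult_carrier_mat[OF pow_carrier_mat])
  qed
  thus ?case by simp
qed

lemma measurable_det: "(\<lambda>x. Determinant.det (f x)) \<in> borel_measurable M"
proof -
  have "(\<lambda>x. \<Sum>p\<in>{p. p permutes {0..<d}}. signof p * (\<Prod>i = 0..<d. f x $$ (i, p i))) \<in> borel_measurable M"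
    using measurable_mat_entry' permutes_in_image
    by (intro borel_measurable_sum borel_measurable_times borel_measurable_const borel_measurable_prod) fastforce
  moreover have "Determinant.det (f x) = (\<Sum>p\<in>{p. p permutes {0..<d}}. signof p * (\<Prod>i = 0..<d. f x $$ (i, p i)))"
    if "x \<in> space M" for x
    using det_def'[OF measurable_mat_carrier[OF that]] .
  ultimately show ?thesis by (simp cong: measurable_cong)
qed

end

lemma measurable_mat_delete:
  assumes f: "f \<in> M \<rightarrow>\<^sub>M mat_borel d" and ij: "i < d" "j < d"
  shows "(\<lambda>x. mat_delete (f x) i j) \<in> M \<rightarrow>\<^sub>M mat_borel (d - 1)"
proof (rule measurable_mat_borelI)
  fix a b assume ab: "a < d - 1" "b < d - 1"
  define a' b' where "a' = (if a < i then a else Suc a)" and "b' = (if b < j then b else Suc b)"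
  have "a' < d" "b' < d" using ab by (auto simp: a'_def b'_def)
  from measurable_mat_entry'[OF f this] show "(\<lambda>x. mat_delete (f x) i j $$ (a, b)) \<in> borel_measurable M"
  proof (rule measurable_eqI)
    fix x assume "x \<in> space M"
    from carrier_matD[OF measurable_mat_carrier[OF f this]]
    show "mat_delete (f x) i j $$ (a, b) = f x $$ (a', b')"
      using ab by (simp add: mat_delete_def a'_def b'_def)
  qed
next
  fix x assume "x \<in> space M"
  thus "mat_delete (f x) i j \<in> carrier_mat (d - 1) (d - 1)"
    using measurable_mat_carrier[OF f, of x] by (auto simp: mat_delete_def)
qed

lemma measurable_inv_mat: "inv_mat d \<in> mat_borel d \<rightarrow>\<^sub>M mat_borel d"
proof (rule measurable_mat_borelI)
  fix i j assume ij: "i < d" "j < d"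
  have id: "(\<lambda>A. A) \<in> mat_borel d \<rightarrow>\<^sub>M mat_borel d" by simp
  have "inv_mat d A $$ (i, j) = (1 / Determinant.det A) * ((-1) ^ (j + i) * Determinant.det (mat_delete A j i))"
    if "A \<in> carrier_mat d d" for A
    using adj_mat(1)[OF that] that ij unfolding inv_mat_adj[OF that] by (simp add: adj_mat_def cofactor_def)
  moreover have "(\<lambda>A. (1 / Determinant.det A) * ((-1) ^ (j + i) * Determinant.det (mat_delete A j i)))
      \<in> borel_measurable (mat_borel d)"
    using measurable_det[OF id] measurable_det[OF measurable_mat_delete[OF id ij(2,1)]]
    by (intro borel_measurable_times borel_measurable_divide borel_measurable_const) auto
  ultimately show "(\<lambda>A. inv_mat d A $$ (i, j)) \<in> borel_measurable (mat_borel d)"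
    by (intro measurable_eqI[where f="\<lambda>A. inv_mat d A $$ (i, j)"]) auto
qed simp

text \<open>By Weierstrass the \<open>n\<close>-th function is approximated within
  \<open>1 / real (Suc n)\<close> on the interval from \<open>-n\<close> to \<open>n\<close>, and
  every fixed \<open>x\<close> is eventually inside. Passing through continuous functions lets
  \<open>f\<close> itself be discontinuous, as the eigenvalue threshold requires.\<close>

lemma polynomial_pointwise_limit:
  fixes g :: "nat \<Rightarrow> real \<Rightarrow> real"
  assumes cont: "\<And>n. continuous_on UNIV (g n)" and lim: "\<And>x. (\<lambda>n. g n x) \<longlonglongrightarrow> f x"
  shows "\<exists>a N. \<forall>x. (\<lambda>n. \<Sum>k\<le>N n. a n k * x ^ k) \<longlonglongrightarrow> (f x :: real)"
proof -
  have "\<exists>a N. \<forall>x\<in>{- real n..real n}. \<bar>g n x - (\<Sum>k\<le>N. a k * x ^ k)\<bar> < 1 / real (Suc n)" for n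
  proof -
    have c: "compact {- real n..real n}" "continuous_on {- real n..real n} (g n)" "0 < 1 / real (Suc n)"
      using continuous_on_subset[OF cont subset_UNIV] by auto
    obtain p where p: "real_polynomial_function p"
      "\<And>x. x \<in> {- real n..real n} \<Longrightarrow> \<bar>g n x - p x\<bar> < 1 / real (Suc n)"
      by (rule Stone_Weierstrass_real_polynomial_function[OF c]) blast
    then obtain a N where "p = (\<lambda>x. \<Sum>k\<le>N. a k * x ^ k)"
      using real_polynomial_function_iff_sum[of p] by blast
    thus ?thesis using p(2) by blast
  qed
  then obtain a N where aN: "\<And>n x. x \<in> {- real n..real n} \<Longrightarrow> \<bar>g n x - (\<Sum>k\<le>N n. a n k * x ^ k)\<bar> < 1 / real (Suc n)"
    by metis
  have "(\<lambda>n. \<Sum>k\<le>N n. a n k * x ^ k) \<longlonglongrightarrow> f x" for x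
  proof -
    have "(\<lambda>n. g n x - (\<Sum>k\<le>N n. a n k * x ^ k)) \<longlonglongrightarrow> 0"
    proof (rule Lim_null_comparison)
      obtain m where m: "\<bar>x\<bar> \<le> real m" using real_arch_simple by blast
      show "\<forall>\<^sub>F n in sequentially. norm (g n x - (\<Sum>k\<le>N n. a n k * x ^ k)) \<le> 1 / real (Suc n)"
        using eventually_ge_at_top[of m]
      proof eventually_elim
        case (elim n)
        hence "x \<in> {- real n..real n}" using m by auto
        thus ?case using aN[of x n] by simp
      qed
      show "(\<lambda>n. 1 / real (Suc n)) \<longlonglongrightarrow> 0" using LIMSEQ_inverse_real_of_nat by (simp add: inverse_eq_divide)
    qed
    from tendsto_diff[OF lim[of x] this] show ?thesis by simp
  qed
  thus ?thesis by blast
qed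

text \<open>Eigenvectors are chosen separately at each point, with no measurability asked of the
  choice. The entries of polynomials in \<open>g x\<close> are measurable, and they converge to the
  entries of \<open>F x\<close> at every point because in any eigenbasis the convergence is that of
  finitely many numbers.\<close>

lemma measurable_spectral_function:
  fixes h :: "nat \<Rightarrow> real \<Rightarrow> real"
  assumes g: "g \<in> M \<rightarrow>\<^sub>M mat_borel d" and sym: "\<And>x. x \<in> space M \<Longrightarrow> transpose_mat (g x) = g x"
    and F: "\<And>x U l. x \<in> space M \<Longrightarrow> orth_mat d U \<Longrightarrow> g x = spec_mat d U l \<Longrightarrow> F x = spec_mat d U (\<lambda>k. f (l k))"
    and cont: "\<And>n. continuous_on UNIV (h n)" and lim: "\<And>x. (\<lambda>n. h n x) \<longlonglongrightarrow> f x"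
  shows "F \<in> M \<rightarrow>\<^sub>M mat_borel d"
proof (rule measurable_mat_borelI)
  obtain a N where aN: "\<And>x. (\<lambda>n. \<Sum>k\<le>N n. a n k * x ^ k) \<longlonglongrightarrow> f x"
    using polynomial_pointwise_limit[OF cont lim] by blast
  have dec: "\<exists>U l. orth_mat d U \<and> g x = spec_mat d U l" if "x \<in> space M" for x
    using symmetric_spec_mat[OF measurable_mat_carrier[OF g that] sym[OF that]] by blast
  fix i j assume ij: "i < d" "j < d"
  show "(\<lambda>x. F x $$ (i, j)) \<in> borel_measurable M"
  proof (rule borel_measurable_LIMSEQ_real)
    fix x assume x: "x \<in> space M"
    then obtain U l where U: "orth_mat d U" and gx: "g x = spec_mat d U l" using dec by blast
    have "(\<lambda>n. \<Sum>r<d. U $$ (i, r) * (\<Sum>k\<le>N n. a n k * l r ^ k) * U $$ (j, r))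
        \<longlonglongrightarrow> (\<Sum>r<d. U $$ (i, r) * f (l r) * U $$ (j, r))"
      by (intro tendsto_sum tendsto_mult tendsto_const aN)
    thus "(\<lambda>n. \<Sum>k\<le>N n. a n k * (g x ^\<^sub>m k) $$ (i, j)) \<longlonglongrightarrow> F x $$ (i, j)"
      unfolding spec_mat_polynomial[OF U ij] F[OF x U gx] spec_mat_index[OF U ij] gx .
  next
    fix n
    show "(\<lambda>x. \<Sum>k\<le>N n. a n k * (g x ^\<^sub>m k) $$ (i, j)) \<in> borel_measurable M"
      using measurable_mat_entry'[OF measurable_mat_pow[OF g] ij]
      by (intro borel_measurable_sum borel_measurable_times borel_measurable_const) auto
  qed
next
  fix x assume x: "x \<in> space M"
  obtain U l where "orth_mat d U" "g x = spec_mat d U l"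
    using symmetric_spec_mat[OF measurable_mat_carrier[OF g x] sym[OF x]] by blast
  thus "F x \<in> carrier_mat d d" using F[OF x] by simp
qed

text \<open>The projection is the continuous function \<open>max 0\<close> of the symmetric part,
  and the symmetric part depends measurably on the matrix.\<close>

lemma measurable_psd_proj: "psd_proj d \<in> mat_borel d \<rightarrow>\<^sub>M psd_borel d"
proof -
  have "(\<lambda>A. sym_part d A) \<in> mat_borel d \<rightarrow>\<^sub>M mat_borel d"
  proof (rule measurable_mat_borelI)
    fix i j assume ij: "i < d" "j < d"
    have "(\<lambda>A. (A $$ (i, j) + A $$ (j, i)) / 2) \<in> borel_measurable (mat_borel d)"
      using measurable_mat_entry[OF ij] measurable_mat_entry[OF ij(2,1)] by (intro borel_measurable_divide borel_measurable_add) auto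
    thus "(\<lambda>A. sym_part d A $$ (i, j)) \<in> borel_measurable (mat_borel d)" using ij by (simp add: sym_part_def)
  qed simp
  hence "psd_proj d \<in> mat_borel d \<rightarrow>\<^sub>M mat_borel d"
    by (rule measurable_spectral_function[where f="max 0" and h="\<lambda>_. max 0"])
       (auto intro!: psd_proj_eq continuous_intros)
  thus ?thesis unfolding psd_borel_def
    by (intro measurable_restrict_space2) (auto simp: psd_proj_psd)
qed

lemma measurable_precond_step: "precond_step d K \<kappa> \<in> psd_borel d \<rightarrow>\<^sub>M mat_borel d"
proof (rule measurable_spectral_function)
  \<comment> \<open>Continuous ramps for the threshold: 1 from \<open>\<kappa> / 2\<close> upwards
    and 0 below \<open>\<kappa> / 2 - 1 / n\<close>. The limit takes the value 1 at the threshold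
    itself, matching the closed condition in \<open>top_eigenspace\<close>.\<close>
  let ?r = "\<lambda>n x. max 0 (min 1 (1 + real n * (x - \<kappa> / 2)))"
  let ?h = "\<lambda>n x. 1.1 * (1 + (1 / sqrt K - 1) * ?r n x)"
  show "(\<lambda>Z. Z) \<in> psd_borel d \<rightarrow>\<^sub>M mat_borel d"
    unfolding psd_borel_def by (intro measurable_restrict_space1) simp
  show "precond_step d K \<kappa> Z = spec_mat d U (\<lambda>k. 1.1 * (if \<kappa> / 2 \<le> l k then 1 / sqrt K else 1))"
    if "orth_mat d U" "Z = spec_mat d U l" for Z U l
    using precond_step_spec_mat[OF that(1)] that(2) by simp
  show "continuous_on UNIV (?h n)" for n by (intro continuous_intros)
  show "(\<lambda>n. ?h n x) \<longlonglongrightarrow> 1.1 * (if \<kappa> / 2 \<le> x then 1 / sqrt K else 1)" for x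
  proof -
    have "(\<lambda>n. ?r n x) \<longlonglongrightarrow> (if \<kappa> / 2 \<le> x then 1 else 0)"
    proof (cases "\<kappa> / 2 \<le> x")
      case True
      hence "?r n x = 1" for n by (simp add: max_def min_def)
      thus ?thesis using True by simp
    next
      case False
      obtain m where m: "1 / (\<kappa> / 2 - x) \<le> real m" using real_arch_simple by blast
      have "\<forall>\<^sub>F n in sequentially. ?r n x = 0"
        using eventually_ge_at_top[of m]
      proof eventually_elim
        case (elim n)
        hence "1 / (\<kappa> / 2 - x) \<le> real n" using m by simp
        hence "1 \<le> real n * (\<kappa> / 2 - x)" using False by (simp add: divide_le_eq mult.commute)
        thus ?case by (simp add: algebra_simps)
      qed
      thus ?thesis using False by (simp add: tendsto_eventually)
    qed
    from tendsto_mult[OF tendsto_const[of "1.1"] tendsto_add[OF tendsto_const[of 1] tendsto_mult[OF tendsto_const[of "1 / sqrt K - 1"] this]]]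
    show ?thesis by (cases "\<kappa> / 2 \<le> x") simp_all
  qed
qed (auto simp: psd_cone_def)

section \<open>The algorithms as Markov kernels\<close>

lemma prob_space_normal_law: "0 \<le> v \<Longrightarrow> prob_space (normal_law m v)"
  by (auto simp: normal_law_def intro!: prob_space_return prob_space_normal_density)

lemma sets_normal_law [simp, measurable_cong]: "sets (normal_law m v) = sets borel"
  by (simp add: normal_law_def)

lemma space_normal_law [simp]: "space (normal_law m v) = UNIV"
  by (simp add: normal_law_def)

definition sym_of :: "nat \<Rightarrow> (nat \<times> nat \<Rightarrow> real) \<Rightarrow> real mat" where
  "sym_of d g = Matrix.mat d d (\<lambda>(i, j). g (min i j, max i j))"

abbreviation upper_idx :: "nat \<Rightarrow> (nat \<times> nat) set" where
  "upper_idx d \<equiv> {(i, j). i \<le> j \<and> j < d}"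

lemma finite_upper_idx [simp]: "finite (upper_idx d)"
  by (rule finite_subset[of _ "{..<d} \<times> {..<d}"]) auto

lemma sym_of_carrier [simp]: "sym_of d g \<in> carrier_mat d d"
  by (simp add: sym_of_def)

lemma sym_of_transpose [simp]: "transpose_mat (sym_of d g) = sym_of d g"
  by (rule eq_matI) (auto simp: sym_of_def min.commute max.commute)

lemma measurable_sym_of:
  assumes "\<And>p. p \<in> upper_idx d \<Longrightarrow> sets (M p) = sets borel"
  shows "sym_of d \<in> (\<Pi>\<^sub>M p\<in>upper_idx d. M p) \<rightarrow>\<^sub>M mat_borel d"
proof (rule measurable_mat_borelI)
  fix i j assume ij: "i < d" "j < d"
  have m: "(min i j, max i j) \<in> upper_idx d" using ij by auto
  have "(\<lambda>g. g (min i j, max i j)) \<in> (\<Pi>\<^sub>M p\<in>upper_idx d. M p) \<rightarrow>\<^sub>M M (min i j, max i j)"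
    by (rule measurable_component_singleton[OF m])
  hence "(\<lambda>g. g (min i j, max i j)) \<in> borel_measurable (\<Pi>\<^sub>M p\<in>upper_idx d. M p)"
    using measurable_cong_sets[OF refl assms[OF m]] by blast
  thus "(\<lambda>g. sym_of d g $$ (i, j)) \<in> borel_measurable (\<Pi>\<^sub>M p\<in>upper_idx d. M p)"
    using ij by (simp add: sym_of_def)
qed simp

lemma gue_altdef: "gue d v = distr (\<Pi>\<^sub>M p\<in>upper_idx d. normal_law 0 v) (mat_borel d) (sym_of d)"
  by (simp add: gue_def sym_of_def[abs_def])

lemma gue_prob_algebra: "0 \<le> v \<Longrightarrow> gue d v \<in> space (prob_algebra (mat_borel d))"
  by (auto simp: gue_altdef space_prob_algebra
      intro!: prob_space.prob_space_distr prob_space_PiM prob_space_normal_law measurable_sym_of)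

definition trunc_cov :: "nat \<Rightarrow> nat \<Rightarrow> real \<Rightarrow> (nat \<Rightarrow> real Matrix.vec) \<Rightarrow> real mat" where
  "trunc_cov d n c X = Matrix.mat d d (\<lambda>(j, k). (\<Sum>i\<in>{i. i < n \<and> X i \<bullet> X i \<le> c}. X i $ j * X i $ k) / real n)"

definition noise_sd :: "real \<Rightarrow> nat \<Rightarrow> nat \<Rightarrow> real \<Rightarrow> real \<Rightarrow> real \<Rightarrow> real" where
  "noise_sd c\<sigma> d n \<rho> \<beta> \<kappa> = c\<sigma> * (real d * \<kappa> * ln (real n / \<beta>)) / (real n * sqrt \<rho>)"

lemma naive_pce_altdef:
  "naive_pce cS c\<sigma> d n \<rho> \<beta> \<kappa> X =
    gue d ((noise_sd c\<sigma> d n \<rho> \<beta> \<kappa>)\<^sup>2) \<bind>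
      (\<lambda>N. return (psd_borel d) (psd_proj d (trunc_cov d n (cS * (real d * \<kappa> * ln (real n / \<beta>))) X + N)))"
  by (simp add: naive_pce_def Let_def trunc_cov_def noise_sd_def)

lemma trunc_cov_carrier [simp]: "trunc_cov d n c X \<in> carrier_mat d d"
  by (simp add: trunc_cov_def)

lemma trunc_cov_index:
  "j < d \<Longrightarrow> k < d \<Longrightarrow> trunc_cov d n c X $$ (j, k) =
    (\<Sum>i<n. if X i \<bullet> X i \<le> c then X i $ j * X i $ k else 0) / real n"
  by (simp add: trunc_cov_def sum.inter_filter[symmetric])

lemma dim_trunc_cov [simp]: "dim_row (trunc_cov d n c X) = d" "dim_col (trunc_cov d n c X) = d"
  by (simp_all add: trunc_cov_def)

lemma trunc_cov_cong: "(\<And>i. i < n \<Longrightarrow> X i = X' i) \<Longrightarrow> trunc_cov d n c X = trunc_cov d n c X'"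
  by (rule eq_matI) (auto simp: trunc_cov_index intro!: sum.cong)

text \<open>The algorithms accept arbitrary functions on indices, whereas points of
  \<open>data_space\<close> are extensional. This congruence and the one for
  \<open>ppc_rounds\<close> allow a dataset to be replaced by its restriction to the indices below
  \<open>n\<close>.\<close>

lemma naive_pce_cong:
  "(\<And>i. i < n \<Longrightarrow> X i = X' i) \<Longrightarrow> naive_pce cS c\<sigma> d n \<rho> \<beta> \<kappa> X = naive_pce cS c\<sigma> d n \<rho> \<beta> \<kappa> X'"
  unfolding naive_pce_altdef using trunc_cov_cong[of n X X'] by simp

lemma ppc_rounds_cong:
  "(\<And>i. i < n \<Longrightarrow> X i = X' i) \<Longrightarrow> ppc_rounds cS c\<sigma> K d n \<rho> \<beta> t \<kappa> X = ppc_rounds cS c\<sigma> K d n \<rho> \<beta> t \<kappa> X'"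
proof (induction t arbitrary: \<kappa> X X')
  case (Suc t)
  have "ppc_rounds cS c\<sigma> K d n \<rho> \<beta> t (0.7 * \<kappa>) (\<lambda>i. A *\<^sub>v X i) =
      ppc_rounds cS c\<sigma> K d n \<rho> \<beta> t (0.7 * \<kappa>) (\<lambda>i. A *\<^sub>v X' i)" for A
    using Suc by (intro Suc.IH) simp
  thus ?case using naive_pce_cong[OF Suc.prems] by (simp add: Let_def)
qed simp

abbreviation data_space :: "nat \<Rightarrow> nat \<Rightarrow> (nat \<Rightarrow> real Matrix.vec) measure" where
  "data_space d n \<equiv> \<Pi>\<^sub>M i\<in>{..<n}. vec_borel d"

lemma space_data_space: "space (data_space d n) = {..<n} \<rightarrow>\<^sub>E carrier_vec d"
  by (simp add: space_PiM)

lemma measurable_scalar_prod: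
  assumes f: "f \<in> M \<rightarrow>\<^sub>M vec_borel d" and g: "g \<in> M \<rightarrow>\<^sub>M vec_borel d"
  shows "(\<lambda>x. f x \<bullet> g x) \<in> borel_measurable M"
proof (rule measurable_eqI)
  show "(\<lambda>x. \<Sum>i<d. f x $ i * g x $ i) \<in> borel_measurable M"
    using measurable_compose[OF f measurable_vec_entry] measurable_compose[OF g measurable_vec_entry]
    by (intro borel_measurable_sum borel_measurable_times) auto
  fix x assume "x \<in> space M"
  hence "g x \<in> carrier_vec d" using measurable_space[OF g] by simp
  thus "f x \<bullet> g x = (\<Sum>i<d. f x $ i * g x $ i)" by (simp add: scalar_prod_def lessThan_atLeast0)
qed

lemma measurable_trunc_cov: "trunc_cov d n c \<in> data_space d n \<rightarrow>\<^sub>M mat_borel d"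
proof (rule measurable_mat_borelI)
  fix j k assume jk: "j < d" "k < d"
  have c: "(\<lambda>X. X i) \<in> data_space d n \<rightarrow>\<^sub>M vec_borel d" if "i < n" for i
    using that by (intro measurable_component_singleton) simp
  have "(\<lambda>X. if X i \<bullet> X i \<le> c then X i $ j * X i $ k else 0) \<in> borel_measurable (data_space d n)"
    if i: "i < n" for i
  proof (rule measurable_If)
    show "(\<lambda>X. X i $ j * X i $ k) \<in> borel_measurable (data_space d n)"
      using measurable_compose[OF c[OF i] measurable_vec_entry] jk by (intro borel_measurable_times) auto
    show "{X \<in> space (data_space d n). X i \<bullet> X i \<le> c} \<in> sets (data_space d n)"
      using measurable_scalar_prod[OF c[OF i] c[OF i]] by (rule borel_measurable_le) simp
  qed simp
  hence "(\<lambda>X. (\<Sum>i<n. if X i \<bullet> X i \<le> c then X i $ j * X i $ k else 0) / real n) \<in> borel_measurable (data_space d n)"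
    by (intro borel_measurable_divide borel_measurable_sum) auto
  thus "(\<lambda>X. trunc_cov d n c X $$ (j, k)) \<in> borel_measurable (data_space d n)"
    using jk by (simp add: trunc_cov_index)
qed simp

lemma measurable_mat_add:
  assumes f: "f \<in> M \<rightarrow>\<^sub>M mat_borel d" and g: "g \<in> M \<rightarrow>\<^sub>M mat_borel d"
  shows "(\<lambda>x. f x + g x) \<in> M \<rightarrow>\<^sub>M mat_borel d"
proof (rule measurable_mat_borelI)
  fix i j assume ij: "i < d" "j < d"
  show "(\<lambda>x. (f x + g x) $$ (i, j)) \<in> borel_measurable M"
  proof (rule measurable_eqI)
    show "(\<lambda>x. f x $$ (i, j) + g x $$ (i, j)) \<in> borel_measurable M"
      using measurable_mat_entry'[OF f ij] measurable_mat_entry'[OF g ij] by simp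
    show "(f x + g x) $$ (i, j) = f x $$ (i, j) + g x $$ (i, j)" if "x \<in> space M" for x
      using measurable_mat_carrier[OF g that] ij by simp
  qed
next
  fix x assume "x \<in> space M"
  from measurable_mat_carrier[OF g this] show "f x + g x \<in> carrier_mat d d" by simp
qed

lemma measurable_naive_pce:
  "naive_pce cS c\<sigma> d n \<rho> \<beta> \<kappa> \<in> data_space d n \<rightarrow>\<^sub>M prob_algebra (psd_borel d)"
  unfolding naive_pce_altdef[abs_def]
proof (rule measurable_bind_prob_space2)
  let ?v = "(noise_sd c\<sigma> d n \<rho> \<beta> \<kappa>)\<^sup>2" and ?c = "cS * (real d * \<kappa> * ln (real n / \<beta>))"
  show "(\<lambda>X. gue d ?v) \<in> data_space d n \<rightarrow>\<^sub>M prob_algebra (mat_borel d)"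
    by (rule measurable_const) (simp add: gue_prob_algebra)
  have "(\<lambda>z. trunc_cov d n ?c (fst z) + snd z) \<in> data_space d n \<Otimes>\<^sub>M mat_borel d \<rightarrow>\<^sub>M mat_borel d"
    by (intro measurable_mat_add measurable_snd measurable_compose[OF measurable_fst measurable_trunc_cov])
  from measurable_compose[OF measurable_compose[OF this measurable_psd_proj] measurable_return_prob_space]
  show "(\<lambda>(X, N). return (psd_borel d) (psd_proj d (trunc_cov d n ?c X + N)))
      \<in> data_space d n \<Otimes>\<^sub>M mat_borel d \<rightarrow>\<^sub>M prob_algebra (psd_borel d)"
    by (simp add: case_prod_beta')
qed

lemma measurable_naive_pce_compose:
  assumes "\<And>i. i < n \<Longrightarrow> (\<lambda>x. Y x i) \<in> M \<rightarrow>\<^sub>M vec_borel d"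
  shows "(\<lambda>x. naive_pce cS c\<sigma> d n \<rho> \<beta> \<kappa> (Y x)) \<in> M \<rightarrow>\<^sub>M prob_algebra (psd_borel d)"
proof (rule measurable_eqI)
  have "(\<lambda>x. \<lambda>i\<in>{..<n}. Y x i) \<in> M \<rightarrow>\<^sub>M data_space d n" by (rule measurable_restrict) (use assms in auto)
  from measurable_compose[OF this measurable_naive_pce]
  show "(\<lambda>x. naive_pce cS c\<sigma> d n \<rho> \<beta> \<kappa> (\<lambda>i\<in>{..<n}. Y x i)) \<in> M \<rightarrow>\<^sub>M prob_algebra (psd_borel d)" .
qed (rule naive_pce_cong, simp)

text \<open>Joint measurability in the data and in the released matrix \<open>Z\<close>; the
  recursion binds over \<open>Z\<close> while the data stay a parameter.\<close>

lemma measurable_ppc_step: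
  assumes R: "ppc_rounds cS c\<sigma> K d n \<rho> \<beta> t (0.7 * \<kappa>) \<in> data_space d n \<rightarrow>\<^sub>M prob_algebra (mat_borel d)"
  shows "(\<lambda>z. ppc_rounds cS c\<sigma> K d n \<rho> \<beta> t (0.7 * \<kappa>) (\<lambda>i. precond_step d K \<kappa> (snd z) *\<^sub>v fst z i) \<bind>
      (\<lambda>B. return (mat_borel d) (B * precond_step d K \<kappa> (snd z)))) \<in> data_space d n \<Otimes>\<^sub>M psd_borel d \<rightarrow>\<^sub>M prob_algebra (mat_borel d)"
proof -
  let ?R = "data_space d n" and ?A = "\<lambda>Z. precond_step d K \<kappa> Z"
  have A: "(\<lambda>z. ?A (snd z)) \<in> ?R \<Otimes>\<^sub>M psd_borel d \<rightarrow>\<^sub>M mat_borel d"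
    by (rule measurable_compose[OF measurable_snd measurable_precond_step])
  have "(\<lambda>z. \<lambda>i\<in>{..<n}. ?A (snd z) *\<^sub>v fst z i) \<in> ?R \<Otimes>\<^sub>M psd_borel d \<rightarrow>\<^sub>M ?R"
  proof (rule measurable_restrict)
    fix i assume "i \<in> {..<n}"
    hence "(\<lambda>z. fst z i) \<in> ?R \<Otimes>\<^sub>M psd_borel d \<rightarrow>\<^sub>M vec_borel d"
      by (intro measurable_compose[OF measurable_fst measurable_component_singleton])
    from measurable_mat_mult_vec[OF A this]
    show "(\<lambda>z. ?A (snd z) *\<^sub>v fst z i) \<in> ?R \<Otimes>\<^sub>M psd_borel d \<rightarrow>\<^sub>M vec_borel d" .
  qed
  from measurable_compose[OF this R]
  have 1: "(\<lambda>z. ppc_rounds cS c\<sigma> K d n \<rho> \<beta> t (0.7 * \<kappa>) (\<lambda>i. ?A (snd z) *\<^sub>v fst z i))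
      \<in> ?R \<Otimes>\<^sub>M psd_borel d \<rightarrow>\<^sub>M prob_algebra (mat_borel d)"
    by (rule measurable_eqI) (rule ppc_rounds_cong, simp)
  have 2: "(\<lambda>(z, B). return (mat_borel d) (B * ?A (snd z))) \<in> (?R \<Otimes>\<^sub>M psd_borel d) \<Otimes>\<^sub>M mat_borel d \<rightarrow>\<^sub>M prob_algebra (mat_borel d)"
    unfolding case_prod_beta'
    by (intro measurable_compose[OF _ measurable_return_prob_space] measurable_mat_mult measurable_snd
        measurable_compose[OF measurable_fst A])
  show ?thesis by (rule measurable_bind_prob_space2[OF 1 2])
qed

lemma measurable_ppc_rounds:
  "ppc_rounds cS c\<sigma> K d n \<rho> \<beta> t \<kappa> \<in> data_space d n \<rightarrow>\<^sub>M prob_algebra (mat_borel d)"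
proof (induction t arbitrary: \<kappa>)
  case 0
  have "return (mat_borel d) (1\<^sub>m d) \<in> space (prob_algebra (mat_borel d))"
    by (simp add: space_prob_algebra prob_space_return)
  thus ?case by (simp add: measurable_const)
next
  case (Suc t)
  have "(\<lambda>X. naive_pce cS c\<sigma> d n \<rho> \<beta> \<kappa> X \<bind> (\<lambda>Z.
      ppc_rounds cS c\<sigma> K d n \<rho> \<beta> t (0.7 * \<kappa>) (\<lambda>i. precond_step d K \<kappa> Z *\<^sub>v X i) \<bind>
      (\<lambda>B. return (mat_borel d) (B * precond_step d K \<kappa> Z)))) \<in> data_space d n \<rightarrow>\<^sub>M prob_algebra (mat_borel d)"
    by (rule measurable_bind_prob_space2[OF measurable_naive_pce])
       (use measurable_ppc_step[OF Suc.IH] in \<open>simp add: case_prod_beta'\<close>)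
  thus ?case by (simp add: Let_def)
qed

text \<open>Data and preconditioner may both depend on the parameter \<open>x\<close>, so the lemma
  covers joint measurability as well as the case of a fixed dataset.\<close>

lemma measurable_pgce_tail:
  assumes X: "\<And>i. i < n \<Longrightarrow> (\<lambda>x. X x i) \<in> M \<rightarrow>\<^sub>M vec_borel d" and A: "A \<in> M \<rightarrow>\<^sub>M mat_borel d"
  shows "(\<lambda>x. naive_pce cS c\<sigma> d n \<rho> \<beta> \<kappa> (\<lambda>i. A x *\<^sub>v X x i) \<bind>
      (\<lambda>S. return (mat_borel d) (inv_mat d (A x) * S * transpose_mat (inv_mat d (A x)))))
    \<in> M \<rightarrow>\<^sub>M prob_algebra (mat_borel d)"
proof (rule measurable_bind_prob_space2)
  show "(\<lambda>x. naive_pce cS c\<sigma> d n \<rho> \<beta> \<kappa> (\<lambda>i. A x *\<^sub>v X x i)) \<in> M \<rightarrow>\<^sub>M prob_algebra (psd_borel d)"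
    by (intro measurable_naive_pce_compose measurable_mat_mult_vec A X)
  have I: "(\<lambda>z. inv_mat d (A (fst z))) \<in> M \<Otimes>\<^sub>M psd_borel d \<rightarrow>\<^sub>M mat_borel d"
    by (intro measurable_compose[OF _ measurable_inv_mat] measurable_compose[OF measurable_fst A])
  have S: "(\<lambda>z. snd z) \<in> M \<Otimes>\<^sub>M psd_borel d \<rightarrow>\<^sub>M mat_borel d"
    by (rule measurable_compose[OF measurable_snd]) (auto simp: psd_borel_def intro!: measurable_restrict_space1)
  show "(\<lambda>(x, S). return (mat_borel d) (inv_mat d (A x) * S * transpose_mat (inv_mat d (A x))))
      \<in> M \<Otimes>\<^sub>M psd_borel d \<rightarrow>\<^sub>M prob_algebra (mat_borel d)"
    unfolding case_prod_beta'
    by (intro measurable_compose[OF _ measurable_return_prob_space] measurable_mat_mult measurable_mat_transpose I S)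
qed

lemma measurable_pgce:
  "pgce cS c\<sigma> cT K d n \<rho> \<beta> \<kappa> \<in> data_space d n \<rightarrow>\<^sub>M prob_algebra (mat_borel d)"
  unfolding pgce_def[abs_def] ppc_def Let_def
proof (rule measurable_bind_prob_space2[OF measurable_ppc_rounds])
  have "(\<lambda>z. naive_pce cS c\<sigma> d n (\<rho> / 2) (\<beta> / 2) 1000 (\<lambda>i. snd z *\<^sub>v fst z i) \<bind>
      (\<lambda>S. return (mat_borel d) (inv_mat d (snd z) * S * transpose_mat (inv_mat d (snd z)))))
    \<in> data_space d n \<Otimes>\<^sub>M mat_borel d \<rightarrow>\<^sub>M prob_algebra (mat_borel d)"
    by (intro measurable_pgce_tail measurable_snd measurable_compose[OF measurable_fst measurable_component_singleton]) simp
  thus "(\<lambda>(X, A). naive_pce cS c\<sigma> d n (\<rho> / 2) (\<beta> / 2) 1000 (\<lambda>i. A *\<^sub>v X i) \<bind>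
      (\<lambda>S. return (mat_borel d) (inv_mat d A * S * transpose_mat (inv_mat d A))))
    \<in> data_space d n \<Otimes>\<^sub>M mat_borel d \<rightarrow>\<^sub>M prob_algebra (mat_borel d)"
    by (simp add: case_prod_beta')
qed

section \<open>A dual form of the Renyi divergence bound\<close>

text \<open>
  By Hoelder duality a bound on the Renyi divergence of order \<open>a\<close> is an inequality between integrals
  of test functions. In this form post-processing and adaptive composition are immediate.
\<close>
definition renyi_dom :: "real \<Rightarrow> real \<Rightarrow> 'a measure \<Rightarrow> 'a measure \<Rightarrow> bool" where
  "renyi_dom a c P Q \<longleftrightarrow> (\<forall>f \<in> borel_measurable P. (\<forall>x\<in>space P. 0 \<le> f x \<and> f x \<le> (1 :: real)) \<longrightarrow>
     integral\<^sup>L P f \<le> exp c * (\<integral>x. f x powr (a / (a - 1)) \<partial>Q) powr ((a - 1) / a))"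

lemma renyi_dom_mono: "renyi_dom a c P Q \<Longrightarrow> c \<le> c' \<Longrightarrow> renyi_dom a c' P Q"
  unfolding renyi_dom_def by (meson exp_le_cancel_iff mult_right_mono order_trans powr_ge_zero)

lemma integral_Hoelder:
  fixes f h :: "'a \<Rightarrow> real"
  assumes p: "1 < p" "1 < q" "1 / p + 1 / q = 1"
    and m: "f \<in> borel_measurable M" "h \<in> borel_measurable M"
    and nn: "\<And>x. x \<in> space M \<Longrightarrow> 0 \<le> f x" "\<And>x. x \<in> space M \<Longrightarrow> 0 \<le> h x"
    and i: "integrable M (\<lambda>x. f x powr p)" "integrable M (\<lambda>x. h x powr q)"
  shows "(\<integral>x. f x * h x \<partial>M) \<le> (\<integral>x. f x powr p \<partial>M) powr (1 / p) * (\<integral>x. h x powr q \<partial>M) powr (1 / q)"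
proof -
  define F where "F = (\<integral>x. f x powr p \<partial>M)"
  define H where "H = (\<integral>x. h x powr q \<partial>M)"
  have FH: "0 \<le> F" "0 \<le> H" by (simp_all add: F_def H_def)
  show ?thesis
  proof (cases "F = 0 \<or> H = 0")
    case True
    have "AE x in M. f x * h x = 0"
    proof (cases "F = 0")
      case True
      hence "AE x in M. f x powr p = 0" using integral_nonneg_eq_0_iff_AE[OF i(1)] by (simp add: F_def)
      thus ?thesis by eventually_elim simp
    next
      case False
      hence "AE x in M. h x powr q = 0" using True integral_nonneg_eq_0_iff_AE[OF i(2)] by (simp add: H_def)
      thus ?thesis by eventually_elim simp
    qed
    hence "(\<integral>x. f x * h x \<partial>M) = 0" using integral_cong_AE[of "\<lambda>x. f x * h x" M "\<lambda>_. 0"] m by simp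
    thus ?thesis by simp
  next
    case False
    hence pos: "0 < F" "0 < H" using FH by auto
    define C where "C = F powr (1 / p) * H powr (1 / q)"
    have C: "0 < C" using pos by (simp add: C_def)
    have young: "f x * h x \<le> C * (f x powr p / F / p + h x powr q / H / q)" if x: "x \<in> space M" for x
    proof -
      have "(f x / F powr (1 / p)) * (h x / H powr (1 / q)) \<le>
          (f x / F powr (1 / p)) powr p / p + (h x / H powr (1 / q)) powr q / q"
        by (rule Youngs_inequality[OF p]) (use nn[OF x] in auto)
      also have "\<dots> = f x powr p / F / p + h x powr q / H / q"
        using nn[OF x] pos p by (simp add: powr_divide powr_powr)
      finally show ?thesis using C pos by (simp add: C_def field_simps)
    qed
    have iR: "integrable M (\<lambda>x. C * (f x powr p / F / p + h x powr q / H / q))"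
      using i by (intro integrable_mult_right integrable_add integrable_divide) auto
    have "integrable M (\<lambda>x. f x * h x)"
    proof (rule Bochner_Integration.integrable_bound[OF iR])
      show "AE x in M. norm (f x * h x) \<le> norm (C * (f x powr p / F / p + h x powr q / H / q))"
      proof (rule AE_I2)
        fix x assume x: "x \<in> space M"
        show "norm (f x * h x) \<le> norm (C * (f x powr p / F / p + h x powr q / H / q))"
          unfolding real_norm_def using young[OF x] mult_nonneg_nonneg[OF nn(1)[OF x] nn(2)[OF x]] by linarith
      qed
    qed (use m in auto)
    hence "(\<integral>x. f x * h x \<partial>M) \<le> (\<integral>x. C * (f x powr p / F / p + h x powr q / H / q) \<partial>M)"
      using iR young by (intro integral_mono) auto
    also have "\<dots> = C * (F / F / p + H / H / q)" using i by (simp add: F_def H_def)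
    also have "\<dots> = C" using pos p by simp
    finally show ?thesis by (simp add: C_def F_def H_def)
  qed
qed

text \<open>Hoelder with exponents \<open>a\<close> and \<open>a / (a - 1)\<close>. The parameter
  \<open>c\<close> bounds the logarithm of the \<open>a\<close>-norm of the density; a divergence
  bound \<open>\<rho> * a\<close> therefore corresponds to \<open>c = (a - 1) * \<rho>\<close>,
  which explains this expression in all privacy lemmas.\<close>

lemma renyi_dom_density:
  fixes h :: "'a \<Rightarrow> real"
  assumes a: "1 < a" and Q: "prob_space Q" and P: "P = density Q (\<lambda>x. ennreal (h x))"
    and h: "h \<in> borel_measurable Q" "\<And>x. 0 \<le> h x"
    and m: "(\<integral>\<^sup>+x. ennreal (h x powr a) \<partial>Q) \<le> ennreal (exp (a * c))"
  shows "renyi_dom a c P Q"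
  unfolding renyi_dom_def
proof (intro ballI impI)
  interpret Q: prob_space Q by fact
  let ?b = "a / (a - 1)"
  have b: "1 < ?b" "1 / ?b + 1 / a = 1" using a by (auto simp: field_simps)
  fix f :: "'a \<Rightarrow> real" assume "f \<in> borel_measurable P" and f01: "\<forall>x\<in>space P. 0 \<le> f x \<and> f x \<le> 1"
  hence f: "f \<in> borel_measurable Q" and f01: "\<And>x. x \<in> space Q \<Longrightarrow> 0 \<le> f x \<and> f x \<le> 1" by (auto simp: P)
  have ih: "integrable Q (\<lambda>x. h x powr a)"
    using h m by (intro integrableI_bounded) (auto simp: order_le_less_trans)
  have if': "integrable Q (\<lambda>x. f x powr ?b)"
    using f f01 b by (intro Q.integrable_const_bound[of _ 1] AE_I2) (auto intro!: powr_le1)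
  have H: "(\<integral>x. h x powr a \<partial>Q) \<le> exp (a * c)"
    using m nn_integral_eq_integral[OF ih] by (simp add: ennreal_le_iff)
  have "integral\<^sup>L P f = (\<integral>x. f x * h x \<partial>Q)"
    unfolding P using f h by (subst integral_real_density) (auto simp: mult.commute)
  also have "\<dots> \<le> (\<integral>x. f x powr ?b \<partial>Q) powr (1 / ?b) * (\<integral>x. h x powr a \<partial>Q) powr (1 / a)"
    by (rule integral_Hoelder[OF b(1) a b(2) f h(1) _ _ if' ih]) (use f01 h in auto)
  also have "\<dots> \<le> (\<integral>x. f x powr ?b \<partial>Q) powr (1 / ?b) * exp (a * c) powr (1 / a)"
    using a H by (intro mult_left_mono powr_mono2) (auto intro!: integral_nonneg_AE)
  also have "exp (a * c) powr (1 / a) = exp c" using a by (simp add: powr_def)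
  finally show "integral\<^sup>L P f \<le> exp c * (\<integral>x. f x powr ?b \<partial>Q) powr ((a - 1) / a)" by (simp add: mult.commute)
qed

lemma renyi_dom_refl:
  assumes "1 < a" "prob_space P"
  shows "renyi_dom a 0 P P"
proof (rule renyi_dom_density[where h="\<lambda>_. 1"])
  interpret prob_space P by fact
  show "(\<integral>\<^sup>+x. ennreal (1 powr a) \<partial>P) \<le> ennreal (exp (a * 0))" by (simp add: emeasure_space_1)
qed (use assms in \<open>auto simp: density_1\<close>)

text \<open>The inner bound, applied at each \<open>x\<close>, replaces the test function
  \<open>f\<close> by the function \<open>g\<close> on the first stage. It takes values in [0, 1]
  again, so the outer bound applies to \<open>g\<close>, and its conjugate power is exactly the
  inner integral. The parameters add; \<open>e = 0\<close> with equal kernels is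
  post-processing.\<close>

lemma renyi_dom_bind:
  assumes a: "1 < a" and P: "P \<in> space (prob_algebra M)" and Q: "Q \<in> space (prob_algebra M)"
    and K: "K \<in> M \<rightarrow>\<^sub>M prob_algebra N" and L: "L \<in> M \<rightarrow>\<^sub>M prob_algebra N"
    and PQ: "renyi_dom a c P Q" and KL: "\<And>x. x \<in> space M \<Longrightarrow> renyi_dom a e (K x) (L x)"
  shows "renyi_dom a (c + e) (P \<bind> K) (Q \<bind> L)"
  unfolding renyi_dom_def
proof (intro ballI impI)
  let ?b = "a / (a - 1)" and ?b' = "(a - 1) / a"
  have b: "0 < ?b'" "?b' * ?b = 1" "0 < ?b" using a by auto
  have sP: "sets P = sets M" "prob_space P" and sQ: "sets Q = sets M" "prob_space Q"
    using P Q by (auto simp: space_prob_algebra)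
  interpret P: prob_space P by fact
  interpret Q: prob_space Q by fact
  have spP: "space P = space M" and spQ: "space Q = space M"
    by (rule sets_eq_imp_space_eq[OF sP(1)], rule sets_eq_imp_space_eq[OF sQ(1)])
  have Ks: "sets (K x) = sets N" "prob_space (K x)" "space (K x) = space N" if "x \<in> space M" for x
    using measurable_space[OF K that] sets_eq_imp_space_eq[of "K x" N] by (auto simp: space_prob_algebra)
  have Ls: "sets (L x) = sets N" "prob_space (L x)" "space (L x) = space N" if "x \<in> space M" for x
    using measurable_space[OF L that] sets_eq_imp_space_eq[of "L x" N] by (auto simp: space_prob_algebra)
  have KP: "K \<in> P \<rightarrow>\<^sub>M subprob_algebra N" and LQ: "L \<in> Q \<rightarrow>\<^sub>M subprob_algebra N"
    using measurable_prob_algebraD[OF K] measurable_prob_algebraD[OF L] measurable_cong_sets[OF sP(1) refl]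
      measurable_cong_sets[OF sQ(1) refl] by auto
  have sb: "sets (P \<bind> K) = sets N" by (rule sets_bind'[OF P K])
  have spb: "space (P \<bind> K) = space N" using sb by (rule sets_eq_imp_space_eq)
  fix f :: "'b \<Rightarrow> real" assume "f \<in> borel_measurable (P \<bind> K)" and "\<forall>x\<in>space (P \<bind> K). 0 \<le> f x \<and> f x \<le> 1"
  hence f: "f \<in> borel_measurable N" and f01: "\<And>y. y \<in> space N \<Longrightarrow> 0 \<le> f y \<and> f y \<le> 1"
    using measurable_cong_sets[OF sb refl] by (auto simp: spb)
  define fb where "fb = (\<lambda>y. f y powr ?b)"
  have fb: "fb \<in> borel_measurable N" using f by (simp add: fb_def)
  have fb01: "0 \<le> fb y \<and> fb y \<le> 1" if "y \<in> space N" for y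
    using f01[OF that] b by (auto simp: fb_def intro!: powr_le1)
  have int01: "0 \<le> integral\<^sup>L R u \<and> integral\<^sup>L R u \<le> 1"
    if "prob_space R" "\<And>y. y \<in> space R \<Longrightarrow> 0 \<le> u y \<and> u y \<le> (1::real)" "u \<in> borel_measurable R" for R and u :: "'b \<Rightarrow> real"
  proof -
    interpret R: prob_space R by fact
    have "integrable R u" using that by (intro R.integrable_const_bound[of _ 1] AE_I2) auto
    hence "integral\<^sup>L R u \<le> integral\<^sup>L R (\<lambda>_. 1)" using that by (intro integral_mono) auto
    moreover have "0 \<le> integral\<^sup>L R u" using that by (intro integral_nonneg_AE AE_I2) auto
    ultimately show ?thesis by (simp add: R.prob_space)
  qed
  define G where "G = (\<lambda>x. integral\<^sup>L (L x) fb)"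
  have G01: "0 \<le> G x \<and> G x \<le> 1" if "x \<in> space M" for x
    unfolding G_def using Ls[OF that] fb fb01 measurable_cong_sets[OF Ls(1)[OF that] refl]
    by (intro int01) auto
  have Gm: "G \<in> borel_measurable M" unfolding G_def
    by (rule measurable_compose[OF measurable_prob_algebraD[OF L] integral_measurable_subprob_algebra[OF fb]])
  define g where "g = (\<lambda>x. G x powr ?b')"
  have gm: "g \<in> borel_measurable M" using Gm by (simp add: g_def)
  have g01: "0 \<le> g x \<and> g x \<le> 1" if "x \<in> space M" for x
    using G01[OF that] b by (auto simp: g_def intro!: powr_le1)
  have gb: "g x powr ?b = G x" if "x \<in> space M" for x
    using G01[OF that] b by (simp add: g_def powr_powr)
  have KI: "integral\<^sup>L (K x) f \<le> exp e * g x" if x: "x \<in> space M" for x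
    using KL[OF x] f f01 Ks[OF x] measurable_cong_sets[OF Ks(1)[OF x] refl, of borel]
    unfolding renyi_dom_def g_def G_def fb_def by auto
  have KIm: "(\<lambda>x. integral\<^sup>L (K x) f) \<in> borel_measurable M"
    by (rule measurable_compose[OF measurable_prob_algebraD[OF K] integral_measurable_subprob_algebra[OF f]])
  have KI01: "0 \<le> integral\<^sup>L (K x) f \<and> integral\<^sup>L (K x) f \<le> 1" if "x \<in> space M" for x
    using Ks[OF that] f f01 measurable_cong_sets[OF Ks(1)[OF that] refl] by (intro int01) auto
  have mP: "u \<in> borel_measurable M \<Longrightarrow> u \<in> borel_measurable P" for u :: "'a \<Rightarrow> real"
    using measurable_cong_sets[OF sP(1) refl] by blast
  have "integral\<^sup>L (P \<bind> K) f = (\<integral>x. integral\<^sup>L (K x) f \<partial>P)"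
    by (rule integral_bind[OF f _ KP P.finite_measure_axioms, where B=1 and B'=1])
       (use f01 Ks in \<open>auto simp: spP intro!: AE_I2 prob_space.measure_le_1 prob_space.emeasure_le_1\<close>)
  also have "\<dots> \<le> (\<integral>x. exp e * g x \<partial>P)"
  proof (rule integral_mono)
    show "integrable P (\<lambda>x. integral\<^sup>L (K x) f)"
      using KI01 mP[OF KIm] by (intro P.integrable_const_bound[of _ 1] AE_I2) (auto simp: spP)
    show "integrable P (\<lambda>x. exp e * g x)"
      using g01 mP[OF gm] by (intro integrable_mult_right P.integrable_const_bound[of _ 1] AE_I2) (auto simp: spP)
  qed (use KI in \<open>simp add: spP\<close>)
  also have "\<dots> = exp e * integral\<^sup>L P g" by simp
  also have "integral\<^sup>L P g \<le> exp c * (\<integral>x. g x powr ?b \<partial>Q) powr ?b'"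
    using PQ g01 mP[OF gm] unfolding renyi_dom_def by (auto simp: spP)
  also have "(\<integral>x. g x powr ?b \<partial>Q) = (\<integral>x. G x \<partial>Q)"
    by (intro Bochner_Integration.integral_cong refl gb) (simp add: spQ)
  also have "\<dots> = integral\<^sup>L (Q \<bind> L) fb"
    unfolding G_def
    by (rule integral_bind[OF fb _ LQ Q.finite_measure_axioms, where B=1 and B'=1, symmetric])
       (use fb01 Ls in \<open>auto simp: spQ intro!: AE_I2 prob_space.emeasure_le_1\<close>)
  finally show "integral\<^sup>L (P \<bind> K) f \<le> exp (c + e) * (\<integral>y. f y powr ?b \<partial>(Q \<bind> L)) powr ?b'"
    by (simp add: fb_def exp_add mult_ac)
qed

text \<open>The converse half of Hoelder duality. Indicators as test functions give absolute
  continuity; powers of the truncated density give the moment bound, and monotone convergence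
  removes the truncation.\<close>

lemma renyi_divergence_le:
  assumes a: "1 < a" and rho: "0 \<le> \<rho>" and P: "prob_space P" and Q: "prob_space Q" and s: "sets P = sets Q"
    and dom: "renyi_dom a ((a - 1) * \<rho>) P Q"
  shows "renyi_divergence a P Q \<le> ereal (\<rho> * a)"
proof -
  interpret P: prob_space P by fact
  interpret Q: prob_space Q by fact
  let ?b = "a / (a - 1)" and ?b' = "(a - 1) / a" and ?c = "(a - 1) * \<rho>"
  have sp: "space P = space Q" using s by (rule sets_eq_imp_space_eq)
  have b: "0 < ?b'" "0 < ?b" using a by auto
  note domD = dom[unfolded renyi_dom_def, rule_format]
  have ac: "absolutely_continuous Q P"
    unfolding absolutely_continuous_def
  proof
    fix A assume A: "A \<in> null_sets Q"
    hence As: "A \<in> sets P" "A \<in> sets Q" by (auto simp: s)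
    have "(\<lambda>x. indicator A x powr ?b) = (indicator A :: 'a \<Rightarrow> real)"
      by (auto simp: indicator_def)
    hence "measure P A \<le> exp ?c * measure Q A powr ?b'"
      using domD[of "indicator A"] As sets.Int_space_eq1[OF As(1)] sets.Int_space_eq1[OF As(2)] sets.sets_into_space[OF As(1)] sets.sets_into_space[OF As(2)]
      by (simp add: indicator_def Int_absorb1 Int_absorb2 P.emeasure_eq_measure)
    hence "measure P A \<le> 0" using A by (simp add: measure_def null_setsD1)
    hence "measure P A = 0" using measure_nonneg[of P A] by linarith
    thus "A \<in> null_sets P" using As by (simp add: null_sets_def P.emeasure_eq_measure)
  qed
  define h where "h = (\<lambda>x. enn2real (RN_deriv Q P x))"
  have hm: "h \<in> borel_measurable Q" by (simp add: h_def)
  have h0: "0 \<le> h x" for x by (simp add: h_def)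
  have "P = density Q (RN_deriv Q P)" using Q.density_RN_deriv[OF ac s] by simp
  also have "\<dots> = density Q (\<lambda>x. ennreal (h x))"
  proof (rule density_cong)
    show "AE x in Q. RN_deriv Q P x = ennreal (h x)"
      using Q.RN_deriv_finite[OF P.sigma_finite_measure_axioms ac s]
      by eventually_elim (simp add: h_def less_top)
  qed (use hm in auto)
  finally have Pd: "P = density Q (\<lambda>x. ennreal (h x))" .
  define I where "I = (\<lambda>n::nat. \<integral>x. min (h x) (real n) powr a \<partial>Q)"
  have hn: "0 \<le> min (h x) (real n) \<and> min (h x) (real n) \<le> real n" for x n using h0[of x] by auto
  have int: "integrable Q (\<lambda>x. min (h x) (real n) powr a)" for n
    using hm hn a by (intro Q.integrable_const_bound[of _ "real n powr a"] AE_I2) (auto intro!: powr_mono2)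
  have I0: "0 \<le> I n" for n by (simp add: I_def)
  have In: "I n \<le> exp (a * ?c)" if n: "0 < n" for n
  proof (cases "I n = 0")
    case False
    \<comment> \<open>The extremal test function of Hoelder's inequality, with the density cut at
      \<open>n\<close> and divided by \<open>n\<close> so that it stays in [0, 1]. The powers of
      \<open>n\<close> cancel, leaving \<open>I n \<le> exp ?c * I n powr ?b'\<close>; the
      truncation makes \<open>I n\<close> finite, so it can be divided out.\<close>
    define f where "f = (\<lambda>x. (min (h x) (real n) / real n) powr (a - 1))"
    have fm: "f \<in> borel_measurable Q" using hm by (simp add: f_def)
    have f01: "0 \<le> f x \<and> f x \<le> 1" for x
      using hn[of x n] n a by (auto simp: f_def intro!: powr_le1)
    have fb: "f x powr ?b = min (h x) (real n) powr a / real n powr a" for x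
      using hn[of x n] n a by (simp add: f_def powr_powr powr_divide)
    have mf: "min (h x) (real n) * f x = min (h x) (real n) powr a / real n powr (a - 1)" for x
    proof -
      have "min (h x) (real n) * min (h x) (real n) powr (a - 1) = min (h x) (real n) powr a"
        using hn[of x n] by (cases "min (h x) (real n) = 0") (auto simp: powr_mult_base)
      thus ?thesis using hn[of x n] n by (simp add: f_def powr_divide)
    qed
    have hf: "integrable Q (\<lambda>x. h x * f x)"
    proof -
      have "integrable P f" using fm f01 by (intro P.integrable_const_bound[of _ 1] AE_I2) (auto simp: measurable_cong_sets[OF s refl])
      thus ?thesis unfolding Pd using hm h0 fm by (subst (asm) integrable_real_density) auto
    qed
    have "I n / real n powr (a - 1) = (\<integral>x. min (h x) (real n) * f x \<partial>Q)"
      unfolding mf I_def by simp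
    also have "\<dots> \<le> (\<integral>x. h x * f x \<partial>Q)"
    proof (rule integral_mono[OF _ hf])
      show "integrable Q (\<lambda>x. min (h x) (real n) * f x)" unfolding mf using int by simp
    qed (use f01 in \<open>auto intro!: mult_right_mono\<close>)
    also have "\<dots> = integral\<^sup>L P f"
      unfolding Pd using hm h0 fm by (subst integral_real_density) auto
    also have "\<dots> \<le> exp ?c * (\<integral>x. f x powr ?b \<partial>Q) powr ?b'"
      using f01 fm by (intro domD) (auto simp: measurable_cong_sets[OF s refl])
    also have "(\<integral>x. f x powr ?b \<partial>Q) = I n / real n powr a" unfolding fb I_def by simp
    also have "(I n / real n powr a) powr ?b' = I n powr ?b' / real n powr (a - 1)"
      using I0[of n] n a by (simp add: powr_divide powr_powr)
    finally have "I n \<le> exp ?c * I n powr ?b'" using n by (simp add: divide_le_cancel)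
    moreover have "I n = I n powr (1 / a) * I n powr ?b'"
      using False I0[of n] a by (simp add: powr_add[symmetric] add_divide_distrib[symmetric])
    moreover have "0 < I n powr ?b'" using False by simp
    ultimately have "I n powr (1 / a) \<le> exp ?c" by (metis mult_le_cancel_right_pos)
    hence "(I n powr (1 / a)) powr a \<le> exp ?c powr a" using a by (intro powr_mono2) auto
    thus ?thesis using I0[of n] a by (simp add: powr_powr exp_powr_real mult.commute)
  qed simp
  have sup: "(SUP n. ennreal (min (h x) (real n) powr a)) = ennreal (h x powr a)" for x
  proof (rule antisym)
    show "(SUP n. ennreal (min (h x) (real n) powr a)) \<le> ennreal (h x powr a)"
      using h0[of x] a by (intro SUP_least ennreal_leI powr_mono2) auto
    obtain m where "h x \<le> real m" using real_arch_simple by blast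
    hence "ennreal (h x powr a) = ennreal (min (h x) (real m) powr a)" by simp
    also have "\<dots> \<le> (SUP n. ennreal (min (h x) (real n) powr a))" by (rule SUP_upper) simp
    finally show "ennreal (h x powr a) \<le> (SUP n. ennreal (min (h x) (real n) powr a))" .
  qed
  define J where "J = (\<integral>\<^sup>+ x. ennreal (h x powr a) \<partial>Q)"
  have "J = (SUP n. \<integral>\<^sup>+ x. ennreal (min (h x) (real n) powr a) \<partial>Q)"
    unfolding J_def sup[symmetric]
  proof (rule nn_integral_monotone_convergence_SUP)
    show "incseq (\<lambda>n x. ennreal (min (h x) (real n) powr a))"
      using h0 a by (intro incseq_SucI le_funI ennreal_leI powr_mono2) auto
  qed (use hm in auto)
  also have "\<dots> \<le> ennreal (exp (a * ?c))"
  proof (rule SUP_least)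
    fix n
    have "(\<integral>\<^sup>+ x. ennreal (min (h x) (real n) powr a) \<partial>Q) = ennreal (I n)"
      unfolding I_def by (rule nn_integral_eq_integral[OF int]) simp
    also have "\<dots> \<le> ennreal (exp (a * ?c))"
    proof (cases "n = 0")
      case True
      have "min (h x) (real 0) = 0" for x using h0[of x] by simp
      hence "I 0 = 0" by (simp only: I_def) simp
      thus ?thesis using True by simp
    qed (use In in \<open>auto intro!: ennreal_leI\<close>)
    finally show "(\<integral>\<^sup>+ x. ennreal (min (h x) (real n) powr a) \<partial>Q) \<le> ennreal (exp (a * ?c))" .
  qed
  finally have J: "J \<le> ennreal (exp (a * ?c))" .
  hence Jf: "J < \<infinity>" by (simp add: order_le_less_trans)
  have "ln (enn2real J) / (a - 1) \<le> \<rho> * a"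
  proof (cases "enn2real J = 0")
    case False
    hence "0 < enn2real J" using enn2real_nonneg[of J] by linarith
    moreover have "enn2real J \<le> exp (a * ?c)" using J by (intro enn2real_leI) auto
    ultimately have "ln (enn2real J) \<le> ln (exp (a * ?c))" by (subst ln_le_cancel_iff) auto
    hence "ln (enn2real J) \<le> a * ?c" by simp
    thus ?thesis using a by (simp add: divide_le_eq mult_ac)
  qed (use a rho in simp)
  thus ?thesis using ac Jf unfolding renyi_divergence_def Let_def J_def h_def by simp
qed

section \<open>The Gaussian mechanism\<close>

lemma measurable_PiM_compose:
  assumes "i \<in> I" "f \<in> M i \<rightarrow>\<^sub>M N"
  shows "(\<lambda>x. f (x i)) \<in> PiM I M \<rightarrow>\<^sub>M N"
  using measurable_component_singleton[OF assms(1)] assms(2) by (rule measurable_compose)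

lemma measurable_shift_normal_law: "(\<lambda>x. x + m) \<in> normal_law 0 v \<rightarrow>\<^sub>M borel"
  by (subst measurable_cong_sets[OF sets_normal_law refl]) simp

lemma density_PiM:
  assumes I: "finite I" and M: "product_sigma_finite M" and D: "product_sigma_finite (\<lambda>i. density (M i) (h i))"
    and h: "\<And>i. i \<in> I \<Longrightarrow> h i \<in> borel_measurable (M i)"
  shows "density (PiM I M) (\<lambda>x. \<Prod>i\<in>I. h i (x i)) = PiM I (\<lambda>i. density (M i) (h i))"
proof -
  interpret M: product_sigma_finite M by fact
  interpret D: product_sigma_finite "\<lambda>i. density (M i) (h i)" by fact
  have hm: "(\<lambda>x. \<Prod>i\<in>I. h i (x i)) \<in> borel_measurable (PiM I M)"
    using h by (intro borel_measurable_prod_ennreal measurable_PiM_compose)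
  show ?thesis
  proof (rule D.PiM_eqI[OF I])
    show "sets (density (PiM I M) (\<lambda>x. \<Prod>i\<in>I. h i (x i))) = sets (PiM I (\<lambda>i. density (M i) (h i)))"
      by (simp cong: sets_PiM_cong)
    fix A assume "\<And>i. i \<in> I \<Longrightarrow> A i \<in> sets (density (M i) (h i))"
    hence A: "A i \<in> sets (M i)" if "i \<in> I" for i using that by simp
    have "emeasure (density (PiM I M) (\<lambda>x. \<Prod>i\<in>I. h i (x i))) (Pi\<^sub>E I A) =
        (\<integral>\<^sup>+x. (\<Prod>i\<in>I. h i (x i)) * indicator (Pi\<^sub>E I A) x \<partial>PiM I M)"
      using hm A I by (intro emeasure_density sets_PiM_I_finite)
    also have "\<dots> = (\<integral>\<^sup>+x. (\<Prod>i\<in>I. h i (x i) * indicator (A i) (x i)) \<partial>PiM I M)"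
    proof (rule nn_integral_cong)
      fix x assume "x \<in> space (PiM I M)"
      hence "indicator (Pi\<^sub>E I A) x = (\<Prod>i\<in>I. indicator (A i) (x i) :: ennreal)"
        using I by (auto simp: space_PiM PiE_iff indicator_def prod_zero)
      thus "(\<Prod>i\<in>I. h i (x i)) * indicator (Pi\<^sub>E I A) x = (\<Prod>i\<in>I. h i (x i) * indicator (A i) (x i))"
        by (simp add: prod.distrib)
    qed
    also have "\<dots> = (\<Prod>i\<in>I. \<integral>\<^sup>+y. h i y * indicator (A i) y \<partial>M i)"
      using h A by (intro M.product_nn_integral_prod I) auto
    also have "\<dots> = (\<Prod>i\<in>I. emeasure (density (M i) (h i)) (A i))"
      using h A by (intro prod.cong refl) (simp add: emeasure_density)
    finally show "emeasure (density (PiM I M) (\<lambda>x. \<Prod>i\<in>I. h i (x i))) (Pi\<^sub>E I A) =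
        (\<Prod>i\<in>I. emeasure (density (M i) (h i)) (A i))" .
  qed
qed

lemma distr_PiM_pointwise:
  assumes I: "finite I" and M: "\<And>i. prob_space (M i)" and f: "\<And>i. f i \<in> M i \<rightarrow>\<^sub>M N i"
  shows "distr (PiM I M) (PiM I N) (\<lambda>x. \<lambda>i\<in>I. f i (x i)) = PiM I (\<lambda>i. distr (M i) (N i) (f i))"
proof -
  interpret M: product_prob_space M
    using M by (intro product_prob_spaceI) auto
  interpret D: product_prob_space "\<lambda>i. distr (M i) (N i) (f i)"
    using M f by (intro product_prob_spaceI prob_space.prob_space_distr) auto
  have m: "(\<lambda>x. \<lambda>i\<in>I. f i (x i)) \<in> PiM I M \<rightarrow>\<^sub>M PiM I N"
    by (intro measurable_restrict measurable_PiM_compose f)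
  show ?thesis
  proof (rule D.PiM_eqI[OF I])
    show "sets (distr (PiM I M) (PiM I N) (\<lambda>x. \<lambda>i\<in>I. f i (x i))) = sets (PiM I (\<lambda>i. distr (M i) (N i) (f i)))"
      by (simp cong: sets_PiM_cong)
    fix A assume "\<And>i. i \<in> I \<Longrightarrow> A i \<in> sets (distr (M i) (N i) (f i))"
    hence A: "A i \<in> sets (N i)" if "i \<in> I" for i using that by simp
    have "emeasure (distr (PiM I M) (PiM I N) (\<lambda>x. \<lambda>i\<in>I. f i (x i))) (Pi\<^sub>E I A) =
        emeasure (PiM I M) ((\<lambda>x. \<lambda>i\<in>I. f i (x i)) -` Pi\<^sub>E I A \<inter> space (PiM I M))"
      using A I by (intro emeasure_distr m sets_PiM_I_finite)
    also have "(\<lambda>x. \<lambda>i\<in>I. f i (x i)) -` Pi\<^sub>E I A \<inter> space (PiM I M) = Pi\<^sub>E I (\<lambda>i. f i -` A i \<inter> space (M i))"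
      by (auto simp: space_PiM PiE_iff)
    also have "emeasure (PiM I M) \<dots> = (\<Prod>i\<in>I. emeasure (M i) (f i -` A i \<inter> space (M i)))"
      using A f by (intro M.emeasure_PiM I) (auto intro: measurable_sets)
    also have "\<dots> = (\<Prod>i\<in>I. emeasure (distr (M i) (N i) (f i)) (A i))"
      using A f by (intro prod.cong refl) (simp add: emeasure_distr)
    finally show "emeasure (distr (PiM I M) (PiM I N) (\<lambda>x. \<lambda>i\<in>I. f i (x i))) (Pi\<^sub>E I A) =
        (\<Prod>i\<in>I. emeasure (distr (M i) (N i) (f i)) (A i))" .
  qed
qed

text \<open>The one-dimensional likelihood ratio of a translation. Privacy of the noise and its
  exponential moments both come from this formula.\<close>

lemma normal_law_shift:
  assumes v: "0 < v"
  shows "distr (normal_law 0 v) borel (\<lambda>x. x + m) = density (normal_law 0 v) (\<lambda>x. ennreal (exp ((x * m - m\<^sup>2 / 2) / v)))"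
proof -
  have s: "0 < sqrt v" using v by simp
  interpret N: prob_space "normal_law 0 v" using v by (intro prob_space_normal_law) simp
  have nl: "normal_law \<mu> v = density lborel (\<lambda>x. ennreal (normal_density \<mu> (sqrt v) x))" for \<mu>
    using v by (simp add: normal_law_def)
  have "distributed (normal_law 0 v) lborel (\<lambda>x. x) (normal_density 0 (sqrt v))"
    unfolding distributed_def nl by (auto simp: distr_id2 intro!: distr_id2)
  from N.normal_density_affine[OF this s, of 1 m]
  have "distr (normal_law 0 v) lborel (\<lambda>x. m + x) = density lborel (\<lambda>x. ennreal (normal_density m (sqrt v) x))"
    by (simp add: distributed_def)
  also have "distr (normal_law 0 v) lborel (\<lambda>x. m + x) = distr (normal_law 0 v) borel (\<lambda>x. x + m)"
    by (intro distr_cong) (auto simp: add.commute)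
  also have "density lborel (\<lambda>x. ennreal (normal_density m (sqrt v) x)) =
      density lborel (\<lambda>x. ennreal (normal_density 0 (sqrt v) x) * ennreal (exp ((x * m - m\<^sup>2 / 2) / v)))"
  proof (intro density_cong AE_I2)
    fix x
    have "exp (- (x - m)\<^sup>2 / (2 * v)) = exp (- x\<^sup>2 / (2 * v)) * exp ((x * m - m\<^sup>2 / 2) / v)"
      unfolding exp_add[symmetric] using v by (simp add: field_simps power2_eq_square)
    thus "ennreal (normal_density m (sqrt v) x) = ennreal (normal_density 0 (sqrt v) x) * ennreal (exp ((x * m - m\<^sup>2 / 2) / v))"
      using v by (simp add: normal_density_def ennreal_mult'[symmetric])
  qed auto
  also have "\<dots> = density (normal_law 0 v) (\<lambda>x. ennreal (exp ((x * m - m\<^sup>2 / 2) / v)))"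
    unfolding nl by (subst density_density_eq) auto
  finally show ?thesis .
qed

text \<open>With shift \<open>t * v\<close> the density in \<open>normal_law_shift\<close> is
  \<open>exp (t * x)\<close> up to a constant, and it integrates to 1 because the shifted law is a
  probability. Variance zero is the point mass at 0.\<close>

lemma nn_integral_normal_law_exp:
  assumes v: "0 \<le> v"
  shows "(\<integral>\<^sup>+x. ennreal (exp (t * x)) \<partial>normal_law 0 v) = ennreal (exp (t\<^sup>2 * v / 2))"
proof (cases "v = 0")
  case True
  thus ?thesis by (simp add: normal_law_def nn_integral_return)
next
  case False
  hence v: "0 < v" using v by simp
  interpret D: prob_space "distr (normal_law 0 v) borel (\<lambda>x. x + t * v)"
    using v by (intro prob_space.prob_space_distr prob_space_normal_law measurable_shift_normal_law) simp
  have "(\<integral>\<^sup>+x. ennreal (exp ((x * (t * v) - (t * v)\<^sup>2 / 2) / v)) \<partial>normal_law 0 v)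
      = emeasure (density (normal_law 0 v) (\<lambda>x. ennreal (exp ((x * (t * v) - (t * v)\<^sup>2 / 2) / v)))) UNIV"
    by (subst emeasure_density) (auto simp: measurable_def[symmetric] cong: nn_integral_cong)
  also have "\<dots> = 1" unfolding normal_law_shift[OF v, symmetric] using D.emeasure_space_1 by simp
  finally have 1: "(\<integral>\<^sup>+x. ennreal (exp ((x * (t * v) - (t * v)\<^sup>2 / 2) / v)) \<partial>normal_law 0 v) = 1" .
  have "(\<integral>\<^sup>+x. ennreal (exp (t * x)) \<partial>normal_law 0 v) =
      (\<integral>\<^sup>+x. ennreal (exp (t\<^sup>2 * v / 2)) * ennreal (exp ((x * (t * v) - (t * v)\<^sup>2 / 2) / v)) \<partial>normal_law 0 v)"
  proof (rule nn_integral_cong)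
    fix x
    have "t * x = t\<^sup>2 * v / 2 + (x * (t * v) - (t * v)\<^sup>2 / 2) / v"
      using v by (simp add: field_simps power2_eq_square)
    thus "ennreal (exp (t * x)) = ennreal (exp (t\<^sup>2 * v / 2)) * ennreal (exp ((x * (t * v) - (t * v)\<^sup>2 / 2) / v))"
      by (simp only: exp_add ennreal_mult'[symmetric] exp_ge_zero)
  qed
  also have "\<dots> = ennreal (exp (t\<^sup>2 * v / 2))" by (subst nn_integral_cmult) (auto simp: 1)
  finally show ?thesis .
qed

text \<open>The likelihood ratio is a product over coordinates, so its moment of order
  \<open>a\<close> factorises; one coordinate contributes
  \<open>exp (a * (a - 1) * (m p)\<^sup>2 / (2 * v))\<close>.\<close>

lemma renyi_dom_gaussian_shift:
  assumes a: "1 < a" and v: "0 < v" and I: "finite I"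
  shows "renyi_dom a ((a - 1) * (\<Sum>p\<in>I. (m p)\<^sup>2) / (2 * v))
    (distr (\<Pi>\<^sub>M p\<in>I. normal_law 0 v) (\<Pi>\<^sub>M p\<in>I. borel) (\<lambda>g. \<lambda>p\<in>I. g p + m p)) (\<Pi>\<^sub>M p\<in>I. normal_law 0 v)"
proof -
  define h where "h = (\<lambda>p x. exp ((x * m p - (m p)\<^sup>2 / 2) / v))"
  have N: "prob_space (normal_law 0 v)" using v by (intro prob_space_normal_law) simp
  have D: "prob_space (density (normal_law 0 v) (\<lambda>x. ennreal (h p x)))" for p
    unfolding h_def normal_law_shift[OF v, symmetric]
    by (intro prob_space.prob_space_distr N measurable_shift_normal_law)
  interpret P: product_prob_space "\<lambda>_. normal_law 0 v" by (intro product_prob_spaceI N)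
  interpret PD: product_prob_space "\<lambda>p. density (normal_law 0 v) (\<lambda>x. ennreal (h p x))" by (intro product_prob_spaceI D)
  have hm: "(\<lambda>x. h p x) \<in> borel_measurable borel" for p by (simp add: h_def)
  have "distr (\<Pi>\<^sub>M p\<in>I. normal_law 0 v) (\<Pi>\<^sub>M p\<in>I. borel) (\<lambda>g. \<lambda>p\<in>I. g p + m p) =
      (\<Pi>\<^sub>M p\<in>I. density (normal_law 0 v) (\<lambda>x. ennreal (h p x)))"
    unfolding h_def normal_law_shift[OF v, symmetric]
    by (rule distr_PiM_pointwise[OF I N measurable_shift_normal_law])
  also have "\<dots> = density (\<Pi>\<^sub>M p\<in>I. normal_law 0 v) (\<lambda>x. \<Prod>p\<in>I. ennreal (h p (x p)))"
    by (rule density_PiM[symmetric, OF I P.product_sigma_finite_axioms PD.product_sigma_finite_axioms])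
       (simp add: h_def)
  also have "(\<lambda>x. \<Prod>p\<in>I. ennreal (h p (x p))) = (\<lambda>x. ennreal (\<Prod>p\<in>I. h p (x p)))"
    by (intro ext prod_ennreal) (simp add: h_def)
  finally have eq: "distr (\<Pi>\<^sub>M p\<in>I. normal_law 0 v) (\<Pi>\<^sub>M p\<in>I. borel) (\<lambda>g. \<lambda>p\<in>I. g p + m p) =
      density (\<Pi>\<^sub>M p\<in>I. normal_law 0 v) (\<lambda>x. ennreal (\<Prod>p\<in>I. h p (x p)))" .
  have one: "(\<integral>\<^sup>+x. ennreal (h p x powr a) \<partial>normal_law 0 v) = ennreal (exp (a * (a - 1) * (m p)\<^sup>2 / (2 * v)))" for p
  proof -
    have "(\<integral>\<^sup>+x. ennreal (h p x powr a) \<partial>normal_law 0 v) =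
        (\<integral>\<^sup>+x. ennreal (exp (- a * (m p)\<^sup>2 / (2 * v))) * ennreal (exp (a * m p / v * x)) \<partial>normal_law 0 v)"
    proof (rule nn_integral_cong)
      fix x
      have "h p x powr a = exp (- a * (m p)\<^sup>2 / (2 * v) + a * m p / v * x)"
        unfolding h_def powr_def using v by (simp add: field_simps)
      thus "ennreal (h p x powr a) = ennreal (exp (- a * (m p)\<^sup>2 / (2 * v))) * ennreal (exp (a * m p / v * x))"
        by (simp only: exp_add ennreal_mult'[symmetric] exp_ge_zero)
    qed
    also have "\<dots> = ennreal (exp (- a * (m p)\<^sup>2 / (2 * v))) * ennreal (exp ((a * m p / v)\<^sup>2 * v / 2))"
      using nn_integral_normal_law_exp[OF less_imp_le[OF v], of "a * m p / v"] by (subst nn_integral_cmult) simp_all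
    also have "\<dots> = ennreal (exp (- a * (m p)\<^sup>2 / (2 * v) + (a * m p / v)\<^sup>2 * v / 2))"
      by (simp only: exp_add ennreal_mult'[symmetric] exp_ge_zero)
    also have "- a * (m p)\<^sup>2 / (2 * v) + (a * m p / v)\<^sup>2 * v / 2 = a * (a - 1) * (m p)\<^sup>2 / (2 * v)"
      using v by (simp add: field_simps power2_eq_square)
    finally show ?thesis .
  qed
  show ?thesis
  proof (rule renyi_dom_density[OF a _ eq])
    show "prob_space (\<Pi>\<^sub>M p\<in>I. normal_law 0 v)" by (intro prob_space_PiM N)
    have "(\<lambda>x. h p (x p)) \<in> borel_measurable (\<Pi>\<^sub>M p\<in>I. normal_law 0 v)" if "p \<in> I" for p
      by (rule measurable_PiM_compose[OF that]) (simp add: h_def)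
    thus "(\<lambda>x. \<Prod>p\<in>I. h p (x p)) \<in> borel_measurable (\<Pi>\<^sub>M p\<in>I. normal_law 0 v)"
      by (intro borel_measurable_prod)
    show "0 \<le> (\<Prod>p\<in>I. h p (x p))" for x by (intro prod_nonneg) (simp add: h_def)
    have "(\<integral>\<^sup>+x. ennreal ((\<Prod>p\<in>I. h p (x p)) powr a) \<partial>(\<Pi>\<^sub>M p\<in>I. normal_law 0 v)) =
        (\<integral>\<^sup>+x. (\<Prod>p\<in>I. ennreal (h p (x p) powr a)) \<partial>(\<Pi>\<^sub>M p\<in>I. normal_law 0 v))"
      by (intro nn_integral_cong) (simp add: prod_powr_distrib prod_ennreal h_def)
    also have "\<dots> = (\<Prod>p\<in>I. \<integral>\<^sup>+x. ennreal (h p x powr a) \<partial>normal_law 0 v)"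
      by (rule P.product_nn_integral_prod[OF I]) (simp add: h_def)
    also have "\<dots> = ennreal (exp (\<Sum>p\<in>I. a * (a - 1) * (m p)\<^sup>2 / (2 * v)))"
      unfolding one using I by (simp add: prod_ennreal exp_sum)
    also have "(\<Sum>p\<in>I. a * (a - 1) * (m p)\<^sup>2 / (2 * v)) = a * ((a - 1) * (\<Sum>p\<in>I. (m p)\<^sup>2) / (2 * v))"
      by (simp add: sum_distrib_left sum_divide_distrib mult_ac)
    finally show "(\<integral>\<^sup>+x. ennreal ((\<Prod>p\<in>I. h p (x p)) powr a) \<partial>(\<Pi>\<^sub>M p\<in>I. normal_law 0 v))
        \<le> ennreal (exp (a * ((a - 1) * (\<Sum>p\<in>I. (m p)\<^sup>2) / (2 * v))))" by simp
  qed
qed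

section \<open>Privacy\<close>

definition trunc_entry :: "real \<Rightarrow> real Matrix.vec \<Rightarrow> nat \<Rightarrow> nat \<Rightarrow> real" where
  "trunc_entry c x j k = (if x \<bullet> x \<le> c then x $ j * x $ k else 0)"

text \<open>The outer product of \<open>x\<close> with itself has Frobenius norm
  \<open>x \<bullet> x\<close>. Truncation thus bounds the influence of one record.\<close>

lemma trunc_entry_sum_le:
  assumes x: "x \<in> carrier_vec d"
  shows "(\<Sum>j<d. \<Sum>k<d. (trunc_entry c x j k)\<^sup>2) \<le> c\<^sup>2"
proof (cases "x \<bullet> x \<le> c")
  case True
  have "(\<Sum>j<d. \<Sum>k<d. (trunc_entry c x j k)\<^sup>2) = (\<Sum>j<d. \<Sum>k<d. (x $ j)\<^sup>2 * (x $ k)\<^sup>2)"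
    using True by (simp add: trunc_entry_def power_mult_distrib)
  also have "\<dots> = (x \<bullet> x) * (x \<bullet> x)" by (simp add: scalar_prod_self_sum[OF x] sum_product)
  also have "\<dots> \<le> c * c" using True scalar_prod_self_nonneg[of x] by (intro mult_mono) auto
  finally show ?thesis by (simp add: power2_eq_square)
qed (simp add: trunc_entry_def)

text \<open>Privacy is claimed for all parameters, including those where the logarithm in the
  truncation radius is not positive and the noise formula degenerates. Then only zero vectors
  survive truncation, and the output does not depend on the data.\<close>

lemma trunc_entry_nonpos:
  assumes x: "x \<in> carrier_vec d" and c: "c \<le> 0" and "j < d"
  shows "trunc_entry c x j k = 0"
proof (cases "x \<bullet> x \<le> c")
  case True
  hence "x \<bullet> x = 0" using c scalar_prod_self_nonneg[of x] by linarith
  hence "x = 0\<^sub>v d" using scalar_prod_self_eq_0[OF x] by simp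
  thus ?thesis using assms by (simp add: trunc_entry_def)
qed (simp add: trunc_entry_def)

lemma trunc_cov_neighbours:
  assumes j: "j0 < n" and eq: "\<And>i. i < n \<Longrightarrow> i \<noteq> j0 \<Longrightarrow> X i = X' i" and jk: "j < d" "k < d"
  shows "trunc_cov d n c X $$ (j, k) - trunc_cov d n c X' $$ (j, k) =
    (trunc_entry c (X j0) j k - trunc_entry c (X' j0) j k) / real n"
proof -
  have "(\<Sum>i<n. trunc_entry c (X i) j k) - (\<Sum>i<n. trunc_entry c (X' i) j k) =
      (\<Sum>i<n. if i = j0 then trunc_entry c (X j0) j k - trunc_entry c (X' j0) j k else 0)"
    unfolding sum_subtractf[symmetric] using eq by (intro sum.cong) auto
  also have "\<dots> = trunc_entry c (X j0) j k - trunc_entry c (X' j0) j k" using j by simp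
  finally show ?thesis
    unfolding trunc_cov_index[OF jk] by (simp add: trunc_entry_def[symmetric] diff_divide_distrib[symmetric])
qed

lemma trunc_cov_commute: "j < d \<Longrightarrow> k < d \<Longrightarrow> trunc_cov d n c X $$ (j, k) = trunc_cov d n c X $$ (k, j)"
  unfolding trunc_cov_index by (intro arg_cong2[where f="(/)"] sum.cong refl) auto

text \<open>Independent noise sits on the upper triangle only, so the sensitivity is taken over
  \<open>upper_idx d\<close>. The factor 4 is the square of a distance \<open>2 * c\<close> between
  two matrices of norm at most \<open>c\<close>.\<close>

lemma trunc_cov_sensitivity:
  assumes j: "j0 < n" and eq: "\<And>i. i < n \<Longrightarrow> i \<noteq> j0 \<Longrightarrow> X i = X' i"
    and X: "X j0 \<in> carrier_vec d" "X' j0 \<in> carrier_vec d"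
  shows "(\<Sum>p\<in>upper_idx d. (trunc_cov d n c X $$ p - trunc_cov d n c X' $$ p)\<^sup>2) \<le> 4 * c\<^sup>2 / (real n)\<^sup>2"
proof -
  let ?D = "\<lambda>p. (trunc_cov d n c X $$ p - trunc_cov d n c X' $$ p)\<^sup>2"
  have "(\<Sum>p\<in>upper_idx d. ?D p) \<le> (\<Sum>p\<in>{..<d} \<times> {..<d}. ?D p)" by (intro sum_mono2) auto
  also have "\<dots> = (\<Sum>j<d. \<Sum>k<d. ?D (j, k))" by (simp add: sum.cartesian_product)
  also have "\<dots> = (\<Sum>j<d. \<Sum>k<d. (trunc_entry c (X j0) j k - trunc_entry c (X' j0) j k)\<^sup>2 / (real n)\<^sup>2)"
    by (intro sum.cong refl) (simp add: trunc_cov_neighbours[OF j eq] power_divide)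
  also have "\<dots> \<le> (\<Sum>j<d. \<Sum>k<d. (2 * (trunc_entry c (X j0) j k)\<^sup>2 + 2 * (trunc_entry c (X' j0) j k)\<^sup>2) / (real n)\<^sup>2)"
  proof (intro sum_mono divide_right_mono)
    fix j k
    show "(trunc_entry c (X j0) j k - trunc_entry c (X' j0) j k)\<^sup>2 \<le>
        2 * (trunc_entry c (X j0) j k)\<^sup>2 + 2 * (trunc_entry c (X' j0) j k)\<^sup>2"
      using zero_le_power2[of "trunc_entry c (X j0) j k + trunc_entry c (X' j0) j k"]
      by (simp add: power2_eq_square algebra_simps)
  qed simp
  also have "\<dots> = (2 * (\<Sum>j<d. \<Sum>k<d. (trunc_entry c (X j0) j k)\<^sup>2) +
      2 * (\<Sum>j<d. \<Sum>k<d. (trunc_entry c (X' j0) j k)\<^sup>2)) / (real n)\<^sup>2"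
    by (simp only: sum.distrib sum_divide_distrib[symmetric] sum_distrib_left[symmetric])
  also have "\<dots> \<le> (2 * c\<^sup>2 + 2 * c\<^sup>2) / (real n)\<^sup>2"
    using trunc_entry_sum_le[OF X(1), of c] trunc_entry_sum_le[OF X(2), of c]
    by (intro divide_right_mono add_mono mult_left_mono) auto
  finally show ?thesis by simp
qed

lemma naive_pce_prob_algebra: "naive_pce cS c\<sigma> d n \<rho> \<beta> \<kappa> X \<in> space (prob_algebra (psd_borel d))" if "\<And>i. i < n \<Longrightarrow> X i \<in> carrier_vec d"
proof -
  have "restrict X {..<n} \<in> space (data_space d n)" using that by (auto simp: space_data_space)
  from measurable_space[OF measurable_naive_pce this]
  show ?thesis using naive_pce_cong[of n "restrict X {..<n}" X] by simp
qed

lemma ppc_rounds_prob_algebra: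
  assumes "\<And>i. i < n \<Longrightarrow> X i \<in> carrier_vec d"
  shows "ppc_rounds cS c\<sigma> K d n \<rho> \<beta> t \<kappa> X \<in> space (prob_algebra (mat_borel d))"
proof -
  have "restrict X {..<n} \<in> space (data_space d n)" using assms by (auto simp: space_data_space)
  from measurable_space[OF measurable_ppc_rounds this]
  show ?thesis using ppc_rounds_cong[of n "restrict X {..<n}" X] by simp
qed

text \<open>The change of the data is moved into the noise: both outputs are the same kernel applied
  to the noise, once shifted by the difference of the truncated covariances. With noise constant
  \<open>2 * cS\<close> the product \<open>v * \<rho>\<close> equals the squared sensitivity bound,
  so the Gaussian estimate gives even \<open>(a - 1) * \<rho> / 2\<close>.\<close>

lemma naive_pce_renyi:
  assumes a: "1 < a" and rho: "0 < \<rho>" and c: "0 < cS"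
    and X: "\<And>i. i < n \<Longrightarrow> X i \<in> carrier_vec d" "\<And>i. i < n \<Longrightarrow> X' i \<in> carrier_vec d"
    and j: "j0 < n" and eq: "\<And>i. i < n \<Longrightarrow> i \<noteq> j0 \<Longrightarrow> X i = X' i"
  shows "renyi_dom a ((a - 1) * \<rho>) (naive_pce cS (2 * cS) d n \<rho> \<beta> \<kappa> X) (naive_pce cS (2 * cS) d n \<rho> \<beta> \<kappa> X')"
proof -
  define r where "r = real d * \<kappa> * ln (real n / \<beta>)"
  define E E' where "E = trunc_cov d n (cS * r) X" and "E' = trunc_cov d n (cS * r) X'"
  define v where "v = (noise_sd (2 * cS) d n \<rho> \<beta> \<kappa>)\<^sup>2"
  have N: "naive_pce cS (2 * cS) d n \<rho> \<beta> \<kappa> X = gue d v \<bind> (\<lambda>N. return (psd_borel d) (psd_proj d (E + N)))"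
    "naive_pce cS (2 * cS) d n \<rho> \<beta> \<kappa> X' = gue d v \<bind> (\<lambda>N. return (psd_borel d) (psd_proj d (E' + N)))"
    by (simp_all add: naive_pce_altdef v_def E_def E'_def r_def)
  have pN: "prob_space (naive_pce cS (2 * cS) d n \<rho> \<beta> \<kappa> X)"
    using naive_pce_prob_algebra[of n X d] X by (auto simp: space_prob_algebra)
  show ?thesis
  proof (cases "r \<le> 0")
    case True
    have cr: "cS * r \<le> 0" using True c by (simp add: mult_nonneg_nonpos)
    have "trunc_entry (cS * r) (X i) p k = trunc_entry (cS * r) (X' i) p k" if "i < n" "p < d" for i p k
      using trunc_entry_nonpos[OF X(1)[OF that(1)] cr that(2)] trunc_entry_nonpos[OF X(2)[OF that(1)] cr that(2)] by simp
    hence "E = E'" unfolding E_def E'_def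
      by (intro eq_matI) (auto simp: trunc_cov_index trunc_entry_def[symmetric] intro!: sum.cong)
    thus ?thesis using renyi_dom_mono[OF renyi_dom_refl[OF a pN], of "(a - 1) * \<rho>"] a rho by (simp add: N)
  next
    case False
    hence r: "0 < r" by simp
    have n: "0 < real n" using j by simp
    have v: "0 < v" using r n rho c unfolding v_def noise_sd_def r_def[symmetric] by simp
    have vr: "v = 4 * cS\<^sup>2 * r\<^sup>2 / ((real n)\<^sup>2 * \<rho>)"
      using rho unfolding v_def noise_sd_def r_def[symmetric] by (simp add: power_divide power_mult_distrib)
    define \<Delta> where "\<Delta> = (\<lambda>p. E $$ p - E' $$ p)"
    let ?I = "upper_idx d"
    let ?g = "\<Pi>\<^sub>M p\<in>?I. normal_law 0 v" and ?B = "(\<Pi>\<^sub>M p\<in>?I. borel) :: (nat \<times> nat \<Rightarrow> real) measure"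
    let ?s = "\<lambda>g. \<lambda>p\<in>?I. g p + \<Delta> p"
    let ?K = "\<lambda>g. return (psd_borel d) (psd_proj d (E' + sym_of d g))"
    have gB: "sets ?g = sets ?B" by (intro sets_PiM_cong) auto
    have pg: "prob_space ?g" using v by (intro prob_space_PiM prob_space_normal_law) simp
    have Ec: "E \<in> carrier_mat d d" "E' \<in> carrier_mat d d" by (simp_all add: E_def E'_def)
    have sym: "sym_of d \<in> ?B \<rightarrow>\<^sub>M mat_borel d" by (rule measurable_sym_of) simp
    have symg: "sym_of d \<in> ?g \<rightarrow>\<^sub>M mat_borel d" by (rule measurable_sym_of) simp
    have K: "?K \<in> ?B \<rightarrow>\<^sub>M prob_algebra (psd_borel d)"
      using Ec by (intro measurable_compose[OF _ measurable_return_prob_space] measurable_compose[OF _ measurable_psd_proj]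
          measurable_mat_add sym measurable_const) simp
    have sm: "?s \<in> ?g \<rightarrow>\<^sub>M ?B"
      by (intro measurable_restrict measurable_PiM_compose measurable_shift_normal_law)
    have F: "(\<lambda>N. return (psd_borel d) (psd_proj d (A + N))) \<in> mat_borel d \<rightarrow>\<^sub>M subprob_algebra (psd_borel d)"
      if "A \<in> carrier_mat d d" for A
      using that by (intro measurable_prob_algebraD measurable_compose[OF _ measurable_return_prob_space]
          measurable_compose[OF _ measurable_psd_proj] measurable_mat_add measurable_const) auto
    have ne: "space ?g \<noteq> {}" using prob_space.not_empty[OF pg] .
    have X'K: "naive_pce cS (2 * cS) d n \<rho> \<beta> \<kappa> X' = ?g \<bind> ?K"
      unfolding N gue_altdef by (rule bind_distr[OF symg F[OF Ec(2)] ne])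
    have shift: "E' + sym_of d (?s g) = E + sym_of d g" for g
    proof (rule eq_matI)
      fix i k assume "i < dim_row (E + sym_of d g)" "k < dim_col (E + sym_of d g)"
      hence ik: "i < d" "k < d" using carrier_matD[OF sym_of_carrier[of d g]] by auto
      have Es: "E $$ (min i k, max i k) = E $$ (i, k)" "E' $$ (min i k, max i k) = E' $$ (i, k)"
        using ik trunc_cov_commute[of k d i] by (auto simp: E_def E'_def min_def max_def)
      have "(min i k, max i k) \<in> ?I" using ik by auto
      thus "(E' + sym_of d (?s g)) $$ (i, k) = (E + sym_of d g) $$ (i, k)"
        using ik Es by (simp add: sym_of_def \<Delta>_def)
    qed (auto simp: sym_of_def)
    have "naive_pce cS (2 * cS) d n \<rho> \<beta> \<kappa> X = ?g \<bind> (\<lambda>g. ?K (?s g))"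
      unfolding N gue_altdef shift by (rule bind_distr[OF symg F[OF Ec(1)] ne])
    also have "\<dots> = distr ?g ?B ?s \<bind> ?K"
      by (rule bind_distr[OF sm measurable_prob_algebraD[OF K] ne, symmetric])
    finally have XK: "naive_pce cS (2 * cS) d n \<rho> \<beta> \<kappa> X = distr ?g ?B ?s \<bind> ?K" .
    have "renyi_dom a ((a - 1) * (\<Sum>p\<in>?I. (\<Delta> p)\<^sup>2) / (2 * v) + 0) (distr ?g ?B ?s \<bind> ?K) (?g \<bind> ?K)"
    proof (rule renyi_dom_bind[OF a _ _ K K])
      show "distr ?g ?B ?s \<in> space (prob_algebra ?B)"
        using prob_space.prob_space_distr[OF pg sm] by (simp add: space_prob_algebra)
      show "?g \<in> space (prob_algebra ?B)" using pg gB by (simp add: space_prob_algebra)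
      show "renyi_dom a ((a - 1) * (\<Sum>p\<in>?I. (\<Delta> p)\<^sup>2) / (2 * v)) (distr ?g ?B ?s) ?g"
        by (rule renyi_dom_gaussian_shift[OF a v finite_upper_idx])
      show "renyi_dom a 0 (?K g) (?K g)" if "g \<in> space ?B" for g
        using measurable_space[OF K that] by (intro renyi_dom_refl a) (simp add: space_prob_algebra)
    qed
    moreover have "(a - 1) * (\<Sum>p\<in>?I. (\<Delta> p)\<^sup>2) / (2 * v) + 0 \<le> (a - 1) * \<rho>"
    proof -
      have "(\<Sum>p\<in>?I. (\<Delta> p)\<^sup>2) \<le> 4 * (cS * r)\<^sup>2 / (real n)\<^sup>2"
        unfolding \<Delta>_def E_def E'_def by (rule trunc_cov_sensitivity[OF j eq]) (use X j in auto)
      also have "\<dots> = v * \<rho>" unfolding vr using rho n by (simp add: power_mult_distrib)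
      finally have "(\<Sum>p\<in>?I. (\<Delta> p)\<^sup>2) / (2 * v) \<le> \<rho> / 2" using v by (simp add: field_simps)
      hence "(\<Sum>p\<in>?I. (\<Delta> p)\<^sup>2) / (2 * v) \<le> \<rho>" using rho by linarith
      from mult_left_mono[OF this, of "a - 1"] show ?thesis using a by simp
    qed
    ultimately show ?thesis unfolding XK X'K by (rule renyi_dom_mono)
  qed
qed

text \<open>The preconditioner is a function of the released \<open>Z\<close>. Conditionally on
  \<open>Z\<close> the two transformed datasets again differ in at most one entry, so the rounds
  compose adaptively and their budgets add.\<close>

lemma ppc_rounds_renyi:
  assumes a: "1 < a" and rho: "0 < \<rho>" and c: "0 < cS"
    and X: "\<And>i. i < n \<Longrightarrow> X i \<in> carrier_vec d" "\<And>i. i < n \<Longrightarrow> X' i \<in> carrier_vec d"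
    and j: "j0 < n" and eq: "\<And>i. i < n \<Longrightarrow> i \<noteq> j0 \<Longrightarrow> X i = X' i"
  shows "renyi_dom a ((a - 1) * (real t * \<rho>)) (ppc_rounds cS (2 * cS) K d n \<rho> \<beta> t \<kappa> X)
    (ppc_rounds cS (2 * cS) K d n \<rho> \<beta> t \<kappa> X')"
  using X eq
proof (induction t arbitrary: \<kappa> X X')
  case 0
  show ?case using renyi_dom_refl[OF a, of "return (mat_borel d) (1\<^sub>m d)"] by (simp add: prob_space_return)
next
  case (Suc t)
  let ?A = "\<lambda>Z. precond_step d K \<kappa> Z"
  let ?K = "\<lambda>X Z. ppc_rounds cS (2 * cS) K d n \<rho> \<beta> t (0.7 * \<kappa>) (\<lambda>i. ?A Z *\<^sub>v X i) \<bind>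
      (\<lambda>B. return (mat_borel d) (B * ?A Z))"
  have R: "ppc_rounds cS (2 * cS) K d n \<rho> \<beta> (Suc t) \<kappa> Y = naive_pce cS (2 * cS) d n \<rho> \<beta> \<kappa> Y \<bind> ?K Y" for Y
    by (simp add: Let_def)
  have K: "?K Y \<in> psd_borel d \<rightarrow>\<^sub>M prob_algebra (mat_borel d)" if "\<And>i. i < n \<Longrightarrow> Y i \<in> carrier_vec d" for Y
  proof -
    have Y: "restrict Y {..<n} \<in> space (data_space d n)" using that by (auto simp: space_data_space)
    have "?K (restrict Y {..<n}) \<in> psd_borel d \<rightarrow>\<^sub>M prob_algebra (mat_borel d)"
      using measurable_compose[OF measurable_Pair1'[OF Y] measurable_ppc_step[OF measurable_ppc_rounds]] by simp
    moreover have "?K (restrict Y {..<n}) = ?K Y"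
      by (intro ext arg_cong2[where f=bind] ppc_rounds_cong refl) simp
    ultimately show ?thesis by simp
  qed
  have "renyi_dom a ((a - 1) * \<rho> + (a - 1) * (real t * \<rho>)) (naive_pce cS (2 * cS) d n \<rho> \<beta> \<kappa> X \<bind> ?K X)
      (naive_pce cS (2 * cS) d n \<rho> \<beta> \<kappa> X' \<bind> ?K X')"
  proof (rule renyi_dom_bind[OF a])
    show "renyi_dom a ((a - 1) * \<rho>) (naive_pce cS (2 * cS) d n \<rho> \<beta> \<kappa> X) (naive_pce cS (2 * cS) d n \<rho> \<beta> \<kappa> X')"
      using Suc.prems by (intro naive_pce_renyi[OF a rho c _ _ j]) auto
    fix Z assume "Z \<in> space (psd_borel d)"
    hence A: "?A Z \<in> carrier_mat d d" by (simp add: precond_step_symmetric)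
    have AX: "?A Z *\<^sub>v Y i \<in> carrier_vec d" if "Y i \<in> carrier_vec d" for Y :: "nat \<Rightarrow> real Matrix.vec" and i using A that by simp
    have L: "(\<lambda>B. return (mat_borel d) (B * ?A Z)) \<in> mat_borel d \<rightarrow>\<^sub>M prob_algebra (mat_borel d)"
      using A by (intro measurable_compose[OF _ measurable_return_prob_space] measurable_mat_mult measurable_const) auto
    have "renyi_dom a ((a - 1) * (real t * \<rho>) + 0) (?K X Z) (?K X' Z)"
    proof (rule renyi_dom_bind[OF a _ _ L L])
      show "renyi_dom a ((a - 1) * (real t * \<rho>)) (ppc_rounds cS (2 * cS) K d n \<rho> \<beta> t (0.7 * \<kappa>) (\<lambda>i. ?A Z *\<^sub>v X i))
          (ppc_rounds cS (2 * cS) K d n \<rho> \<beta> t (0.7 * \<kappa>) (\<lambda>i. ?A Z *\<^sub>v X' i))"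
        using Suc.prems AX by (intro Suc.IH) auto
      show "renyi_dom a 0 (return (mat_borel d) (B * ?A Z)) (return (mat_borel d) (B * ?A Z))"
        if "B \<in> space (mat_borel d)" for B
        using measurable_space[OF L that] by (intro renyi_dom_refl a) (simp add: space_prob_algebra)
    qed (use Suc.prems AX in \<open>auto intro!: ppc_rounds_prob_algebra\<close>)
    thus "renyi_dom a ((a - 1) * (real t * \<rho>)) (?K X Z) (?K X' Z)" by simp
  qed (use Suc.prems K in \<open>auto intro!: naive_pce_prob_algebra\<close>)
  thus ?case unfolding R by (simp add: algebra_simps)
qed

theorem pgce_zCDP:
  assumes rho: "0 < \<rho>" and c: "0 < cS"
  shows "zCDP \<rho> n (carrier_vec d) (mat_borel d) (pgce cS (2 * cS) cT K d n \<rho> \<beta> \<kappa>)"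
  unfolding zCDP_def
proof (intro conjI ballI impI allI)
  fix X :: "nat \<Rightarrow> real Matrix.vec" assume "X \<in> {..<n} \<rightarrow>\<^sub>E carrier_vec d"
  thus "pgce cS (2 * cS) cT K d n \<rho> \<beta> \<kappa> X \<in> space (prob_algebra (mat_borel d))"
    using measurable_space[OF measurable_pgce] by (simp add: space_data_space)
next
  fix X X' :: "nat \<Rightarrow> real Matrix.vec" and a :: real
  assume XE: "X \<in> {..<n} \<rightarrow>\<^sub>E carrier_vec d" "X' \<in> {..<n} \<rightarrow>\<^sub>E carrier_vec d"
    and "\<exists>j<n. \<forall>i<n. i \<noteq> j \<longrightarrow> X i = X' i" and a: "1 < a"
  then obtain j0 where j: "j0 < n" and eq: "\<And>i. i < n \<Longrightarrow> i \<noteq> j0 \<Longrightarrow> X i = X' i" by auto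
  have X: "\<And>i. i < n \<Longrightarrow> X i \<in> carrier_vec d" "\<And>i. i < n \<Longrightarrow> X' i \<in> carrier_vec d" using XE by auto
  define T where "T = nat \<lceil>cT * ln \<kappa>\<rceil>"
  let ?P = "\<lambda>X. ppc_rounds cS (2 * cS) K d n (\<rho> / 2 / real T) (\<beta> / 2 / real T) T \<kappa> X"
  let ?K = "\<lambda>X A. naive_pce cS (2 * cS) d n (\<rho> / 2) (\<beta> / 2) 1000 (\<lambda>i. A *\<^sub>v X i) \<bind>
      (\<lambda>S. return (mat_borel d) (inv_mat d A * S * transpose_mat (inv_mat d A)))"
  have R: "pgce cS (2 * cS) cT K d n \<rho> \<beta> \<kappa> Y = ?P Y \<bind> ?K Y" for Y
    by (simp add: pgce_def ppc_def Let_def T_def)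
  have K: "?K Y \<in> mat_borel d \<rightarrow>\<^sub>M prob_algebra (mat_borel d)" if "\<And>i. i < n \<Longrightarrow> Y i \<in> carrier_vec d" for Y
    using that by (intro measurable_pgce_tail measurable_const) auto
  have "renyi_dom a ((a - 1) * (\<rho> / 2) + (a - 1) * (\<rho> / 2)) (?P X \<bind> ?K X) (?P X' \<bind> ?K X')"
  proof (rule renyi_dom_bind[OF a])
    show "renyi_dom a ((a - 1) * (\<rho> / 2)) (?P X) (?P X')"
    \<comment> \<open>With no rounds the budget per round is a division by zero, and the
      cancellation of \<open>real T\<close> fails; the output is then the constant identity
      matrix.\<close>
    proof (cases "T = 0")
      case True
      show ?thesis
        using renyi_dom_mono[OF renyi_dom_refl[OF a, of "return (mat_borel d) (1\<^sub>m d)"], of "(a - 1) * (\<rho> / 2)"] a rho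
        by (simp add: prob_space_return True)
    next
      case False
      have "renyi_dom a ((a - 1) * (real T * (\<rho> / 2 / real T))) (?P X) (?P X')"
        using False rho by (intro ppc_rounds_renyi[OF a _ c X j eq]) auto
      thus ?thesis using False by simp
    qed
    fix A assume A: "A \<in> space (mat_borel d)"
    have AX: "A *\<^sub>v Y i \<in> carrier_vec d" if "Y i \<in> carrier_vec d" for Y :: "nat \<Rightarrow> real Matrix.vec" and i using A that by simp
    have L: "(\<lambda>S. return (mat_borel d) (inv_mat d A * S * transpose_mat (inv_mat d A))) \<in> psd_borel d \<rightarrow>\<^sub>M prob_algebra (mat_borel d)"
      using A by (intro measurable_compose[OF _ measurable_return_prob_space] measurable_mat_mult measurable_const)
        (auto simp: psd_borel_def intro!: measurable_restrict_space1)
    have "renyi_dom a ((a - 1) * (\<rho> / 2) + 0) (?K X A) (?K X' A)"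
    proof (rule renyi_dom_bind[OF a _ _ L L])
      show "renyi_dom a ((a - 1) * (\<rho> / 2)) (naive_pce cS (2 * cS) d n (\<rho> / 2) (\<beta> / 2) 1000 (\<lambda>i. A *\<^sub>v X i))
          (naive_pce cS (2 * cS) d n (\<rho> / 2) (\<beta> / 2) 1000 (\<lambda>i. A *\<^sub>v X' i))"
        using X AX eq rho by (intro naive_pce_renyi[OF a _ c _ _ j]) auto
      show "renyi_dom a 0 (return (mat_borel d) (inv_mat d A * S * transpose_mat (inv_mat d A)))
          (return (mat_borel d) (inv_mat d A * S * transpose_mat (inv_mat d A)))" if "S \<in> space (psd_borel d)" for S
        using measurable_space[OF L that] by (intro renyi_dom_refl a) (simp add: space_prob_algebra)
    qed (use X AX in \<open>auto intro!: naive_pce_prob_algebra\<close>)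
    thus "renyi_dom a ((a - 1) * (\<rho> / 2)) (?K X A) (?K X' A)" by simp
  qed (use X K in \<open>auto intro!: ppc_rounds_prob_algebra\<close>)
  moreover have "(a - 1) * (\<rho> / 2) + (a - 1) * (\<rho> / 2) = (a - 1) * \<rho>" by simp
  ultimately have dom: "renyi_dom a ((a - 1) * \<rho>) (pgce cS (2 * cS) cT K d n \<rho> \<beta> \<kappa> X) (pgce cS (2 * cS) cT K d n \<rho> \<beta> \<kappa> X')"
    unfolding R by (simp only:)
  have "pgce cS (2 * cS) cT K d n \<rho> \<beta> \<kappa> Y \<in> space (prob_algebra (mat_borel d))"
    if "Y \<in> {..<n} \<rightarrow>\<^sub>E carrier_vec d" for Y
    using measurable_space[OF measurable_pgce] that by (simp add: space_data_space)
  from this[OF XE(1)] this[OF XE(2)] dom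
  show "renyi_divergence a (pgce cS (2 * cS) cT K d n \<rho> \<beta> \<kappa> X) (pgce cS (2 * cS) cT K d n \<rho> \<beta> \<kappa> X') \<le> ereal (\<rho> * a)"
    using rho by (intro renyi_divergence_le a) (auto simp: space_prob_algebra)
qed

section \<open>Gaussian vectors\<close>

lemma triangular_solve:
  fixes L :: "nat \<Rightarrow> nat \<Rightarrow> real"
  assumes "\<And>i k. i < k \<Longrightarrow> L i k = 0" "\<And>i. i < d \<Longrightarrow> L i i \<noteq> 0"
  shows "\<exists>y. \<forall>i<d. (\<Sum>k<d. L i k * y k) = s i"
  using assms(2)
proof (induction d)
  case (Suc d)
  then obtain y where y: "\<And>i. i < d \<Longrightarrow> (\<Sum>k<d. L i k * y k) = s i" by auto
  define z where "z = y(d := (s d - (\<Sum>k<d. L d k * y k)) / L d d)"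
  have e: "(\<Sum>k<d. L i k * z k) = (\<Sum>k<d. L i k * y k)" for i by (intro sum.cong) (auto simp: z_def)
  have "(\<Sum>k<Suc d. L i k * z k) = s i" if "i < Suc d" for i
  proof (cases "i = d")
    case True
    have "L d d \<noteq> 0" using Suc.prems by simp
    thus ?thesis unfolding sum.lessThan_Suc e True by (simp add: z_def)
  next
    case False
    hence "i < d" using that by simp
    thus ?thesis unfolding sum.lessThan_Suc e using y assms(1)[of i d] by simp
  qed
  thus ?case by blast
qed simp

lemma triangular_solve_transpose:
  fixes L :: "nat \<Rightarrow> nat \<Rightarrow> real"
  assumes "\<And>i k. i < k \<Longrightarrow> L i k = 0" "\<And>i. i < d \<Longrightarrow> L i i \<noteq> 0"
  shows "\<exists>y. \<forall>k<d. (\<Sum>i<d. L i k * y i) = s k"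
  using assms(2)
proof (induction d arbitrary: s)
  case (Suc d)
  define t where "t = s d / L d d"
  from Suc.IH[of "\<lambda>k. s k - L d k * t"] Suc.prems
  obtain y where y: "\<And>k. k < d \<Longrightarrow> (\<Sum>i<d. L i k * y i) = s k - L d k * t" by auto
  define z where "z = y(d := t)"
  have e: "(\<Sum>i<d. L i k * z i) = (\<Sum>i<d. L i k * y i)" for k by (intro sum.cong) (auto simp: z_def)
  have "(\<Sum>i<Suc d. L i k * z i) = s k" if "k < Suc d" for k
  proof (cases "k = d")
    case True
    have "(\<Sum>i<d. L i d * y i) = 0" by (intro sum.neutral) (simp add: assms(1))
    moreover have "L d d \<noteq> 0" using Suc.prems by simp
    ultimately show ?thesis unfolding sum.lessThan_Suc e True by (simp add: z_def t_def)
  next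
    case False
    hence "k < d" using that by simp
    thus ?thesis unfolding sum.lessThan_Suc e using y by (simp add: z_def)
  qed
  thus ?case by blast
qed simp

text \<open>Border the factor of the leading block: the new row \<open>l\<close> solves a triangular
  system, and the new diagonal entry is the root of the Schur complement \<open>S d d\<close> minus
  the squared length of \<open>l\<close>.\<close>

lemma Cholesky:
  fixes S :: "nat \<Rightarrow> nat \<Rightarrow> real"
  assumes sym: "\<And>i j. i < d \<Longrightarrow> j < d \<Longrightarrow> S i j = S j i"
    and pos: "\<And>x. \<exists>i<d. x i \<noteq> 0 \<Longrightarrow> 0 < (\<Sum>i<d. \<Sum>j<d. x i * S i j * x j)"
  shows "\<exists>L. (\<forall>i k. i < k \<longrightarrow> L i k = 0) \<and> (\<forall>i<d. 0 < L i i) \<and>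
    (\<forall>i<d. \<forall>j<d. S i j = (\<Sum>k<d. L i k * L j k))"
  using sym pos
proof (induction d)
  case 0
  thus ?case by (intro exI[of _ "\<lambda>_ _. 0"]) auto
next
  case (Suc d)
  have "\<exists>L. (\<forall>i k. i < k \<longrightarrow> L i k = 0) \<and> (\<forall>i<d. 0 < L i i) \<and>
    (\<forall>i<d. \<forall>j<d. S i j = (\<Sum>k<d. L i k * L j k))"
  proof (rule Suc.IH)
    fix x :: "nat \<Rightarrow> real" assume "\<exists>i<d. x i \<noteq> 0"
    then obtain i where "i < d" "x i \<noteq> 0" by auto
    hence "\<exists>i<Suc d. (x(d := 0)) i \<noteq> 0" by (intro exI[of _ i]) auto
    from Suc.prems(2)[OF this] show "0 < (\<Sum>i<d. \<Sum>j<d. x i * S i j * x j)"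
      by (simp add: sum.distrib)
  qed (use Suc.prems in auto)
  then obtain L where L0: "\<And>i k. i < k \<Longrightarrow> L i k = 0" and Ld: "\<And>i. i < d \<Longrightarrow> 0 < L i i"
    and LL: "\<And>i j. i < d \<Longrightarrow> j < d \<Longrightarrow> S i j = (\<Sum>k<d. L i k * L j k)" by metis
  have Ld0: "\<And>i. i < d \<Longrightarrow> L i i \<noteq> 0" using Ld by force
  obtain l where l: "\<And>i. i < d \<Longrightarrow> (\<Sum>k<d. L i k * l k) = S i d"
    using triangular_solve[of L d "\<lambda>i. S i d", OF L0 Ld0] by blast
  obtain y where y: "\<And>k. k < d \<Longrightarrow> (\<Sum>i<d. L i k * y i) = - l k"
    using triangular_solve_transpose[of L d "\<lambda>k. - l k", OF L0 Ld0] by blast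
  have yS: "(\<Sum>i<d. y i * S i d) = - (\<Sum>k<d. l k * l k)"
  proof -
    have "(\<Sum>i<d. y i * S i d) = (\<Sum>i<d. \<Sum>k<d. L i k * y i * l k)"
      by (intro sum.cong refl) (simp add: l[symmetric] sum_distrib_left mult_ac)
    also have "\<dots> = (\<Sum>k<d. \<Sum>i<d. L i k * y i * l k)" by (rule sum.swap)
    also have "\<dots> = (\<Sum>k<d. - l k * l k)" by (intro sum.cong refl) (simp add: sum_distrib_right[symmetric] y)
    finally show ?thesis by (simp add: sum_negf)
  qed
  have ySy: "(\<Sum>i<d. \<Sum>j<d. y i * S i j * y j) = (\<Sum>k<d. l k * l k)"
  proof -
    have "(\<Sum>i<d. \<Sum>j<d. y i * S i j * y j) = (\<Sum>i<d. \<Sum>j<d. \<Sum>k<d. (L i k * y i) * (L j k * y j))"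
      by (intro sum.cong refl) (simp add: LL sum_distrib_left sum_distrib_right mult_ac)
    also have "\<dots> = (\<Sum>i<d. \<Sum>k<d. \<Sum>j<d. (L i k * y i) * (L j k * y j))" by (intro sum.cong refl sum.swap)
    also have "\<dots> = (\<Sum>k<d. \<Sum>i<d. \<Sum>j<d. (L i k * y i) * (L j k * y j))" by (rule sum.swap)
    also have "\<dots> = (\<Sum>k<d. (- l k) * (- l k))"
      by (intro sum.cong refl) (simp add: sum_product[symmetric] y)
    finally show ?thesis by simp
  qed
  \<comment> \<open>Because \<open>y\<close> solves the transposed system with right-hand side
    \<open>- l\<close>, the quadratic form at this vector is exactly the Schur complement, which is
    therefore positive.\<close>
  define x where "x = y(d := 1)"
  have "0 < (\<Sum>i<Suc d. \<Sum>j<Suc d. x i * S i j * x j)"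
    by (rule Suc.prems(2)) (auto simp: x_def intro!: exI[of _ d])
  also have "\<dots> = (\<Sum>i<d. \<Sum>j<d. y i * S i j * y j) + (\<Sum>i<d. y i * S i d) + (\<Sum>j<d. S d j * y j) + S d d"
    by (simp add: x_def sum.distrib)
  also have "(\<Sum>j<d. S d j * y j) = (\<Sum>i<d. y i * S i d)"
    using Suc.prems(1) by (intro sum.cong) auto
  finally have rest: "0 < S d d - (\<Sum>k<d. l k * l k)" by (simp add: yS ySy)
  define m where "m = sqrt (S d d - (\<Sum>k<d. l k * l k))"
  have m: "0 < m" "m * m = S d d - (\<Sum>k<d. l k * l k)" using rest by (auto simp: m_def)
  define L' where "L' = (\<lambda>i k. if i < d then L i k else if i = d \<and> k < d then l k else if i = d \<and> k = d then m else 0)"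
  have "S i j = (\<Sum>k<Suc d. L' i k * L' j k)" if ij: "i < Suc d" "j < Suc d" for i j
  proof -
    have a: "S i d = (\<Sum>k<d. L' i k * L' d k)" if "i < d" for i
      using that by (simp add: l[OF that, symmetric] L'_def)
    have b: "L' i d = 0" if "i < d" for i using that L0 by (simp add: L'_def)
    have "S d d = (\<Sum>k<d. L' d k * L' d k) + m * m" unfolding m(2) by (simp add: L'_def)
    moreover have "S d j = (\<Sum>k<d. L' d k * L' j k)" if "j < d" for j
      using a[OF that] Suc.prems(1)[of j d] that by (simp add: mult.commute)
    moreover have "S i j = (\<Sum>k<d. L' i k * L' j k)" if "i < d" "j < d" using LL[OF that] that by (simp add: L'_def)
    moreover have "L' d d = m" by (simp add: L'_def)
    ultimately show ?thesis using ij a b by (auto simp: less_Suc_eq)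
  qed
  moreover have "L' i k = 0" if "i < k" for i k using that L0 by (auto simp: L'_def)
  moreover have "0 < L' i i" if "i < Suc d" for i using that Ld m by (auto simp: L'_def less_Suc_eq)
  ultimately show ?case by blast
qed

section \<open>Linear images of the standard Gaussian law\<close>

text \<open>The reason for a triangular factor in place of the symmetric square root: the last
  variable enters only the last component, so the change of variables follows from Fubini and one
  affine substitution per coordinate. The determinant appears as the product of the slopes.\<close>

lemma nn_integral_triangular:
  fixes L :: "nat \<Rightarrow> nat \<Rightarrow> real" and F :: "(nat \<Rightarrow> real) \<Rightarrow> ennreal"
  assumes L0: "\<And>i k. i < k \<Longrightarrow> L i k = 0" and Ld: "\<And>i. i < d \<Longrightarrow> 0 < L i i"
    and F: "F \<in> borel_measurable (\<Pi>\<^sub>M i\<in>{..<d}. lborel)"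
  shows "(\<integral>\<^sup>+x. F x \<partial>(\<Pi>\<^sub>M i\<in>{..<d}. lborel)) =
    ennreal (\<Prod>i<d. L i i) * (\<integral>\<^sup>+g. F (\<lambda>i\<in>{..<d}. \<Sum>k<d. L i k * g k) \<partial>(\<Pi>\<^sub>M i\<in>{..<d}. lborel))"
  using Ld F
proof (induction d arbitrary: F)
  case 0
  have "(\<lambda>x. undefined) = restrict (\<lambda>x. 0 :: real) {}" by auto
  thus ?case by (simp add: PiM_empty nn_integral_count_space_finite)
next
  case (Suc d)
  interpret product_sigma_finite "\<lambda>_. lborel :: real measure" by standard
  let ?M = "\<lambda>d. \<Pi>\<^sub>M i\<in>{..<d}. lborel :: real measure"
  let ?L = "\<lambda>d g. \<lambda>i\<in>{..<d}. \<Sum>k<d. L i k * g k"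
  have ins: "{..<Suc d} = insert d {..<d}" by auto
  have F: "F \<in> borel_measurable (PiM (insert d {..<d}) (\<lambda>_. lborel))" using Suc.prems(2) by (simp add: ins)
  have split: "(\<integral>\<^sup>+x. H x \<partial>?M (Suc d)) = (\<integral>\<^sup>+x. \<integral>\<^sup>+y. H (x(d := y)) \<partial>lborel \<partial>?M d)"
    if "H \<in> borel_measurable (PiM (insert d {..<d}) (\<lambda>_. lborel))" for H :: "(nat \<Rightarrow> real) \<Rightarrow> ennreal"
    unfolding ins using that by (intro product_nn_integral_insert) auto
  have LM: "?L (Suc d) \<in> ?M (Suc d) \<rightarrow>\<^sub>M ?M (Suc d)"
  proof (rule measurable_restrict)
    fix i assume "i \<in> {..<Suc d}"
    have "(\<lambda>g. g k) \<in> borel_measurable (?M (Suc d))" if "k < Suc d" for k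
      using measurable_component_singleton[of k "{..<Suc d}" "\<lambda>_. lborel"] that by simp
    thus "(\<lambda>g. \<Sum>k<Suc d. L i k * g k) \<in> ?M (Suc d) \<rightarrow>\<^sub>M lborel"
      by (simp del: sum.lessThan_Suc)
  qed
  have FL: "(\<lambda>g. F (?L (Suc d) g)) \<in> borel_measurable (PiM (insert d {..<d}) (\<lambda>_. lborel))"
    unfolding ins[symmetric] by (rule measurable_compose[OF LM Suc.prems(2)])
  have upd: "(\<lambda>(x, y). x(d := y)) \<in> ?M d \<Otimes>\<^sub>M lborel \<rightarrow>\<^sub>M PiM (insert d {..<d}) (\<lambda>_. lborel)"
    by (rule measurable_add_dim)
  have m1: "(\<lambda>x. \<integral>\<^sup>+y. F (x(d := y)) \<partial>lborel) \<in> borel_measurable (?M d)"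
    using measurable_compose[OF upd F] by (intro lborel.borel_measurable_nn_integral) (simp add: case_prod_beta')
  have "(\<integral>\<^sup>+x. F x \<partial>?M (Suc d)) = (\<integral>\<^sup>+x. \<integral>\<^sup>+y. F (x(d := y)) \<partial>lborel \<partial>?M d)"
    by (rule split[OF F])
  also have "\<dots> = ennreal (\<Prod>i<d. L i i) * (\<integral>\<^sup>+g. \<integral>\<^sup>+y. F ((?L d g)(d := y)) \<partial>lborel \<partial>?M d)"
    using Suc.prems(1) by (intro Suc.IH m1) auto
  also have "(\<integral>\<^sup>+g. \<integral>\<^sup>+y. F ((?L d g)(d := y)) \<partial>lborel \<partial>?M d) =
      (\<integral>\<^sup>+g. ennreal (L d d) * (\<integral>\<^sup>+z. F (?L (Suc d) (g(d := z))) \<partial>lborel) \<partial>?M d)"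
  proof (rule nn_integral_cong)
    fix g assume g: "g \<in> space (?M d)"
    have Lg: "?L d g \<in> space (?M d)" by (auto simp: space_PiM)
    have Fy: "(\<lambda>y. F ((?L d g)(d := y))) \<in> borel_measurable borel"
      using measurable_compose[OF measurable_compose[OF measurable_Pair1'[OF Lg] upd] F] by simp
    have Ldd: "0 < L d d" using Suc.prems(1) by simp
    have "(?L d g)(d := (\<Sum>k<d. L d k * g k) + L d d * z) = ?L (Suc d) (g(d := z))" for z
    proof (rule ext)
      fix i
      have "(\<Sum>k<d. L i k * (g(d := z)) k) = (\<Sum>k<d. L i k * g k)" for i by (intro sum.cong) auto
      thus "((?L d g)(d := (\<Sum>k<d. L d k * g k) + L d d * z)) i = ?L (Suc d) (g(d := z)) i"
        using L0[of i d] by (auto simp: less_Suc_eq)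
    qed
    thus "(\<integral>\<^sup>+y. F ((?L d g)(d := y)) \<partial>lborel) = ennreal (L d d) * (\<integral>\<^sup>+z. F (?L (Suc d) (g(d := z))) \<partial>lborel)"
      using nn_integral_real_affine[OF Fy, of "L d d" "\<Sum>k<d. L d k * g k"] Ldd by simp
  qed
  also have "\<dots> = ennreal (L d d) * (\<integral>\<^sup>+g. \<integral>\<^sup>+z. F (?L (Suc d) (g(d := z))) \<partial>lborel \<partial>?M d)"
    using measurable_compose[OF upd FL]
    by (intro nn_integral_cmult lborel.borel_measurable_nn_integral) (simp add: case_prod_beta')
  also have "(\<integral>\<^sup>+g. \<integral>\<^sup>+z. F (?L (Suc d) (g(d := z))) \<partial>lborel \<partial>?M d) = (\<integral>\<^sup>+g. F (?L (Suc d) g) \<partial>?M (Suc d))"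
    by (rule split[OF FL, symmetric])
  also have "ennreal (\<Prod>i<d. L i i) * (ennreal (L d d) * (\<integral>\<^sup>+g. F (?L (Suc d) g) \<partial>?M (Suc d))) =
      ennreal (\<Prod>i<Suc d. L i i) * (\<integral>\<^sup>+g. F (?L (Suc d) g) \<partial>?M (Suc d))"
  proof -
    have "0 \<le> (\<Prod>i<d. L i i)" using Suc.prems(1) by (intro prod_nonneg) (auto intro: less_imp_le)
    moreover have "0 \<le> L d d" using Suc.prems(1)[of d] by simp
    ultimately show ?thesis by (simp add: ennreal_mult mult.assoc)
  qed
  finally show ?case .
qed

abbreviation std_gaussian :: "nat \<Rightarrow> (nat \<Rightarrow> real) measure" where
  "std_gaussian d \<equiv> \<Pi>\<^sub>M i\<in>{..<d}. normal_law 0 1"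

lemma prob_space_std_gaussian: "prob_space (std_gaussian d)"
  by (intro prob_space_PiM prob_space_normal_law) simp

lemma std_gaussian_density:
  "std_gaussian d = density (\<Pi>\<^sub>M i\<in>{..<d}. lborel) (\<lambda>x. \<Prod>i<d. ennreal (normal_density 0 1 (x i)))"
proof -
  have nl: "normal_law 0 1 = density lborel (\<lambda>x. ennreal (normal_density 0 1 x))" by (simp add: normal_law_def)
  interpret P: product_prob_space "\<lambda>_::nat. normal_law 0 1" by (intro product_prob_spaceI prob_space_normal_law) simp
  have L: "product_sigma_finite (\<lambda>_::nat. lborel :: real measure)" by standard
  show ?thesis
    using density_PiM[of "{..<d}" "\<lambda>_. lborel" "\<lambda>_ x. ennreal (normal_density 0 1 x)"] L P.product_sigma_finite_axioms
    by (simp add: nl)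
qed

lemma measurable_component_real:
  assumes "k \<in> I" "\<And>i. sets (M i) = sets borel"
  shows "(\<lambda>g. g k) \<in> borel_measurable (PiM I M)"
  using measurable_component_singleton[OF assms(1), of M] measurable_cong_sets[OF refl assms(2)] by blast

text \<open>With \<open>S = Lm * transpose_mat Lm\<close> the exponent of the density at
  \<open>Lm *\<^sub>v x\<close> becomes half of \<open>x \<bullet> x\<close>, and the Jacobian of
  the substitution cancels the root of the determinant.\<close>

lemma gaussian_eq_distr:
  fixes L :: "nat \<Rightarrow> nat \<Rightarrow> real"
  assumes L0: "\<And>i k. i < k \<Longrightarrow> L i k = 0" and Ld: "\<And>i. i < d \<Longrightarrow> 0 < L i i"
    and S: "S = Matrix.mat d d (\<lambda>(i, j). L i j) * transpose_mat (Matrix.mat d d (\<lambda>(i, j). L i j))"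
  shows "gaussian d S = distr (std_gaussian d) (vec_borel d) (\<lambda>g. Matrix.mat d d (\<lambda>(i, j). L i j) *\<^sub>v Matrix.vec d g)"
proof -
  define Lm where "Lm = Matrix.mat d d (\<lambda>(i, j). L i j)"
  define P where "P = (\<Prod>i<d. L i i)"
  have P: "0 < P" unfolding P_def using Ld by (intro prod_pos) auto
  have Lm: "Lm \<in> carrier_mat d d" by (simp add: Lm_def)
  have SL: "S = Lm * transpose_mat Lm" by (simp add: S Lm_def)
  have Sc: "S \<in> carrier_mat d d" using Lm by (simp add: SL)
  have dL: "Determinant.det Lm = P"
  proof -
    have "Determinant.det Lm = prod_list (diag_mat Lm)"
      by (rule det_lower_triangular[OF _ Lm]) (simp add: Lm_def L0)
    also have "diag_mat Lm = map (\<lambda>i. L i i) [0..<d]" using Lm by (auto simp: diag_mat_def Lm_def)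
    also have "prod_list (map (\<lambda>i. L i i) [0..<m]) = (\<Prod>i<m. L i i)" for m
      by (induction m) (simp_all add: mult.commute)
    hence "prod_list (map (\<lambda>i. L i i) [0..<d]) = P" by (simp add: P_def)
    finally show ?thesis .
  qed
  have dS: "Determinant.det S = P\<^sup>2"
    using det_mult[OF Lm, of "transpose_mat Lm"] det_transpose[OF Lm] Lm by (simp add: SL dL power2_eq_square)
  define B where "B = inv_mat d S"
  have B: "B \<in> carrier_mat d d" "S * B = 1\<^sub>m d" using det_nonzero_inverse[OF Sc] dS P by (auto simp: B_def)
  have LB: "transpose_mat Lm * B * Lm = 1\<^sub>m d"
  proof (rule mat_mult_left_right_inverse[OF Lm])
    show "transpose_mat Lm * B \<in> carrier_mat d d" using Lm B by simp
    show "Lm * (transpose_mat Lm * B) = 1\<^sub>m d"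
      using B Lm by (simp add: SL assoc_mult_mat[of _ d d _ d _ d])
  qed
  have quad: "(Lm *\<^sub>v x) \<bullet> (B *\<^sub>v (Lm *\<^sub>v x)) = x \<bullet> x" if x: "x \<in> carrier_vec d" for x
  proof -
    have "(Lm *\<^sub>v x) \<bullet> (B *\<^sub>v (Lm *\<^sub>v x)) = x \<bullet> (transpose_mat Lm *\<^sub>v (B *\<^sub>v (Lm *\<^sub>v x)))"
      using transpose_vec_mult_scalar[of "transpose_mat Lm" d d "B *\<^sub>v (Lm *\<^sub>v x)" x] Lm B x by simp
    also have "transpose_mat Lm *\<^sub>v (B *\<^sub>v (Lm *\<^sub>v x)) = (transpose_mat Lm * B * Lm) *\<^sub>v x"
      by (rule mat_assoc_vec3[symmetric]) (use Lm B x in auto)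
    finally show ?thesis using x by (simp add: LB)
  qed
  let ?lb = "\<Pi>\<^sub>M i\<in>{..<d}. lborel :: real measure"
  let ?D = "\<lambda>x. ennreal (exp (- (x \<bullet> (B *\<^sub>v x)) / 2) / sqrt ((2 * pi) ^ d * Determinant.det S))"
  let ?T = "\<lambda>g. \<lambda>i\<in>{..<d}. \<Sum>k<d. L i k * g k"
  have vm: "Matrix.vec d \<in> ?lb \<rightarrow>\<^sub>M vec_borel d"
    by (rule measurable_vec_borelI) (auto intro!: measurable_component_real)
  have idm: "(\<lambda>x. x) \<in> vec_borel d \<rightarrow>\<^sub>M vec_borel d" by simp
  have Bm: "(\<lambda>_. B) \<in> vec_borel d \<rightarrow>\<^sub>M mat_borel d" using B by (intro measurable_const) simp
  have Dm: "?D \<in> borel_measurable (vec_borel d)"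
    using measurable_scalar_prod[OF idm measurable_mat_mult_vec[OF Bm idm]] by measurable
  have vT: "Matrix.vec d (?T g) = Lm *\<^sub>v Matrix.vec d g" for g
    by (rule eq_vecI) (auto simp: Lm_def scalar_prod_def lessThan_atLeast0)
  have sT: "(\<lambda>g. Lm *\<^sub>v Matrix.vec d g) \<in> std_gaussian d \<rightarrow>\<^sub>M vec_borel d"
  proof (rule measurable_mat_mult_vec)
    show "(\<lambda>x. Lm) \<in> std_gaussian d \<rightarrow>\<^sub>M mat_borel d" using Lm by (intro measurable_const) simp
    show "Matrix.vec d \<in> std_gaussian d \<rightarrow>\<^sub>M vec_borel d"
      by (rule measurable_vec_borelI) (auto intro!: measurable_component_real)
  qed
  have G: "gaussian d S = density (distr ?lb (vec_borel d) (Matrix.vec d)) ?D"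
    by (simp add: gaussian_def B_def)
  show ?thesis
  proof (rule measure_eqI)
    fix A assume "A \<in> sets (gaussian d S)"
    hence A: "A \<in> sets (vec_borel d)" by (simp add: G)
    have Fm: "(\<lambda>f. ?D (Matrix.vec d f) * indicator A (Matrix.vec d f)) \<in> borel_measurable ?lb"
      using measurable_compose[OF vm, of "\<lambda>x. ?D x * indicator A x"] Dm A by simp
    have "emeasure (gaussian d S) A = (\<integral>\<^sup>+x. ?D x * indicator A x \<partial>distr ?lb (vec_borel d) (Matrix.vec d))"
      unfolding G using A Dm by (intro emeasure_density) auto
    also have "\<dots> = (\<integral>\<^sup>+f. ?D (Matrix.vec d f) * indicator A (Matrix.vec d f) \<partial>?lb)"
      using vm Dm A by (intro nn_integral_distr) auto
    also have "\<dots> = ennreal P * (\<integral>\<^sup>+g. ?D (Matrix.vec d (?T g)) * indicator A (Matrix.vec d (?T g)) \<partial>?lb)"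
      unfolding P_def by (rule nn_integral_triangular[OF L0 Ld Fm])
    also have "\<dots> = (\<integral>\<^sup>+g. ennreal P * (?D (Matrix.vec d (?T g)) * indicator A (Matrix.vec d (?T g))) \<partial>?lb)"
    proof (rule nn_integral_cmult[symmetric])
      have "?T \<in> ?lb \<rightarrow>\<^sub>M ?lb"
        by (intro measurable_restrict) (auto intro!: borel_measurable_sum borel_measurable_times measurable_component_real simp: measurable_lborel1)
      from measurable_compose[OF this Fm]
      show "(\<lambda>g. ?D (Matrix.vec d (?T g)) * indicator A (Matrix.vec d (?T g))) \<in> borel_measurable ?lb" .
    qed
    also have "\<dots> = (\<integral>\<^sup>+g. (\<Prod>i<d. ennreal (normal_density 0 1 (g i))) * indicator A (Lm *\<^sub>v Matrix.vec d g) \<partial>?lb)"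
    proof (rule nn_integral_cong)
      fix g :: "nat \<Rightarrow> real"
      have "(\<Prod>i<d. normal_density 0 1 (g i)) = (\<Prod>i<d. 1 / sqrt (2 * pi)) * (\<Prod>i<d. exp (- (g i)\<^sup>2 / 2))"
        unfolding prod.distrib[symmetric] by (intro prod.cong refl) (simp add: normal_density_def)
      also have "(\<Prod>i<d. exp (- (g i)\<^sup>2 / 2)) = exp (- (Matrix.vec d g \<bullet> Matrix.vec d g) / 2)"
        by (simp add: exp_sum[symmetric] scalar_prod_self_sum[where d=d] sum_negf sum_divide_distrib)
      also have "(\<Prod>i<d. 1 / sqrt (2 * pi)) = P / sqrt ((2 * pi) ^ d * Determinant.det S)"
        using P by (simp add: dS real_sqrt_mult real_sqrt_power power_divide power_mult_distrib)
      finally have "ennreal P * ?D (Matrix.vec d (?T g)) = (\<Prod>i<d. ennreal (normal_density 0 1 (g i)))"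
        using P by (simp add: vT quad prod_ennreal ennreal_mult'[symmetric])
      thus "ennreal P * (?D (Matrix.vec d (?T g)) * indicator A (Matrix.vec d (?T g))) =
          (\<Prod>i<d. ennreal (normal_density 0 1 (g i))) * indicator A (Lm *\<^sub>v Matrix.vec d g)"
        by (simp only: mult.assoc[symmetric] vT)
    qed
    also have "\<dots> = (\<integral>\<^sup>+g. indicator A (Lm *\<^sub>v Matrix.vec d g) \<partial>std_gaussian d)"
    proof -
      have "(\<lambda>g. indicator A (Lm *\<^sub>v Matrix.vec d g)) \<in> borel_measurable (std_gaussian d)"
        by (intro measurable_compose[OF sT] borel_measurable_indicator A)
      moreover have "(\<lambda>x. \<Prod>i<d. ennreal (normal_density 0 1 (x i))) \<in> borel_measurable ?lb"
        by (intro borel_measurable_prod_ennreal measurable_PiM_compose) auto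
      ultimately show ?thesis unfolding std_gaussian_density by (subst nn_integral_density) auto
    qed
    also have "\<dots> = emeasure (distr (std_gaussian d) (vec_borel d) (\<lambda>g. Lm *\<^sub>v Matrix.vec d g)) A"
      using nn_integral_distr[OF sT, of "indicator A"] A by simp
    finally show "emeasure (gaussian d S) A = emeasure (distr (std_gaussian d) (vec_borel d)
        (\<lambda>g. Matrix.mat d d (\<lambda>(i, j). L i j) *\<^sub>v Matrix.vec d g)) A" by (simp add: Lm_def)
  qed (simp add: G)
qed

section \<open>Exponential moments of Gaussian quadratic forms\<close>

text \<open>Completing the square leaves a normal density of mean \<open>t / r\<close> and variance
  \<open>1 / r\<close>, with \<open>r = 1 - 2 * q\<close>, whose total mass is 1.\<close>

lemma nn_integral_std_normal_quadratic:
  assumes q: "q < 1 / 2"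
  shows "(\<integral>\<^sup>+y. ennreal (exp (q * y\<^sup>2 + t * y)) \<partial>normal_law 0 1) =
    ennreal (1 / sqrt (1 - 2 * q) * exp (t\<^sup>2 / (2 * (1 - 2 * q))))"
proof -
  define r where "r = 1 - 2 * q"
  have r: "0 < r" using q by (simp add: r_def)
  have qr: "q = (1 - r) / 2" by (simp add: r_def)
  define s where "s = 1 / sqrt r"
  have s: "0 < s" "s\<^sup>2 = 1 / r" using r by (auto simp: s_def power_divide)
  interpret D: prob_space "density lborel (\<lambda>y. ennreal (normal_density (t / r) s y))"
    using s(1) by (rule prob_space_normal_density)
  have "(\<integral>\<^sup>+y. ennreal (exp (q * y\<^sup>2 + t * y)) \<partial>normal_law 0 1) =
      (\<integral>\<^sup>+y. ennreal (normal_density 0 1 y) * ennreal (exp (q * y\<^sup>2 + t * y)) \<partial>lborel)"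
    unfolding normal_law_def by (simp add: nn_integral_density)
  also have "\<dots> = (\<integral>\<^sup>+y. ennreal (s * exp (t\<^sup>2 / (2 * r))) * ennreal (normal_density (t / r) s y) \<partial>lborel)"
  proof (rule nn_integral_cong)
    fix y :: real
    have "- y\<^sup>2 / 2 + (q * y\<^sup>2 + t * y) = t\<^sup>2 / (2 * r) - (y - t / r)\<^sup>2 / (2 * s\<^sup>2)"
      using r unfolding s(2) qr by (simp add: field_simps power2_eq_square)
    hence "exp (- y\<^sup>2 / 2) * exp (q * y\<^sup>2 + t * y) = exp (t\<^sup>2 / (2 * r)) * exp (- (y - t / r)\<^sup>2 / (2 * s\<^sup>2))"
      by (simp add: exp_add[symmetric])
    hence "normal_density 0 1 y * exp (q * y\<^sup>2 + t * y) = s * exp (t\<^sup>2 / (2 * r)) * normal_density (t / r) s y"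
    proof -
      assume e: "exp (- y\<^sup>2 / 2) * exp (q * y\<^sup>2 + t * y) = exp (t\<^sup>2 / (2 * r)) * exp (- (y - t / r)\<^sup>2 / (2 * s\<^sup>2))"
      have "normal_density 0 1 y = exp (- y\<^sup>2 / 2) / sqrt (2 * pi)" by (simp add: normal_density_def)
      moreover have "s * normal_density (t / r) s y = exp (- (y - t / r)\<^sup>2 / (2 * s\<^sup>2)) / sqrt (2 * pi)"
        using s(1) unfolding normal_density_def real_sqrt_mult real_sqrt_abs by simp
      ultimately have "normal_density 0 1 y * exp (q * y\<^sup>2 + t * y) =
          exp (t\<^sup>2 / (2 * r)) * (s * normal_density (t / r) s y)" using e by simp
      thus ?thesis by (simp only: mult_ac)
    qed
    thus "ennreal (normal_density 0 1 y) * ennreal (exp (q * y\<^sup>2 + t * y)) =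
        ennreal (s * exp (t\<^sup>2 / (2 * r))) * ennreal (normal_density (t / r) s y)"
      using s by (simp add: ennreal_mult'[symmetric] del: ennreal_mult)
  qed
  also have "\<dots> = ennreal (s * exp (t\<^sup>2 / (2 * r))) * (\<integral>\<^sup>+y. ennreal (normal_density (t / r) s y) \<partial>lborel)"
    by (intro nn_integral_cmult) auto
  also have "(\<integral>\<^sup>+y. ennreal (normal_density (t / r) s y) \<partial>lborel) = 1"
    using D.emeasure_space_1 by (simp add: emeasure_density)
  finally show ?thesis by (simp add: s_def r_def)
qed

definition quad_form :: "nat \<Rightarrow> (nat \<Rightarrow> nat \<Rightarrow> real) \<Rightarrow> (nat \<Rightarrow> real) \<Rightarrow> real" where
  "quad_form d Q g = (\<Sum>i<d. \<Sum>j<d. Q i j * g i * g j)"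

lemma measurable_quad_form:
  assumes "{..<d} \<subseteq> I" "\<And>i. sets (M i) = sets borel"
  shows "quad_form d Q \<in> borel_measurable (PiM I M)"
  unfolding quad_form_def[abs_def]
  using assms by (intro borel_measurable_sum borel_measurable_times borel_measurable_const measurable_component_real) auto

lemma quad_form_Suc:
  assumes "\<And>i. i < d \<Longrightarrow> Q d i = Q i d"
  shows "quad_form (Suc d) Q (g(d := y)) = quad_form d Q g + (Q d d * y\<^sup>2 + 2 * (\<Sum>i<d. Q i d * g i) * y)"
proof -
  have "quad_form (Suc d) Q (g(d := y)) = quad_form d Q g + (\<Sum>i<d. Q i d * g i) * y + (\<Sum>j<d. Q d j * g j) * y + Q d d * y\<^sup>2"
    by (simp add: quad_form_def sum.distrib sum_distrib_left sum_distrib_right power2_eq_square mult_ac)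
  also have "(\<Sum>j<d. Q d j * g j) = (\<Sum>i<d. Q i d * g i)" using assms by (intro sum.cong) auto
  finally show ?thesis by (simp add: algebra_simps del: fun_upd_apply)
qed

lemma quad_form_rank_one: "quad_form d (\<lambda>i j. Q i j + c * b i * b j) g = quad_form d Q g + c * (\<Sum>i<d. b i * g i)\<^sup>2"
proof -
  have e: "c * (\<Sum>i<d. b i * g i)\<^sup>2 = (\<Sum>i<d. \<Sum>j<d. c * b i * b j * g i * g j)"
    by (simp add: power2_eq_square sum_product sum_distrib_left mult_ac)
  show ?thesis unfolding quad_form_def e sum.distrib[symmetric]
    by (intro sum.cong refl) (simp add: algebra_simps)
qed

text \<open>
  Integrating out the last coordinate replaces \<open>Q\<close> by a rank one perturbation of its leading block,
  whose Frobenius norm is not larger than that of \<open>Q\<close> as long as the latter is small.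
\<close>
lemma quad_form_mgf:
  assumes "\<And>i j. i < d \<Longrightarrow> j < d \<Longrightarrow> Q i j = Q j i" and "(\<Sum>i<d. \<Sum>j<d. (Q i j)\<^sup>2) \<le> (1 / 16)\<^sup>2"
  shows "(\<integral>\<^sup>+g. ennreal (exp (quad_form d Q g)) \<partial>std_gaussian d) \<le>
    ennreal (exp ((\<Sum>i<d. Q i i) + 4 * (\<Sum>i<d. \<Sum>j<d. (Q i j)\<^sup>2)))"
  using assms
proof (induction d arbitrary: Q)
  case 0
  show ?case using prob_space.emeasure_space_1[OF prob_space_std_gaussian[of 0]] by (simp add: quad_form_def)
next
  case (Suc d)
  interpret product_prob_space "\<lambda>_::nat. normal_law 0 1" by (intro product_prob_spaceI prob_space_normal_law) simp
  have ins: "{..<Suc d} = insert d {..<d}" by auto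
  define q where "q = Q d d"
  define b where "b = (\<lambda>i. Q i d)"
  define B where "B = (\<Sum>i<d. (b i)\<^sup>2)"
  define N where "N = (\<Sum>i<d. \<Sum>j<d. (Q i j)\<^sup>2)"
  have sym: "Q d i = Q i d" if "i < d" for i using Suc.prems(1)[of d i] that by simp
  have B0: "0 \<le> B" and N0: "0 \<le> N" by (auto simp: B_def N_def sum_nonneg)
  have tot: "(\<Sum>i<Suc d. \<Sum>j<Suc d. (Q i j)\<^sup>2) = N + 2 * B + q\<^sup>2"
    using sym by (simp add: N_def B_def b_def q_def sum.distrib)
  hence small: "N + 2 * B + q\<^sup>2 \<le> (1 / 16)\<^sup>2" using Suc.prems(2) by simp
  have "q\<^sup>2 \<le> (1 / 16)\<^sup>2" using small B0 N0 by linarith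
  hence q: "\<bar>q\<bar> \<le> 1 / 16" by (subst (asm) abs_le_square_iff[symmetric]) simp
  have "N + 2 * B + q\<^sup>2 \<le> 1 / 256" using small by (simp add: power_divide)
  hence "B \<le> 1 / 512" using B0 N0 zero_le_power2[of q] by linarith
  \<comment> \<open>The exponent left by the last coordinate is the square of
    \<open>2 * (\<Sum>i<d. b i * g i)\<close> over \<open>2 * (1 - 2 * q)\<close>, which is
    \<open>c\<close> times the squared sum. From \<open>\<bar>q\<bar> \<le> 1 / 16\<close> follows
    \<open>c \<le> 16 / 7 < 2.3\<close>.\<close>
  define c where "c = 2 / (1 - 2 * q)"
  have c: "0 < c" "c \<le> 2.3" using q by (auto simp: c_def divide_le_eq)
  define Q' where "Q' = (\<lambda>i j. Q i j + c * b i * b j)"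
  define N' where "N' = (\<Sum>i<d. \<Sum>j<d. (Q' i j)\<^sup>2)"
  define R where "R = (\<Sum>i<d. \<Sum>j<d. Q i j * (b i * b j))"
  have "R\<^sup>2 \<le> N * B\<^sup>2"
  proof -
    have "R = (\<Sum>p\<in>{..<d} \<times> {..<d}. Q (fst p) (snd p) * (b (fst p) * b (snd p)))"
      by (simp add: R_def sum.cartesian_product case_prod_beta)
    also have "\<dots>\<^sup>2 \<le> (\<Sum>p\<in>{..<d} \<times> {..<d}. (Q (fst p) (snd p))\<^sup>2) * (\<Sum>p\<in>{..<d} \<times> {..<d}. (b (fst p) * b (snd p))\<^sup>2)"
      by (rule Cauchy_Schwarz_ineq_sum)
    also have "(\<Sum>p\<in>{..<d} \<times> {..<d}. (Q (fst p) (snd p))\<^sup>2) = N"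
      by (simp add: N_def sum.cartesian_product case_prod_beta)
    also have "(\<Sum>p\<in>{..<d} \<times> {..<d}. (b (fst p) * b (snd p))\<^sup>2) = (\<Sum>i<d. \<Sum>j<d. (b i)\<^sup>2 * (b j)\<^sup>2)"
      by (simp add: sum.cartesian_product case_prod_beta power_mult_distrib)
    also have "\<dots> = B\<^sup>2" by (simp add: B_def power2_eq_square[of "sum _ _"] sum_product)
    finally show ?thesis .
  qed
  also have "\<dots> \<le> (1 / 16)\<^sup>2 * B\<^sup>2"
  proof (rule mult_right_mono)
    show "N \<le> (1 / 16)\<^sup>2" using small B0 zero_le_power2[of q] by linarith
  qed simp
  finally have "R\<^sup>2 \<le> (1 / 16 * B)\<^sup>2" by (simp only: power_mult_distrib)
  hence "\<bar>R\<bar> \<le> \<bar>1 / 16 * B\<bar>" by (subst abs_le_square_iff)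
  hence R: "R \<le> 1 / 16 * B" using B0 by linarith
  have "N' = (\<Sum>i<d. \<Sum>j<d. (Q i j)\<^sup>2 + 2 * c * (Q i j * (b i * b j)) + c\<^sup>2 * ((b i)\<^sup>2 * (b j)\<^sup>2))"
    unfolding N'_def Q'_def by (intro sum.cong refl) (simp add: power2_eq_square algebra_simps)
  also have "\<dots> = N + 2 * c * R + c\<^sup>2 * (B * B)"
    by (simp add: N_def R_def B_def sum.distrib sum_distrib_left[symmetric] sum_product)
  also have "\<dots> \<le> N + 2 * 2.3 * (1 / 16 * B) + 2.3\<^sup>2 * (1 / 512 * B)"
  proof (intro add_mono order_refl)
    have "2 * c * R \<le> 2 * c * (1 / 16 * B)" using R c by (intro mult_left_mono) auto
    also have "\<dots> \<le> 2 * 2.3 * (1 / 16 * B)" using c B0 by (intro mult_right_mono) auto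
    finally show "2 * c * R \<le> 2 * 2.3 * (1 / 16 * B)" .
    show "c\<^sup>2 * (B * B) \<le> 2.3\<^sup>2 * (1 / 512 * B)"
      using c B0 \<open>B \<le> 1 / 512\<close> by (intro mult_mono power_mono mult_right_mono) auto
  qed
  \<comment> \<open>4.6/16 + 5.29/512 is below 0.3. The smallness assumption passes to the leading
    block because the removed off-diagonal entries had weight \<open>2 * B\<close> in the Frobenius
    norm.\<close>
  also have "\<dots> \<le> N + 0.3 * B" using B0 by (simp add: power2_eq_square)
  finally have N': "N' \<le> N + 0.3 * B" .
  have IH: "(\<integral>\<^sup>+g. ennreal (exp (quad_form d Q' g)) \<partial>std_gaussian d) \<le> ennreal (exp ((\<Sum>i<d. Q' i i) + 4 * N'))"
    unfolding N'_def
  proof (rule Suc.IH)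
    show "(\<Sum>i<d. \<Sum>j<d. (Q' i j)\<^sup>2) \<le> (1 / 16)\<^sup>2"
      unfolding N'_def[symmetric] using N' small B0 zero_le_power2[of q] by linarith
    show "Q' i j = Q' j i" if "i < d" "j < d" for i j
      using Suc.prems(1)[of i j] that by (simp add: Q'_def)
  qed
  have tr: "(\<Sum>i<d. Q' i i) = (\<Sum>i<d. Q i i) + c * B"
    by (simp add: Q'_def B_def sum.distrib sum_distrib_left power2_eq_square mult_ac)
  have hm: "(\<lambda>g. ennreal (exp (quad_form (Suc d) Q g))) \<in> borel_measurable (PiM (insert d {..<d}) (\<lambda>_. normal_law 0 1))"
    using measurable_quad_form[of "Suc d" "insert d {..<d}" "\<lambda>_. normal_law 0 1" Q] by (simp add: lessThan_Suc)
  have "(\<integral>\<^sup>+g. ennreal (exp (quad_form (Suc d) Q g)) \<partial>std_gaussian (Suc d)) =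
      (\<integral>\<^sup>+g. \<integral>\<^sup>+y. ennreal (exp (quad_form (Suc d) Q (g(d := y)))) \<partial>normal_law 0 1 \<partial>std_gaussian d)"
    unfolding ins using hm by (intro product_nn_integral_insert) auto
  also have "\<dots> = (\<integral>\<^sup>+g. ennreal (1 / sqrt (1 - 2 * q)) * ennreal (exp (quad_form d Q' g)) \<partial>std_gaussian d)"
  proof (rule nn_integral_cong)
    fix g :: "nat \<Rightarrow> real"
    let ?t = "2 * (\<Sum>i<d. b i * g i)"
    have "(\<integral>\<^sup>+y. ennreal (exp (quad_form (Suc d) Q (g(d := y)))) \<partial>normal_law 0 1) =
        (\<integral>\<^sup>+y. ennreal (exp (quad_form d Q g)) * ennreal (exp (q * y\<^sup>2 + ?t * y)) \<partial>normal_law 0 1)"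
      by (intro nn_integral_cong) (simp add: quad_form_Suc[of d Q, OF sym] exp_add ennreal_mult' b_def q_def)
    also have "\<dots> = ennreal (exp (quad_form d Q g)) * (\<integral>\<^sup>+y. ennreal (exp (q * y\<^sup>2 + ?t * y)) \<partial>normal_law 0 1)"
      by (intro nn_integral_cmult) simp
    also have "(\<integral>\<^sup>+y. ennreal (exp (q * y\<^sup>2 + ?t * y)) \<partial>normal_law 0 1) =
        ennreal (1 / sqrt (1 - 2 * q) * exp (?t\<^sup>2 / (2 * (1 - 2 * q))))"
      using q by (intro nn_integral_std_normal_quadratic) auto
    also have "?t\<^sup>2 / (2 * (1 - 2 * q)) = c * (\<Sum>i<d. b i * g i)\<^sup>2"
      using q by (auto simp: c_def power_mult_distrib frac_eq_eq algebra_simps)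
    finally have "(\<integral>\<^sup>+y. ennreal (exp (quad_form (Suc d) Q (g(d := y)))) \<partial>normal_law 0 1) =
        ennreal (exp (quad_form d Q g)) * ennreal (1 / sqrt (1 - 2 * q) * exp (c * (\<Sum>i<d. b i * g i)\<^sup>2))" .
    also have "\<dots> = ennreal (1 / sqrt (1 - 2 * q)) * ennreal (exp (quad_form d Q' g))"
    proof -
      have "quad_form d Q' g = quad_form d Q g + c * (\<Sum>i<d. b i * g i)\<^sup>2"
        unfolding Q'_def by (rule quad_form_rank_one)
      thus ?thesis using q by (simp add: exp_add ennreal_mult'[symmetric] mult_ac)
    qed
    finally show "(\<integral>\<^sup>+y. ennreal (exp (quad_form (Suc d) Q (g(d := y)))) \<partial>normal_law 0 1) =
        ennreal (1 / sqrt (1 - 2 * q)) * ennreal (exp (quad_form d Q' g))" .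
  qed
  also have "\<dots> = ennreal (1 / sqrt (1 - 2 * q)) * (\<integral>\<^sup>+g. ennreal (exp (quad_form d Q' g)) \<partial>std_gaussian d)"
    using measurable_quad_form[of d "{..<d}" "\<lambda>_. normal_law 0 1" Q'] by (intro nn_integral_cmult) simp
  also have "\<dots> \<le> ennreal (1 / sqrt (1 - 2 * q)) * ennreal (exp ((\<Sum>i<d. Q' i i) + 4 * N'))"
    by (intro mult_left_mono IH) simp
  also have "\<dots> = ennreal (1 / sqrt (1 - 2 * q) * exp ((\<Sum>i<d. Q' i i) + 4 * N'))"
    using q by (intro ennreal_mult[symmetric]) auto
  also have "\<dots> \<le> ennreal (exp (q + 4 * q\<^sup>2) * exp ((\<Sum>i<d. Q' i i) + 4 * N'))"
  proof (intro ennreal_leI mult_right_mono)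
    have "\<bar>ln (1 + (- 2 * q)) - (- 2 * q)\<bar> \<le> 2 * (- 2 * q)\<^sup>2"
      using q by (intro abs_ln_one_plus_x_minus_x_bound) auto
    hence "- ln (1 - 2 * q) / 2 \<le> q + 4 * q\<^sup>2" by (simp add: power_mult_distrib)
    hence le: "exp (- ln (1 - 2 * q) / 2) \<le> exp (q + 4 * q\<^sup>2)" by simp
    have "exp (- ln (1 - 2 * q) / 2) = 1 / sqrt (1 - 2 * q)"
      using q by (simp add: ln_sqrt[symmetric] exp_minus inverse_eq_divide)
    from le[unfolded this] show "1 / sqrt (1 - 2 * q) \<le> exp (q + 4 * q\<^sup>2)" .
  qed simp
  also have "\<dots> \<le> ennreal (exp ((\<Sum>i<Suc d. Q i i) + 4 * (\<Sum>i<Suc d. \<Sum>j<Suc d. (Q i j)\<^sup>2)))"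
  proof -
    \<comment> \<open>The bound has \<open>8 * B\<close> to spend on the removed off-diagonal
      entries: the trace uses \<open>c * B \<le> 2.3 * B\<close>, the norm
      \<open>4 * 0.3 * B\<close>.\<close>
    have "c * B \<le> 2.3 * B" using c B0 by (intro mult_right_mono) auto
    hence "q + 4 * q\<^sup>2 + ((\<Sum>i<d. Q' i i) + 4 * N') \<le> (\<Sum>i<Suc d. Q i i) + 4 * (\<Sum>i<Suc d. \<Sum>j<Suc d. (Q i j)\<^sup>2)"
      unfolding tr tot using N' B0 by (simp add: q_def)
    thus ?thesis by (intro ennreal_leI) (simp add: exp_add[symmetric])
  qed
  finally show ?case .
qed

section \<open>A finite net\<close>

text \<open>Integer points that, divided by twice the root of the dimension, form a cubic net in the
  unit ball. The box only makes finiteness immediate: for a nonempty index set the bound on the sum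
  of squares already confines each coordinate to it.\<close>

definition grid :: "'a set \<Rightarrow> ('a \<Rightarrow> int) set" where
  "grid I = {k \<in> I \<rightarrow>\<^sub>E {- int (2 * card I)..int (2 * card I)}. (\<Sum>i\<in>I. (k i)\<^sup>2) \<le> 4 * int (card I)}"

definition grid_point :: "'a set \<Rightarrow> ('a \<Rightarrow> int) \<Rightarrow> 'a \<Rightarrow> real" where
  "grid_point I k i = real_of_int (k i) / (2 * sqrt (real (card I)))"

lemma finite_grid: "finite I \<Longrightarrow> finite (grid I)"
  unfolding grid_def by (rule finite_subset[OF _ finite_PiE[of I "\<lambda>_. {- int (2 * card I)..int (2 * card I)}"]]) auto

lemma sum_half_power_le: "(\<Sum>k\<in>{- int M..int M}. (1 / 2) ^ nat \<bar>k\<bar>) \<le> (3 :: real)"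
proof -
  have "(\<Sum>k\<in>{- int M..int M}. (1 / 2) ^ nat \<bar>k\<bar>) = (3 :: real) - 2 * (1 / 2) ^ M"
  proof (induction M)
    case (Suc M)
    have "{- int (Suc M)..int (Suc M)} = insert (- int (Suc M)) (insert (int (Suc M)) {- int M..int M})" by auto
    thus ?case using Suc by (simp add: nat_add_distrib)
  qed simp
  thus ?thesis by simp
qed

text \<open>Count with weights \<open>(1 / 2) ^ nat \<bar>k i\<bar>\<close>. For integers the
  absolute value is at most the square, so every grid point has weight at least 2 to the power
  \<open>- 4 * card I\<close>, while the weight of the whole box factorises and is at most 3 per
  coordinate. Finally 3 * 16 = 48 < 64, and 64 is at most \<open>exp 6\<close>.\<close>

lemma card_grid:
  assumes I: "finite I"
  shows "real (card (grid I)) \<le> exp (6 * real (card I))"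
proof -
  let ?m = "card I" and ?B = "{- int (2 * card I)..int (2 * card I)}"
  have "real (card (grid I)) * (1 / 2) ^ (4 * ?m) = (\<Sum>k\<in>grid I. (1 / 2) ^ (4 * ?m))" by simp
  also have "\<dots> \<le> (\<Sum>k\<in>grid I. \<Prod>i\<in>I. (1 / 2) ^ nat \<bar>k i\<bar>)"
  proof (rule sum_mono)
    fix k assume k: "k \<in> grid I"
    have "\<bar>z\<bar> \<le> z\<^sup>2" for z :: int
    proof (cases "z = 0")
      case False
      hence "\<bar>z\<bar> * 1 \<le> \<bar>z\<bar> * \<bar>z\<bar>" by (intro mult_left_mono) auto
      thus ?thesis by (simp add: power2_eq_square)
    qed simp
    hence "(\<Sum>i\<in>I. \<bar>k i\<bar>) \<le> (\<Sum>i\<in>I. (k i)\<^sup>2)" by (intro sum_mono)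
    also have "\<dots> \<le> 4 * int ?m" using k by (simp add: grid_def)
    finally have "int (\<Sum>i\<in>I. nat \<bar>k i\<bar>) \<le> int (4 * ?m)" by simp
    hence "(\<Sum>i\<in>I. nat \<bar>k i\<bar>) \<le> 4 * ?m" by (simp only: of_nat_le_iff)
    thus "(1 / 2) ^ (4 * ?m) \<le> (\<Prod>i\<in>I. (1 / 2 :: real) ^ nat \<bar>k i\<bar>)"
      unfolding power_sum[symmetric] by (intro power_decreasing) auto
  qed
  also have "\<dots> \<le> (\<Sum>k\<in>I \<rightarrow>\<^sub>E ?B. \<Prod>i\<in>I. (1 / 2) ^ nat \<bar>k i\<bar>)"
    by (rule sum_mono2) (auto simp: grid_def I finite_PiE intro!: prod_nonneg)
  also have "\<dots> = (\<Prod>i\<in>I. \<Sum>z\<in>?B. (1 / 2) ^ nat \<bar>z\<bar>)"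
    by (rule prod_sum_PiE[symmetric]) (auto simp: I)
  also have "\<dots> \<le> (\<Prod>i\<in>I. 3)" by (intro prod_mono conjI sum_nonneg sum_half_power_le) simp
  finally have "real (card (grid I)) * (1 / 2) ^ (4 * ?m) \<le> 3 ^ ?m" by simp
  hence "real (card (grid I)) \<le> 3 ^ ?m * 2 ^ (4 * ?m)" by (simp add: power_one_over divide_le_eq)
  also have "\<dots> = 48 ^ ?m" by (simp add: power_mult power_mult_distrib[symmetric])
  also have "\<dots> \<le> exp 6 ^ ?m"
  proof (rule power_mono)
    have "(2::real) ^ 6 \<le> exp 1 ^ 6" using exp_ge_add_one_self[of 1] by (intro power_mono) auto
    thus "(48::real) \<le> exp 6" by (simp add: exp_of_nat_mult[symmetric])
  qed simp
  also have "\<dots> = exp (6 * real ?m)" by (simp add: exp_of_nat_mult[symmetric] mult.commute)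
  finally show ?thesis .
qed

lemma grid_point_norm:
  assumes "finite I" "k \<in> grid I"
  shows "(\<Sum>i\<in>I. (grid_point I k i)\<^sup>2) \<le> 1"
proof (cases "card I = 0")
  case False
  have "(\<Sum>i\<in>I. (grid_point I k i)\<^sup>2) = (\<Sum>i\<in>I. real_of_int ((k i)\<^sup>2)) / (4 * real (card I))"
    by (simp add: grid_point_def power_divide power_mult_distrib sum_divide_distrib)
  also have "(\<Sum>i\<in>I. real_of_int ((k i)\<^sup>2)) = real_of_int (\<Sum>i\<in>I. (k i)\<^sup>2)" by simp
  also have "\<dots> \<le> real_of_int (4 * int (card I))" using assms by (subst of_int_le_iff) (simp add: grid_def)
  finally show ?thesis using False by (simp add: divide_right_mono)
qed (use assms in simp)

text \<open>Rounding the coordinates of the maximiser towards zero gives a point of the grid.\<close>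
lemma norm_le_grid:
  assumes I: "finite I" "I \<noteq> {}" and W: "\<And>k. k \<in> grid I \<Longrightarrow> (\<Sum>i\<in>I. grid_point I k i * W i) \<le> t"
  shows "sqrt (\<Sum>i\<in>I. (W i)\<^sup>2) \<le> 2 * t"
proof -
  define w where "w = sqrt (\<Sum>i\<in>I. (W i)\<^sup>2)"
  define s where "s = sqrt (real (card I))"
  have w0: "0 \<le> w" by (simp add: w_def sum_nonneg)
  have w2: "w\<^sup>2 = (\<Sum>i\<in>I. (W i)\<^sup>2)" by (simp add: w_def sum_nonneg)
  have m: "card I > 0" using I by (simp add: card_gt_0_iff)
  have s0: "0 < s" and s2: "s\<^sup>2 = real (card I)" using m by (auto simp: s_def)
  show ?thesis
  proof (cases "w = 0")
    case True
    have "(\<lambda>i\<in>I. 0) \<in> grid I" by (auto simp: grid_def)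
    from W[OF this] have "0 \<le> t" by (simp add: grid_point_def)
    thus ?thesis using True by (simp add: w_def)
  next
    case False
    hence w: "0 < w" using w0 by simp
    define y where "y = (\<lambda>i. 2 * s * W i / w)"
    define k where "k = (\<lambda>i\<in>I. if 0 \<le> y i then \<lfloor>y i\<rfloor> else \<lceil>y i\<rceil>)"
    have kr: "\<bar>real_of_int (k i)\<bar> \<le> \<bar>y i\<bar>" "\<bar>y i - real_of_int (k i)\<bar> \<le> 1" if "i \<in> I" for i
      using that by (auto simp: k_def) linarith+
    have "(\<Sum>i\<in>I. (real_of_int (k i))\<^sup>2) \<le> (\<Sum>i\<in>I. (y i)\<^sup>2)"
      using kr by (intro sum_mono) (simp add: abs_le_square_iff)
    also have "\<dots> = 4 * s\<^sup>2 / w\<^sup>2 * (\<Sum>i\<in>I. (W i)\<^sup>2)"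
      by (simp add: y_def power_divide power_mult_distrib sum_distrib_left)
    also have "\<dots> = 4 * real (card I)" using w by (simp add: w2[symmetric] s2)
    finally have "real_of_int (\<Sum>i\<in>I. (k i)\<^sup>2) \<le> real_of_int (4 * int (card I))" by simp
    hence ks: "(\<Sum>i\<in>I. (k i)\<^sup>2) \<le> 4 * int (card I)" by (simp only: of_int_le_iff)
    have "k i \<in> {- int (2 * card I)..int (2 * card I)}" if i: "i \<in> I" for i
    proof -
      have "(k i)\<^sup>2 \<le> (\<Sum>i\<in>I. (k i)\<^sup>2)" using i I by (intro member_le_sum) auto
      also have "\<dots> \<le> 4 * int (card I)" by (rule ks)
      also have "\<dots> \<le> (2 * int (card I))\<^sup>2" using m by (simp add: power2_eq_square)
      finally have "\<bar>k i\<bar> \<le> \<bar>2 * int (card I)\<bar>" by (simp only: abs_le_square_iff)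
      thus ?thesis by auto
    qed
    hence kg: "k \<in> grid I" using ks by (auto simp: grid_def k_def)
    have "(\<Sum>i\<in>I. \<bar>W i\<bar>) \<le> s * w"
    proof (rule power2_le_imp_le)
      have "(\<Sum>i\<in>I. 1 * \<bar>W i\<bar>)\<^sup>2 \<le> (\<Sum>i\<in>I. 1\<^sup>2) * (\<Sum>i\<in>I. \<bar>W i\<bar>\<^sup>2)" by (rule Cauchy_Schwarz_ineq_sum)
      thus "(\<Sum>i\<in>I. \<bar>W i\<bar>)\<^sup>2 \<le> (s * w)\<^sup>2" by (simp add: power_mult_distrib s2 w2)
    qed (use s0 w0 in simp)
    \<comment> \<open>Rounding loses at most 1 per scaled coordinate, in total at most
      \<open>s * w\<close>, which is half of the value \<open>2 * s * w\<close> at the maximiser.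
      This is the factor 2 in the conclusion.\<close>
    moreover have "2 * s * w \<le> (\<Sum>i\<in>I. real_of_int (k i) * W i) + (\<Sum>i\<in>I. \<bar>W i\<bar>)"
    proof -
      have "2 * s * w = (\<Sum>i\<in>I. y i * W i)"
      proof -
        have "(\<Sum>i\<in>I. y i * W i) = 2 * s / w * (\<Sum>i\<in>I. (W i)\<^sup>2)"
          by (simp add: y_def sum_distrib_left power2_eq_square mult_ac)
        also have "\<dots> = 2 * s * w" using w unfolding w2[symmetric] by (simp add: power2_eq_square)
        finally show ?thesis by simp
      qed
      also have "\<dots> \<le> (\<Sum>i\<in>I. real_of_int (k i) * W i + \<bar>W i\<bar>)"
      proof (rule sum_mono)
        fix i assume i: "i \<in> I"
        have "(y i - real_of_int (k i)) * W i \<le> \<bar>y i - real_of_int (k i)\<bar> * \<bar>W i\<bar>" by (metis abs_ge_self abs_mult)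
        also have "\<dots> \<le> 1 * \<bar>W i\<bar>" using kr(2)[OF i] by (intro mult_right_mono) auto
        finally show "y i * W i \<le> real_of_int (k i) * W i + \<bar>W i\<bar>" by (simp add: algebra_simps)
      qed
      finally show ?thesis by (simp add: sum.distrib)
    qed
    moreover have "(\<Sum>i\<in>I. real_of_int (k i) * W i) \<le> 2 * s * t"
    proof -
      have "(\<Sum>i\<in>I. real_of_int (k i) * W i) = 2 * s * (\<Sum>i\<in>I. grid_point I k i * W i)"
        using s0 by (simp add: grid_point_def s_def[symmetric] sum_distrib_left)
      also have "\<dots> \<le> 2 * s * t" using W[OF kg] s0 by (intro mult_left_mono) auto
      finally show ?thesis .
    qed
    ultimately have "s * w \<le> s * (2 * t)" by (simp add: mult_ac)
    hence "w \<le> 2 * t" using s0 by (simp add: mult_le_cancel_left_pos)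
    thus ?thesis by (simp add: w_def)
  qed
qed

section \<open>Concentration\<close>

lemma emeasure_exp_Markov:
  fixes f :: "'a \<Rightarrow> real"
  assumes f: "f \<in> borel_measurable M" and e: "(\<integral>\<^sup>+x. ennreal (exp (f x)) \<partial>M) \<le> ennreal (exp b)"
  shows "emeasure M {x \<in> space M. a \<le> f x} \<le> ennreal (exp (b - a))"
proof -
  have "emeasure M {x \<in> space M. a \<le> f x} = emeasure M {x \<in> space M. 1 \<le> ennreal (exp (- a)) * ennreal (exp (f x))}"
  proof (intro arg_cong[of _ _ "emeasure M"] Collect_cong conj_cong refl)
    fix x
    have "1 \<le> ennreal (exp (- a)) * ennreal (exp (f x)) \<longleftrightarrow> ennreal 1 \<le> ennreal (exp (f x - a))"
      by (simp add: ennreal_mult'[symmetric] exp_add[symmetric])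
    also have "\<dots> \<longleftrightarrow> a \<le> f x" by (subst ennreal_le_iff) auto
    finally show "a \<le> f x \<longleftrightarrow> 1 \<le> ennreal (exp (- a)) * ennreal (exp (f x))" by simp
  qed
  also have "\<dots> \<le> ennreal (exp (- a)) * (\<integral>\<^sup>+x. ennreal (exp (f x)) * indicator (space M) x \<partial>M)"
    using nn_integral_Markov_inequality[of "\<lambda>x. ennreal (exp (f x))" "space M" M "ennreal (exp (- a))"] f by simp
  also have "(\<integral>\<^sup>+x. ennreal (exp (f x)) * indicator (space M) x \<partial>M) = (\<integral>\<^sup>+x. ennreal (exp (f x)) \<partial>M)"
    by (intro nn_integral_cong) simp
  also have "ennreal (exp (- a)) * \<dots> \<le> ennreal (exp (- a)) * ennreal (exp b)" by (intro mult_left_mono e) simp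
  also have "\<dots> = ennreal (exp (b - a))" by (simp add: ennreal_mult'[symmetric] exp_add[symmetric])
  finally show ?thesis .
qed

lemma emeasure_UN_le_card:
  assumes F: "finite F" and m: "\<And>k. k \<in> F \<Longrightarrow> A k \<in> sets M" and b: "\<And>k. k \<in> F \<Longrightarrow> emeasure M (A k) \<le> ennreal b" and b0: "0 \<le> b"
  shows "emeasure M (\<Union>k\<in>F. A k) \<le> ennreal (real (card F) * b)"
proof -
  have "emeasure M (\<Union>k\<in>F. A k) \<le> (\<Sum>k\<in>F. emeasure M (A k))"
    using m by (intro emeasure_subadditive_finite F) auto
  also have "\<dots> \<le> (\<Sum>k\<in>F. ennreal b)" by (intro sum_mono b)
  also have "\<dots> = ennreal (real (card F) * b)" using b0 by (simp add: ennreal_mult ennreal_of_nat_eq_real_of_nat)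
  finally show ?thesis .
qed

section \<open>Operator norm of the noise\<close>

definition sort_pair :: "nat \<times> nat \<Rightarrow> nat \<times> nat" where
  "sort_pair p = (min (fst p) (snd p), max (fst p) (snd p))"

text \<open>Each independent entry occurs at up to two positions of the symmetric matrix. Collecting
  its coefficients costs a factor 2 in the sum of squares, so the bilinear form is Gaussian of
  variance at most \<open>2 * v\<close>.\<close>

lemma gue_bilinear_mgf:
  assumes v: "0 \<le> v" and x: "(\<Sum>i<d. (x i)\<^sup>2) \<le> 1" and y: "(\<Sum>i<d. (y i)\<^sup>2) \<le> 1"
  shows "(\<integral>\<^sup>+N. ennreal (exp (s * (\<Sum>i<d. \<Sum>j<d. x i * N $$ (i, j) * y j))) \<partial>gue d v) \<le> ennreal (exp (s\<^sup>2 * v))"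
proof -
  let ?I = "upper_idx d" and ?sq = "{..<d} \<times> {..<d}"
  let ?\<gamma> = "\<Pi>\<^sub>M p\<in>?I. normal_law 0 v"
  define c where "c = (\<lambda>p. \<Sum>q\<in>{q \<in> ?sq. sort_pair q = p}. x (fst q) * y (snd q))"
  interpret product_prob_space "\<lambda>_ :: nat \<times> nat. normal_law 0 v" using v by (intro product_prob_spaceI prob_space_normal_law)
  have img: "sort_pair ` ?sq \<subseteq> ?I" by (auto simp: sort_pair_def)
  have lin: "(\<Sum>i<d. \<Sum>j<d. x i * sym_of d g $$ (i, j) * y j) = (\<Sum>p\<in>?I. c p * g p)" for g
  proof -
    have "(\<Sum>i<d. \<Sum>j<d. x i * sym_of d g $$ (i, j) * y j) = (\<Sum>q\<in>?sq. x (fst q) * y (snd q) * g (sort_pair q))"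
      by (simp add: sum.cartesian_product case_prod_beta sym_of_def sort_pair_def mult_ac)
    also have "\<dots> = (\<Sum>p\<in>?I. \<Sum>q\<in>{q \<in> ?sq. sort_pair q = p}. x (fst q) * y (snd q) * g (sort_pair q))"
      by (rule sum.group[symmetric, OF _ finite_upper_idx img]) simp
    also have "\<dots> = (\<Sum>p\<in>?I. c p * g p)"
      unfolding c_def sum_distrib_right by (intro sum.cong refl) auto
    finally show ?thesis .
  qed
  have lin': "ennreal (exp (s * (\<Sum>i<d. \<Sum>j<d. x i * sym_of d g $$ (i, j) * y j))) = (\<Prod>p\<in>?I. ennreal (exp (s * c p * g p)))" for g
    unfolding lin by (simp add: sum_distrib_left mult.assoc prod_ennreal exp_sum[symmetric] finite_upper_idx)
  have "(\<Sum>p\<in>?I. (c p)\<^sup>2) \<le> (\<Sum>p\<in>?I. 2 * (\<Sum>q\<in>{q \<in> ?sq. sort_pair q = p}. (x (fst q) * y (snd q))\<^sup>2))"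
  proof (rule sum_mono)
    fix p
    let ?F = "{q \<in> ?sq. sort_pair q = p}"
    have "?F \<subseteq> {p, (snd p, fst p)}" by (auto simp: sort_pair_def min_def max_def split: if_splits)
    hence "card ?F \<le> card {p, (snd p, fst p)}" by (intro card_mono) auto
    also have "\<dots> \<le> 2" by (simp add: card_insert_if)
    finally have F: "real (card ?F) \<le> 2" by simp
    have "(c p)\<^sup>2 = (\<Sum>q\<in>?F. 1 * (x (fst q) * y (snd q)))\<^sup>2" by (simp add: c_def)
    also have "\<dots> \<le> (\<Sum>q\<in>?F. 1\<^sup>2) * (\<Sum>q\<in>?F. (x (fst q) * y (snd q))\<^sup>2)" by (rule Cauchy_Schwarz_ineq_sum)
    also have "\<dots> \<le> 2 * (\<Sum>q\<in>?F. (x (fst q) * y (snd q))\<^sup>2)"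
      using F by (intro mult_right_mono sum_nonneg) auto
    finally show "(c p)\<^sup>2 \<le> 2 * (\<Sum>q\<in>?F. (x (fst q) * y (snd q))\<^sup>2)" .
  qed
  also have "\<dots> = 2 * (\<Sum>q\<in>?sq. (x (fst q) * y (snd q))\<^sup>2)"
    unfolding sum_distrib_left[symmetric] by (subst sum.group[OF _ finite_upper_idx img]) auto
  also have "(\<Sum>q\<in>?sq. (x (fst q) * y (snd q))\<^sup>2) = (\<Sum>i<d. (x i)\<^sup>2) * (\<Sum>j<d. (y j)\<^sup>2)"
    by (simp add: sum_product sum.cartesian_product case_prod_beta power_mult_distrib)
  also have "2 * \<dots> \<le> 2 * (1 * 1)" using x y by (intro mult_left_mono mult_mono) (auto intro: sum_nonneg)
  finally have c2: "(\<Sum>p\<in>?I. (c p)\<^sup>2) \<le> 2" by simp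
  have bm: "(\<lambda>N. ennreal (exp (s * (\<Sum>i<d. \<Sum>j<d. x i * N $$ (i, j) * y j)))) \<in> borel_measurable (mat_borel d)"
  proof -
    have "(\<lambda>N. \<Sum>i<d. \<Sum>j<d. x i * N $$ (i, j) * y j) \<in> borel_measurable (mat_borel d)"
      by (intro borel_measurable_sum borel_measurable_times borel_measurable_const measurable_mat_entry) auto
    thus ?thesis by measurable
  qed
  have symg: "sym_of d \<in> ?\<gamma> \<rightarrow>\<^sub>M mat_borel d" by (rule measurable_sym_of) simp
  have "(\<integral>\<^sup>+N. ennreal (exp (s * (\<Sum>i<d. \<Sum>j<d. x i * N $$ (i, j) * y j))) \<partial>gue d v) =
      (\<integral>\<^sup>+g. (\<Prod>p\<in>?I. ennreal (exp (s * c p * g p))) \<partial>?\<gamma>)"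
    unfolding gue_altdef
    using bm by (subst nn_integral_distr[OF symg]) (simp_all only: measurable_distr_eq1 lin')
  also have "\<dots> = (\<Prod>p\<in>?I. \<integral>\<^sup>+z. ennreal (exp (s * c p * z)) \<partial>normal_law 0 v)"
    by (rule product_nn_integral_prod) auto
  also have "\<dots> = (\<Prod>p\<in>?I. ennreal (exp ((s * c p)\<^sup>2 * v / 2)))"
    by (simp add: nn_integral_normal_law_exp[OF v])
  also have "\<dots> = ennreal (exp (\<Sum>p\<in>?I. (s * c p)\<^sup>2 * v / 2))" by (simp add: prod_ennreal exp_sum)
  also have "(\<Sum>p\<in>?I. (s * c p)\<^sup>2 * v / 2) = s\<^sup>2 * v / 2 * (\<Sum>p\<in>?I. (c p)\<^sup>2)"
    unfolding sum_distrib_left by (intro sum.cong refl) (simp add: power_mult_distrib)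
  also have "ennreal (exp (s\<^sup>2 * v / 2 * (\<Sum>p\<in>?I. (c p)\<^sup>2))) \<le> ennreal (exp (s\<^sup>2 * v / 2 * 2))"
    using c2 v by (intro ennreal_leI) (auto intro!: mult_left_mono)
  finally show ?thesis by simp
qed

text \<open>A union bound over pairs of grid points; each of the two vectors has its own net, which
  gives \<open>12 * real d\<close> in the exponent and a factor 2 twice in the norm.\<close>

lemma gue_op_norm:
  assumes d: "0 < d" and v: "0 < v" and t: "0 < t"
  shows "\<exists>G \<in> sets (mat_borel d). emeasure (gue d v) (carrier_mat d d - G) \<le> ennreal (exp (12 * real d - t\<^sup>2 / (4 * v))) \<and>
    (\<forall>N\<in>G. \<forall>x\<in>carrier_vec d. \<forall>y\<in>carrier_vec d. \<bar>x \<bullet> (N *\<^sub>v y)\<bar> \<le> 4 * t * vnorm x * vnorm y)"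
proof -
  let ?I = "{..<d}" and ?P = "grid {..<d} \<times> grid {..<d}"
  define b where "b = (\<lambda>q N. \<Sum>i<d. \<Sum>j<d. grid_point ?I (fst q) i * N $$ (i, j) * grid_point ?I (snd q) j)"
  have bm: "b q \<in> borel_measurable (mat_borel d)" for q
    unfolding b_def
    by (intro borel_measurable_sum borel_measurable_times borel_measurable_const measurable_mat_entry) auto
  have sg: "sets (gue d v) = sets (mat_borel d)" "space (gue d v) = carrier_mat d d" by (simp_all add: gue_altdef)
  have bg: "b q \<in> borel_measurable (gue d v)" for q using bm measurable_cong_sets[OF sg(1) refl] by blast
  define A where "A = (\<lambda>q. {N \<in> carrier_mat d d. t \<le> b q N})"
  have As: "A q \<in> sets (gue d v)" for q
    using borel_measurable_le[OF borel_measurable_const[of t] bg[of q]] by (simp add: A_def sg)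
  define G where "G = carrier_mat d d - (\<Union>q\<in>?P. A q)"
  have fin: "finite ?P" by (intro finite_cartesian_product finite_grid) auto
  have Gs: "G \<in> sets (mat_borel d)"
    unfolding G_def using As fin sets.top[of "mat_borel d"] by (intro sets.Diff sets.finite_UN) (auto simp: sg)
  have "emeasure (gue d v) (A q) \<le> ennreal (exp (- t\<^sup>2 / (4 * v)))" if q: "q \<in> ?P" for q
  proof -
    \<comment> \<open>The minimiser of \<open>s\<^sup>2 * v - s * t\<close>.\<close>
    define s where "s = t / (2 * v)"
    have s: "0 < s" using t v by (simp add: s_def)
    have "(\<integral>\<^sup>+N. ennreal (exp (s * b q N)) \<partial>gue d v) \<le> ennreal (exp (s\<^sup>2 * v))"
      unfolding b_def using q v by (intro gue_bilinear_mgf grid_point_norm) auto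
    hence "emeasure (gue d v) {N \<in> space (gue d v). s * t \<le> s * b q N} \<le> ennreal (exp (s\<^sup>2 * v - s * t))"
      using bg by (intro emeasure_exp_Markov) auto
    also have "s\<^sup>2 * v - s * t = - t\<^sup>2 / (4 * v)" using v by (simp add: s_def power2_eq_square field_simps)
    finally show ?thesis using s by (simp add: A_def sg)
  qed
  hence "emeasure (gue d v) (\<Union>q\<in>?P. A q) \<le> ennreal (real (card ?P) * exp (- t\<^sup>2 / (4 * v)))"
    using As by (intro emeasure_UN_le_card fin) auto
  also have "\<dots> \<le> ennreal (exp (6 * real d) * exp (6 * real d) * exp (- t\<^sup>2 / (4 * v)))"
    using card_grid[of ?I] by (intro ennreal_leI mult_right_mono) (auto simp: card_cartesian_product intro!: mult_mono)
  also have "exp (6 * real d) * exp (6 * real d) * exp (- t\<^sup>2 / (4 * v)) = exp (12 * real d - t\<^sup>2 / (4 * v))"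
    by (simp add: exp_add[symmetric])
  finally have e: "emeasure (gue d v) (\<Union>q\<in>?P. A q) \<le> ennreal (exp (12 * real d - t\<^sup>2 / (4 * v)))" .
  have "carrier_mat d d - G = (\<Union>q\<in>?P. A q)" by (auto simp: G_def A_def)
  moreover have "\<bar>x \<bullet> (N *\<^sub>v y)\<bar> \<le> 4 * t * vnorm x * vnorm y"
    if N: "N \<in> G" and x: "x \<in> carrier_vec d" and y: "y \<in> carrier_vec d" for N x y
  proof -
    have Nc: "N \<in> carrier_mat d d" using N by (simp add: G_def)
    have bt: "b (k, l) N \<le> t" if "k \<in> grid ?I" "l \<in> grid ?I" for k l
      using N that unfolding G_def A_def by force
    have I: "finite ?I" "?I \<noteq> {}" using d by auto
    have 1: "sqrt (\<Sum>i<d. (\<Sum>j<d. N $$ (i, j) * grid_point ?I l j)\<^sup>2) \<le> 2 * t" if l: "l \<in> grid ?I" for l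
      by (rule norm_le_grid[OF I]) (use bt[OF _ l] in \<open>simp add: b_def sum_distrib_left mult_ac\<close>)
    have xs: "vnorm x = sqrt (\<Sum>i<d. (x $ i)\<^sup>2)" by (simp add: vnorm_def scalar_prod_self_sum[OF x])
    have ys: "vnorm y = sqrt (\<Sum>i<d. (y $ i)\<^sup>2)" by (simp add: vnorm_def scalar_prod_self_sum[OF y])
    have CS: "(\<Sum>i<d. u i * w i) \<le> sqrt (\<Sum>i<d. (u i)\<^sup>2) * sqrt (\<Sum>i<d. (w i)\<^sup>2)" for u w :: "nat \<Rightarrow> real"
      using real_sqrt_le_mono[OF Cauchy_Schwarz_ineq_sum[of u w ?I]] by (simp add: real_sqrt_mult)
    have 2: "sqrt (\<Sum>j<d. (\<Sum>i<d. x $ i * N $$ (i, j))\<^sup>2) \<le> 2 * (vnorm x * (2 * t))"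
    proof (rule norm_le_grid[OF I])
      fix l assume l: "l \<in> grid ?I"
      have "(\<Sum>j<d. grid_point ?I l j * (\<Sum>i<d. x $ i * N $$ (i, j))) =
          (\<Sum>i<d. x $ i * (\<Sum>j<d. N $$ (i, j) * grid_point ?I l j))"
        unfolding sum_distrib_left by (subst sum.swap) (simp add: mult_ac)
      also have "\<dots> \<le> vnorm x * sqrt (\<Sum>i<d. (\<Sum>j<d. N $$ (i, j) * grid_point ?I l j)\<^sup>2)"
        unfolding xs by (rule CS)
      also have "\<dots> \<le> vnorm x * (2 * t)" by (intro mult_left_mono 1 l) simp
      finally show "(\<Sum>j<d. grid_point ?I l j * (\<Sum>i<d. x $ i * N $$ (i, j))) \<le> vnorm x * (2 * t)" .
    qed
    have xNy: "x \<bullet> (N *\<^sub>v y) = (\<Sum>j<d. (\<Sum>i<d. x $ i * N $$ (i, j)) * y $ j)"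
    proof -
      have "x \<bullet> (N *\<^sub>v y) = (\<Sum>i<d. \<Sum>j<d. x $ i * N $$ (i, j) * y $ j)"
        using x y Nc by (simp add: scalar_prod_def lessThan_atLeast0 sum_distrib_left mult.assoc)
      also have "\<dots> = (\<Sum>j<d. \<Sum>i<d. x $ i * N $$ (i, j) * y $ j)" by (rule sum.swap)
      finally show ?thesis by (simp add: sum_distrib_right)
    qed
    have "\<bar>x \<bullet> (N *\<^sub>v y)\<bar> \<le> sqrt (\<Sum>j<d. (\<Sum>i<d. x $ i * N $$ (i, j))\<^sup>2) * vnorm y"
      using CS[of "\<lambda>j. \<Sum>i<d. x $ i * N $$ (i, j)" "\<lambda>j. y $ j"] CS[of "\<lambda>j. \<Sum>i<d. x $ i * N $$ (i, j)" "\<lambda>j. - y $ j"]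
      unfolding xNy ys by (simp add: sum_negf)
    also have "\<dots> \<le> 2 * (vnorm x * (2 * t)) * vnorm y" by (intro mult_right_mono 2) simp
    finally show ?thesis by (simp add: mult_ac)
  qed
  ultimately show ?thesis using Gs e by metis
qed

section \<open>Length of the samples and deviation of their covariance\<close>

text \<open>The exponential moment at 1/4 is \<open>sqrt 2\<close> per coordinate. The level is a
  product of \<open>d\<close> and the logarithm, because this is the shape of the truncation radius;
  \<open>e \<le> 1 / 2\<close> makes the logarithm large enough to absorb \<open>ln 2 / 2\<close>
  per coordinate.\<close>

lemma std_gaussian_norm_tail:
  assumes d: "0 < d" and e: "0 < e" "e \<le> 1 / 2"
  shows "emeasure (std_gaussian d) {g \<in> space (std_gaussian d). 8 * real d * ln (1 / e) \<le> (\<Sum>j<d. (g j)\<^sup>2)} \<le> ennreal e"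
proof -
  interpret product_prob_space "\<lambda>_ :: nat. normal_law 0 1" by (intro product_prob_spaceI prob_space_normal_law) simp
  have l: "ln 2 \<le> ln (1 / e)" using e by (subst ln_le_cancel_iff) (auto simp: field_simps)
  have m: "(\<lambda>g. 1 / 4 * (\<Sum>j<d. (g j)\<^sup>2)) \<in> borel_measurable (std_gaussian d)"
    by (intro borel_measurable_times borel_measurable_const borel_measurable_sum borel_measurable_power measurable_component_real) auto
  have "(\<integral>\<^sup>+g. ennreal (exp (1 / 4 * (\<Sum>j<d. (g j)\<^sup>2))) \<partial>std_gaussian d) =
      (\<integral>\<^sup>+g. (\<Prod>j<d. ennreal (exp (1 / 4 * (g j)\<^sup>2 + 0 * g j))) \<partial>std_gaussian d)"
    by (simp add: prod_ennreal exp_sum[symmetric] sum_distrib_left)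
  also have "\<dots> = (\<Prod>j<d. \<integral>\<^sup>+y. ennreal (exp (1 / 4 * y\<^sup>2 + 0 * y)) \<partial>normal_law 0 1)"
    by (rule product_nn_integral_prod) auto
  also have "\<dots> = (\<Prod>j<d. ennreal (sqrt 2))"
    by (subst nn_integral_std_normal_quadratic) (auto simp: real_sqrt_divide)
  also have "\<dots> = ennreal (exp (real d * (ln 2 / 2)))"
    by (simp add: ennreal_power exp_of_nat_mult ln_sqrt[symmetric])
  finally have "(\<integral>\<^sup>+g. ennreal (exp (1 / 4 * (\<Sum>j<d. (g j)\<^sup>2))) \<partial>std_gaussian d) \<le> ennreal (exp (real d * (ln 2 / 2)))"
    by simp
  from emeasure_exp_Markov[OF m this, of "2 * real d * ln (1 / e)"]
  have "emeasure (std_gaussian d) {g \<in> space (std_gaussian d). 8 * real d * ln (1 / e) \<le> (\<Sum>j<d. (g j)\<^sup>2)}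
      \<le> ennreal (exp (real d * (ln 2 / 2) - 2 * real d * ln (1 / e)))"
    by (simp add: field_simps)
  also have "\<dots> \<le> ennreal (exp (- ln (1 / e)))"
  proof (intro ennreal_leI, subst exp_le_cancel_iff)
    have l0: "0 < ln (1 / e)" using e by (intro ln_gt_zero) (auto simp: field_simps)
    hence "real d * (ln 2 / 2 - 2 * ln (1 / e)) \<le> real d * (- ln (1 / e))" using l by (intro mult_left_mono) auto
    also have "\<dots> \<le> 1 * (- ln (1 / e))" using d l0 by (intro mult_right_mono_neg) auto
    finally show "real d * (ln 2 / 2) - 2 * real d * ln (1 / e) \<le> - ln (1 / e)" by (simp add: algebra_simps)
  qed
  also have "exp (- ln (1 / e)) = e" using e by (simp add: ln_div)
  finally show ?thesis .
qed

abbreviation std_sample :: "nat \<Rightarrow> nat \<Rightarrow> (nat \<Rightarrow> nat \<Rightarrow> real) measure" where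
  "std_sample d n \<equiv> \<Pi>\<^sub>M i\<in>{..<n}. std_gaussian d"

definition cov_dev :: "nat \<Rightarrow> (nat \<Rightarrow> nat \<Rightarrow> real) \<Rightarrow> nat \<Rightarrow> nat \<Rightarrow> real" where
  "cov_dev n g j k = (\<Sum>i<n. g i j * g i k) / real n - (if j = k then 1 else 0)"

lemma prob_space_std_sample: "prob_space (std_sample d n)"
  by (intro prob_space_PiM prob_space_std_gaussian)

lemma measurable_std_sample_row: "i < n \<Longrightarrow> (\<lambda>g. g i) \<in> std_sample d n \<rightarrow>\<^sub>M std_gaussian d"
  by (rule measurable_component_singleton) simp

lemma measurable_std_sample_entry:
  assumes "i < n" "j < d"
  shows "(\<lambda>g. g i j) \<in> borel_measurable (std_sample d n)"
proof -
  have "(\<lambda>g. g j) \<in> borel_measurable (std_gaussian d)" using assms by (intro measurable_component_real) auto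
  from measurable_compose[OF measurable_std_sample_row[OF assms(1)] this] show ?thesis .
qed

lemma measurable_cov_dev:
  "j < d \<Longrightarrow> k < d \<Longrightarrow> (\<lambda>g. cov_dev n g j k) \<in> borel_measurable (std_sample d n)"
  unfolding cov_dev_def
  by (intro borel_measurable_diff borel_measurable_divide borel_measurable_sum borel_measurable_times
      borel_measurable_const measurable_std_sample_entry) auto

text \<open>In a fixed direction \<open>x\<close> the deviation is an average of independent centred
  quadratic forms. Symmetrising \<open>x\<close> makes \<open>quad_form_mgf\<close> applicable
  without increasing the norm, and the trace it produces cancels against the identity subtracted in
  \<open>cov_dev\<close>.\<close>

lemma cov_dev_mgf:
  assumes n: "0 < n" and x: "(\<Sum>j<d. \<Sum>k<d. (x j k)\<^sup>2) \<le> 1" and s: "\<bar>s\<bar> \<le> 1 / 16"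
  shows "(\<integral>\<^sup>+g. ennreal (exp (s * real n * (\<Sum>j<d. \<Sum>k<d. x j k * cov_dev n g j k))) \<partial>std_sample d n)
    \<le> ennreal (exp (4 * real n * s\<^sup>2))"
proof -
  interpret product_prob_space "\<lambda>_ :: nat. std_gaussian d" by (intro product_prob_spaceI prob_space_std_gaussian)
  define Q where "Q = (\<lambda>j k. s * ((x j k + x k j) / 2))"
  define q where "q = (\<Sum>j<d. x j j)"
  have qf: "quad_form d Q h = s * (\<Sum>j<d. \<Sum>k<d. x j k * h j * h k)" for h
  proof -
    have "(\<Sum>j<d. \<Sum>k<d. x k j * h j * h k) = (\<Sum>j<d. \<Sum>k<d. x j k * h j * h k)"
      by (subst sum.swap) (simp add: mult_ac)
    moreover have "quad_form d Q h = s / 2 * ((\<Sum>j<d. \<Sum>k<d. x j k * h j * h k) + (\<Sum>j<d. \<Sum>k<d. x k j * h j * h k))"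
      unfolding quad_form_def Q_def sum.distrib[symmetric] sum_distrib_left
      by (intro sum.cong refl) (simp add: algebra_simps add_divide_distrib)
    ultimately show ?thesis by simp
  qed
  have lin: "s * real n * (\<Sum>j<d. \<Sum>k<d. x j k * cov_dev n g j k) = (\<Sum>i<n. quad_form d Q (g i)) - s * real n * q" for g
  proof -
    have "(\<Sum>j<d. \<Sum>k<d. x j k * cov_dev n g j k) =
        (\<Sum>j<d. \<Sum>k<d. (\<Sum>i<n. x j k * g i j * g i k) / real n) - (\<Sum>j<d. \<Sum>k<d. x j k * (if j = k then 1 else 0))"
      unfolding sum_subtractf[symmetric] cov_dev_def
      by (intro sum.cong refl) (simp add: right_diff_distrib sum_distrib_left mult.assoc)
    also have "(\<Sum>j<d. \<Sum>k<d. x j k * (if j = k then 1 else 0)) = q" by (simp add: q_def if_distrib cong: if_cong)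
    also have "(\<Sum>j<d. \<Sum>k<d. (\<Sum>i<n. x j k * g i j * g i k) / real n) = (\<Sum>j<d. \<Sum>k<d. \<Sum>i<n. x j k * g i j * g i k) / real n"
      by (simp add: sum_divide_distrib)
    also have "(\<Sum>j<d. \<Sum>k<d. \<Sum>i<n. x j k * g i j * g i k) = (\<Sum>i<n. \<Sum>j<d. \<Sum>k<d. x j k * g i j * g i k)"
      by (simp add: sum.swap[of _ "{..<n}"])
    finally show ?thesis using n by (simp add: qf sum_distrib_left[symmetric] right_diff_distrib)
  qed
  have Q2: "(\<Sum>j<d. \<Sum>k<d. (Q j k)\<^sup>2) \<le> s\<^sup>2"
  proof -
    have "(\<Sum>j<d. \<Sum>k<d. (Q j k)\<^sup>2) \<le> (\<Sum>j<d. \<Sum>k<d. s\<^sup>2 / 2 * ((x j k)\<^sup>2 + (x k j)\<^sup>2))"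
    proof (intro sum_mono)
      fix j k
      have "((x j k + x k j) / 2)\<^sup>2 \<le> ((x j k)\<^sup>2 + (x k j)\<^sup>2) / 2"
        using zero_le_power2[of "x j k - x k j"] by (simp add: power2_eq_square field_simps)
      from mult_left_mono[OF this zero_le_power2[of s]]
      show "(Q j k)\<^sup>2 \<le> s\<^sup>2 / 2 * ((x j k)\<^sup>2 + (x k j)\<^sup>2)" unfolding Q_def power_mult_distrib by simp
    qed
    also have "\<dots> = s\<^sup>2 / 2 * ((\<Sum>j<d. \<Sum>k<d. (x j k)\<^sup>2) + (\<Sum>j<d. \<Sum>k<d. (x k j)\<^sup>2))"
      unfolding sum_distrib_left[symmetric] sum.distrib by simp
    also have "(\<Sum>j<d. \<Sum>k<d. (x k j)\<^sup>2) = (\<Sum>j<d. \<Sum>k<d. (x j k)\<^sup>2)" by (rule sum.swap)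
    also have "s\<^sup>2 / 2 * ((\<Sum>j<d. \<Sum>k<d. (x j k)\<^sup>2) + (\<Sum>j<d. \<Sum>k<d. (x j k)\<^sup>2)) \<le> s\<^sup>2 / 2 * (1 + 1)"
      using x by (intro mult_left_mono add_mono) auto
    finally show ?thesis by simp
  qed
  have "s\<^sup>2 \<le> (1 / 16)\<^sup>2" using power_mono[OF s, of 2] by simp
  hence mgf: "(\<integral>\<^sup>+h. ennreal (exp (quad_form d Q h)) \<partial>std_gaussian d) \<le> ennreal (exp (s * q + 4 * s\<^sup>2))"
    (is "?m \<le> _")
  proof -
    assume s2: "s\<^sup>2 \<le> (1 / 16)\<^sup>2"
    have "?m \<le> ennreal (exp ((\<Sum>i<d. Q i i) + 4 * (\<Sum>j<d. \<Sum>k<d. (Q j k)\<^sup>2)))"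
      by (rule quad_form_mgf) (use Q2 s2 in \<open>auto simp: Q_def add.commute\<close>)
    also have "(\<Sum>i<d. Q i i) = s * q" by (simp add: Q_def q_def sum_distrib_left)
    also have "ennreal (exp (s * q + 4 * (\<Sum>j<d. \<Sum>k<d. (Q j k)\<^sup>2))) \<le> ennreal (exp (s * q + 4 * s\<^sup>2))"
      using Q2 by (intro ennreal_leI) simp
    finally show ?thesis .
  qed
  have qm: "quad_form d Q \<in> borel_measurable (std_gaussian d)" by (rule measurable_quad_form) auto
  have "(\<integral>\<^sup>+g. ennreal (exp (s * real n * (\<Sum>j<d. \<Sum>k<d. x j k * cov_dev n g j k))) \<partial>std_sample d n) =
      (\<integral>\<^sup>+g. (\<Prod>i<n. ennreal (exp (- (s * q)) * exp (quad_form d Q (g i)))) \<partial>std_sample d n)"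
    unfolding lin
    by (simp add: prod_ennreal exp_sum[symmetric] exp_add[symmetric] sum_subtractf mult_ac)
  also have "\<dots> = (\<Prod>i<n. \<integral>\<^sup>+h. ennreal (exp (- (s * q)) * exp (quad_form d Q h)) \<partial>std_gaussian d)"
    by (rule product_nn_integral_prod) (use qm in auto)
  also have "\<dots> = (ennreal (exp (- (s * q))) * ?m) ^ n"
    using qm by (simp add: ennreal_mult nn_integral_cmult)
  also have "\<dots> \<le> (ennreal (exp (- (s * q))) * ennreal (exp (s * q + 4 * s\<^sup>2))) ^ n"
    by (intro power_mono mult_left_mono mgf) auto
  also have "\<dots> = ennreal (exp (4 * real n * s\<^sup>2))"
    by (simp add: ennreal_mult[symmetric] exp_add[symmetric] ennreal_power exp_of_nat_mult[symmetric] mult_ac)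
  finally show ?thesis .
qed

text \<open>The deviation matrix is treated as a vector with d^2 coordinates, so the net controls
  its Frobenius norm directly; this is the source of the d^2 in the first term of the sample size.
  The exponent 1/64 comes from \<open>s = \<tau> / 16\<close>, where 4/256 - 1/32 = -1/64.\<close>

lemma sample_cov_concentration:
  assumes d: "0 < d" and n: "0 < n" and \<tau>: "0 < \<tau>" "\<tau> \<le> 1"
  shows "\<exists>G \<in> sets (std_sample d n). emeasure (std_sample d n) (space (std_sample d n) - G)
      \<le> ennreal (exp (6 * (real d)\<^sup>2 - real n * \<tau>\<^sup>2 / 64)) \<and>
    (\<forall>g\<in>G. (\<Sum>j<d. \<Sum>k<d. (cov_dev n g j k)\<^sup>2) \<le> \<tau>\<^sup>2)"
proof -
  let ?I = "{..<d} \<times> {..<d}" and ?M = "std_sample d n"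
  define b where "b = (\<lambda>k g. \<Sum>i<d. \<Sum>j<d. grid_point ?I k (i, j) * cov_dev n g i j)"
  have bm: "b k \<in> borel_measurable ?M" for k
    unfolding b_def
    by (intro borel_measurable_sum borel_measurable_times borel_measurable_const measurable_cov_dev) auto
  define A where "A = (\<lambda>k. {g \<in> space ?M. \<tau> / 2 \<le> b k g})"
  have As: "A k \<in> sets ?M" for k
    unfolding A_def by (rule borel_measurable_le[OF borel_measurable_const bm])
  define G where "G = space ?M - (\<Union>k\<in>grid ?I. A k)"
  have fin: "finite (grid ?I)" by (intro finite_grid) auto
  have Gs: "G \<in> sets ?M"
    unfolding G_def using As fin by (intro sets.Diff sets.finite_UN) auto
  have "emeasure ?M (A k) \<le> ennreal (exp (- real n * \<tau>\<^sup>2 / 64))" if k: "k \<in> grid ?I" for k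
  proof -
    define s where "s = \<tau> / 16"
    have s: "0 < s" "s \<le> 1 / 16" using \<tau> by (auto simp: s_def)
    have gp: "(\<Sum>i<d. \<Sum>j<d. (grid_point ?I k (i, j))\<^sup>2) \<le> 1"
      using grid_point_norm[OF _ k] by (simp add: sum.cartesian_product case_prod_beta)
    have "(\<integral>\<^sup>+g. ennreal (exp (s * real n * b k g)) \<partial>?M) \<le> ennreal (exp (4 * real n * s\<^sup>2))"
      unfolding b_def using s by (intro cov_dev_mgf n gp) auto
    hence "emeasure ?M {g \<in> space ?M. s * real n * (\<tau> / 2) \<le> s * real n * b k g} \<le> ennreal (exp (4 * real n * s\<^sup>2 - s * real n * (\<tau> / 2)))"
      using bm by (intro emeasure_exp_Markov) auto
    also have "4 * real n * s\<^sup>2 - s * real n * (\<tau> / 2) = - real n * \<tau>\<^sup>2 / 64" by (simp add: s_def power2_eq_square field_simps)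
    also have "{g \<in> space ?M. s * real n * (\<tau> / 2) \<le> s * real n * b k g} = A k"
      using s n unfolding A_def by (intro Collect_cong conj_cong refl mult_le_cancel_left_pos) auto
    finally show ?thesis .
  qed
  hence "emeasure ?M (\<Union>k\<in>grid ?I. A k) \<le> ennreal (real (card (grid ?I)) * exp (- real n * \<tau>\<^sup>2 / 64))"
    using As by (intro emeasure_UN_le_card fin) auto
  also have "\<dots> \<le> ennreal (exp (6 * (real d)\<^sup>2) * exp (- real n * \<tau>\<^sup>2 / 64))"
    using card_grid[of ?I] by (intro ennreal_leI mult_right_mono) (auto simp: card_cartesian_product power2_eq_square)
  also have "exp (6 * (real d)\<^sup>2) * exp (- real n * \<tau>\<^sup>2 / 64) = exp (6 * (real d)\<^sup>2 - real n * \<tau>\<^sup>2 / 64)"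
    by (simp add: exp_add[symmetric])
  finally have e: "emeasure ?M (\<Union>k\<in>grid ?I. A k) \<le> ennreal (exp (6 * (real d)\<^sup>2 - real n * \<tau>\<^sup>2 / 64))" .
  have "space ?M - G = (\<Union>k\<in>grid ?I. A k)" by (auto simp: G_def A_def)
  moreover have "(\<Sum>j<d. \<Sum>k<d. (cov_dev n g j k)\<^sup>2) \<le> \<tau>\<^sup>2" if g: "g \<in> G" for g
  proof -
    have bt: "b k g \<le> \<tau> / 2" if "k \<in> grid ?I" for k
      using g that unfolding G_def A_def by force
    have "?I \<noteq> {}" using d by auto
    hence "sqrt (\<Sum>p\<in>?I. (cov_dev n g (fst p) (snd p))\<^sup>2) \<le> 2 * (\<tau> / 2)"
      using bt by (intro norm_le_grid) (auto simp: b_def sum.cartesian_product case_prod_beta)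
    from power_mono[OF this, of 2] show ?thesis
      by (simp add: sum.cartesian_product case_prod_beta sum_nonneg)
  qed
  ultimately show ?thesis using Gs e by metis
qed

text \<open>One \<beta> pays for the covariance, the other for \<open>n\<close> length bounds at
  level \<open>\<beta> / real n\<close> each. The event concerns the standard normal vectors alone
  and thus serves every matrix later applied to them.\<close>

lemma good_sample:
  assumes d: "0 < d" and n: "2 \<le> n" and \<beta>: "0 < \<beta>" "\<beta> \<le> 1" and \<tau>: "0 < \<tau>" "\<tau> \<le> 1"
    and size: "64 * (6 * (real d)\<^sup>2 + ln (1 / \<beta>)) \<le> real n * \<tau>\<^sup>2"
  shows "\<exists>G \<in> sets (std_sample d n). emeasure (std_sample d n) (space (std_sample d n) - G) \<le> ennreal (2 * \<beta>) \<and>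
    (\<forall>g\<in>G. (\<Sum>j<d. \<Sum>k<d. (cov_dev n g j k)\<^sup>2) \<le> \<tau>\<^sup>2 \<and>
      (\<forall>i<n. (\<Sum>j<d. (g i j)\<^sup>2) \<le> 8 * real d * ln (real n / \<beta>)))"
proof -
  let ?M = "std_sample d n"
  obtain G where G: "G \<in> sets ?M" "emeasure ?M (space ?M - G) \<le> ennreal (exp (6 * (real d)\<^sup>2 - real n * \<tau>\<^sup>2 / 64))"
      "\<And>g. g \<in> G \<Longrightarrow> (\<Sum>j<d. \<Sum>k<d. (cov_dev n g j k)\<^sup>2) \<le> \<tau>\<^sup>2"
    using sample_cov_concentration[OF d _ \<tau>, of n] n by auto
  define e where "e = \<beta> / real n"
  have e: "0 < e" "e \<le> 1 / 2" using n \<beta> by (auto simp: e_def field_simps)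
  define B where "B = {h \<in> space (std_gaussian d). 8 * real d * ln (1 / e) \<le> (\<Sum>j<d. (h j)\<^sup>2)}"
  have Bs: "B \<in> sets (std_gaussian d)"
    unfolding B_def by (intro borel_measurable_le borel_measurable_const borel_measurable_sum borel_measurable_power measurable_component_real) auto
  define A where "A = (\<lambda>i. {g \<in> space ?M. g i \<in> B})"
  have As: "A i \<in> sets ?M" if "i < n" for i
    using measurable_sets[OF measurable_std_sample_row[OF that] Bs] by (simp add: A_def vimage_def Int_def conj_commute)
  have Ae: "emeasure ?M (A i) \<le> ennreal e" if "i < n" for i
  proof -
    have "emeasure ?M (A i) = emeasure (distr ?M (std_gaussian d) (\<lambda>g. g i)) B"
      using measurable_std_sample_row[OF that] Bs by (simp add: A_def emeasure_distr vimage_def Int_def conj_commute)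
    also have "distr ?M (std_gaussian d) (\<lambda>g. g i) = std_gaussian d" using that by (intro distr_PiM_component prob_space_std_gaussian) auto
    also have "emeasure (std_gaussian d) B \<le> ennreal e" unfolding B_def by (rule std_gaussian_norm_tail[OF d e])
    finally show ?thesis .
  qed
  define G' where "G' = G - (\<Union>i\<in>{..<n}. A i)"
  have G's: "G' \<in> sets ?M" unfolding G'_def using As by (intro sets.Diff G(1) sets.finite_UN) auto
  have "emeasure ?M (\<Union>i\<in>{..<n}. A i) \<le> ennreal (real (card {..<n}) * e)"
    using As Ae e by (intro emeasure_UN_le_card) auto
  hence 1: "emeasure ?M (\<Union>i\<in>{..<n}. A i) \<le> ennreal \<beta>" using n by (simp add: e_def)
  have "exp (6 * (real d)\<^sup>2 - real n * \<tau>\<^sup>2 / 64) \<le> exp (- ln (1 / \<beta>))" using size by simp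
  also have "\<dots> = \<beta>" using \<beta> by (simp add: ln_div)
  finally have 2: "emeasure ?M (space ?M - G) \<le> ennreal \<beta>" using G(2) by (meson ennreal_leI order_trans)
  have "space ?M - G' \<subseteq> (space ?M - G) \<union> (\<Union>i\<in>{..<n}. A i)" by (auto simp: G'_def)
  moreover have "(space ?M - G) \<union> (\<Union>i\<in>{..<n}. A i) \<in> sets ?M" using As G(1) by (intro sets.Un sets.finite_UN sets.compl_sets) auto
  ultimately have "emeasure ?M (space ?M - G') \<le> emeasure ?M ((space ?M - G) \<union> (\<Union>i\<in>{..<n}. A i))" by (rule emeasure_mono)
  also have "\<dots> \<le> emeasure ?M (space ?M - G) + emeasure ?M (\<Union>i\<in>{..<n}. A i)"
    using As G(1) by (intro emeasure_subadditive sets.finite_UN sets.compl_sets) auto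
  also have "\<dots> \<le> ennreal \<beta> + ennreal \<beta>" by (intro add_mono 1 2)
  also have "\<dots> = ennreal (2 * \<beta>)" using \<beta> by (simp flip: ennreal_plus)
  finally have em: "emeasure ?M (space ?M - G') \<le> ennreal (2 * \<beta>)" .
  have "(\<Sum>j<d. (g i j)\<^sup>2) \<le> 8 * real d * ln (real n / \<beta>)" if g: "g \<in> G'" and i: "i < n" for g i
  proof -
    have gs: "g \<in> space ?M" using g G's sets.sets_into_space by blast
    have "g i \<in> space (std_gaussian d)" using measurable_space[OF measurable_std_sample_row[OF i] gs] .
    moreover have "g i \<notin> B" using g i gs by (auto simp: G'_def A_def)
    ultimately show ?thesis by (auto simp: B_def e_def)
  qed
  moreover have "(\<Sum>j<d. \<Sum>k<d. (cov_dev n g j k)\<^sup>2) \<le> \<tau>\<^sup>2" if "g \<in> G'" for g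
    using that by (intro G(3)) (simp add: G'_def)
  ultimately show ?thesis using em G's by blast
qed

section \<open>Accuracy\<close>

lemma emeasure_bind_le:
  assumes M: "M \<in> space (prob_algebra N)" and f: "f \<in> N \<rightarrow>\<^sub>M prob_algebra R" and B: "B \<in> sets R" and G: "G \<in> sets N"
    and a: "emeasure M (space N - G) \<le> a" and b: "\<And>x. x \<in> G \<Longrightarrow> emeasure (f x) B \<le> b"
  shows "emeasure (M \<bind> f) B \<le> a + b"
proof -
  have sM: "sets M = sets N" "prob_space M" using M by (auto simp: space_prob_algebra)
  have spM: "space M = space N" using sets_eq_imp_space_eq[OF sM(1)] .
  have "emeasure (M \<bind> f) B = (\<integral>\<^sup>+x. emeasure (f x) B \<partial>M)" by (rule emeasure_bind_prob_algebra[OF M f B])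
  also have "\<dots> \<le> (\<integral>\<^sup>+x. indicator (space N - G) x + b \<partial>M)"
  proof (rule nn_integral_mono)
    fix x assume x: "x \<in> space M"
    have "prob_space (f x)" using measurable_space[OF f, of x] x by (simp add: spM space_prob_algebra)
    hence "emeasure (f x) B \<le> 1" by (rule prob_space.emeasure_le_1)
    thus "emeasure (f x) B \<le> indicator (space N - G) x + b"
      using b x by (cases "x \<in> G") (auto simp: spM intro: order_trans add_increasing2)
  qed
  also have "\<dots> = emeasure M (space N - G) + b"
    using G sM by (subst nn_integral_add) (auto simp: prob_space.emeasure_space_1 nn_integral_indicator)
  also have "\<dots> \<le> a + b" by (intro add_mono a order_refl)
  finally show ?thesis .
qed

lemma symmetric_sets: "{N \<in> carrier_mat d d. transpose_mat N = N} \<in> sets (mat_borel d)"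
proof -
  have m: "(\<lambda>N. N $$ (i, j)) \<in> borel_measurable (mat_borel d)" if "i < d" "j < d" for i j
    using that by (rule measurable_mat_entry)
  have "{N \<in> carrier_mat d d. transpose_mat N = N} =
      space (mat_borel d) \<inter> (\<Inter>i\<in>{..<d}. space (mat_borel d) \<inter> (\<Inter>j\<in>{..<d}. {N \<in> space (mat_borel d). N $$ (i, j) = N $$ (j, i)}))"
    (is "?l = ?r")
  proof (intro equalityI subsetI)
    fix N assume N: "N \<in> ?l"
    hence "N $$ (i, j) = N $$ (j, i)" if "i < d" "j < d" for i j
      using that index_transpose_mat(1)[of i N j] by auto
    thus "N \<in> ?r" using N by auto
  next
    fix N assume N: "N \<in> ?r"
    hence c: "N \<in> carrier_mat d d" by simp
    have "transpose_mat N = N" by (rule eq_matI) (use N c in \<open>auto split: if_splits\<close>)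
    thus "N \<in> ?l" using c by simp
  qed
  also have "\<dots> \<in> sets (mat_borel d)"
  proof (cases "d = 0")
    case False
    thus ?thesis by (intro sets.Int sets.top sets.finite_INT borel_measurable_eq m) auto
  qed (use sets.top[of "mat_borel 0"] in simp)
  finally show ?thesis .
qed

text \<open>One noisy call, with \<open>f\<close> the remaining algorithm and \<open>B\<close> its
  failure event: \<open>f\<close> has to be analysed only for symmetric noise of operator norm at
  most \<open>4 * t\<close>, for one fixed input matrix.\<close>

lemma naive_pce_bind_le:
  assumes d: "0 < d" and sd: "noise_sd c\<sigma> d n \<rho> \<beta> \<kappa> \<noteq> 0" and t: "0 < t"
    and f: "f \<in> psd_borel d \<rightarrow>\<^sub>M prob_algebra R" and B: "B \<in> sets R"
    and good: "\<And>N. N \<in> carrier_mat d d \<Longrightarrow> transpose_mat N = N \<Longrightarrow>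
      (\<And>x y. x \<in> carrier_vec d \<Longrightarrow> y \<in> carrier_vec d \<Longrightarrow> \<bar>x \<bullet> (N *\<^sub>v y)\<bar> \<le> 4 * t * vnorm x * vnorm y) \<Longrightarrow>
      emeasure (f (psd_proj d (trunc_cov d n (cS * (real d * \<kappa> * ln (real n / \<beta>))) X + N))) B \<le> b"
  shows "emeasure (naive_pce cS c\<sigma> d n \<rho> \<beta> \<kappa> X \<bind> f) B \<le>
    ennreal (exp (12 * real d - t\<^sup>2 / (4 * (noise_sd c\<sigma> d n \<rho> \<beta> \<kappa>)\<^sup>2))) + b"
proof -
  define v where "v = (noise_sd c\<sigma> d n \<rho> \<beta> \<kappa>)\<^sup>2"
  have v: "0 < v" using sd by (simp add: v_def)
  define E where "E = trunc_cov d n (cS * (real d * \<kappa> * ln (real n / \<beta>))) X"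
  have E: "E \<in> space (mat_borel d)" by (simp add: E_def)
  have pm: "(\<lambda>N. psd_proj d (E + N)) \<in> mat_borel d \<rightarrow>\<^sub>M psd_borel d"
    by (intro measurable_compose[OF measurable_mat_add measurable_psd_proj] measurable_const E measurable_ident)
       simp
  have gp: "gue d v \<in> space (prob_algebra (mat_borel d))" using v by (intro gue_prob_algebra) simp
  have sg: "sets (gue d v) = sets (mat_borel d)" using gp by (simp add: space_prob_algebra)
  have "naive_pce cS c\<sigma> d n \<rho> \<beta> \<kappa> X \<bind> f = gue d v \<bind> (\<lambda>N. return (psd_borel d) (psd_proj d (E + N)) \<bind> f)"
    unfolding naive_pce_altdef v_def[symmetric] E_def[symmetric]
    by (rule bind_assoc[where N="psd_borel d" and R=R])
       (use f measurable_compose[OF pm return_measurable] in \<open>simp_all add: measurable_prob_algebraD measurable_cong_sets[OF sg refl]\<close>)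
  also have "\<dots> = gue d v \<bind> (\<lambda>N. f (psd_proj d (E + N)))"
  proof (rule bind_cong[OF refl])
    fix N assume "N \<in> space (gue d v)"
    hence "psd_proj d (E + N) \<in> space (psd_borel d)"
      using measurable_space[OF pm] sets_eq_imp_space_eq[OF sg] by simp
    thus "return (psd_borel d) (psd_proj d (E + N)) \<bind> f = f (psd_proj d (E + N))"
      by (rule bind_return[OF measurable_prob_algebraD[OF f]])
  qed
  finally have eq: "naive_pce cS c\<sigma> d n \<rho> \<beta> \<kappa> X \<bind> f = gue d v \<bind> (\<lambda>N. f (psd_proj d (E + N)))" .
  obtain G where G: "G \<in> sets (mat_borel d)" "emeasure (gue d v) (carrier_mat d d - G) \<le> ennreal (exp (12 * real d - t\<^sup>2 / (4 * v)))"
      "\<And>N x y. N \<in> G \<Longrightarrow> x \<in> carrier_vec d \<Longrightarrow> y \<in> carrier_vec d \<Longrightarrow> \<bar>x \<bullet> (N *\<^sub>v y)\<bar> \<le> 4 * t * vnorm x * vnorm y"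
    using gue_op_norm[OF d v t] by blast
  define Sy :: "real mat set" where "Sy = {N \<in> carrier_mat d d. transpose_mat N = N}"
  have Sy: "Sy \<in> sets (mat_borel d)" unfolding Sy_def by (rule symmetric_sets)
  \<comment> \<open>The space of \<open>gue\<close> contains all square matrices; symmetry holds
    almost surely since every matrix produced by \<open>sym_of\<close> is symmetric.\<close>
  have "AE N in gue d v. N \<in> Sy"
    unfolding gue_altdef by (subst AE_distr_iff) (use Sy in \<open>auto simp: Sy_def intro!: measurable_sym_of\<close>)
  hence null: "emeasure (gue d v) (carrier_mat d d - Sy) = 0"
    using Sy by (subst (asm) AE_iff_measurable[of "carrier_mat d d - Sy"])
      (auto simp: sg sets_eq_imp_space_eq[OF sg] intro: sets.Diff sets.top[of "mat_borel d", simplified])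
  have "emeasure (gue d v) (space (mat_borel d) - G \<inter> Sy) \<le> emeasure (gue d v) ((carrier_mat d d - G) \<union> (carrier_mat d d - Sy))"
    using G(1) Sy sets.top[of "mat_borel d"] by (intro emeasure_mono) (auto simp: sg)
  also have "\<dots> \<le> emeasure (gue d v) (carrier_mat d d - G) + emeasure (gue d v) (carrier_mat d d - Sy)"
    using G(1) Sy sets.top[of "mat_borel d"] by (intro emeasure_subadditive) (auto simp: sg)
  also have "\<dots> \<le> ennreal (exp (12 * real d - t\<^sup>2 / (4 * v)))" using G(2) null by simp
  finally have "emeasure (gue d v) (space (mat_borel d) - G \<inter> Sy) \<le> ennreal (exp (12 * real d - t\<^sup>2 / (4 * v)))" .
  from emeasure_bind_le[OF gp measurable_compose[OF pm f] B _ this, of b] show ?thesis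
    unfolding eq v_def[symmetric] using G Sy good by (auto simp: E_def Sy_def)
qed

section \<open>The noisy covariance of linearly transformed samples\<close>

definition cov_dev_mat :: "nat \<Rightarrow> nat \<Rightarrow> (nat \<Rightarrow> nat \<Rightarrow> real) \<Rightarrow> real mat" where
  "cov_dev_mat d n g = Matrix.mat d d (\<lambda>(j, k). cov_dev n g j k)"

lemma cov_dev_mat_carrier [simp]: "cov_dev_mat d n g \<in> carrier_mat d d"
  by (simp add: cov_dev_mat_def)

lemma mat_triple_index:
  assumes M: "(M :: real mat) \<in> carrier_mat d d" "V \<in> carrier_mat d d" and jk: "j < d" "k < d"
  shows "(M * V * transpose_mat M) $$ (j, k) = (\<Sum>a<d. \<Sum>b<d. M $$ (j, a) * V $$ (a, b) * M $$ (k, b))"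
proof -
  have "(M * V * transpose_mat M) $$ (j, k) = (\<Sum>b<d. (\<Sum>a<d. M $$ (j, a) * V $$ (a, b)) * M $$ (k, b))"
    using M jk by (simp add: scalar_prod_def lessThan_atLeast0 del: assoc_mult_mat)
  also have "\<dots> = (\<Sum>b<d. \<Sum>a<d. M $$ (j, a) * V $$ (a, b) * M $$ (k, b))" by (simp add: sum_distrib_right)
  also have "\<dots> = (\<Sum>a<d. \<Sum>b<d. M $$ (j, a) * V $$ (a, b) * M $$ (k, b))" by (rule sum.swap)
  finally show ?thesis .
qed

text \<open>When no sample is truncated, the empirical covariance is exactly the conjugate by
  \<open>M\<close> of the empirical covariance of the \<open>g\<close>. The deviation matrix is the
  same for every \<open>M\<close>.\<close>

lemma trunc_cov_linear_image:
  assumes M: "(M :: real mat) \<in> carrier_mat d d" and n: "0 < n"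
    and X: "\<And>i. i < n \<Longrightarrow> X i = M *\<^sub>v Matrix.vec d (g i)" and c: "\<And>i. i < n \<Longrightarrow> X i \<bullet> X i \<le> c"
  shows "trunc_cov d n c X = M * transpose_mat M + M * cov_dev_mat d n g * transpose_mat M"
proof (rule eq_matI)
  fix j k assume "j < dim_row (M * transpose_mat M + M * cov_dev_mat d n g * transpose_mat M)"
    "k < dim_col (M * transpose_mat M + M * cov_dev_mat d n g * transpose_mat M)"
  hence jk: "j < d" "k < d" using M by auto
  have Xj: "X i $ j = (\<Sum>a<d. M $$ (j, a) * g i a)" if "i < n" "j < d" for i j
    using M that by (simp add: X scalar_prod_def lessThan_atLeast0)
  have 1: "M * 1\<^sub>m d * transpose_mat M = M * transpose_mat M" using M by simp
  have "(M * transpose_mat M + M * cov_dev_mat d n g * transpose_mat M) $$ (j, k) =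
      (\<Sum>a<d. \<Sum>b<d. M $$ (j, a) * 1\<^sub>m d $$ (a, b) * M $$ (k, b)) + (\<Sum>a<d. \<Sum>b<d. M $$ (j, a) * cov_dev_mat d n g $$ (a, b) * M $$ (k, b))"
    unfolding mat_triple_index[OF M one_carrier_mat jk, symmetric] mat_triple_index[OF M cov_dev_mat_carrier jk, symmetric] 1
    using M jk by (intro index_add_mat(1)) auto
  also have "\<dots> = (\<Sum>a<d. \<Sum>b<d. M $$ (j, a) * ((\<Sum>i<n. g i a * g i b) / real n) * M $$ (k, b))"
    unfolding sum.distrib[symmetric]
    by (intro sum.cong refl) (simp add: cov_dev_mat_def cov_dev_def algebra_simps)
  also have "\<dots> = (\<Sum>a<d. \<Sum>b<d. \<Sum>i<n. M $$ (j, a) * g i a * (M $$ (k, b) * g i b)) / real n"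
    unfolding sum_divide_distrib by (intro sum.cong refl) (simp add: sum_distrib_left sum_distrib_right sum_divide_distrib mult_ac)
  also have "(\<Sum>a<d. \<Sum>b<d. \<Sum>i<n. M $$ (j, a) * g i a * (M $$ (k, b) * g i b)) =
      (\<Sum>i<n. \<Sum>a<d. \<Sum>b<d. M $$ (j, a) * g i a * (M $$ (k, b) * g i b))"
    by (simp add: sum.swap[of _ "{..<n}"])
  also have "\<dots> = (\<Sum>i<n. X i $ j * X i $ k)"
    using jk by (intro sum.cong refl) (simp add: Xj sum_product)
  also have "\<dots> / real n = trunc_cov d n c X $$ (j, k)" using jk c by (simp add: trunc_cov_index)
  finally show "trunc_cov d n c X $$ (j, k) = (M * transpose_mat M + M * cov_dev_mat d n g * transpose_mat M) $$ (j, k)" by simp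
qed (use M in auto)

lemma frob_norm_L2_set: "A \<in> carrier_mat d d \<Longrightarrow> frob_norm A = L2_set (\<lambda>p. A $$ p) ({..<d} \<times> {..<d})"
  by (simp add: frob_norm_def L2_set_def sum.cartesian_product case_prod_unfold)

lemma frob_norm_triangle:
  assumes "A \<in> carrier_mat d d" "B \<in> carrier_mat d d"
  shows "frob_norm (A + B) \<le> frob_norm A + frob_norm B"
proof -
  have "frob_norm (A + B) = L2_set (\<lambda>p. A $$ p + B $$ p) ({..<d} \<times> {..<d})"
    using assms unfolding frob_norm_L2_set[OF add_carrier_mat[OF assms(2)], of A] L2_set_def
    by (intro arg_cong[where f=sqrt] sum.cong refl) auto
  also have "\<dots> \<le> L2_set (\<lambda>p. A $$ p) ({..<d} \<times> {..<d}) + L2_set (\<lambda>p. B $$ p) ({..<d} \<times> {..<d})"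
    by (rule L2_set_triangle_ineq)
  finally show ?thesis using assms by (simp add: frob_norm_L2_set[of _ d])
qed

lemma vnorm_mult_le_frob_norm:
  assumes A: "A \<in> carrier_mat d d" and x: "x \<in> carrier_vec d"
  shows "vnorm (A *\<^sub>v x) \<le> frob_norm A * vnorm x"
proof (rule power2_le_imp_le)
  have "(vnorm (A *\<^sub>v x))\<^sup>2 = (\<Sum>i<d. (\<Sum>j<d. A $$ (i, j) * x $ j)\<^sup>2)"
    using A x unfolding vnorm_sq by (subst scalar_prod_self_sum[where d=d]) (auto simp: scalar_prod_def lessThan_atLeast0)
  also have "\<dots> \<le> (\<Sum>i<d. (\<Sum>j<d. (A $$ (i, j))\<^sup>2) * (\<Sum>j<d. (x $ j)\<^sup>2))"
    by (intro sum_mono Cauchy_Schwarz_ineq_sum)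
  also have "\<dots> = (frob_norm A * vnorm x)\<^sup>2"
    using A unfolding power_mult_distrib vnorm_sq scalar_prod_self_sum[OF x]
    by (simp add: frob_norm_def sum_nonneg sum_distrib_right)
  finally show "(vnorm (A *\<^sub>v x))\<^sup>2 \<le> (frob_norm A * vnorm x)\<^sup>2" .
qed simp

text \<open>Pairing a column with its unit vector bounds each column by \<open>e\<close>. The factor
  \<open>sqrt d\<close> lost here is why the final call needs d^2 samples where a round needs only
  the power 3/2.\<close>

lemma frob_norm_le_op:
  assumes N: "N \<in> carrier_mat d d" and e: "0 \<le> e"
    and op: "\<And>x y. x \<in> carrier_vec d \<Longrightarrow> y \<in> carrier_vec d \<Longrightarrow> \<bar>x \<bullet> (N *\<^sub>v y)\<bar> \<le> e * vnorm x * vnorm y"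
  shows "frob_norm N \<le> sqrt (real d) * e"
proof (rule power2_le_imp_le)
  have "col N j \<bullet> col N j \<le> e\<^sup>2" if j: "j < d" for j
  proof -
    have c: "col N j \<in> carrier_vec d" using N by auto
    have Ne: "N *\<^sub>v unit_vec d j = col N j"
      using N j by (intro eq_vecI) (auto simp: scalar_prod_right_unit)
    have u: "vnorm (unit_vec d j) = 1" using j by (simp add: vnorm_def)
    have "(vnorm (col N j))\<^sup>2 \<le> e * vnorm (col N j)"
      using op[OF c unit_vec_carrier[of d j]] by (simp add: Ne u vnorm_sq)
    hence "vnorm (col N j) \<le> e"
      using e by (cases "vnorm (col N j) = 0") (auto simp: power2_eq_square mult_le_cancel_right less_le)
    from power_mono[OF this, of 2] show ?thesis by (simp add: vnorm_sq)
  qed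
  hence "(\<Sum>j<d. col N j \<bullet> col N j) \<le> (\<Sum>j<d. e\<^sup>2)" by (intro sum_mono) simp
  thus "(frob_norm N)\<^sup>2 \<le> (sqrt (real d) * e)\<^sup>2" by (simp add: frob_norm_sq_cols[OF N] power_mult_distrib)
qed (use e in simp)

text \<open>Two-sided bounds for the covariance \<open>M * transpose_mat M\<close> of the current
  data. They are stated through the transpose, which plays the part of \<open>G\<close> in
  \<open>precond_step_invariant\<close>.\<close>

definition well_cond :: "nat \<Rightarrow> real \<Rightarrow> real mat \<Rightarrow> bool" where
  "well_cond d \<kappa> M \<longleftrightarrow> M \<in> carrier_mat d d \<and> (\<forall>x\<in>carrier_vec d.
    x \<bullet> x \<le> 2000 * ((transpose_mat M *\<^sub>v x) \<bullet> (transpose_mat M *\<^sub>v x)) \<and>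
    (transpose_mat M *\<^sub>v x) \<bullet> (transpose_mat M *\<^sub>v x) \<le> \<kappa> * (x \<bullet> x))"

lemma well_cond_norm:
  assumes W: "well_cond d \<kappa> M" and k: "0 \<le> \<kappa>" and x: "x \<in> carrier_vec d"
  shows "vnorm (transpose_mat M *\<^sub>v x) \<le> sqrt \<kappa> * vnorm x" "vnorm (M *\<^sub>v x) \<le> sqrt \<kappa> * vnorm x"
proof -
  have M: "M \<in> carrier_mat d d" using W by (simp add: well_cond_def)
  have 1: "vnorm (transpose_mat M *\<^sub>v x) \<le> sqrt \<kappa> * vnorm x" if "x \<in> carrier_vec d" for x
    unfolding vnorm_def real_sqrt_mult[symmetric] using W that by (intro real_sqrt_le_mono) (simp add: well_cond_def)
  show "vnorm (transpose_mat M *\<^sub>v x) \<le> sqrt \<kappa> * vnorm x" by (rule 1[OF x])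
  have "vnorm (transpose_mat (transpose_mat M) *\<^sub>v x) \<le> sqrt \<kappa> * vnorm x"
    using M k by (intro transpose_op_bound[OF _ _ 1 x]) auto
  thus "vnorm (M *\<^sub>v x) \<le> sqrt \<kappa> * vnorm x" using M by simp
qed

text \<open>The constant 8 in the truncation radius is that of the tail bound for the standard
  normal vectors. The algorithm may use a larger \<open>\<kappa>'\<close> than the true bound: the
  final call uses 1000 although the data are then bounded by 1.\<close>

lemma trunc_cov_well_cond:
  assumes W: "well_cond d \<kappa> M" and k: "0 \<le> \<kappa>" "\<kappa> \<le> \<kappa>'" and n: "0 < n"
    and X: "\<And>i. i < n \<Longrightarrow> X i = M *\<^sub>v Matrix.vec d (g i)"
    and g: "\<And>i. i < n \<Longrightarrow> (\<Sum>j<d. (g i j)\<^sup>2) \<le> 8 * real d * l" and l: "0 \<le> l"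
  shows "trunc_cov d n (8 * (real d * \<kappa>' * l)) X = M * transpose_mat M + M * cov_dev_mat d n g * transpose_mat M"
proof (rule trunc_cov_linear_image[OF _ n X])
  show "M \<in> carrier_mat d d" using W by (simp add: well_cond_def)
  fix i assume i: "i < n"
  have v: "Matrix.vec d (g i) \<in> carrier_vec d" by simp
  have "X i \<bullet> X i = (vnorm (M *\<^sub>v Matrix.vec d (g i)))\<^sup>2" by (simp add: X[OF i] vnorm_sq)
  also have "\<dots> \<le> (sqrt \<kappa> * vnorm (Matrix.vec d (g i)))\<^sup>2" using well_cond_norm(2)[OF W k(1) v] by (intro power_mono) auto
  also have "\<dots> = \<kappa> * (\<Sum>j<d. (g i j)\<^sup>2)"
    using k by (simp add: power_mult_distrib vnorm_sq scalar_prod_self_sum[OF v])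
  also have "\<dots> \<le> \<kappa>' * (8 * real d * l)" using k g[OF i] by (intro mult_mono) (auto intro: sum_nonneg)
  finally show "X i \<bullet> X i \<le> 8 * (real d * \<kappa>' * l)" by (simp add: mult_ac)
qed

lemma psd_gram: "(M :: real mat) \<in> carrier_mat d d \<Longrightarrow> M * transpose_mat M \<in> psd_cone d"
proof -
  assume M: "M \<in> carrier_mat d d"
  have "x \<bullet> ((M * transpose_mat M) *\<^sub>v x) = (transpose_mat M *\<^sub>v x) \<bullet> (transpose_mat M *\<^sub>v x)" if x: "x \<in> carrier_vec d" for x
    using M x transpose_vec_mult_scalar[of M d d "transpose_mat M *\<^sub>v x" x] by (simp add: assoc_mult_mat_vec[where n\<^sub>1=d and n\<^sub>2=d and n\<^sub>3=d])
  moreover have "transpose_mat (M * transpose_mat M) = M * transpose_mat M"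
    using M by (simp add: transpose_mult[where nr=d and n=d and nc=d])
  ultimately show ?thesis using M by (simp add: psd_cone_def scalar_prod_self_nonneg)
qed

lemma bilinear_adjoint:
  assumes "(M :: real mat) \<in> carrier_mat d d" "x \<in> carrier_vec d" "y \<in> carrier_vec d"
  shows "x \<bullet> (M *\<^sub>v y) = (transpose_mat M *\<^sub>v x) \<bullet> y"
  using transpose_vec_mult_scalar[OF assms(1) assms(3) assms(2)] by simp

text \<open>Conjugation by \<open>M\<close> turns a deviation of norm \<tau> into one of norm
  \<open>\<tau> * \<kappa>\<close>, relative to the current scale; the factor 2 is the price of the
  projection in \<open>psd_proj_op_le\<close>.\<close>

lemma noisy_cov_close:
  assumes W: "well_cond d \<kappa> M" and k: "0 \<le> \<kappa>" and V: "V \<in> carrier_mat d d" "transpose_mat V = V" "frob_norm V \<le> \<tau>"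
    and N: "N \<in> carrier_mat d d" "transpose_mat N = N"
    and op: "\<And>x y. x \<in> carrier_vec d \<Longrightarrow> y \<in> carrier_vec d \<Longrightarrow> \<bar>x \<bullet> (N *\<^sub>v y)\<bar> \<le> e * vnorm x * vnorm y" and e: "0 \<le> e"
    and x: "x \<in> carrier_vec d" and y: "y \<in> carrier_vec d"
  shows "\<bar>x \<bullet> (psd_proj d (M * transpose_mat M + M * V * transpose_mat M + N) *\<^sub>v y) -
    (transpose_mat M *\<^sub>v x) \<bullet> (transpose_mat M *\<^sub>v y)\<bar> \<le> 2 * (\<tau> * \<kappa> + e) * vnorm x * vnorm y"
proof -
  have M: "M \<in> carrier_mat d d" using W by (simp add: well_cond_def)
  define Mt where "Mt = transpose_mat M"
  have Mt: "Mt \<in> carrier_mat d d" using M by (simp add: Mt_def)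
  define P where "P = M * Mt + M * V * Mt + N"
  have P: "P \<in> carrier_mat d d" using M Mt V N by (simp add: P_def)
  have "transpose_mat (M * V * Mt) = M * V * Mt"
    using M Mt V by (simp add: transpose_mult[where nr=d and n=d and nc=d] Mt_def assoc_mult_mat[where n\<^sub>1=d and n\<^sub>2=d and n\<^sub>3=d and n\<^sub>4=d])
  hence Pt: "transpose_mat P = P"
    using M Mt V N unfolding P_def
    by (simp add: transpose_add[where nr=d and nc=d] transpose_mult[where nr=d and n=d and nc=d] Mt_def)
  have \<tau>: "0 \<le> \<tau>" using V(3) frob_norm_nonneg[of V] by linarith
  have gram: "u \<bullet> ((M * Mt) *\<^sub>v w) = (Mt *\<^sub>v u) \<bullet> (Mt *\<^sub>v w)" if "u \<in> carrier_vec d" "w \<in> carrier_vec d" for u w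
    using bilinear_adjoint[OF M that(1), of "Mt *\<^sub>v w"] M Mt that by (simp add: assoc_mult_mat_vec[where n\<^sub>1=d and n\<^sub>2=d and n\<^sub>3=d] Mt_def)
  have close: "\<bar>u \<bullet> (P *\<^sub>v w) - u \<bullet> ((M * Mt) *\<^sub>v w)\<bar> \<le> (\<tau> * \<kappa> + e) * vnorm u * vnorm w"
    if u: "u \<in> carrier_vec d" and w: "w \<in> carrier_vec d" for u w
  proof -
    have c: "Mt *\<^sub>v u \<in> carrier_vec d" "Mt *\<^sub>v w \<in> carrier_vec d" "V *\<^sub>v (Mt *\<^sub>v w) \<in> carrier_vec d" using Mt V u w by auto
    have "u \<bullet> (P *\<^sub>v w) = u \<bullet> ((M * Mt) *\<^sub>v w) + u \<bullet> ((M * V * Mt) *\<^sub>v w) + u \<bullet> (N *\<^sub>v w)"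
    proof -
      have c: "M * Mt \<in> carrier_mat d d" "M * V * Mt \<in> carrier_mat d d" using M Mt V by auto
      have v: "(M * Mt) *\<^sub>v w \<in> carrier_vec d" "(M * V * Mt) *\<^sub>v w \<in> carrier_vec d" "N *\<^sub>v w \<in> carrier_vec d"
        using c N w by (auto intro!: mult_mat_vec_carrier)
      show ?thesis
        unfolding P_def add_mult_distrib_mat_vec[OF add_carrier_mat[OF c(2)] N(1) w] add_mult_distrib_mat_vec[OF c w]
          scalar_prod_add_distrib[OF u add_carrier_vec[OF v(1,2)] v(3)] scalar_prod_add_distrib[OF u v(1,2)] ..
    qed
    moreover have "u \<bullet> ((M * V * Mt) *\<^sub>v w) = (Mt *\<^sub>v u) \<bullet> (V *\<^sub>v (Mt *\<^sub>v w))"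
      using bilinear_adjoint[OF M u c(3)] mat_assoc_vec3[OF M V(1) Mt w] by (simp add: Mt_def)
    moreover have "\<bar>(Mt *\<^sub>v u) \<bullet> (V *\<^sub>v (Mt *\<^sub>v w))\<bar> \<le> \<tau> * \<kappa> * vnorm u * vnorm w"
    proof -
      have "\<bar>(Mt *\<^sub>v u) \<bullet> (V *\<^sub>v (Mt *\<^sub>v w))\<bar> \<le> vnorm (Mt *\<^sub>v u) * vnorm (V *\<^sub>v (Mt *\<^sub>v w))"
        by (rule vnorm_Cauchy_Schwarz[OF c(1,3)])
      also have "\<dots> \<le> vnorm (Mt *\<^sub>v u) * (\<tau> * vnorm (Mt *\<^sub>v w))"
        using order_trans[OF vnorm_mult_le_frob_norm[OF V(1) c(2)] mult_right_mono[OF V(3) vnorm_nonneg]]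
        by (intro mult_left_mono) auto
      also have "\<dots> \<le> (sqrt \<kappa> * vnorm u) * (\<tau> * (sqrt \<kappa> * vnorm w))"
        using well_cond_norm(1)[OF W k u] well_cond_norm(1)[OF W k w] \<tau> k by (intro mult_mono) (auto simp: Mt_def)
      also have "\<dots> = \<tau> * (sqrt \<kappa> * sqrt \<kappa>) * vnorm u * vnorm w" by (simp only: mult_ac)
      finally show ?thesis using k by simp
    qed
    ultimately show ?thesis using op[OF u w] by (simp add: algebra_simps)
  qed
  have "\<bar>x \<bullet> (psd_proj d P *\<^sub>v y) - x \<bullet> ((M * Mt) *\<^sub>v y)\<bar> \<le> 2 * (\<tau> * \<kappa> + e) * vnorm x * vnorm y"
    using \<tau> k e psd_gram[OF M] by (intro psd_proj_op_le[OF P Pt _ _ close x y]) (auto simp: Mt_def)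
  thus ?thesis using gram[OF x y] by (simp add: P_def Mt_def)
qed

text \<open>A preconditioner is symmetric, so the transpose of the new product applies it first and
  then the old transpose. This is the composition treated in \<open>precond_step_invariant\<close>,
  with \<open>G = transpose_mat M\<close>.\<close>

lemma well_cond_round:
  assumes W: "well_cond d \<kappa> M" and k: "1 \<le> \<kappa>" and Z: "Z \<in> psd_cone d"
    and close: "\<And>x y. x \<in> carrier_vec d \<Longrightarrow> y \<in> carrier_vec d \<Longrightarrow>
      \<bar>x \<bullet> (Z *\<^sub>v y) - (transpose_mat M *\<^sub>v x) \<bullet> (transpose_mat M *\<^sub>v y)\<bar> \<le> 0.01 * \<kappa> * vnorm x * vnorm y"
  shows "well_cond d (0.7 * \<kappa>) (precond_step d 20 \<kappa> Z * M)"
proof -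
  have M: "M \<in> carrier_mat d d" "transpose_mat M \<in> carrier_mat d d" using W by (auto simp: well_cond_def)
  note A = precond_step_symmetric[OF Z, of 20 \<kappa>]
  have t: "transpose_mat (precond_step d 20 \<kappa> Z * M) *\<^sub>v z = transpose_mat M *\<^sub>v (precond_step d 20 \<kappa> Z *\<^sub>v z)"
    if "z \<in> carrier_vec d" for z
    unfolding transpose_mult[OF A(1) M(1)] A(2) using assoc_mult_mat_vec[OF M(2) A(1) that] .
  have W1: "x \<bullet> x \<le> 2000 * ((transpose_mat M *\<^sub>v x) \<bullet> (transpose_mat M *\<^sub>v x))"
    and W2: "(transpose_mat M *\<^sub>v x) \<bullet> (transpose_mat M *\<^sub>v x) \<le> \<kappa> * (x \<bullet> x)" if "x \<in> carrier_vec d" for x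
    using W that by (auto simp: well_cond_def)
  show ?thesis
    using precond_step_invariant[OF M(2) Z k W1 W2 close] A(1) M(1) unfolding well_cond_def by (simp add: t)
qed

text \<open>
  The failure probability for noise of operator norm at most \<open>\<kappa> / 250\<close>. The constant is \<open>4 \<cdot> 16\<^sup>2 \<cdot> 1000\<^sup>2\<close>,
  where \<open>16\<close> is the constant of the noise level; the factor \<open>\<kappa>\<close> cancels.
\<close>
definition round_fail :: "nat \<Rightarrow> nat \<Rightarrow> real \<Rightarrow> real \<Rightarrow> real" where
  "round_fail d n \<rho> \<beta> = exp (12 * real d - (real n * sqrt \<rho> / (real d * ln (real n / \<beta>)))\<^sup>2 / 1024000000)"

lemma cov_dev_mat_transpose [simp]: "transpose_mat (cov_dev_mat d n g) = cov_dev_mat d n g"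
  by (rule eq_matI) (auto simp: cov_dev_mat_def cov_dev_def mult.commute)

lemma bind_return_compose:
  assumes P: "P \<in> space (prob_algebra N)" and h: "h \<in> N \<rightarrow>\<^sub>M K" and f: "f \<in> K \<rightarrow>\<^sub>M prob_algebra R"
  shows "(P \<bind> (\<lambda>x. return K (h x))) \<bind> f = P \<bind> (\<lambda>x. f (h x))"
proof -
  have sP: "sets P = sets N" using P by (simp add: space_prob_algebra)
  have "(P \<bind> (\<lambda>x. return K (h x))) \<bind> f = P \<bind> (\<lambda>x. return K (h x) \<bind> f)"
    by (rule bind_assoc[where N=K and R=R])
       (use measurable_compose[OF h return_measurable] measurable_prob_algebraD[OF f] in \<open>simp_all add: measurable_cong_sets[OF sP refl]\<close>)
  also have "\<dots> = P \<bind> (\<lambda>x. f (h x))"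
  proof (rule bind_cong[OF refl])
    fix x assume "x \<in> space P"
    hence "h x \<in> space K" using measurable_space[OF h] sets_eq_imp_space_eq[OF sP] by simp
    thus "return K (h x) \<bind> f = f (h x)" by (rule bind_return[OF measurable_prob_algebraD[OF f]])
  qed
  finally show ?thesis .
qed

text \<open>The continuation \<open>f\<close> is arbitrary because the recursion multiplies the
  later factors by the current one from the right: the induction hypothesis is used with
  \<open>f\<close> precomposed with that multiplication. The matrix \<open>M\<close> collects the
  Cholesky factor and all earlier preconditioners. The exponent \<open>t - 1\<close> asks for
  \<kappa> at least 1 before the last round, hence before every round.\<close>

lemma ppc_rounds_bind_le:
  assumes d: "0 < d" and n: "0 < n" and \<rho>: "0 < \<rho>" and l: "0 < ln (real n / \<beta>)"
    and V: "frob_norm (cov_dev_mat d n g) \<le> 0.001"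
    and g: "\<And>i. i < n \<Longrightarrow> (\<Sum>j<d. (g i j)\<^sup>2) \<le> 8 * real d * ln (real n / \<beta>)"
    and B: "B \<in> sets R"
  shows "\<lbrakk>\<And>i. i < n \<Longrightarrow> X i = M *\<^sub>v Matrix.vec d (g i); well_cond d \<kappa> M; 0 < t \<Longrightarrow> 1 \<le> 0.7 ^ (t - 1) * \<kappa>;
      f \<in> mat_borel d \<rightarrow>\<^sub>M prob_algebra R;
      \<And>C. C \<in> carrier_mat d d \<Longrightarrow> well_cond d (0.7 ^ t * \<kappa>) (C * M) \<Longrightarrow> emeasure (f C) B \<le> b\<rbrakk> \<Longrightarrow>
    emeasure (ppc_rounds 8 16 20 d n \<rho> \<beta> t \<kappa> X \<bind> f) B \<le> ennreal (real t * round_fail d n \<rho> \<beta>) + b"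
proof (induction t arbitrary: X M \<kappa> f)
  case 0
  have "M \<in> carrier_mat d d" using 0(2) by (simp add: well_cond_def)
  hence "emeasure (f (1\<^sub>m d)) B \<le> b" using 0(2) by (intro 0(5)) auto
  moreover have "return (mat_borel d) (1\<^sub>m d) \<bind> f = f (1\<^sub>m d)"
    by (rule bind_return[OF measurable_prob_algebraD[OF 0(4)]]) simp
  ultimately show ?case by simp
next
  case (Suc t)
  note X = Suc.prems(1) and W = Suc.prems(2) and f = Suc.prems(4) and good = Suc.prems(5)
  have M: "M \<in> carrier_mat d d" using W by (simp add: well_cond_def)
  have "0.7 ^ t * \<kappa> \<le> 1 * \<kappa> \<or> \<kappa> \<le> 0" by (cases "0 \<le> \<kappa>") (auto intro!: mult_right_mono power_le_one)
  moreover have "0.7 ^ t * \<kappa> \<le> 0" if "\<kappa> \<le> 0" using that by (intro mult_nonneg_nonpos) auto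
  ultimately have k: "1 \<le> \<kappa>" using Suc.prems(3) by auto
  define A where "A = precond_step d 20 \<kappa>"
  define h where "h = (\<lambda>Z. ppc_rounds 8 16 20 d n \<rho> \<beta> t (0.7 * \<kappa>) (\<lambda>i. A Z *\<^sub>v X i) \<bind> (\<lambda>C. return (mat_borel d) (C * A Z)))"
  have Xc: "X i \<in> carrier_vec d" if "i < n" for i using X[OF that] M by (auto intro: mult_mat_vec_carrier)
  have Ac: "A Z \<in> carrier_mat d d" if "Z \<in> psd_cone d" for Z unfolding A_def by (rule precond_step_symmetric(1)[OF that])
  have hm: "h \<in> psd_borel d \<rightarrow>\<^sub>M prob_algebra (mat_borel d)"
  proof (rule measurable_eqI)
    have "restrict X {..<n} \<in> space (data_space d n)" using Xc by (auto simp: space_data_space)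
    hence "(\<lambda>Z. (restrict X {..<n}, Z)) \<in> psd_borel d \<rightarrow>\<^sub>M data_space d n \<Otimes>\<^sub>M psd_borel d" by simp
    from measurable_compose[OF this measurable_ppc_step[OF measurable_ppc_rounds, of 8 16 20 d n \<rho> \<beta> t \<kappa>]]
    show "(\<lambda>Z. ppc_rounds 8 16 20 d n \<rho> \<beta> t (0.7 * \<kappa>) (\<lambda>i. A Z *\<^sub>v restrict X {..<n} i) \<bind> (\<lambda>C. return (mat_borel d) (C * A Z)))
        \<in> psd_borel d \<rightarrow>\<^sub>M prob_algebra (mat_borel d)"
      by (simp add: A_def)
    show "h Z = ppc_rounds 8 16 20 d n \<rho> \<beta> t (0.7 * \<kappa>) (\<lambda>i. A Z *\<^sub>v restrict X {..<n} i) \<bind> (\<lambda>C. return (mat_borel d) (C * A Z))" for Z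
      unfolding h_def by (intro arg_cong2[where f=bind] ppc_rounds_cong refl) simp
  qed
  have np: "naive_pce 8 16 d n \<rho> \<beta> \<kappa> X \<in> space (prob_algebra (psd_borel d))" by (rule naive_pce_prob_algebra[OF Xc])
  hence ns: "sets (naive_pce 8 16 d n \<rho> \<beta> \<kappa> X) = sets (psd_borel d)" by (simp add: space_prob_algebra)
  have "ppc_rounds 8 16 20 d n \<rho> \<beta> (Suc t) \<kappa> X \<bind> f = (naive_pce 8 16 d n \<rho> \<beta> \<kappa> X \<bind> h) \<bind> f"
    by (simp add: h_def[abs_def] Let_def A_def)
  also have "\<dots> = naive_pce 8 16 d n \<rho> \<beta> \<kappa> X \<bind> (\<lambda>Z. h Z \<bind> f)"
    by (rule bind_assoc[where N="mat_borel d" and R=R])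
       (use measurable_prob_algebraD[OF hm] measurable_prob_algebraD[OF f] in \<open>simp_all add: measurable_cong_sets[OF ns refl]\<close>)
  finally have eq: "ppc_rounds 8 16 20 d n \<rho> \<beta> (Suc t) \<kappa> X \<bind> f = naive_pce 8 16 d n \<rho> \<beta> \<kappa> X \<bind> (\<lambda>Z. h Z \<bind> f)" .
  define \<sigma> where "\<sigma> = noise_sd 16 d n \<rho> \<beta> \<kappa>"
  have \<sigma>: "\<sigma> = 16 * \<kappa> / (real n * sqrt \<rho> / (real d * ln (real n / \<beta>)))" by (simp add: \<sigma>_def noise_sd_def)
  have s0: "\<sigma> \<noteq> 0" unfolding \<sigma> using k n \<rho> l d by simp
  have "emeasure (naive_pce 8 16 d n \<rho> \<beta> \<kappa> X \<bind> (\<lambda>Z. h Z \<bind> f)) B \<le>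
      ennreal (exp (12 * real d - (\<kappa> / 1000)\<^sup>2 / (4 * \<sigma>\<^sup>2))) + (ennreal (real t * round_fail d n \<rho> \<beta>) + b)"
    unfolding \<sigma>_def
  proof (rule naive_pce_bind_le[OF d])
    show "noise_sd 16 d n \<rho> \<beta> \<kappa> \<noteq> 0" using s0 by (simp add: \<sigma>_def)
    show "0 < \<kappa> / 1000" using k by simp
    show "(\<lambda>Z. h Z \<bind> f) \<in> psd_borel d \<rightarrow>\<^sub>M prob_algebra R" by (rule measurable_bind_prob_space[OF hm f])
    show "B \<in> sets R" by (rule B)
    fix N assume N: "N \<in> carrier_mat d d" "transpose_mat N = N"
      and op: "\<And>x y. x \<in> carrier_vec d \<Longrightarrow> y \<in> carrier_vec d \<Longrightarrow> \<bar>x \<bullet> (N *\<^sub>v y)\<bar> \<le> 4 * (\<kappa> / 1000) * vnorm x * vnorm y"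
    have E: "trunc_cov d n (8 * (real d * \<kappa> * ln (real n / \<beta>))) X = M * transpose_mat M + M * cov_dev_mat d n g * transpose_mat M"
      by (rule trunc_cov_well_cond[OF W _ _ n X g]) (use k l in auto)
    define Z where "Z = psd_proj d (trunc_cov d n (8 * (real d * \<kappa> * ln (real n / \<beta>))) X + N)"
    have Z: "Z \<in> psd_cone d" unfolding Z_def using N by (intro psd_proj_psd) simp
    \<comment> \<open>Sample deviation 0.001 and noise \<open>4 * \<kappa> / 1000\<close> give 2 *
      (0.001 + 0.004) = 0.01, the error that \<open>well_cond_round\<close> tolerates.\<close>
    have close: "\<bar>x \<bullet> (Z *\<^sub>v y) - (transpose_mat M *\<^sub>v x) \<bullet> (transpose_mat M *\<^sub>v y)\<bar> \<le> 0.01 * \<kappa> * vnorm x * vnorm y"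
      if "x \<in> carrier_vec d" "y \<in> carrier_vec d" for x y
      using noisy_cov_close[OF W _ cov_dev_mat_carrier cov_dev_mat_transpose V N op _ that] k
      unfolding Z_def E by (simp add: algebra_simps)
    have W': "well_cond d (0.7 * \<kappa>) (A Z * M)" unfolding A_def by (rule well_cond_round[OF W k Z close])
    have mult: "(\<lambda>C. C * A Z) \<in> mat_borel d \<rightarrow>\<^sub>M mat_borel d"
      using Ac[OF Z] by (intro measurable_mat_mult measurable_ident measurable_const) auto
    have AX: "A Z *\<^sub>v X i \<in> carrier_vec d" if "i < n" for i using Ac[OF Z] Xc[OF that] by (auto intro: mult_mat_vec_carrier)
    have "h Z \<bind> f = ppc_rounds 8 16 20 d n \<rho> \<beta> t (0.7 * \<kappa>) (\<lambda>i. A Z *\<^sub>v X i) \<bind> (\<lambda>C. f (C * A Z))"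
      unfolding h_def by (rule bind_return_compose[OF ppc_rounds_prob_algebra mult f]) (use AX in auto)
    moreover have "emeasure (ppc_rounds 8 16 20 d n \<rho> \<beta> t (0.7 * \<kappa>) (\<lambda>i. A Z *\<^sub>v X i) \<bind> (\<lambda>C. f (C * A Z))) B
        \<le> ennreal (real t * round_fail d n \<rho> \<beta>) + b"
    proof (rule Suc.IH[OF _ W'])
      show "A Z *\<^sub>v X i = (A Z * M) *\<^sub>v Matrix.vec d (g i)" if "i < n" for i
        using Ac[OF Z] M X[OF that] by (simp add: assoc_mult_mat_vec[where n\<^sub>1=d and n\<^sub>2=d and n\<^sub>3=d])
      show "1 \<le> 0.7 ^ (t - 1) * (0.7 * \<kappa>)" if "0 < t"
        using Suc.prems(3) that by (cases t) (auto simp: mult_ac)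
      show "(\<lambda>C. f (C * A Z)) \<in> mat_borel d \<rightarrow>\<^sub>M prob_algebra R" by (rule measurable_compose[OF mult f])
      fix C assume C: "C \<in> carrier_mat d d" "well_cond d (0.7 ^ t * (0.7 * \<kappa>)) (C * (A Z * M))"
      thus "emeasure (f (C * A Z)) B \<le> b"
        using assoc_mult_mat[OF C(1) Ac[OF Z] M] Ac[OF Z] by (intro good) (auto simp: mult_ac)
    qed
    ultimately show "emeasure (h (psd_proj d (trunc_cov d n (8 * (real d * \<kappa> * ln (real n / \<beta>))) X + N)) \<bind> f) B
        \<le> ennreal (real t * round_fail d n \<rho> \<beta>) + b" by (simp add: Z_def)
  qed
  also have "exp (12 * real d - (\<kappa> / 1000)\<^sup>2 / (4 * \<sigma>\<^sup>2)) = round_fail d n \<rho> \<beta>"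
    unfolding \<sigma> round_fail_def using k by (simp add: power_divide power_mult_distrib)
  also have "ennreal (round_fail d n \<rho> \<beta>) + (ennreal (real t * round_fail d n \<rho> \<beta>) + b) =
      ennreal (real (Suc t) * round_fail d n \<rho> \<beta>) + b"
    by (simp add: round_fail_def add.assoc[symmetric] ennreal_plus[symmetric] algebra_simps del: ennreal_plus)
  finally show ?case unfolding eq .
qed

lemma measurable_rel_norm_diff:
  assumes S: "S \<in> psd_cone d"
  shows "(\<lambda>S'. rel_norm d S (S - S')) \<in> borel_measurable (mat_borel d)"
proof -
  have Sc: "S \<in> carrier_mat d d" using S by (simp add: psd_cone_def)
  define R where "R = inv_mat d (mat_sqrt d S)"
  have R: "R \<in> carrier_mat d d"
    using measurable_space[OF measurable_inv_mat, of "mat_sqrt d S" d] mat_sqrt(1)[OF S] by (simp add: R_def psd_cone_def)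
  have "(\<lambda>S'. S - S') \<in> mat_borel d \<rightarrow>\<^sub>M mat_borel d"
  proof (rule measurable_mat_borelI)
    fix i j assume ij: "i < d" "j < d"
    show "(\<lambda>S'. (S - S') $$ (i, j)) \<in> borel_measurable (mat_borel d)"
    proof (rule measurable_eqI)
      show "(\<lambda>S'. S $$ (i, j) - S' $$ (i, j)) \<in> borel_measurable (mat_borel d)"
        by (intro borel_measurable_diff borel_measurable_const measurable_mat_entry ij)
    qed (use Sc ij in auto)
  qed (use Sc in auto)
  hence m: "(\<lambda>S'. R * (S - S') * R) \<in> mat_borel d \<rightarrow>\<^sub>M mat_borel d"
    using R by (intro measurable_mat_mult) (auto intro: measurable_const)
  show ?thesis
  proof (rule measurable_eqI)
    show "(\<lambda>S'. sqrt (\<Sum>i<d. \<Sum>j<d. ((R * (S - S') * R) $$ (i, j))\<^sup>2)) \<in> borel_measurable (mat_borel d)"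
      using measurable_mat_entry'[OF m]
      by (intro measurable_compose[OF _ borel_measurable_sqrt] borel_measurable_sum borel_measurable_power) auto
    fix S' assume "S' \<in> space (mat_borel d)"
    hence c: "R * (S - S') * R \<in> carrier_mat d d" using R Sc by auto
    show "rel_norm d S (S - S') = sqrt (\<Sum>i<d. \<Sum>j<d. ((R * (S - S') * R) $$ (i, j))\<^sup>2)"
      unfolding rel_norm_def Let_def R_def[symmetric] frob_norm_def carrier_matD[OF c] ..
  qed
qed

text \<open>
  The failure probability for noise of operator norm at most \<open>\<alpha> / sqrt d\<close>, hence of Frobenius norm at
  most \<open>\<alpha>\<close>. The constant is \<open>64 \<cdot> (16 \<cdot> 1000)\<^sup>2\<close>.
\<close>
definition final_fail :: "nat \<Rightarrow> nat \<Rightarrow> real \<Rightarrow> real \<Rightarrow> real \<Rightarrow> real" where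
  "final_fail d n \<rho> \<beta> \<alpha> = exp (12 * real d - (\<alpha> * (real n * sqrt \<rho> / (real d * ln (real n / \<beta>))))\<^sup>2 / (16384000000 * real d))"

lemma frob_norm_minus_commute:
  "A \<in> carrier_mat d d \<Longrightarrow> B \<in> carrier_mat d d \<Longrightarrow> frob_norm (A - B) = frob_norm (B - A)"
  by (simp add: frob_norm_def power2_commute)

section \<open>Assembling the accuracy bound\<close>

text \<open>After the last round the data have covariance between 1/2000 and 1. The sample then
  contributes Frobenius error at most \<open>0.001 * \<alpha>\<close> and the noise at most
  \<alpha>; returning to the original scale multiplies by 2000. The number \<open>l\<close> is a
  common lower bound for the logarithms in the truncation radii of the rounds and of the final
  call.\<close>

lemma pgce_sample_le:
  fixes T :: nat
  assumes d: "0 < d" and n: "0 < n" and \<rho>: "0 < \<rho>" and \<alpha>: "0 < \<alpha>" "\<alpha> \<le> 1"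
    and S: "S \<in> psd_cone d" and L: "L \<in> carrier_mat d d" "S = L * transpose_mat L" and W: "well_cond d \<kappa> L"
    and T: "T = nat \<lceil>cT * ln \<kappa>\<rceil>" "0 < T \<Longrightarrow> 1 \<le> 0.7 ^ (T - 1) * \<kappa>" "0.7 ^ T * \<kappa> \<le> 1" "0 \<le> \<kappa>"
    and l: "0 < l" "l \<le> ln (real n / (\<beta> / 2))" "0 < T \<Longrightarrow> l \<le> ln (real n / (\<beta> / 2 / real T))"
    and V: "frob_norm (cov_dev_mat d n g) \<le> 0.001 * \<alpha>"
    and g: "\<And>i. i < n \<Longrightarrow> (\<Sum>j<d. (g i j)\<^sup>2) \<le> 8 * real d * l"
    and X: "\<And>i. i < n \<Longrightarrow> X i = L *\<^sub>v Matrix.vec d (g i)"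
  shows "emeasure (pgce 8 16 cT 20 d n \<rho> \<beta> \<kappa> X) {S' \<in> carrier_mat d d. \<not> rel_norm d S (S - S') \<le> 4000 * \<alpha>} \<le>
    ennreal (real T * round_fail d n (\<rho> / 2 / real T) (\<beta> / 2 / real T)) + ennreal (final_fail d n (\<rho> / 2) (\<beta> / 2) \<alpha>)"
proof -
  define B where "B = {S' \<in> carrier_mat d d. \<not> rel_norm d S (S - S') \<le> 4000 * \<alpha>}"
  have "{S' \<in> space (mat_borel d). \<not> rel_norm d S (S - S') \<le> 4000 * \<alpha>} \<in> sets (mat_borel d)"
    using measurable_rel_norm_diff[OF S] by (intro sets.sets_Collect_neg borel_measurable_le) auto
  hence B: "B \<in> sets (mat_borel d)" by (simp add: B_def)
  \<comment> \<open>For \<open>T = 0\<close> the quotients by \<open>real T\<close> are zero.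
    Replacing them keeps the parameters usable, and zero rounds give the same kernel either
    way.\<close>
  define \<rho>1 \<beta>1 where "\<rho>1 = (if T = 0 then \<rho> / 2 else \<rho> / 2 / real T)" and "\<beta>1 = (if T = 0 then \<beta> / 2 else \<beta> / 2 / real T)"
  have p1: "0 < \<rho>1" and l1: "l \<le> ln (real n / \<beta>1)" using \<rho> l by (auto simp: \<rho>1_def \<beta>1_def)
  define ret where "ret = (\<lambda>A S. return (mat_borel d) (inv_mat d A * S * transpose_mat (inv_mat d A)))"
  define f where "f = (\<lambda>A. naive_pce 8 16 d n (\<rho> / 2) (\<beta> / 2) 1000 (\<lambda>i. A *\<^sub>v X i) \<bind> ret A)"
  have Xc: "X i \<in> carrier_vec d" if "i < n" for i using X[OF that] L by (auto intro: mult_mat_vec_carrier)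
  have fm: "f \<in> mat_borel d \<rightarrow>\<^sub>M prob_algebra (mat_borel d)"
    unfolding f_def[abs_def] ret_def
    by (rule measurable_pgce_tail[where X="\<lambda>_. X" and A="\<lambda>A. A"]) (use Xc in \<open>auto intro: measurable_const\<close>)
  have "pgce 8 16 cT 20 d n \<rho> \<beta> \<kappa> X = ppc_rounds 8 16 20 d n \<rho>1 \<beta>1 T \<kappa> X \<bind> f"
    by (cases "T = 0") (simp_all add: pgce_def ppc_def Let_def T(1)[symmetric] f_def[abs_def] ret_def[abs_def] \<rho>1_def \<beta>1_def)
  also have "emeasure \<dots> B \<le> ennreal (real T * round_fail d n \<rho>1 \<beta>1) + ennreal (final_fail d n (\<rho> / 2) (\<beta> / 2) \<alpha>)"
  proof (rule ppc_rounds_bind_le[OF d n p1 _ _ _ B X W T(2) fm])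
    show "0 < ln (real n / \<beta>1)" using l l1 by linarith
    show "frob_norm (cov_dev_mat d n g) \<le> 0.001" using V \<alpha> by simp
    show "(\<Sum>j<d. (g i j)\<^sup>2) \<le> 8 * real d * ln (real n / \<beta>1)" if "i < n" for i
      using order_trans[OF g[OF that] mult_left_mono[OF l1]] d by simp
    fix C assume C: "C \<in> carrier_mat d d" and WC: "well_cond d (0.7 ^ T * \<kappa>) (C * L)"
    define M where "M = C * L"
    have M: "M \<in> carrier_mat d d" using C L by (simp add: M_def)
    define \<kappa>1 where "\<kappa>1 = 0.7 ^ T * \<kappa>"
    have k1: "0 \<le> \<kappa>1" "\<kappa>1 \<le> 1" using T(3,4) by (auto simp: \<kappa>1_def)
    have WM: "well_cond d \<kappa>1 M" using WC by (simp add: \<kappa>1_def M_def)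
    have retm: "ret C \<in> psd_borel d \<rightarrow>\<^sub>M prob_algebra (mat_borel d)"
    proof -
      have "inv_mat d C \<in> carrier_mat d d" using measurable_space[OF measurable_inv_mat, of C d] C by simp
      thus ?thesis unfolding ret_def
        by (intro measurable_compose[OF _ measurable_return_prob_space] measurable_mat_mult measurable_mat_transpose)
           (auto intro: measurable_const simp: psd_borel_def intro!: measurable_restrict_space1)
    qed
    define \<sigma> where "\<sigma> = noise_sd 16 d n (\<rho> / 2) (\<beta> / 2) 1000"
    \<comment> \<open>Operator norm \<open>4 * t\<close>, equal to \<alpha> over
      \<open>sqrt d\<close>, bounds the Frobenius norm of the noise by \<alpha>.\<close>
    define t where "t = \<alpha> / (4 * sqrt (real d))"
    have \<sigma>: "\<sigma> = 16000 / (real n * sqrt (\<rho> / 2) / (real d * ln (real n / (\<beta> / 2))))" by (simp add: \<sigma>_def noise_sd_def)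
    have s0: "\<sigma> \<noteq> 0" unfolding \<sigma> using n \<rho> l d by simp
    have "emeasure (f C) B \<le> ennreal (exp (12 * real d - t\<^sup>2 / (4 * \<sigma>\<^sup>2))) + 0"
      unfolding f_def \<sigma>_def
    proof (rule naive_pce_bind_le[OF d _ _ retm B])
      show "noise_sd 16 d n (\<rho> / 2) (\<beta> / 2) 1000 \<noteq> 0" using s0 by (simp add: \<sigma>_def)
      show "0 < t" using \<alpha> d by (simp add: t_def)
      fix N assume N: "N \<in> carrier_mat d d" "transpose_mat N = N"
        and op: "\<And>x y. x \<in> carrier_vec d \<Longrightarrow> y \<in> carrier_vec d \<Longrightarrow> \<bar>x \<bullet> (N *\<^sub>v y)\<bar> \<le> 4 * t * vnorm x * vnorm y"
      define V where "V = cov_dev_mat d n g"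
      have Vc: "V \<in> carrier_mat d d" by (simp add: V_def)
      have CX: "C *\<^sub>v X i = M *\<^sub>v Matrix.vec d (g i)" if "i < n" for i
        using C L X[OF that] by (simp add: M_def assoc_mult_mat_vec[where n\<^sub>1=d and n\<^sub>2=d and n\<^sub>3=d])
      have E: "trunc_cov d n (8 * (real d * 1000 * ln (real n / (\<beta> / 2)))) (\<lambda>i. C *\<^sub>v X i) = M * transpose_mat M + M * V * transpose_mat M"
        unfolding V_def
      proof (rule trunc_cov_well_cond[OF WM k1(1) _ n CX])
        show "(\<Sum>j<d. (g i j)\<^sup>2) \<le> 8 * real d * ln (real n / (\<beta> / 2))" if "i < n" for i
          using order_trans[OF g[OF that] mult_left_mono[OF l(2)]] d by simp
      qed (use k1 l in auto)
      define Z where "Z = psd_proj d (trunc_cov d n (8 * (real d * 1000 * ln (real n / (\<beta> / 2)))) (\<lambda>i. C *\<^sub>v X i) + N)"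
      have Z: "Z \<in> psd_cone d" unfolding Z_def using N by (intro psd_proj_psd) simp
      hence Zc: "Z \<in> carrier_mat d d" by (simp add: psd_cone_def)
      let ?Q = "M * transpose_mat M" and ?W = "M * V * transpose_mat M"
      have c: "?Q \<in> carrier_mat d d" "?W \<in> carrier_mat d d" using M Vc by auto
      have "frob_norm (?Q - Z) = frob_norm (Z - ?Q)"
        by (rule frob_norm_minus_commute[OF c(1) Zc])
      also have "\<dots> \<le> frob_norm (?Q + ?W + N - ?Q)"
        unfolding Z_def E using c N by (intro psd_proj_frob_le psd_gram M) auto
      also have "?Q + ?W + N - ?Q = ?W + N" by (rule eq_matI) (use c N in auto)
      also have "frob_norm \<dots> \<le> frob_norm ?W + frob_norm N" by (rule frob_norm_triangle[OF c(2) N(1)])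
      also have "\<dots> \<le> 0.001 * \<alpha> + \<alpha>"
      proof (rule add_mono)
        have "vnorm (M *\<^sub>v x) \<le> 1 * vnorm x" if x: "x \<in> carrier_vec d" for x
        proof -
          have "sqrt \<kappa>1 * vnorm x \<le> 1 * vnorm x" using k1 by (intro mult_right_mono) auto
          thus ?thesis using well_cond_norm(2)[OF WM k1(1) x] by linarith
        qed
        from frob_norm_conjugate[OF M Vc _ this] show "frob_norm ?W \<le> 0.001 * \<alpha>"
          using V by (simp add: V_def)
        have "frob_norm N \<le> sqrt (real d) * (4 * t)" using op \<open>0 < t\<close> by (intro frob_norm_le_op[OF N(1)]) auto
        thus "frob_norm N \<le> \<alpha>" using d by (simp add: t_def)
      qed
      finally have fr: "frob_norm (?Q - Z) \<le> 2 * \<alpha>" using \<alpha> by simp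
      have "rel_norm d S (S - inv_mat d C * Z * transpose_mat (inv_mat d C)) \<le> sqrt 2000 * sqrt 2000 * frob_norm (?Q - Z)"
        unfolding M_def using WM by (intro rel_norm_preconditioned[OF S L C Zc]) (auto simp: well_cond_def M_def)
      also have "\<dots> \<le> sqrt 2000 * sqrt 2000 * (2 * \<alpha>)" by (intro mult_left_mono fr) simp
      also have "\<dots> = 4000 * \<alpha>" by simp
      finally have r: "rel_norm d S (S - inv_mat d C * Z * transpose_mat (inv_mat d C)) \<le> 4000 * \<alpha>" .
      have "emeasure (ret C Z) B = 0" using r B by (simp add: ret_def B_def)
      thus "emeasure (ret C (psd_proj d (trunc_cov d n (8 * (real d * 1000 * ln (real n / (\<beta> / 2)))) (\<lambda>i. C *\<^sub>v X i) + N))) B \<le> 0"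
        by (simp add: Z_def)
    qed
    also have "exp (12 * real d - t\<^sup>2 / (4 * \<sigma>\<^sup>2)) = final_fail d n (\<rho> / 2) (\<beta> / 2) \<alpha>"
      unfolding final_fail_def \<sigma> t_def using d by (simp add: power_divide power_mult_distrib)
    finally show "emeasure (f C) B \<le> ennreal (final_fail d n (\<rho> / 2) (\<beta> / 2) \<alpha>)" by simp
  qed
  finally show ?thesis by (cases "T = 0") (simp_all add: B_def \<rho>1_def \<beta>1_def)
qed

text \<open>The starting point of the rounds: the lower bound holds at first with constant 1, far
  inside the 2000 that \<open>well_cond\<close> allows. Testing both inequalities on one unit vector
  yields \<open>1 \<le> \<kappa>\<close> in positive dimension.\<close>

lemma loewner_Cholesky:
  assumes "loewner_le d (1\<^sub>m d) S" "loewner_le d S (\<kappa> \<cdot>\<^sub>m 1\<^sub>m d)"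
  obtains L :: "nat \<Rightarrow> nat \<Rightarrow> real" where "\<And>i k. i < k \<Longrightarrow> L i k = 0" "\<And>i. i < d \<Longrightarrow> 0 < L i i"
    "S = Matrix.mat d d (\<lambda>(i, j). L i j) * transpose_mat (Matrix.mat d d (\<lambda>(i, j). L i j))"
    "well_cond d \<kappa> (Matrix.mat d d (\<lambda>(i, j). L i j))" "S \<in> psd_cone d"
    "0 < d \<Longrightarrow> 1 \<le> \<kappa>"
proof -
  have S: "S \<in> carrier_mat d d" using assms by (simp add: loewner_le_def)
  have low: "x \<bullet> x \<le> x \<bullet> (S *\<^sub>v x)" and high: "x \<bullet> (S *\<^sub>v x) \<le> \<kappa> * (x \<bullet> x)" if x: "x \<in> carrier_vec d" for x
  proof -
    have Sx: "S *\<^sub>v x \<in> carrier_vec d" using S x by simp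
    have "0 \<le> x \<bullet> ((S - 1\<^sub>m d) *\<^sub>v x)" using assms(1) x by (auto simp: loewner_le_def psd_cone_def)
    also have "(S - 1\<^sub>m d) *\<^sub>v x = S *\<^sub>v x - x"
      using minus_mult_distrib_mat_vec[OF S one_carrier_mat x] x by simp
    also have "x \<bullet> \<dots> = x \<bullet> (S *\<^sub>v x) - x \<bullet> x" using x Sx by (simp add: scalar_prod_minus_distrib[where n=d])
    finally show "x \<bullet> x \<le> x \<bullet> (S *\<^sub>v x)" by simp
    have kc: "\<kappa> \<cdot>\<^sub>m 1\<^sub>m d \<in> carrier_mat d d" by simp
    have kx: "(\<kappa> \<cdot>\<^sub>m 1\<^sub>m d) *\<^sub>v x = \<kappa> \<cdot>\<^sub>v x" using x by (intro eq_vecI) (auto simp: scalar_prod_left_unit)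
    have "0 \<le> x \<bullet> ((\<kappa> \<cdot>\<^sub>m 1\<^sub>m d - S) *\<^sub>v x)" using assms(2) x by (auto simp: loewner_le_def psd_cone_def)
    also have "(\<kappa> \<cdot>\<^sub>m 1\<^sub>m d - S) *\<^sub>v x = \<kappa> \<cdot>\<^sub>v x - S *\<^sub>v x"
      using minus_mult_distrib_mat_vec[OF kc S x] kx by simp
    also have "x \<bullet> \<dots> = \<kappa> * (x \<bullet> x) - x \<bullet> (S *\<^sub>v x)" using x Sx by (simp add: scalar_prod_minus_distrib[where n=d])
    finally show "x \<bullet> (S *\<^sub>v x) \<le> \<kappa> * (x \<bullet> x)" by simp
  qed
  have sym: "S $$ (i, j) = S $$ (j, i)" if "i < d" "j < d" for i j
  proof -
    have "(S - 1\<^sub>m d) $$ (i, j) = (S - 1\<^sub>m d)\<^sup>T $$ (i, j)" using assms(1) by (simp add: loewner_le_def psd_cone_def)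
    also have "\<dots> = (S - 1\<^sub>m d) $$ (j, i)" using that S by (intro index_transpose_mat) auto
    finally show ?thesis using that S by (auto split: if_splits)
  qed
  have St: "transpose_mat S = S" by (rule eq_matI) (use S sym in auto)
  have quad: "x \<bullet> (S *\<^sub>v x) = (\<Sum>i<d. \<Sum>j<d. x $ i * S $$ (i, j) * x $ j)" if "x \<in> carrier_vec d" for x
    using that S by (simp add: scalar_prod_def lessThan_atLeast0 sum_distrib_left mult.assoc)
  have pos: "0 < (\<Sum>i<d. \<Sum>j<d. x i * S $$ (i, j) * x j)" if nz: "\<exists>i<d. x i \<noteq> 0" for x
  proof -
    let ?v = "Matrix.vec d x"
    obtain i where i: "i < d" "x i \<noteq> 0" using nz by auto
    have v: "?v \<in> carrier_vec d" by simp
    have "0 < (x i)\<^sup>2" using i by simp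
    also have "\<dots> \<le> (\<Sum>i<d. (x i)\<^sup>2)" using i by (intro member_le_sum) auto
    also have "\<dots> = ?v \<bullet> ?v" by (simp add: scalar_prod_self_sum[OF v])
    also have "\<dots> \<le> ?v \<bullet> (S *\<^sub>v ?v)" by (rule low[OF v])
    finally show ?thesis by (simp add: quad[OF v])
  qed
  have "\<exists>L. (\<forall>i k. i < k \<longrightarrow> L i k = 0) \<and> (\<forall>i<d. 0 < L i i) \<and>
      (\<forall>i<d. \<forall>j<d. S $$ (i, j) = (\<Sum>k<d. L i k * L j k))"
  proof (rule Cholesky)
    show "S $$ (i, j) = S $$ (j, i)" if "i < d" "j < d" for i j using that by (rule sym)
    show "0 < (\<Sum>i<d. \<Sum>j<d. x i * S $$ (i, j) * x j)" if "\<exists>i<d. x i \<noteq> 0" for x using that by (rule pos)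
  qed
  then obtain L :: "nat \<Rightarrow> nat \<Rightarrow> real" where L0: "\<forall>i k. i < k \<longrightarrow> L i k = 0" and Ld: "\<forall>i<d. 0 < L i i"
    and LL: "\<forall>i<d. \<forall>j<d. S $$ (i, j) = (\<Sum>k<d. L i k * L j k)" by (elim exE conjE)
  have L: "\<And>i k. i < k \<Longrightarrow> L i k = 0" "\<And>i. i < d \<Longrightarrow> 0 < L i i" using L0 Ld by simp_all
  define Lm where "Lm = Matrix.mat d d (\<lambda>(i, j). L i j)"
  have Lm: "Lm \<in> carrier_mat d d" by (simp add: Lm_def)
  have SL: "S = Lm * transpose_mat Lm"
  proof (rule eq_matI)
    fix i j assume "i < dim_row (Lm * transpose_mat Lm)" "j < dim_col (Lm * transpose_mat Lm)"
    hence ij: "i < d" "j < d" using Lm by auto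
    have "S $$ (i, j) = (\<Sum>k<d. L i k * L j k)" using LL ij by blast
    thus "S $$ (i, j) = (Lm * transpose_mat Lm) $$ (i, j)"
      using ij by (simp add: Lm_def scalar_prod_def lessThan_atLeast0)
  qed (use S Lm in auto)
  have q: "(transpose_mat Lm *\<^sub>v x) \<bullet> (transpose_mat Lm *\<^sub>v x) = x \<bullet> (S *\<^sub>v x)" if x: "x \<in> carrier_vec d" for x
    unfolding SL using bilinear_adjoint[OF Lm x, of "transpose_mat Lm *\<^sub>v x"] Lm x
    by (simp add: assoc_mult_mat_vec[where n\<^sub>1=d and n\<^sub>2=d and n\<^sub>3=d])
  have "well_cond d \<kappa> Lm"
    unfolding well_cond_def
  proof (intro conjI ballI Lm)
    fix x :: "real Matrix.vec" assume x: "x \<in> carrier_vec d"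
    show "(transpose_mat Lm *\<^sub>v x) \<bullet> (transpose_mat Lm *\<^sub>v x) \<le> \<kappa> * (x \<bullet> x)" using high[OF x] by (simp add: q[OF x])
    show "x \<bullet> x \<le> 2000 * ((transpose_mat Lm *\<^sub>v x) \<bullet> (transpose_mat Lm *\<^sub>v x))"
      using low[OF x] scalar_prod_self_nonneg[of x] by (simp add: q[OF x])
  qed
  moreover have "S \<in> psd_cone d"
    using S St low scalar_prod_self_nonneg by (auto simp: psd_cone_def intro: order_trans)
  moreover have "1 \<le> \<kappa>" if "0 < d"
    using order_trans[OF low high, of "unit_vec d 0"] that by simp
  ultimately show ?thesis using that[of L, OF L] SL unfolding Lm_def by blast
qed

text \<open>The constant \<open>1 / ln (10 / 7)\<close> makes \<open>T\<close> the least number of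
  factors 0.7 that bring \<kappa> down to 1; the two conclusions are the two sides of the
  ceiling.\<close>

lemma num_rounds:
  fixes \<kappa> :: real
  assumes k: "1 \<le> \<kappa>"
  defines "T \<equiv> nat \<lceil>1 / ln (10 / 7) * ln \<kappa>\<rceil>"
  shows "0 < T \<Longrightarrow> 1 \<le> 0.7 ^ (T - 1) * \<kappa>" "0.7 ^ T * \<kappa> \<le> 1"
proof -
  have r: "0 < ln (10 / 7 :: real)" by simp
  have p: "(0.7::real) ^ m = exp (- (real m * ln (10 / 7)))" for m
  proof -
    have e: "(0.7::real) = exp (- ln (10 / 7))" by (simp add: exp_minus)
    show ?thesis unfolding e by (simp only: exp_of_nat_mult[symmetric] mult_minus_right)
  qed
  have e: "0.7 ^ m * \<kappa> = exp (ln \<kappa> - real m * ln (10 / 7))" for m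
    unfolding p diff_conv_add_uminus exp_add using k by (simp only: exp_ln mult.commute)
  have u0: "0 \<le> 1 / ln (10 / 7) * ln \<kappa>" using k r by simp
  have "1 / ln (10 / 7) * ln \<kappa> \<le> real T" unfolding T_def by (rule real_nat_ceiling_ge)
  thus "0.7 ^ T * \<kappa> \<le> 1" unfolding e using r by (simp add: field_simps)
  assume T0: "0 < T"
  hence "real T - 1 < 1 / ln (10 / 7) * ln \<kappa>" unfolding T_def using u0 by linarith
  thus "1 \<le> 0.7 ^ (T - 1) * \<kappa>" unfolding e using r T0 by (simp add: field_simps of_nat_diff)
qed

section \<open>Sample size\<close>

text \<open>Resolves the circular requirement that \<open>n\<close> exceed a multiple of
  \<open>ln n\<close>. The bound \<open>ln y \<le> 2 * sqrt y\<close> lets each of the two summands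
  take half of \<open>y\<close>.\<close>

lemma log_absorb:
  fixes y c \<Lambda> :: real
  assumes c: "1 \<le> c" and \<Lambda>: "1 \<le> \<Lambda>" and y: "16 * c\<^sup>2 * \<Lambda>\<^sup>2 \<le> y"
  shows "c * sqrt \<Lambda> * (ln y + 8 * \<Lambda>) \<le> y"
proof -
  have cL: "1 \<le> c * \<Lambda>" using mult_mono[OF c \<Lambda>] c by simp
  have "0 < 16 * c\<^sup>2 * \<Lambda>\<^sup>2" using c \<Lambda> by simp
  hence y0: "0 < y" using y by linarith
  have sL: "1 \<le> sqrt \<Lambda>" "sqrt \<Lambda> * sqrt \<Lambda> = \<Lambda>" using \<Lambda> by auto
  have L2: "\<Lambda> * sqrt \<Lambda> \<le> \<Lambda>\<^sup>2" using \<Lambda> by (simp add: power2_eq_square sqrt_le_D real_le_lsqrt)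
  have "16 * (c * \<Lambda>\<^sup>2) \<le> 16 * (c\<^sup>2 * \<Lambda>\<^sup>2)" using c by (intro mult_left_mono mult_right_mono) (auto simp: power2_eq_square)
  moreover have "c * (\<Lambda> * sqrt \<Lambda>) \<le> c * \<Lambda>\<^sup>2" using L2 c by (intro mult_left_mono) auto
  moreover have "c * sqrt \<Lambda> * (8 * \<Lambda>) = 8 * (c * (\<Lambda> * sqrt \<Lambda>))" by simp
  ultimately have 1: "c * sqrt \<Lambda> * (8 * \<Lambda>) \<le> y / 2" using y by linarith
  have "(4 * c * sqrt \<Lambda>)\<^sup>2 \<le> y"
  proof -
    have "(4 * c * sqrt \<Lambda>)\<^sup>2 = 16 * c\<^sup>2 * \<Lambda>" using \<Lambda> by (simp add: power_mult_distrib)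
    also have "\<dots> \<le> 16 * c\<^sup>2 * \<Lambda>\<^sup>2" using \<Lambda> by (intro mult_left_mono) (auto simp: power2_eq_square)
    finally show ?thesis using y by linarith
  qed
  hence sy: "4 * c * sqrt \<Lambda> \<le> sqrt y" by (rule real_le_rsqrt)
  have "ln y \<le> 2 * sqrt y"
  proof -
    have "ln y = 2 * ln (sqrt y)" using y0 by (simp add: ln_sqrt)
    also have "\<dots> \<le> 2 * sqrt y" using ln_le_minus_one[of "sqrt y"] y0 by simp
    finally show ?thesis .
  qed
  hence "c * sqrt \<Lambda> * ln y \<le> c * sqrt \<Lambda> * (2 * sqrt y)" using c \<Lambda> by (intro mult_left_mono) auto
  also have "\<dots> = (4 * c * sqrt \<Lambda>) * sqrt y / 2" by simp
  also have "\<dots> \<le> sqrt y * sqrt y / 2" using sy y0 by (intro divide_right_mono mult_right_mono) auto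
  finally have "c * sqrt \<Lambda> * ln y \<le> y / 2" using y0 by simp
  thus ?thesis using 1 by (simp add: algebra_simps)
qed

text \<open>Here \<open>x\<close> is the sample size, \<open>m\<close> an inverse failure
  probability and \<open>A\<close> the factor before the polylogarithm. With
  \<open>y = x / A\<close> and \<open>\<Lambda> = 1 + max 0 (ln u)\<close> the claim becomes
  \<open>log_absorb\<close>. The tail bound contributes the root of a logarithm and the truncation
  radius a full one; the product of powers 1/2 and 1 is covered by \<Lambda> squared, whence
  \<open>p = 2\<close>.\<close>

lemma noise_absorb:
  fixes A u m c x :: real
  assumes A: "0 < A" and u: "0 < u" and m: "0 < m" "m \<le> 10 * u" "A * m \<le> 10 * u\<^sup>2" and c: "1 \<le> c"
    and x: "16 * c\<^sup>2 * (A * polylog 2 u) \<le> x" "1 \<le> x * m"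
  shows "c * A * sqrt (12 + ln m) * ln (x * m) \<le> 4 * x"
proof -
  define \<Lambda> where "\<Lambda> = 1 + max 0 (ln u)"
  have \<Lambda>: "1 \<le> \<Lambda>" by (simp add: \<Lambda>_def)
  have x': "16 * c\<^sup>2 * (A * \<Lambda>\<^sup>2) \<le> x" using x(1) by (simp add: polylog_def \<Lambda>_def)
  have "0 < 16 * c\<^sup>2 * (A * \<Lambda>\<^sup>2)" using A c \<Lambda> by simp
  hence x0: "0 < x" using x' by linarith
  have "ln 10 \<le> ln ((2::real) ^ 4)" by (subst ln_le_cancel_iff) auto
  also have "\<dots> = 4 * ln 2" using ln_realpow[of "2::real" 4] by simp
  also have "\<dots> \<le> 4" using ln_le_minus_one[of "2::real"] by simp
  finally have l10: "ln (10::real) \<le> 4" .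
  have "ln m \<le> ln (10 * u)" using m u by (subst ln_le_cancel_iff) auto
  hence "ln m \<le> 4 * \<Lambda>" using l10 u by (simp add: ln_mult \<Lambda>_def)
  hence "sqrt (12 + ln m) \<le> sqrt (16 * \<Lambda>)" using \<Lambda> by (intro real_sqrt_le_mono) simp
  hence s: "sqrt (12 + ln m) \<le> 4 * sqrt \<Lambda>" by (simp add: real_sqrt_mult)
  have "ln (A * m) \<le> ln (10 * u\<^sup>2)" using m u A by (subst ln_le_cancel_iff) auto
  hence lA: "ln (A * m) \<le> 8 * \<Lambda>" using l10 u by (simp add: ln_mult ln_realpow \<Lambda>_def)
  have "16 * c\<^sup>2 * \<Lambda>\<^sup>2 \<le> x / A" using x' A by (simp add: field_simps)
  from log_absorb[OF c \<Lambda> this] have la: "c * sqrt \<Lambda> * (ln (x / A) + 8 * \<Lambda>) \<le> x / A" .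
  have "ln (x * m) = ln (x / A) + ln (A * m)" using x0 A m by (simp add: ln_mult ln_div)
  hence l2: "ln (x * m) \<le> ln (x / A) + 8 * \<Lambda>" using lA by simp
  have l0: "0 \<le> ln (x * m)" using x(2) by simp
  have "c * A * sqrt (12 + ln m) * ln (x * m) \<le> c * A * (4 * sqrt \<Lambda>) * ln (x * m)"
    using s l0 c A by (intro mult_right_mono mult_left_mono) auto
  also have "\<dots> \<le> c * A * (4 * sqrt \<Lambda>) * (ln (x / A) + 8 * \<Lambda>)"
    using l2 c A \<Lambda> by (intro mult_left_mono) auto
  also have "\<dots> = 4 * A * (c * sqrt \<Lambda> * (ln (x / A) + 8 * \<Lambda>))" by (simp only: mult_ac)
  also have "\<dots> \<le> 4 * A * (x / A)" using la A by (intro mult_left_mono) auto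
  finally show ?thesis using A by simp
qed

text \<open>32000 squared is the constant in \<open>round_fail\<close>. The number 12 covers the net
  term \<open>12 * real d\<close> in the exponent.\<close>

lemma round_fail_le:
  assumes d: "0 < d" and \<beta>: "0 < \<beta>" "\<beta> < 1" and l: "0 < ln (real n / \<beta>)"
    and H: "32000 * (real d * sqrt (real d)) * sqrt (12 + ln (1 / \<beta>)) * ln (real n / \<beta>) \<le> real n * sqrt \<rho>"
  shows "round_fail d n \<rho> \<beta> \<le> \<beta>"
proof -
  define q where "q = real n * sqrt \<rho> / (real d * ln (real n / \<beta>))"
  have lb: "0 \<le> ln (1 / \<beta>)" using \<beta> by simp
  have dl: "0 < real d * ln (real n / \<beta>)" using d l by simp
  have "32000 * sqrt (real d) * sqrt (12 + ln (1 / \<beta>)) \<le> q"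
    unfolding q_def pos_le_divide_eq[OF dl] using H by (simp add: mult_ac)
  hence "(32000 * sqrt (real d) * sqrt (12 + ln (1 / \<beta>)))\<^sup>2 \<le> q\<^sup>2" using lb by (intro power_mono) auto
  hence "1024000000 * (real d * (12 + ln (1 / \<beta>))) \<le> q\<^sup>2" using lb by (simp add: power_mult_distrib)
  moreover have "1 * ln (1 / \<beta>) \<le> real d * ln (1 / \<beta>)" using d lb by (intro mult_right_mono) auto
  ultimately have "12 * real d - q\<^sup>2 / 1024000000 \<le> - ln (1 / \<beta>)" by (simp add: algebra_simps)
  hence "round_fail d n \<rho> \<beta> \<le> exp (- ln (1 / \<beta>))" by (simp add: round_fail_def q_def)
  thus ?thesis using \<beta> by (simp add: ln_div)
qed

text \<open>128000 squared is the constant in \<open>final_fail\<close>; the additional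
  \<open>real d\<close> in its denominator raises the power of \<open>d\<close> from 3/2 to
  2.\<close>

lemma final_fail_le:
  assumes d: "0 < d" and \<beta>: "0 < \<beta>" "\<beta> < 1" and l: "0 < ln (real n / \<beta>)"
    and H: "128000 * (real d)\<^sup>2 * sqrt (12 + ln (1 / \<beta>)) * ln (real n / \<beta>) \<le> \<alpha> * (real n * sqrt \<rho>)"
  shows "final_fail d n \<rho> \<beta> \<alpha> \<le> \<beta>"
proof -
  define q where "q = \<alpha> * (real n * sqrt \<rho> / (real d * ln (real n / \<beta>)))"
  have lb: "0 \<le> ln (1 / \<beta>)" using \<beta> by simp
  have dl: "0 < real d * ln (real n / \<beta>)" using d l by simp
  have "128000 * real d * sqrt (12 + ln (1 / \<beta>)) \<le> q"
    unfolding q_def times_divide_eq_right pos_le_divide_eq[OF dl] using H by (simp add: mult_ac power2_eq_square)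
  hence "(128000 * real d * sqrt (12 + ln (1 / \<beta>)))\<^sup>2 \<le> q\<^sup>2" using lb by (intro power_mono) auto
  hence "16384000000 * ((real d)\<^sup>2 * (12 + ln (1 / \<beta>))) \<le> q\<^sup>2" using lb by (simp add: power_mult_distrib)
  moreover have "real d * (12 + ln (1 / \<beta>)) * (16384000000 * real d) = 16384000000 * ((real d)\<^sup>2 * (12 + ln (1 / \<beta>)))"
    by (simp add: power2_eq_square)
  ultimately have "real d * (12 + ln (1 / \<beta>)) * (16384000000 * real d) \<le> q\<^sup>2" by linarith
  hence "real d * (12 + ln (1 / \<beta>)) \<le> q\<^sup>2 / (16384000000 * real d)" using d by (intro mult_imp_le_div_pos) auto
  moreover have "1 * ln (1 / \<beta>) \<le> real d * ln (1 / \<beta>)" using d lb by (intro mult_right_mono) auto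
  ultimately have "12 * real d - q\<^sup>2 / (16384000000 * real d) \<le> - ln (1 / \<beta>)" by (simp add: algebra_simps)
  hence "final_fail d n \<rho> \<beta> \<alpha> \<le> exp (- ln (1 / \<beta>))" by (simp add: final_fail_def q_def)
  thus ?thesis using \<beta> by (simp add: ln_div)
qed

lemma powr_three_halves: "0 \<le> x \<Longrightarrow> x powr (3 / 2) = x * sqrt x" for x :: real
proof (cases "x = 0")
  case False
  assume "0 \<le> x"
  hence "x powr (1 + 1 / 2) = x * sqrt x" using False unfolding powr_add by (simp add: powr_half_sqrt)
  thus ?thesis by simp
qed simp

lemma sample_bound_terms:
  assumes d: "0 < d" and \<rho>: "0 < \<rho>" and \<beta>: "0 < \<beta>" "\<beta> < 1" and \<alpha>: "0 < \<alpha>" and k: "1 \<le> \<kappa>" and C: "0 \<le> C"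
    and n: "C * sample_bound 2 d \<alpha> \<rho> \<beta> \<kappa> \<le> n"
  shows "C * (((real d)\<^sup>2 + ln (1 / \<beta>)) / \<alpha>\<^sup>2) \<le> n"
    "C * ((real d)\<^sup>2 / (\<alpha> * sqrt \<rho>) * polylog 2 (real d / (\<alpha> * \<beta> * min 1 \<rho>))) \<le> n"
    "C * (real d * sqrt (real d) * sqrt (ln \<kappa>) / sqrt \<rho> * polylog 2 (real d * ln \<kappa> / (min 1 \<rho> * \<beta>))) \<le> n"
proof -
  let ?a = "((real d)\<^sup>2 + ln (1 / \<beta>)) / \<alpha>\<^sup>2" and ?b = "(real d)\<^sup>2 / (\<alpha> * sqrt \<rho>) * polylog 2 (real d / (\<alpha> * \<beta> * min 1 \<rho>))"
    and ?c = "real d * sqrt (real d) * sqrt (ln \<kappa>) / sqrt \<rho> * polylog 2 (real d * ln \<kappa> / (min 1 \<rho> * \<beta>))"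
  have e: "sample_bound 2 d \<alpha> \<rho> \<beta> \<kappa> = ?a + ?b + ?c"
    by (simp add: sample_bound_def powr_three_halves)
  have "0 \<le> ln (1 / \<beta>)" using \<beta> by simp
  hence "0 \<le> ?a" "0 \<le> ?b" "0 \<le> ?c" using \<alpha> \<rho> k by (simp_all add: polylog_def)
  hence "?a \<le> sample_bound 2 d \<alpha> \<rho> \<beta> \<kappa>" "?b \<le> sample_bound 2 d \<alpha> \<rho> \<beta> \<kappa>" "?c \<le> sample_bound 2 d \<alpha> \<rho> \<beta> \<kappa>"
    unfolding e by linarith+
  from this[THEN mult_left_mono[OF _ C]]
  show "C * ?a \<le> n" "C * ?b \<le> n" "C * ?c \<le> n" using n by linarith+
qed

text \<open>The first term of \<open>sample_bound\<close> controls the sample covariance, the second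
  the final call, and the third the rounds. The second also covers the rounds when \<kappa> is close
  to 1.\<close>

lemma sufficient_samples:
  fixes n d T :: nat
  assumes d: "0 < d" and \<rho>: "0 < \<rho>" and \<beta>: "0 < \<beta>" "\<beta> < 1 / 4" and \<alpha>: "0 < \<alpha>" "\<alpha> \<le> 1" and k: "1 \<le> \<kappa>"
    and n: "16 * 1000000\<^sup>2 * sample_bound 2 d \<alpha> \<rho> \<beta> \<kappa> \<le> real n"
    and T: "T = nat \<lceil>1 / ln (10 / 7) * ln \<kappa>\<rceil>"
  shows "2 \<le> n" "64 * (6 * (real d)\<^sup>2 + ln (1 / \<beta>)) \<le> real n * (0.001 * \<alpha>)\<^sup>2"
    "real T * round_fail d n (\<rho> / 2 / real T) (\<beta> / 2 / real T) \<le> \<beta> / 2"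
    "final_fail d n (\<rho> / 2) (\<beta> / 2) \<alpha> \<le> \<beta> / 2"
proof -
  have "\<beta> < 1" using \<beta> by simp
  note terms = sample_bound_terms[OF d \<rho> \<beta>(1) this \<alpha>(1) k _ n, simplified]
  have d1: "1 \<le> real d" using d by simp
  have lb: "0 \<le> ln (1 / \<beta>)" using \<beta> by simp
  have a2: "0 < \<alpha>\<^sup>2" "\<alpha>\<^sup>2 \<le> 1" using \<alpha> by (auto simp: power_le_one)
  have n1: "16000000000000 * ((real d)\<^sup>2 + ln (1 / \<beta>)) \<le> real n * \<alpha>\<^sup>2"
    using terms(1) a2 \<beta> by (simp add: field_simps ln_div)
  have "real n * (0.001 * \<alpha>)\<^sup>2 = real n * \<alpha>\<^sup>2 / 1000000" by (simp add: power_mult_distrib power_divide)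
  thus "64 * (6 * (real d)\<^sup>2 + ln (1 / \<beta>)) \<le> real n * (0.001 * \<alpha>)\<^sup>2"
    using n1 lb zero_le_power2[of "real d"] unfolding distrib_left by linarith
  have "1 \<le> (real d)\<^sup>2" using d1 by simp
  hence "16000000000000 * 1 \<le> 16000000000000 * ((real d)\<^sup>2 + ln (1 / \<beta>))" using lb by (intro mult_left_mono) auto
  moreover have "real n * \<alpha>\<^sup>2 \<le> real n * 1" using a2 by (intro mult_left_mono) auto
  ultimately have n2: "2 \<le> real n" using n1 by linarith
  thus "2 \<le> n" by simp
  \<comment> \<open>Both \<mu> and its square are at most \<open>sqrt \<rho>\<close>. This bounds
    \<open>1 / sqrt \<rho>\<close> by powers of \<open>1 / \<mu>\<close>, so that logarithms of it
    are covered by the argument of the polylogarithm.\<close>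
  define \<mu> where "\<mu> = min 1 \<rho>"
  have \<mu>: "0 < \<mu>" "\<mu> \<le> 1" "\<mu> \<le> \<rho>" using \<rho> by (auto simp: \<mu>_def)
  have \<mu>r: "\<mu> \<le> sqrt \<rho>"
  proof (rule real_le_rsqrt)
    have "\<mu>\<^sup>2 \<le> 1 * \<rho>" unfolding power2_eq_square using \<mu> by (intro mult_mono) auto
    thus "\<mu>\<^sup>2 \<le> \<rho>" by simp
  qed
  have \<mu>2: "\<mu>\<^sup>2 \<le> sqrt \<rho>"
  proof -
    have "\<mu>\<^sup>2 \<le> 1 * \<mu>" unfolding power2_eq_square using \<mu> by (intro mult_right_mono) auto
    thus ?thesis using \<mu>r by simp
  qed
  define A u where "A = (real d)\<^sup>2 / (\<alpha> * sqrt \<rho>)" and "u = real d / (\<alpha> * \<beta> * \<mu>)"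
  have A: "0 < A" and u: "0 < u" using d \<alpha> \<beta> \<rho> \<mu> by (auto simp: A_def u_def)
  have bu: "1 / \<beta> \<le> u"
  proof -
    have "\<alpha> * \<mu> \<le> 1 * 1" using \<alpha> \<mu> by (intro mult_mono) auto
    hence "\<alpha> * \<mu> \<le> real d" using d1 by linarith
    thus ?thesis using \<alpha> \<beta> \<mu> by (simp add: u_def field_simps)
  qed
  have Au: "A / \<beta> \<le> u\<^sup>2"
  proof -
    have "\<alpha> * \<beta> * \<mu>\<^sup>2 \<le> 1 * 1 * sqrt \<rho>" using \<alpha> \<beta> \<mu>2 by (intro mult_mono) auto
    hence "(real d)\<^sup>2 * (\<alpha> * \<beta> * \<mu>\<^sup>2) \<le> (real d)\<^sup>2 * sqrt \<rho>" by (intro mult_left_mono) auto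
    thus ?thesis using \<alpha> \<beta> \<mu> \<rho> d by (simp add: A_def u_def field_simps power2_eq_square)
  qed
  have nA: "16 * 1000000\<^sup>2 * (A * polylog 2 u) \<le> real n" using terms(2) by (simp add: A_def u_def \<mu>_def)
  have lpos: "1 \<le> real n * m" if "1 \<le> m" for m
    using mult_mono[of 1 "real n" 1 m] n2 that by simp
  show "final_fail d n (\<rho> / 2) (\<beta> / 2) \<alpha> \<le> \<beta> / 2"
  proof (rule final_fail_le[OF d])
    have m1: "1 \<le> 2 / \<beta>" using \<beta> by simp
    have mm: "0 < 2 / \<beta>" "2 / \<beta> \<le> 10 * u" "A * (2 / \<beta>) \<le> 10 * u\<^sup>2"
    proof -
      have "2 / \<beta> = 2 * (1 / \<beta>)" "A * (2 / \<beta>) = 2 * (A / \<beta>)" by simp_all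
      thus "2 / \<beta> \<le> 10 * u" "A * (2 / \<beta>) \<le> 10 * u\<^sup>2" using bu Au u zero_le_power2[of u] by linarith+
    qed (use \<beta> in simp)
    from noise_absorb[OF A u mm _ nA lpos[OF m1]]
    have N: "1000000 * A * sqrt (12 + ln (2 / \<beta>)) * ln (real n * (2 / \<beta>)) \<le> 4 * real n" by simp
    have l0: "0 \<le> ln (real n * (2 / \<beta>))" using lpos[OF m1] by simp
    have s0: "0 \<le> 12 + ln (2 / \<beta>)" using m1 by (intro add_nonneg_nonneg ln_ge_zero) auto
    \<comment> \<open>Halving \<rho> costs \<open>sqrt (1 / 2)\<close>, which exceeds 3/5; the
      estimate from \<open>noise_absorb\<close> gives 4 * 128000 / 1000000 = 0.512.\<close>
    have h: "3 / 5 \<le> sqrt (1 / 2 :: real)" by (rule real_le_rsqrt) (simp add: power2_eq_square)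
    have "128000 * (A * sqrt (12 + ln (2 / \<beta>)) * ln (real n * (2 / \<beta>))) \<le> real n * sqrt (1 / 2)"
    proof -
      have "0 \<le> A * sqrt (12 + ln (2 / \<beta>)) * ln (real n * (2 / \<beta>))" using A s0 l0 by (intro mult_nonneg_nonneg) auto
      hence "128000 * (A * sqrt (12 + ln (2 / \<beta>)) * ln (real n * (2 / \<beta>))) \<le> real n * (3 / 5)"
        using N unfolding mult.assoc by linarith
      also have "\<dots> \<le> real n * sqrt (1 / 2)" using h by (intro mult_left_mono) auto
      finally show ?thesis .
    qed
    hence "\<alpha> * sqrt \<rho> * (128000 * (A * sqrt (12 + ln (2 / \<beta>)) * ln (real n * (2 / \<beta>)))) \<le> \<alpha> * sqrt \<rho> * (real n * sqrt (1 / 2))"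
      using \<alpha> \<rho> by (intro mult_left_mono) auto
    moreover have aA: "\<alpha> * sqrt \<rho> * A = (real d)\<^sup>2" using \<alpha> \<rho> by (simp add: A_def)
    have "\<alpha> * sqrt \<rho> * (128000 * (A * sqrt (12 + ln (2 / \<beta>)) * ln (real n * (2 / \<beta>)))) =
        128000 * (real d)\<^sup>2 * sqrt (12 + ln (2 / \<beta>)) * ln (real n * (2 / \<beta>))"
      unfolding aA[symmetric] by (simp only: mult_ac)
    moreover have "\<alpha> * sqrt \<rho> * (real n * sqrt (1 / 2)) = \<alpha> * (real n * sqrt (\<rho> / 2))" by (simp add: real_sqrt_divide)
    moreover have "1 / (\<beta> / 2) = 2 / \<beta>" "real n / (\<beta> / 2) = real n * (2 / \<beta>)" by simp_all
    ultimately show "128000 * (real d)\<^sup>2 * sqrt (12 + ln (1 / (\<beta> / 2))) * ln (real n / (\<beta> / 2)) \<le> \<alpha> * (real n * sqrt (\<rho> / 2))"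
      by (simp only:)
    have "1 < real n * (2 / \<beta>)" using mult_strict_mono[of 1 "real n" 1 "2 / \<beta>"] n2 \<beta> by simp
    thus "0 < ln (real n / (\<beta> / 2))" by (simp add: mult_ac)
  qed (use \<beta> in auto)
  show "real T * round_fail d n (\<rho> / 2 / real T) (\<beta> / 2 / real T) \<le> \<beta> / 2"
  proof (cases "T = 0")
    case True
    thus ?thesis using \<beta> by simp
  next
    case False
    \<comment> \<open>The maximum with 1 accounts for the ceiling: a single round may be run however
      small \<open>ln \<kappa>\<close> is.\<close>
    define e where "e = max 1 (ln \<kappa>)"
    have lk: "0 \<le> ln \<kappa>" using k by simp
    have T1: "1 \<le> real T" using False by simp
    have r: "3 / 10 \<le> ln (10 / 7 :: real)" using ln_le_minus_one[of "7 / 10 :: real"] by (simp add: ln_div)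
    have Te: "real T \<le> 5 * e"
    proof -
      have "1 / ln (10 / 7) * ln \<kappa> \<le> 10 / 3 * ln \<kappa>" using r lk by (intro mult_right_mono) (auto simp: field_simps)
      moreover have "real T < 1 / ln (10 / 7) * ln \<kappa> + 1" unfolding T using False T by linarith
      moreover have "1 \<le> e" "ln \<kappa> \<le> e" by (simp_all add: e_def)
      ultimately show ?thesis by linarith
    qed
    \<comment> \<open>For \<open>ln \<kappa>\<close> below 1 the third term of the sample bound can
      be arbitrarily small although a round takes place. In that case the number of rounds is
      bounded and the second term is used, since it dominates
      \<open>d * sqrt d / sqrt \<rho>\<close>.\<close>
    obtain A' u' where A': "0 < A'" and u': "0 < u'" and eu: "e / \<beta> \<le> u'" "A' * e / \<beta> \<le> u'\<^sup>2"
      and DA: "real d * sqrt (real d) * sqrt e / sqrt \<rho> \<le> A'" and nA': "16 * 1000000\<^sup>2 * (A' * polylog 2 u') \<le> real n"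
    proof (cases "1 \<le> ln \<kappa>")
      case True
      define A' u' where "A' = real d * sqrt (real d) * sqrt (ln \<kappa>) / sqrt \<rho>" and "u' = real d * ln \<kappa> / (\<mu> * \<beta>)"
      have e: "e = ln \<kappa>" using True by (simp add: e_def)
      have "\<mu> \<le> real d" using \<mu> d1 by linarith
      hence 1: "e / \<beta> \<le> u'" using True \<mu> \<beta> by (simp add: u'_def e field_simps mult_left_mono)
      have 2: "A' * e / \<beta> \<le> u'\<^sup>2"
      proof -
        have "sqrt (real d) \<le> real d" "sqrt (ln \<kappa>) \<le> ln \<kappa>" using d1 True by (auto intro!: real_le_lsqrt simp: power2_eq_square)
        moreover have "\<mu>\<^sup>2 * \<beta> \<le> sqrt \<rho> * 1" using \<mu>2 \<beta> \<rho> by (intro mult_mono) auto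
        ultimately have "(sqrt (real d) * sqrt (ln \<kappa>)) * (\<mu>\<^sup>2 * \<beta>) \<le> (real d * ln \<kappa>) * (sqrt \<rho> * 1)"
          using \<beta> \<rho> \<mu> \<mu>2 True by (intro mult_mono) auto
        hence "(real d * ln \<kappa>) * ((sqrt (real d) * sqrt (ln \<kappa>)) * (\<mu>\<^sup>2 * \<beta>)) \<le> (real d * ln \<kappa>) * ((real d * ln \<kappa>) * (sqrt \<rho> * 1))"
          using True by (intro mult_left_mono) auto
        thus ?thesis using \<mu> \<beta> \<rho> by (simp add: A'_def u'_def e field_simps power2_eq_square)
      qed
      have nn: "16 * 1000000\<^sup>2 * (A' * polylog 2 u') \<le> real n" using terms(3) by (simp add: A'_def u'_def \<mu>_def)
      show ?thesis
        by (rule that[of A' u', OF _ _ 1 2 _ nn]) (use True d \<rho> \<mu> \<beta> in \<open>auto simp: A'_def u'_def e\<close>)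
    next
      case False
      have e: "e = 1" using False by (simp add: e_def)
      have sd: "sqrt (real d) \<le> real d" using d1 by (auto intro!: real_le_lsqrt simp: power2_eq_square)
      have "real d * sqrt (real d) / sqrt \<rho> \<le> real d * real d / sqrt \<rho>" using sd \<rho> by (intro divide_right_mono mult_left_mono) auto
      also have "\<dots> \<le> A" using \<alpha> \<rho> by (simp add: A_def power2_eq_square field_simps mult_left_le_one_le)
      finally show ?thesis using that[of A u, OF A u _ _ _ nA] bu Au e by simp
    qed
    define \<beta>1 where "\<beta>1 = \<beta> / 2 / real T"
    have b1: "0 < \<beta>1" "\<beta>1 < 1" using \<beta> T1 by (auto simp: \<beta>1_def field_simps)
    have inv: "1 / \<beta>1 = 2 * real T / \<beta>" by (simp add: \<beta>1_def)
    have m1: "1 < 1 / \<beta>1" using b1 by simp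
    have t2: "2 * real T / \<beta> \<le> 10 * (e / \<beta>)" using Te \<beta> by (simp add: field_simps)
    have mm: "0 < 1 / \<beta>1" "1 / \<beta>1 \<le> 10 * u'" "A' * (1 / \<beta>1) \<le> 10 * u'\<^sup>2"
    proof -
      show "0 < 1 / \<beta>1" using b1 by simp
      show "1 / \<beta>1 \<le> 10 * u'" unfolding inv using t2 eu by linarith
      have "A' * (1 / \<beta>1) \<le> A' * (10 * (e / \<beta>))" unfolding inv using t2 A' by (intro mult_left_mono) auto
      also have "\<dots> = 10 * (A' * e / \<beta>)" by simp
      finally show "A' * (1 / \<beta>1) \<le> 10 * u'\<^sup>2" using eu(2) by linarith
    qed
    from noise_absorb[OF A' u' mm _ nA' lpos[OF less_imp_le[OF m1]]]
    have N: "1000000 * A' * sqrt (12 + ln (1 / \<beta>1)) * ln (real n * (1 / \<beta>1)) \<le> 4 * real n" by simp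
    define Q where "Q = sqrt (12 + ln (1 / \<beta>1)) * ln (real n / \<beta>1)"
    have l0: "0 \<le> ln (real n / \<beta>1)" using lpos[OF less_imp_le[OF m1]] by simp
    have s0: "0 \<le> 12 + ln (1 / \<beta>1)" using m1 by (intro add_nonneg_nonneg ln_ge_zero) auto
    have Q0: "0 \<le> Q" unfolding Q_def using s0 l0 by (intro mult_nonneg_nonneg) auto
    have NQ: "1000000 * A' * Q \<le> 4 * real n" using N by (simp add: Q_def mult.assoc)
    have e1: "1 \<le> e" by (simp add: e_def)
    \<comment> \<open>Sharing \<rho> among the rounds multiplies the noise by
      \<open>sqrt (2 * real T)\<close>; this is the \<open>sqrt (ln \<kappa>)\<close> of the sample
      bound.\<close>
    have "sqrt (2 * real T) \<le> sqrt (16 * e)" using Te e1 by (intro real_sqrt_le_mono) linarith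
    hence sT: "sqrt (2 * real T) \<le> 4 * sqrt e" by (simp add: real_sqrt_mult)
    have "32000 * (real d * sqrt (real d)) * Q * sqrt (2 * real T) \<le> 32000 * (real d * sqrt (real d)) * Q * (4 * sqrt e)"
      using sT Q0 by (intro mult_left_mono) auto
    also have "\<dots> = 128000 * Q * sqrt \<rho> * (real d * sqrt (real d) * sqrt e / sqrt \<rho>)" using \<rho> by simp
    also have "\<dots> \<le> 128000 * Q * sqrt \<rho> * A'" using DA Q0 \<rho> by (intro mult_left_mono) auto
    also have "\<dots> = sqrt \<rho> * (128000 * A' * Q)" by simp
    also have "\<dots> \<le> sqrt \<rho> * real n"
    proof (rule mult_left_mono)
      have "0 \<le> A' * Q" using A' Q0 by simp
      thus "128000 * A' * Q \<le> real n" using NQ by (simp add: mult.assoc)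
    qed (use \<rho> in simp)
    finally have fin: "32000 * (real d * sqrt (real d)) * Q * sqrt (2 * real T) \<le> sqrt \<rho> * real n" .
    have sr: "sqrt (\<rho> / 2 / real T) = sqrt \<rho> / sqrt (2 * real T)" by (simp add: real_sqrt_divide real_sqrt_mult)
    have "0 < sqrt (2 * real T)" using T1 by simp
    hence "32000 * (real d * sqrt (real d)) * Q \<le> real n * sqrt (\<rho> / 2 / real T)"
      using fin unfolding sr times_divide_eq_right by (subst pos_le_divide_eq) (auto simp: mult_ac)
    hence H: "32000 * (real d * sqrt (real d)) * sqrt (12 + ln (1 / \<beta>1)) * ln (real n / \<beta>1) \<le> real n * sqrt (\<rho> / 2 / real T)"
      by (simp add: Q_def mult.assoc)
    have "1 < real n * (1 / \<beta>1)" using mult_strict_mono[of 1 "real n" 1 "1 / \<beta>1"] n2 m1 by simp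
    hence "0 < ln (real n / \<beta>1)" by simp
    from round_fail_le[OF d b1 this H] have "real T * round_fail d n (\<rho> / 2 / real T) \<beta>1 \<le> real T * \<beta>1"
      by (intro mult_left_mono) auto
    thus ?thesis using T1 by (simp add: \<beta>1_def)
  qed
qed

text \<open>The Gaussian sample is the image of standard normal vectors under the Cholesky factor,
  which reduces the claim to \<open>good_sample\<close> and a fixed sample. The failure probability
  is \<open>2 * \<beta>\<close> for the sample and half a \<beta> each for the rounds and the final
  call.\<close>

lemma pgce_accuracy:
  assumes d: "0 < d" and \<rho>: "0 < \<rho>" and \<beta>: "0 < \<beta>" "\<beta> < 1 / 4" and \<alpha>: "0 < \<alpha>" "\<alpha> \<le> 1"
    and S: "loewner_le d (1\<^sub>m d) S" "loewner_le d S (\<kappa> \<cdot>\<^sub>m 1\<^sub>m d)"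
    and n: "16 * 1000000\<^sup>2 * sample_bound 2 d \<alpha> \<rho> \<beta> \<kappa> \<le> real n"
  defines "P \<equiv> (\<Pi>\<^sub>M i\<in>{..<n}. gaussian d S) \<bind> pgce 8 16 (1 / ln (10 / 7)) 20 d n \<rho> \<beta> \<kappa>"
  shows "\<P>(S' in P. rel_norm d S (S - S') \<le> 4000 * \<alpha>) \<ge> 1 - 4 * \<beta>"
proof -
  let ?pgce = "pgce 8 16 (1 / ln (10 / 7)) 20 d n \<rho> \<beta> \<kappa>"
  obtain L :: "nat \<Rightarrow> nat \<Rightarrow> real" where L: "\<And>i k. i < k \<Longrightarrow> L i k = 0" "\<And>i. i < d \<Longrightarrow> 0 < L i i"
      "S = Matrix.mat d d (\<lambda>(i, j). L i j) * transpose_mat (Matrix.mat d d (\<lambda>(i, j). L i j))"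
      "well_cond d \<kappa> (Matrix.mat d d (\<lambda>(i, j). L i j))" "S \<in> psd_cone d" "0 < d \<Longrightarrow> 1 \<le> \<kappa>"
    using loewner_Cholesky[OF S] by blast
  define Lm where "Lm = Matrix.mat d d (\<lambda>(i, j). L i j)"
  have Lm: "Lm \<in> carrier_mat d d" by (simp add: Lm_def)
  have k: "1 \<le> \<kappa>" by (rule L(6)[OF d])
  define T where "T = nat \<lceil>1 / ln (10 / 7) * ln \<kappa>\<rceil>"
  note rounds = num_rounds[OF k, folded T_def]
  note suff = sufficient_samples[OF d \<rho> \<beta> \<alpha> k n T_def]
  let ?SG = "std_sample d n"
  define \<Phi> where "\<Phi> = (\<lambda>g. \<lambda>i\<in>{..<n}. Lm *\<^sub>v Matrix.vec d (g i))"
  have vm: "(\<lambda>h. Matrix.vec d h) \<in> std_gaussian d \<rightarrow>\<^sub>M vec_borel d"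
    by (rule measurable_vec_borelI) (auto intro!: measurable_component_real)
  have Lvm: "(\<lambda>h. Lm *\<^sub>v Matrix.vec d h) \<in> std_gaussian d \<rightarrow>\<^sub>M vec_borel d"
    using measurable_mat_mult_vec[OF measurable_const vm, of Lm] Lm by simp
  have \<Phi>m: "\<Phi> \<in> ?SG \<rightarrow>\<^sub>M data_space d n"
    unfolding \<Phi>_def by (intro measurable_restrict measurable_PiM_compose Lvm)
  have "(\<Pi>\<^sub>M i\<in>{..<n}. gaussian d S) = (\<Pi>\<^sub>M i\<in>{..<n}. distr (std_gaussian d) (vec_borel d) (\<lambda>h. Lm *\<^sub>v Matrix.vec d h))"
    using gaussian_eq_distr[OF L(1,2,3)] by (simp add: Lm_def)
  also have "\<dots> = distr ?SG (data_space d n) \<Phi>"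
    unfolding \<Phi>_def using distr_PiM_pointwise[OF _ prob_space_std_gaussian Lvm, of "{..<n}"] by simp
  finally have D: "(\<Pi>\<^sub>M i\<in>{..<n}. gaussian d S) = distr ?SG (data_space d n) \<Phi>" .
  have SGp: "?SG \<in> space (prob_algebra ?SG)" by (simp add: space_prob_algebra prob_space_std_sample)
  have Km: "(\<lambda>g. ?pgce (\<Phi> g)) \<in> ?SG \<rightarrow>\<^sub>M prob_algebra (mat_borel d)"
    by (rule measurable_compose[OF \<Phi>m measurable_pgce])
  have P: "P = ?SG \<bind> (\<lambda>g. ?pgce (\<Phi> g))"
    unfolding P_def D
    by (rule bind_distr[OF \<Phi>m measurable_prob_algebraD[OF measurable_pgce] prob_space.not_empty[OF prob_space_std_sample]])
  interpret prob_space P unfolding P by (rule prob_space_bind'[OF SGp Km])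
  have sP: "sets P = sets (mat_borel d)" unfolding P by (rule sets_bind'[OF SGp Km])
  have spP: "space P = carrier_mat d d" using sets_eq_imp_space_eq[OF sP] by simp
  define B where "B = {S' \<in> carrier_mat d d. \<not> rel_norm d S (S - S') \<le> 4000 * \<alpha>}"
  have "{S' \<in> space (mat_borel d). \<not> rel_norm d S (S - S') \<le> 4000 * \<alpha>} \<in> sets (mat_borel d)"
    using measurable_rel_norm_diff[OF L(5)] by (intro sets.sets_Collect_neg borel_measurable_le) auto
  hence B: "B \<in> sets (mat_borel d)" by (simp add: B_def)
  have \<tau>: "0 < 0.001 * \<alpha>" "0.001 * \<alpha> \<le> 1" and b1: "\<beta> \<le> 1" using \<alpha> \<beta> by auto
  obtain G where G: "G \<in> sets ?SG" "emeasure ?SG (space ?SG - G) \<le> ennreal (2 * \<beta>)"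
      and Gcov: "\<And>g. g \<in> G \<Longrightarrow> (\<Sum>j<d. \<Sum>k<d. (cov_dev n g j k)\<^sup>2) \<le> (0.001 * \<alpha>)\<^sup>2"
      and Gnorm: "\<And>g i. g \<in> G \<Longrightarrow> i < n \<Longrightarrow> (\<Sum>j<d. (g i j)\<^sup>2) \<le> 8 * real d * ln (real n / \<beta>)"
    using good_sample[OF d suff(1) \<beta>(1) b1 \<tau> suff(2)] by blast
  have "emeasure P B \<le> ennreal (2 * \<beta>) + ennreal \<beta>"
    unfolding P
  proof (rule emeasure_bind_le[OF SGp Km B G])
    fix g assume g: "g \<in> G"
    have n0: "0 < n" using suff(1) by simp
    have nb: "1 < real n / \<beta>" using suff(1) \<beta> by (simp add: field_simps)
    have "frob_norm (cov_dev_mat d n g) = sqrt (\<Sum>j<d. \<Sum>k<d. (cov_dev n g j k)\<^sup>2)"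
      by (simp add: frob_norm_def cov_dev_mat_def)
    also have "\<dots> \<le> 0.001 * \<alpha>" using Gcov[OF g] \<alpha> by (intro real_le_lsqrt) auto
    finally have V: "frob_norm (cov_dev_mat d n g) \<le> 0.001 * \<alpha>" .
    have "emeasure (?pgce (\<Phi> g)) B \<le> ennreal (real T * round_fail d n (\<rho> / 2 / real T) (\<beta> / 2 / real T)) +
        ennreal (final_fail d n (\<rho> / 2) (\<beta> / 2) \<alpha>)"
      unfolding B_def
    proof (rule pgce_sample_le[OF d n0 \<rho> \<alpha> L(5) Lm _ _ T_def rounds _ _ _ _ V Gnorm[OF g]])
      show "S = Lm * transpose_mat Lm" "well_cond d \<kappa> Lm" using L(3,4) by (simp_all add: Lm_def)
      show "0 \<le> \<kappa>" using k by simp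
      show "0 < ln (real n / \<beta>)" using nb by simp
      have mono: "ln (real n / \<beta>) \<le> ln (real n / \<beta>')" if "0 < \<beta>'" "\<beta>' \<le> \<beta>" for \<beta>'
        using that n0 \<beta> by (subst ln_le_cancel_iff) (auto intro: divide_left_mono)
      show "ln (real n / \<beta>) \<le> ln (real n / (\<beta> / 2))" using \<beta> by (intro mono) auto
      show "ln (real n / \<beta>) \<le> ln (real n / (\<beta> / 2 / real T))" if "0 < T"
        using \<beta> that by (intro mono) (auto simp: field_simps)
      show "\<Phi> g i = Lm *\<^sub>v Matrix.vec d (g i)" if "i < n" for i using that by (simp add: \<Phi>_def)
    qed
    also have "\<dots> \<le> ennreal (\<beta> / 2) + ennreal (\<beta> / 2)" by (intro add_mono ennreal_leI suff)
    also have "\<dots> = ennreal \<beta>" using \<beta> by (simp flip: ennreal_plus)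
    finally show "emeasure (?pgce (\<Phi> g)) B \<le> ennreal \<beta>" .
  qed
  also have "\<dots> = ennreal (3 * \<beta>)" using \<beta> by (simp flip: ennreal_plus)
  finally have "ennreal (prob B) \<le> ennreal (3 * \<beta>)" by (simp add: emeasure_eq_measure)
  hence pB: "prob B \<le> 3 * \<beta>" using \<beta> by (simp add: ennreal_le_iff)
  have "{S' \<in> space P. rel_norm d S (S - S') \<le> 4000 * \<alpha>} = space P - B" by (auto simp: B_def spP)
  hence "prob {S' \<in> space P. rel_norm d S (S - S') \<le> 4000 * \<alpha>} = 1 - prob B"
    using prob_compl[of B] B sP by simp
  thus ?thesis using pB \<beta> by simp
qed

theorem theorem3p12:
  shows "\<exists>cS c\<sigma> cT K Cn C\<alpha> C\<beta> :: real. \<exists>p :: nat.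
    0 < cS \<and> 0 < c\<sigma> \<and> 0 < cT \<and> 0 < K \<and> 0 < Cn \<and> 0 < C\<alpha> \<and> 0 < C\<beta> \<and>
    (\<forall>(d :: nat) (\<rho> :: real) (\<beta> :: real) (\<kappa> :: real). 0 < d \<and> 0 < \<rho> \<and> 0 < \<beta> \<and> 0 < \<kappa> \<longrightarrow>
       (\<forall>n :: nat. zCDP \<rho> n (carrier_vec d) (mat_borel d) (pgce cS c\<sigma> cT K d n \<rho> \<beta> \<kappa>)) \<and>
       (\<forall>(\<alpha> :: real) (n :: nat) (S :: real mat).
          0 < \<alpha> \<and> \<alpha> \<le> 1 \<and>
          loewner_le d (1\<^sub>m d) S \<and> loewner_le d S (\<kappa> \<cdot>\<^sub>m 1\<^sub>m d) \<and>
          real n \<ge> Cn * sample_bound p d \<alpha> \<rho> \<beta> \<kappa> \<longrightarrow>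
          \<P>(S' in (\<Pi>\<^sub>M i\<in>{..<n}. gaussian d S) \<bind> pgce cS c\<sigma> cT K d n \<rho> \<beta> \<kappa>.
              rel_norm d S (S - S') \<le> C\<alpha> * \<alpha>) \<ge> 1 - C\<beta> * \<beta>))"
\<comment> \<open>8 is the constant of the norm tail and 16 its double, as privacy requires; 20 and
  the number of rounds come from the invariant with rate 0.7. The sample constant is that of
  \<open>noise_absorb\<close> with \<open>c = 1000000\<close>, and 4000 is 2000 times the Frobenius
  error \<open>2 * \<alpha>\<close>.\<close>
proof (rule exI[of _ 8], rule exI[of _ 16], rule exI[of _ "1 / ln (10 / 7)"], rule exI[of _ 20],
    rule exI[of _ "16 * 1000000\<^sup>2"], rule exI[of _ 4000], rule exI[of _ 4], rule exI[of _ 2], intro conjI allI impI)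
  fix d n :: nat and \<rho> \<beta> \<kappa> :: real
  assume a: "0 < d \<and> 0 < \<rho> \<and> 0 < \<beta> \<and> 0 < \<kappa>"
  show "zCDP \<rho> n (carrier_vec d) (mat_borel d) (pgce 8 16 (1 / ln (10 / 7)) 20 d n \<rho> \<beta> \<kappa>)"
    using pgce_zCDP[of \<rho> 8] a by simp
  fix \<alpha> :: real and S :: "real mat"
  assume b: "0 < \<alpha> \<and> \<alpha> \<le> 1 \<and> loewner_le d (1\<^sub>m d) S \<and> loewner_le d S (\<kappa> \<cdot>\<^sub>m 1\<^sub>m d) \<and>
    real n \<ge> 16 * 1000000\<^sup>2 * sample_bound 2 d \<alpha> \<rho> \<beta> \<kappa>"
  show "\<P>(S' in (\<Pi>\<^sub>M i\<in>{..<n}. gaussian d S) \<bind> pgce 8 16 (1 / ln (10 / 7)) 20 d n \<rho> \<beta> \<kappa>.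
      rel_norm d S (S - S') \<le> 4000 * \<alpha>) \<ge> 1 - 4 * \<beta>"
  \<comment> \<open>For larger \<beta> the claimed lower bound on the probability is not
    positive.\<close>
  proof (cases "\<beta> < 1 / 4")
    case True
    thus ?thesis using a b by (intro pgce_accuracy) auto
  next
    case False
    hence "1 - 4 * \<beta> \<le> 0" by simp
    thus ?thesis by (rule order_trans) simp
  qed
qed auto

end
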